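(* Let $0<\alpha<1$, $1<p<\infty$ and $T>0$. The equation $\partial_t^\alpha u-\mathrm{i}Au=f$ on $(0,T)$ satisfies the maximal $L^p$-regularity: for every $f\in L^p(0,T;H)$ the unique weak solution $u$ belongs to $W_{\alpha,p}(0,T;H)\cap L^p(0,T;D(A))$, and there exists a constant $C>0$, independent of $f$, such that \[ \|u\|_{W_{\alpha,p}(0,T;H)}+\|u\|_{L^p(0,T;D(A))}\le C\,\|f\|_{L^p(0,T;H)}. \]
   Context: $(H,\langle\cdot,\cdot\rangle)$ is a complex Hilbert space with norm $\|\cdot\|$ (inner product linear in the first argument). $A:D(A)\subset H\to H$ is self-adjoint, negative-definite ($\langle Au,u\rangle<0$ for all $u\in D(A)\setminus\{0\}$) and has compact resolvent. $\{\varphi_n\}_{n\in\mathbb N}\subset D(A)$ is an orthonormal basis of $H$ with $A\varphi_n=-\lambda_n\varphi_n$, $0<\lambda_1\le\lambda_2\le\cdots\to\infty$. $D(A)$ carries the norm $\|u\|_{D(A)}=\|Au\|$ (equivalent to the graph norm). Fractional derivative. For $v\in L^p(0,T;H)$, $J^\alpha v(t)=\frac1{\Gamma(\alpha)}\int_0^t(t-s)^{\alpha-1}v(s)\,\mathrm ds$; $J^\alpha$ is injective on $L^p(0,T;H)$. $W_{\alpha,p}(0,T;H)=J^\alpha L^p(0,T;H)$ with norm $\|v\|_{W_{\alpha,p}(0,T;H)}=\|J^{-\alpha}v\|_{L^p(0,T;H)}$, and $\partial_t^\alpha:=J^{-\alpha}$ with domain $W_{\alpha,p}(0,T;H)$.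 Weak solution. Let $q$ be the conjugate exponent of $p$, $(\tau_Tv)(t)=v(T-t)$, and $(\partial_t^\alpha)'u=\tau_T\partial_t^\alpha(\tau_Tu)$ for $u\in\tau_TW_{\alpha,q}(0,T;H)$. Let $\Psi=\{\psi\in C^\infty([0,T];D(A)):\psi(T)=0\}$ (which is contained in the domain of $(\partial_t^\alpha)'$). For $f\in L^p(0,T;H)$, a weak solution of $\partial_t^\alpha u-\mathrm{i}Au=f$ is $u\in L^p(0,T;H)$ such that $\int_0^T\langle u(t),(\partial_t^\alpha)'\psi(t)+\mathrm iA\psi(t)\rangle\,\mathrm dt=\int_0^T\langle f(t),\psi(t)\rangle\,\mathrm dt$ for all $\psi\in\Psi$. A unique weak solution exists for every $f\in L^p(0,T;H)$. *)

theory Defs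
  imports "HOL-Analysis.Analysis"
begin

section \<open>Complex Hilbert spaces\<close>

class complex_hilbert = banach +
  fixes scaleC :: "complex \<Rightarrow> 'a \<Rightarrow> 'a"  (infixr \<open>*\<^sub>C\<close> 75)
    and cinner :: "'a \<Rightarrow> 'a \<Rightarrow> complex"
  assumes scaleC_add_right: "a *\<^sub>C (x + y) = a *\<^sub>C x + a *\<^sub>C y"
    and scaleC_add_left: "(a + b) *\<^sub>C x = a *\<^sub>C x + b *\<^sub>C x"
    and scaleC_scaleC: "a *\<^sub>C b *\<^sub>C x = (a * b) *\<^sub>C x"
    and scaleC_of_real: "complex_of_real r *\<^sub>C x = r *\<^sub>R x"
    and cinner_add_left: "cinner (x + y) z = cinner x z + cinner y z"
    and cinner_scaleC_left: "cinner (a *\<^sub>C x) y = a * cinner x y"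
    and cinner_commute: "cinner x y = cnj (cinner y x)"
    and cinner_self: "cinner x x = complex_of_real ((norm x)\<^sup>2)"

lemma vector_space_scaleC:
  "vector_space (scaleC :: complex \<Rightarrow> 'a::complex_hilbert \<Rightarrow> 'a)"
proof
  show "1 *\<^sub>C x = x" for x :: 'a
    using scaleC_of_real[of 1 x] by simp
qed (simp_all add: scaleC_add_right scaleC_add_left scaleC_scaleC)

abbreviation csubspace :: "'a::complex_hilbert set \<Rightarrow> bool"
  where "csubspace \<equiv> module.subspace scaleC"

abbreviation cspan :: "'a::complex_hilbert set \<Rightarrow> 'a set"
  where "cspan \<equiv> module.span scaleC"

definition orthonormal_basis :: "(nat \<Rightarrow> 'a::complex_hilbert) \<Rightarrow> bool"
  where "orthonormal_basis \<phi> \<longleftrightarrow>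
    (\<forall>m n. cinner (\<phi> m) (\<phi> n) = (if m = n then 1 else 0)) \<and>
    closure (cspan (range \<phi>)) = UNIV"

section \<open>Unbounded operators\<close>

text \<open>An operator is a domain \<open>D\<close> together with a function \<open>A\<close> whose values
  outside \<open>D\<close> are irrelevant.\<close>

definition linear_operator :: "'a::complex_hilbert set \<Rightarrow> ('a \<Rightarrow> 'a) \<Rightarrow> bool"
  where "linear_operator D A \<longleftrightarrow> csubspace D \<and>
    (\<forall>x\<in>D. \<forall>y\<in>D. A (x + y) = A x + A y) \<and>
    (\<forall>c. \<forall>x\<in>D. A (c *\<^sub>C x) = c *\<^sub>C A x)"

definition operator_graph :: "'a set \<Rightarrow> ('a \<Rightarrow> 'a) \<Rightarrow> ('a \<times> 'a) set"
  where "operator_graph D A = {(x, A x) | x. x \<in> D}"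

text \<open>The graph of the adjoint; it is single-valued when \<open>D\<close> is dense.\<close>

definition adjoint_graph :: "'a::complex_hilbert set \<Rightarrow> ('a \<Rightarrow> 'a) \<Rightarrow> ('a \<times> 'a) set"
  where "adjoint_graph D A = {(y, z). \<forall>x\<in>D. cinner (A x) y = cinner x z}"

definition self_adjoint :: "'a::complex_hilbert set \<Rightarrow> ('a \<Rightarrow> 'a) \<Rightarrow> bool"
  where "self_adjoint D A \<longleftrightarrow>
    linear_operator D A \<and> closure D = UNIV \<and> adjoint_graph D A = operator_graph D A"

definition negative_definite :: "'a::complex_hilbert set \<Rightarrow> ('a \<Rightarrow> 'a) \<Rightarrow> bool"
  where "negative_definite D A \<longleftrightarrow>
    (\<forall>x\<in>D - {0}. Im (cinner (A x) x) = 0 \<and> Re (cinner (A x) x) < 0)"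

definition resolvent_set :: "'a::complex_hilbert set \<Rightarrow> ('a \<Rightarrow> 'a) \<Rightarrow> complex set"
  where "resolvent_set D A = {z. bij_betw (\<lambda>x. z *\<^sub>C x - A x) D UNIV \<and>
    (\<exists>K. \<forall>x\<in>D. norm x \<le> K * norm (z *\<^sub>C x - A x))}"

definition resolvent :: "'a::complex_hilbert set \<Rightarrow> ('a \<Rightarrow> 'a) \<Rightarrow> complex \<Rightarrow> 'a \<Rightarrow> 'a"
  where "resolvent D A z = inv_into D (\<lambda>x. z *\<^sub>C x - A x)"

definition compact_resolvent :: "'a::complex_hilbert set \<Rightarrow> ('a \<Rightarrow> 'a) \<Rightarrow> bool"
  where "compact_resolvent D A \<longleftrightarrow>
    (\<exists>z\<in>resolvent_set D A. compact (closure (resolvent D A z ` cball 0 1)))"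

section \<open>Vector-valued Lebesgue spaces on \<open>(0, T)\<close>\<close>

text \<open>Elements of \<open>L\<^sup>p(0,T;H)\<close> are represented by functions that are Borel measurable
  on \<open>(0,T)\<close>, identified when they agree almost everywhere there; their values outside
  \<open>(0,T)\<close> are irrelevant. As \<open>H\<close> is separable, Borel measurability into \<open>H\<close> is strong
  measurability.\<close>

abbreviation interval_lborel :: "real \<Rightarrow> real measure"
  where "interval_lborel T \<equiv> restrict_space lborel {0<..<T}"

definition Lp_space ::
    "real \<Rightarrow> real \<Rightarrow> (real \<Rightarrow> 'a::{complex_hilbert, second_countable_topology}) set"
  where "Lp_space p T = {v. v \<in> borel_measurable (interval_lborel T) \<and>
    integrable (interval_lborel T) (\<lambda>t. norm (v t) powr p)}"

definition Lp_norm ::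
    "real \<Rightarrow> real \<Rightarrow> (real \<Rightarrow> 'a::{complex_hilbert, second_countable_topology}) \<Rightarrow> real"
  where "Lp_norm p T v =
    (integral\<^sup>L (interval_lborel T) (\<lambda>t. norm (v t) powr p)) powr (1 / p)"

text \<open>\<open>D(A)\<close> carries the norm \<open>\<parallel>A x\<parallel>\<close>, so a \<open>D(A)\<close>-valued function \<open>u\<close> is measurable
  iff \<open>A \<circ> u\<close> is \<open>H\<close>-valued measurable, and its norm is that of \<open>A \<circ> u\<close>.  On the null set
  where a representative \<open>u\<close> leaves \<open>D(A)\<close>, \<open>A u\<close> is replaced by \<open>0\<close>.\<close>

definition apply_op :: "'a::zero set \<Rightarrow> ('a \<Rightarrow> 'a) \<Rightarrow> (real \<Rightarrow> 'a) \<Rightarrow> real \<Rightarrow> 'a"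
  where "apply_op D A u t = (if u t \<in> D then A (u t) else 0)"

definition Lp_domain_space :: "real \<Rightarrow> real \<Rightarrow>
    'a::{complex_hilbert, second_countable_topology} set \<Rightarrow> ('a \<Rightarrow> 'a) \<Rightarrow> (real \<Rightarrow> 'a) set"
  where "Lp_domain_space p T D A = {u. u \<in> borel_measurable (interval_lborel T) \<and>
    (AE t in interval_lborel T. u t \<in> D) \<and> apply_op D A u \<in> Lp_space p T}"

definition Lp_domain_norm :: "real \<Rightarrow> real \<Rightarrow>
    'a::{complex_hilbert, second_countable_topology} set \<Rightarrow> ('a \<Rightarrow> 'a) \<Rightarrow> (real \<Rightarrow> 'a) \<Rightarrow> real"
  where "Lp_domain_norm p T D A u = Lp_norm p T (apply_op D A u)"

section \<open>Fractional integrals and derivatives\<close>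

definition frac_integral ::
    "real \<Rightarrow> (real \<Rightarrow> 'a::{complex_hilbert, second_countable_topology}) \<Rightarrow> real \<Rightarrow> 'a"
  where "frac_integral \<alpha> v t =
    (1 / Gamma \<alpha>) *\<^sub>R (LINT s:{0<..<t}|lborel. (t - s) powr (\<alpha> - 1) *\<^sub>R v s)"

definition W_space ::
    "real \<Rightarrow> real \<Rightarrow> real \<Rightarrow> (real \<Rightarrow> 'a::{complex_hilbert, second_countable_topology}) set"
  where "W_space \<alpha> p T = {u. u \<in> borel_measurable (interval_lborel T) \<and>
    (\<exists>v\<in>Lp_space p T. AE t in interval_lborel T. u t = frac_integral \<alpha> v t)}"

text \<open>\<open>\<partial>\<^sub>t\<^sup>\<alpha> = J\<^sup>-\<^sup>\<alpha>\<close>: the choice is unique almost everywhere for \<open>u \<in> W_space \<alpha> p T\<close>,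
  because \<open>J\<^sup>\<alpha>\<close> is injective on \<open>L\<^sup>p(0,T;H)\<close>.\<close>

definition frac_deriv :: "real \<Rightarrow> real \<Rightarrow> real \<Rightarrow>
    (real \<Rightarrow> 'a::{complex_hilbert, second_countable_topology}) \<Rightarrow> real \<Rightarrow> 'a"
  where "frac_deriv \<alpha> p T u =
    (SOME v. v \<in> Lp_space p T \<and> (AE t in interval_lborel T. u t = frac_integral \<alpha> v t))"

definition W_norm :: "real \<Rightarrow> real \<Rightarrow> real \<Rightarrow>
    (real \<Rightarrow> 'a::{complex_hilbert, second_countable_topology}) \<Rightarrow> real"
  where "W_norm \<alpha> p T u = Lp_norm p T (frac_deriv \<alpha> p T u)"

definition conjugate_exponent :: "real \<Rightarrow> real"
  where "conjugate_exponent p = p / (p - 1)"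

definition time_reversal :: "real \<Rightarrow> (real \<Rightarrow> 'a) \<Rightarrow> real \<Rightarrow> 'a"
  where "time_reversal T v t = v (T - t)"

text \<open>\<open>(\<partial>\<^sub>t\<^sup>\<alpha>)'\<close>, where \<open>q\<close> is the conjugate exponent.\<close>

definition frac_deriv_adj :: "real \<Rightarrow> real \<Rightarrow> real \<Rightarrow>
    (real \<Rightarrow> 'a::{complex_hilbert, second_countable_topology}) \<Rightarrow> real \<Rightarrow> 'a"
  where "frac_deriv_adj \<alpha> q T u =
    time_reversal T (frac_deriv \<alpha> q T (time_reversal T u))"

section \<open>Weak solutions\<close>

text \<open>\<open>\<psi> k\<close> below is the \<open>k\<close>-th derivative; difference quotients converge in the norm
  \<open>\<parallel>A x\<parallel>\<close> of \<open>D(A)\<close>, one-sidedly at the end points.\<close>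

definition smooth_domain_valued ::
    "real \<Rightarrow> 'a::complex_hilbert set \<Rightarrow> ('a \<Rightarrow> 'a) \<Rightarrow> (real \<Rightarrow> 'a) \<Rightarrow> bool"
  where "smooth_domain_valued T D A g \<longleftrightarrow>
    (\<exists>\<psi>. (\<forall>t\<in>{0..T}. \<psi> 0 t = g t) \<and>
      (\<forall>k::nat. \<forall>t\<in>{0..T}. \<psi> k t \<in> D \<and>
        ((\<lambda>s. norm (A ((1 / (s - t)) *\<^sub>R (\<psi> k s - \<psi> k t) - \<psi> (Suc k) t))) \<longlongrightarrow> 0)
          (at t within {0..T})))"

definition test_functions ::
    "real \<Rightarrow> 'a::complex_hilbert set \<Rightarrow> ('a \<Rightarrow> 'a) \<Rightarrow> (real \<Rightarrow> 'a) set"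
  where "test_functions T D A = {\<psi>. smooth_domain_valued T D A \<psi> \<and> \<psi> T = 0}"

definition weak_solution :: "real \<Rightarrow> real \<Rightarrow> real \<Rightarrow>
    'a::{complex_hilbert, second_countable_topology} set \<Rightarrow> ('a \<Rightarrow> 'a) \<Rightarrow>
    (real \<Rightarrow> 'a) \<Rightarrow> (real \<Rightarrow> 'a) \<Rightarrow> bool"
  where "weak_solution \<alpha> p T D A f u \<longleftrightarrow> u \<in> Lp_space p T \<and>
    (\<forall>\<psi>\<in>test_functions T D A.
      (LINT t|interval_lborel T.
        cinner (u t) (frac_deriv_adj \<alpha> (conjugate_exponent p) T \<psi> t + \<i> *\<^sub>C A (\<psi> t))) =
      (LINT t|interval_lborel T. cinner (f t) (\<psi> t)))"

end

theory Submission
  imports Defs "HOL-Complex_Analysis.Complex_Analysis"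
begin

text \<open>In coordinates the equation decouples into \<open>\<partial>\<^sub>t\<^sup>\<alpha> u\<^sub>n + \<i> \<mu>\<^sub>n u\<^sub>n = f\<^sub>n\<close>, whose solution is the
  convolution of \<open>f\<^sub>n\<close> with the resolvent kernel \<open>k\<^sub>n\<close>, the inverse Laplace transform of
  \<open>1 / (z powr \<alpha> + \<i> \<mu>\<^sub>n)\<close>. As \<open>\<alpha> < 1\<close>, the contour can be bent into the left half plane, which gives
  \<open>\<bar>\<mu>\<^sub>n k\<^sub>n t\<bar> \<le> C min (\<mu>\<^sub>n t powr (\<alpha> - 1)) (t powr (- \<alpha> - 1) / \<mu>\<^sub>n)\<close>. So \<open>\<mu>\<^sub>n u\<^sub>n\<close> is dominated by a
  mixture, of mass bounded uniformly in \<open>n\<close>, of averages of \<open>\<bar>f\<^sub>n\<bar>\<close> over symmetric intervals. Testing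
  the square function of such mixtures against a weight moves the mixture onto the weight, where it is
  bounded by the maximal function; with duality this yields
  \<open>\<parallel>A u\<parallel> \<le> C \<parallel>f\<parallel>\<close> in \<open>L\<^sup>p(0,T;H)\<close> for all \<open>1 < p < \<infinity>\<close> without any theory of singular integrals.
  Uniqueness is obtained mode by mode from the test functions \<open>(T - t) ^ Suc m *\<^sub>R \<phi>\<^sub>n\<close>.\<close>

section \<open>Coordinates in a Hilbert space\<close>

text \<open>The obstacle is that \<open>\<i> * A\<close> has purely imaginary spectrum: at order 1
  the scalar kernels would be the oscillations exp (- \<i> \<mu> t), and \<mu> times their L1 norm
  on (0,T) is unbounded in \<mu>. For \<alpha> < 1 a zero of \<open>z powr \<alpha> + \<i> l\<close>
  would need the argument - pi / (2 \<alpha>), which lies outside the sector of half-angle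
  \<open>\<theta> = pi / (1 + \<alpha>)\<close>; hence both rays can run in the left half plane. The
  large-time decay rests on a cancellation: the value 1 / (\<i> l) of the symbol at 0 contributes
  equally to the two rays and disappears from their difference. The two kernel bounds cross at t = l
  powr (- 1 / \<alpha>), and scaling makes the mass of l times their minimum independent of l. No
  Laplace transform is ever inverted: the kernel is defined by its ray integrals, and its Volterra
  equation is verified by rotating rays. Only absolute values of the kernels enter the estimates, so
  these concern positive operators with even kernels, on finitely many modes and with a constant
  independent of their number.\<close>

lemma cinner_add_right: "cinner x (y + z) = cinner x y + cinner x (z::'a::complex_hilbert)"
  by (metis cinner_commute cinner_add_left complex_cnj_add)

lemma cinner_scaleC_right: "cinner x (a *\<^sub>C y) = cnj a * cinner x (y::'a::complex_hilbert)"
  by (metis cinner_commute cinner_scaleC_left complex_cnj_mult)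

lemma cinner_scaleR_left: "cinner (r *\<^sub>R x) y = of_real r * cinner x (y::'a::complex_hilbert)"
  by (metis cinner_scaleC_left scaleC_of_real)

lemma cinner_scaleR_right: "cinner x (r *\<^sub>R y) = of_real r * cinner x (y::'a::complex_hilbert)"
  by (metis cinner_scaleC_right scaleC_of_real complex_cnj_complex_of_real)

lemma cinner_zero_left [simp]: "cinner 0 (y::'a::complex_hilbert) = 0"
  using cinner_scaleR_left[of 0 0 y] by simp

lemma cinner_zero_right [simp]: "cinner (x::'a::complex_hilbert) 0 = 0"
  using cinner_scaleR_right[of x 0 0] by simp

lemma cinner_minus_left: "cinner (- x) (y::'a::complex_hilbert) = - cinner x y"
  using cinner_scaleR_left[of "-1" x y] by simp

lemma cinner_minus_right: "cinner x (- y::'a::complex_hilbert) = - cinner x y"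
  using cinner_scaleR_right[of x "-1" y] by simp

lemma cinner_diff_left: "cinner (x - z) (y::'a::complex_hilbert) = cinner x y - cinner z y"
  using cinner_add_left[of x "-z" y] by (simp add: cinner_minus_left)

lemma cinner_sum_left: "cinner (\<Sum>i\<in>S. f i) (y::'a::complex_hilbert) = (\<Sum>i\<in>S. cinner (f i) y)"
  by (induction S rule: infinite_finite_induct) (auto simp: cinner_add_left)

lemma scaleC_one [simp]: "1 *\<^sub>C x = (x::'a::complex_hilbert)"
  using scaleC_of_real[of 1 x] by simp

lemma scaleC_zero_left [simp]: "0 *\<^sub>C x = (0::'a::complex_hilbert)"
  using scaleC_of_real[of 0 x] by simp

lemma norm_scaleC: "norm (a *\<^sub>C x) = cmod a * norm (x::'a::complex_hilbert)"
proof -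
  have "complex_of_real ((norm (a *\<^sub>C x))\<^sup>2) = complex_of_real ((cmod a * norm x)\<^sup>2)"
    unfolding cinner_self[symmetric] cinner_scaleC_left cinner_scaleC_right mult.assoc[symmetric]
      complex_norm_square[symmetric]
    using complex_norm_square[of a] by (simp add: cinner_self power_mult_distrib)
  then have "(norm (a *\<^sub>C x))\<^sup>2 = (cmod a * norm x)\<^sup>2"
    using of_real_eq_iff by blast
  then show ?thesis by (simp add: power2_eq_iff_nonneg)
qed

lemma bounded_linear_scaleC: "bounded_linear (\<lambda>x::'a::complex_hilbert. a *\<^sub>C x)"
proof (rule bounded_linear_intro[of _ "cmod a"])
  show "a *\<^sub>C (r *\<^sub>R x) = r *\<^sub>R (a *\<^sub>C x)" for r and x :: 'a
    by (metis scaleC_of_real scaleC_scaleC mult.commute)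
qed (auto simp: scaleC_add_right norm_scaleC)

lemma bounded_bilinear_scaleC: "bounded_bilinear (\<lambda>a (x::'a::complex_hilbert). a *\<^sub>C x)"
proof
  show "(r *\<^sub>R a) *\<^sub>C b = r *\<^sub>R (a *\<^sub>C b)" for r a and b :: 'a
    by (metis scaleC_of_real scaleC_scaleC scaleR_conv_of_real)
  show "a *\<^sub>C (r *\<^sub>R b) = r *\<^sub>R (a *\<^sub>C b)" for r a and b :: 'a
    by (metis scaleC_of_real scaleC_scaleC mult.commute)
  show "\<exists>K. \<forall>a (b::'a). norm (a *\<^sub>C b) \<le> norm a * norm b * K"
    by (rule exI[of _ 1]) (simp add: norm_scaleC)
qed (auto simp: scaleC_add_right scaleC_add_left)

lemma norm_add_orthogonal:
  assumes "cinner x (y::'a::complex_hilbert) = 0"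
  shows "(norm (x + y))\<^sup>2 = (norm x)\<^sup>2 + (norm y)\<^sup>2"
proof -
  have "cinner y x = 0" by (metis assms cinner_commute complex_cnj_zero)
  then have "complex_of_real ((norm (x + y))\<^sup>2) = complex_of_real ((norm x)\<^sup>2 + (norm y)\<^sup>2)"
    unfolding cinner_self[symmetric] of_real_add
    by (simp add: cinner_add_left cinner_add_right assms)
  then show ?thesis using of_real_eq_iff by blast
qed

text \<open>Subtracting the projection \<open>a *\<^sub>C y\<close> leaves a vector orthogonal to
  it, so Pythagoras bounds the projection by \<open>x\<close>.\<close>

lemma Cauchy_Schwarz_cinner: "cmod (cinner x y) \<le> norm x * norm (y::'a::complex_hilbert)"
proof (cases "y = 0")
  case False
  define a where "a = cinner x y / of_real ((norm y)\<^sup>2)"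
  have "cinner (x - a *\<^sub>C y) (a *\<^sub>C y) = 0"
    using False by (simp add: cinner_diff_left cinner_scaleC_left cinner_scaleC_right cinner_self a_def)
  from norm_add_orthogonal[OF this]
  have "(cmod a * norm y)\<^sup>2 \<le> (norm x)\<^sup>2" by (simp add: norm_scaleC)
  then have "cmod a * norm y \<le> norm x" by (rule power2_le_imp_le) simp
  then show ?thesis
    using False by (simp add: a_def norm_divide norm_mult field_simps power2_eq_square)
qed simp

lemma bounded_bilinear_cinner: "bounded_bilinear (\<lambda>x y::'a::complex_hilbert. cinner x y)"
proof
  show "\<exists>K. \<forall>a (b::'a). norm (cinner a b) \<le> norm a * norm b * K"
    by (rule exI[of _ 1]) (simp add: Cauchy_Schwarz_cinner)
qed (auto simp: cinner_add_left cinner_add_right cinner_scaleR_left cinner_scaleR_right scaleR_conv_of_real)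

lemmas bounded_linear_cinner_left = bounded_bilinear.bounded_linear_left[OF bounded_bilinear_cinner]

lemma borel_measurable_cinner [measurable]:
  fixes f g :: "'b \<Rightarrow> 'a::{complex_hilbert, second_countable_topology}"
  assumes "f \<in> borel_measurable M" "g \<in> borel_measurable M"
  shows "(\<lambda>x. cinner (f x) (g x)) \<in> borel_measurable M"
  by (rule borel_measurable_continuous_Pair[OF assms])
    (intro bounded_bilinear.continuous_on[OF bounded_bilinear_cinner] continuous_intros)

lemma borel_measurable_scaleC [measurable]:
  fixes g :: "'b \<Rightarrow> 'a::{complex_hilbert, second_countable_topology}"
  assumes "f \<in> borel_measurable M" "g \<in> borel_measurable M"
  shows "(\<lambda>x. f x *\<^sub>C g x) \<in> borel_measurable M"
  by (rule borel_measurable_continuous_Pair[OF assms])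
    (intro bounded_bilinear.continuous_on[OF bounded_bilinear_scaleC] continuous_intros)

section \<open>Expansion in an orthonormal basis\<close>

locale hilbert_basis =
  fixes \<phi> :: "nat \<Rightarrow> 'a::{complex_hilbert, second_countable_topology}"
  assumes basis: "orthonormal_basis \<phi>"
begin

definition coord :: "nat \<Rightarrow> 'a \<Rightarrow> complex"
  where "coord n x = cinner x (\<phi> n)"

definition partial :: "nat \<Rightarrow> 'a \<Rightarrow> 'a"
  where "partial N x = (\<Sum>n<N. coord n x *\<^sub>C \<phi> n)"

lemma coord_basis: "coord n (\<phi> m) = (if m = n then 1 else 0)"
  using basis by (auto simp: coord_def orthonormal_basis_def)

lemma bounded_linear_coord: "bounded_linear (coord n)"
  unfolding coord_def by (rule bounded_linear_cinner_left)

lemma coord_simps: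
  "coord n (x + y) = coord n x + coord n y" "coord n (x - y) = coord n x - coord n y"
  "coord n (a *\<^sub>C x) = a * coord n x" "coord n (r *\<^sub>R x) = of_real r * coord n x"
  "coord n (- x) = - coord n x" "coord n 0 = 0"
  by (auto simp: coord_def cinner_add_left cinner_diff_left cinner_scaleC_left cinner_scaleR_left
      cinner_minus_left)

lemma coord_measurable [measurable]:
  "f \<in> borel_measurable M \<Longrightarrow> (\<lambda>x. coord n (f x)) \<in> borel_measurable M"
  unfolding coord_def by measurable

lemma norm_basis [simp]: "norm (\<phi> n) = 1"
proof -
  have "complex_of_real ((norm (\<phi> n))\<^sup>2) = complex_of_real 1"
    using coord_basis[of n n] unfolding coord_def cinner_self by simp
  then have "(norm (\<phi> n))\<^sup>2 = 1" using of_real_eq_iff by blast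
  then show ?thesis by (simp add: power2_eq_1_iff) (smt (verit) norm_ge_zero)
qed

lemma norm_coord: "cmod (coord n x) \<le> norm x"
  using Cauchy_Schwarz_cinner[of x "\<phi> n"] by (simp add: coord_def)

lemma coord_sum_basis: "coord k (\<Sum>n<N. a n *\<^sub>C \<phi> n) = (if k < N then a k else 0)"
proof -
  have "coord k (\<Sum>n<N. a n *\<^sub>C \<phi> n) = (\<Sum>n<N. if n = k then a n else 0)"
    unfolding coord_def cinner_sum_left
    by (intro sum.cong) (auto simp: coord_simps[unfolded coord_def] coord_basis[unfolded coord_def])
  then show ?thesis by simp
qed

lemma norm_sum_basis: "(norm (\<Sum>n<N. a n *\<^sub>C \<phi> n))\<^sup>2 = (\<Sum>n<N. (cmod (a n))\<^sup>2)"
proof (induction N)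
  case (Suc N)
  have "cinner (\<Sum>n<N. a n *\<^sub>C \<phi> n) (a N *\<^sub>C \<phi> N) = 0"
    using coord_sum_basis[of N a N] by (simp add: cinner_scaleC_right coord_def)
  from norm_add_orthogonal[OF this] Suc show ?case
    by (simp add: norm_scaleC)
qed simp

lemma coord_partial: "coord k (partial N x) = (if k < N then coord k x else 0)"
  unfolding partial_def by (rule coord_sum_basis)

text \<open>The partial sum is the orthogonal projection of \<open>x\<close>: the remainder is
  orthogonal to it, and Pythagoras gives the inequality.\<close>

lemma bessel: "(\<Sum>n<N. (cmod (coord n x))\<^sup>2) \<le> (norm x)\<^sup>2"
proof -
  have "cinner z (partial N x) = cnj (\<Sum>n<N. coord n x * cnj (coord n z))" for z
  proof -
    have "cinner z (partial N x) = cnj (cinner (partial N x) z)" by (rule cinner_commute)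
    also have "cinner (partial N x) z = (\<Sum>n<N. coord n x * cinner (\<phi> n) z)"
      by (simp add: partial_def cinner_sum_left cinner_scaleC_left)
    also have "(\<lambda>n. cinner (\<phi> n) z) = (\<lambda>n. cnj (coord n z))"
      unfolding coord_def by (rule ext) (rule cinner_commute)
    finally show ?thesis by (simp add: fun_eq_iff)
  qed
  then have "cinner (x - partial N x) (partial N x) = 0"
    by (simp add: coord_simps coord_partial)
  then have "(norm (x - partial N x + partial N x))\<^sup>2 = (norm (x - partial N x))\<^sup>2 + (norm (partial N x))\<^sup>2"
    by (rule norm_add_orthogonal)
  then have "(norm (partial N x))\<^sup>2 \<le> (norm x)\<^sup>2" by simp
  then show ?thesis unfolding partial_def norm_sum_basis .
qed

lemma norm_partial: "norm (partial N x) \<le> norm x"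
  by (rule power2_le_imp_le) (use bessel[of x N] in \<open>auto simp: partial_def norm_sum_basis\<close>)

text \<open>The partial sums are linear contractions that eventually fix every element of the span,
  and the span is dense.\<close>

lemma partial_tendsto: "(\<lambda>N. partial N x) \<longlonglongrightarrow> x"
proof -
  interpret vs: vector_space "scaleC :: complex \<Rightarrow> 'a \<Rightarrow> 'a" by (rule vector_space_scaleC)
  have lin: "partial M (y + z) = partial M y + partial M z"
    "partial M (a *\<^sub>C y) = a *\<^sub>C partial M y" "partial M (y - z) = partial M y - partial M z" for M y z a
    by (auto simp: partial_def coord_simps scaleC_add_left vs.scale_left_diff_distrib sum.distrib
        sum_subtractf vs.scale_sum_right)
  have span: "eventually (\<lambda>M. partial M y = y) sequentially" if "y \<in> cspan (range \<phi>)" for y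
    using that
  proof (induction rule: vs.span_induct_alt)
    case base then show ?case by (simp add: partial_def coord_simps)
  next
    case (step c b y)
    then obtain k where b: "b = \<phi> k" by auto
    have "eventually (\<lambda>M. M > k) sequentially" by (rule eventually_gt_at_top)
    with step.IH show ?case
    proof eventually_elim
      case (elim M)
      have "partial M b = (\<Sum>n<M. if n = k then \<phi> n else 0)"
        unfolding partial_def b by (intro sum.cong) (auto simp: coord_basis)
      then show ?case using elim by (simp add: lin b)
    qed
  qed
  show ?thesis
  proof (rule LIMSEQ_I)
    fix r :: real assume r: "r > 0"
    have "x \<in> closure (cspan (range \<phi>))" using basis by (simp add: orthonormal_basis_def)
    then obtain y where y: "y \<in> cspan (range \<phi>)" "dist y x < r/2"
      using r by (meson closure_approachable half_gt_zero)
    from span[OF y(1)] obtain N where N: "\<And>M. M \<ge> N \<Longrightarrow> partial M y = y"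
      by (auto simp: eventually_sequentially)
    have "norm (partial M x - x) < r" if "M \<ge> N" for M
    proof -
      have "partial M x - x = partial M (x - y) + (y - x)" using N[OF that] by (simp add: lin)
      also have "norm \<dots> \<le> norm (x - y) + norm (y - x)"
        using norm_partial[of M "x - y"] norm_triangle_ineq by (smt (verit))
      also have "\<dots> < r" using y(2) by (simp add: dist_norm norm_minus_commute)
      finally show ?thesis .
    qed
    then show "\<exists>no. \<forall>n\<ge>no. norm (partial n x - x) < r" by blast
  qed
qed

lemma cinner_sums: "(\<lambda>n. coord n x * cnj (coord n y)) sums cinner x y"
proof -
  have "(\<lambda>N. cinner (partial N x) y) \<longlonglongrightarrow> cinner x y"
    by (rule bounded_linear.tendsto[OF bounded_linear_cinner_left partial_tendsto])
  moreover have "cinner (partial N x) y = (\<Sum>n<N. coord n x * cnj (coord n y))" for N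
  proof -
    have "cinner (\<phi> n) y = cnj (coord n y)" for n unfolding coord_def by (rule cinner_commute)
    then show ?thesis by (simp add: partial_def cinner_sum_left cinner_scaleC_left)
  qed
  ultimately show ?thesis by (simp add: sums_def)
qed

lemma parseval: "(\<lambda>n. (cmod (coord n x))\<^sup>2) sums (norm x)\<^sup>2"
proof -
  have "(\<lambda>n. complex_of_real ((cmod (coord n x))\<^sup>2)) sums complex_of_real ((norm x)\<^sup>2)"
    using cinner_sums[of x x] unfolding cinner_self complex_norm_square .
  then show ?thesis by (simp only: sums_of_real_iff)
qed

lemma coord_eqI: "(\<And>n. coord n x = coord n y) \<Longrightarrow> x = y"
  using partial_tendsto[of x] partial_tendsto[of y] LIMSEQ_unique unfolding partial_def by auto

text \<open>Differences of partial sums have the tails of the summable series as squared norms. The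
  element is written with \<open>lim\<close> because the solution is later defined pointwise in time
  by the same expression, which keeps it total and measurable.\<close>

lemma riesz_fischer:
  assumes "summable (\<lambda>n. (cmod (a n))\<^sup>2)"
  shows "convergent (\<lambda>N. \<Sum>n<N. a n *\<^sub>C \<phi> n)"
    and "coord k (lim (\<lambda>N. \<Sum>n<N. a n *\<^sub>C \<phi> n)) = a k"
proof -
  let ?S = "\<lambda>N. \<Sum>n<N. a n *\<^sub>C \<phi> n"
  have d: "(norm (?S M - ?S N))\<^sup>2 = (\<Sum>n\<in>{N..<M}. (cmod (a n))\<^sup>2)" if "N \<le> M" for M N
  proof -
    have "?S M - ?S N = (\<Sum>n<M. (if n < N then 0 else a n) *\<^sub>C \<phi> n)"
    proof -
      have "?S N = (\<Sum>n<M. if n < N then a n *\<^sub>C \<phi> n else 0)"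
        using that by (intro sum.mono_neutral_cong_left) auto
      then show ?thesis by (simp add: sum_subtractf[symmetric]) (intro sum.cong, auto)
    qed
    then have "(norm (?S M - ?S N))\<^sup>2 = (\<Sum>n<M. (cmod (if n < N then 0 else a n))\<^sup>2)"
      by (simp only: norm_sum_basis)
    also have "\<dots> = (\<Sum>n\<in>{N..<M}. (cmod (a n))\<^sup>2)"
      using that by (intro sum.mono_neutral_cong_right) auto
    finally show ?thesis .
  qed
  have "Cauchy ?S"
  proof (rule CauchyI')
    fix e :: real assume e: "e > 0"
    from assms[unfolded summable_Cauchy] e obtain N
      where N: "\<And>m n. m \<ge> N \<Longrightarrow> norm (\<Sum>k\<in>{m..<n}. (cmod (a k))\<^sup>2) < e\<^sup>2"
      by (metis zero_less_power)
    have "norm (?S m - ?S n) < e" if "m \<ge> N" "m < n" for m n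
    proof -
      have "(norm (?S n - ?S m))\<^sup>2 < e\<^sup>2" using N[OF that(1), of n] d[of m n] that by simp
      then show ?thesis using e by (metis norm_minus_commute power2_less_imp_less less_imp_le)
    qed
    then show "\<exists>M. \<forall>m\<ge>M. \<forall>n>m. dist (?S m) (?S n) < e" by (auto simp: dist_norm)
  qed
  then show c: "convergent ?S" by (rule Cauchy_convergent)
  have "(\<lambda>N. coord k (?S N)) \<longlonglongrightarrow> coord k (lim ?S)"
    by (rule bounded_linear.tendsto[OF bounded_linear_coord]) (use c in \<open>simp add: convergent_LIMSEQ_iff\<close>)
  moreover have "(\<lambda>N. coord k (?S N)) \<longlonglongrightarrow> a k"
    by (rule tendsto_eventually, unfold coord_sum_basis)
      (use eventually_gt_at_top[of k] in eventually_elim, simp)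
  ultimately show "coord k (lim ?S) = a k" by (rule LIMSEQ_unique)
qed

end

text \<open>Self-adjointness makes the domain as large as the eigenbasis allows: an element whose formal
  image has square summable coordinates lies in the domain of the adjoint.\<close>

locale diagonal_operator = hilbert_basis \<phi>
  for \<phi> :: "nat \<Rightarrow> 'a::{complex_hilbert, second_countable_topology}" +
  fixes D :: "'a set" and A :: "'a \<Rightarrow> 'a" and \<mu> :: "nat \<Rightarrow> real"
  assumes self_adj: "self_adjoint D A"
    and basis_in_domain: "\<And>n. \<phi> n \<in> D"
    and eigen: "\<And>n. A (\<phi> n) = - (\<mu> n *\<^sub>R \<phi> n)"
begin

lemma linear_op: "linear_operator D A" using self_adj by (simp add: self_adjoint_def)

lemma symmetric_op: "x \<in> D \<Longrightarrow> y \<in> D \<Longrightarrow> cinner (A x) y = cinner x (A y)"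
proof -
  assume "x \<in> D" "y \<in> D"
  then have "(y, A y) \<in> adjoint_graph D A" using self_adj by (auto simp: self_adjoint_def operator_graph_def)
  then show ?thesis using \<open>x \<in> D\<close> by (auto simp: adjoint_graph_def)
qed

lemma coord_op: "x \<in> D \<Longrightarrow> coord n (A x) = - of_real (\<mu> n) * coord n x"
  using symmetric_op[of x "\<phi> n"] basis_in_domain
  by (simp add: coord_def eigen cinner_minus_right cinner_scaleR_right)

lemma in_domainI:
  assumes "\<And>n. coord n y = - of_real (\<mu> n) * coord n x"
  shows "x \<in> D" "A x = y"
proof -
  have "cinner (A z) x = cinner z y" if z: "z \<in> D" for z
  proof -
    have "(\<lambda>n. coord n (A z) * cnj (coord n x)) sums cinner (A z) x" by (rule cinner_sums)
    moreover have "coord n (A z) * cnj (coord n x) = coord n z * cnj (coord n y)" for n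
      by (simp add: coord_op[OF z] assms)
    ultimately show ?thesis using cinner_sums[of z y] sums_unique2 by simp
  qed
  then have "(x, y) \<in> adjoint_graph D A" by (auto simp: adjoint_graph_def)
  then show "x \<in> D" "A x = y" using self_adj by (auto simp: self_adjoint_def operator_graph_def)
qed

end

section \<open>Causal convolution on a bounded interval\<close>

text \<open>Extension by zero from (0,T) to the line. It turns the causal convolution
  \<open>conv\<close>, with its moving limits of integration, into the convolution
  \<open>line_conv\<close> on the whole line, where translation invariance and Fubini apply
  directly.\<close>

definition cut :: "real \<Rightarrow> (real \<Rightarrow> 'b::real_normed_vector) \<Rightarrow> real \<Rightarrow> 'b"
  where "cut T a t = indicator {0<..<T} t *\<^sub>R a t"

definition line_conv :: "(real \<Rightarrow> complex) \<Rightarrow> (real \<Rightarrow> complex) \<Rightarrow> real \<Rightarrow> complex"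
  where "line_conv a b t = (LINT s|lborel. a (t - s) * b s)"

definition conv :: "(real \<Rightarrow> complex) \<Rightarrow> (real \<Rightarrow> complex) \<Rightarrow> real \<Rightarrow> complex"
  where "conv a b t = (LINT s:{0<..<t}|lborel. a (t - s) * b s)"

definition L1_on :: "real \<Rightarrow> (real \<Rightarrow> complex) \<Rightarrow> bool"
  where "L1_on T a \<longleftrightarrow> integrable lborel (cut T a)"

lemma L1_on_set: "L1_on T a \<longleftrightarrow> set_integrable lborel {0<..<T} a"
  by (simp add: L1_on_def set_integrable_def cut_def[abs_def])

lemma AE_interval: "(AE t in interval_lborel T. P t) \<longleftrightarrow> (AE t in lborel. 0 < t \<and> t < T \<longrightarrow> P t)"
  by (subst AE_restrict_space_iff) auto

lemma cut_measurable: "f \<in> borel_measurable (interval_lborel T) \<longleftrightarrow> cut T f \<in> borel_measurable borel"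
  unfolding cut_def[abs_def] by (subst borel_measurable_restrict_space_iff) auto

lemma integrable_interval:
  fixes f :: "real \<Rightarrow> 'b::{banach, second_countable_topology}"
  shows "integrable (interval_lborel T) f \<longleftrightarrow> integrable lborel (cut T f)"
  unfolding cut_def[abs_def] by (subst integrable_restrict_space) auto

lemma integral_interval:
  fixes f :: "real \<Rightarrow> 'b::{banach, second_countable_topology}"
  shows "(LINT t|interval_lborel T. f t) = (LINT t|lborel. cut T f t)"
  unfolding cut_def[abs_def] by (subst integral_restrict_space) auto

text \<open>For fixed \<open>s\<close>, translation invariance makes the integral over
  \<open>t\<close> of the norm equal to the L1 norm of \<open>a\<close> times the norm of
  \<open>b s\<close>, so the double integral converges absolutely.\<close>

lemma line_conv_integrable:
  assumes [measurable]: "integrable lborel a" "integrable lborel b"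
  shows "integrable (lborel \<Otimes>\<^sub>M lborel) (\<lambda>(s, t). a (t - s) * b s)"
    and "AE t in lborel. integrable lborel (\<lambda>s. a (t - s) * b s)"
    and "integrable lborel (line_conv a b)"
proof -
  have [measurable]: "a \<in> borel_measurable borel" "b \<in> borel_measurable borel"
    using assms by (auto dest: borel_measurable_integrable)
  have sh: "integrable lborel (\<lambda>t. a (t - s))" for s
    using lborel_integrable_real_affine[OF assms(1), of 1 "- s"] by simp
  have shn: "(LINT t|lborel. norm (a (t - s))) = (LINT t|lborel. norm (a t))" for s
    using lborel_integral_real_affine[of 1 "\<lambda>t. norm (a t)" "- s"] by simp
  show F: "integrable (lborel \<Otimes>\<^sub>M lborel) (\<lambda>(s, t). a (t - s) * b s)"
  proof (rule lborel_pair.Fubini_integrable)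
    show "integrable lborel (\<lambda>s. LINT t|lborel. norm (case (s, t) of (s, t) \<Rightarrow> a (t - s) * b s))"
      using assms(2) by (simp add: norm_mult shn)
    show "AE s in lborel. integrable lborel (\<lambda>t. case (s, t) of (s, t) \<Rightarrow> a (t - s) * b s)"
      using sh by simp
  qed measurable
  show "AE t in lborel. integrable lborel (\<lambda>s. a (t - s) * b s)"
    using lborel_pair.AE_integrable_snd[OF F] .
  show "integrable lborel (line_conv a b)"
    unfolding line_conv_def[abs_def] using lborel_pair.integrable_snd[OF F] .
qed

lemma line_conv_commute: "line_conv a b t = line_conv b a t"
  using lborel_integral_real_affine[of "- 1" "\<lambda>s. a (t - s) * b s" t]
  by (simp add: line_conv_def mult.commute)

text \<open>By Tonelli, the integral over \<open>t\<close> of the absolute double integral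
  \<open>?N\<close> is the product of the three L1 norms. So \<open>?N t\<close> is finite for
  almost every \<open>t\<close>, and at each such \<open>t\<close> Fubini exchanges the two
  integrations.\<close>

lemma line_conv_assoc:
  assumes a: "integrable lborel a" and b: "integrable lborel b" and c: "integrable lborel c"
  shows "AE t in lborel. line_conv (line_conv a b) c t = line_conv a (line_conv b c) t"
proof -
  have [measurable]: "a \<in> borel_measurable borel" "b \<in> borel_measurable borel" "c \<in> borel_measurable borel"
    using assms by (auto dest: borel_measurable_integrable)
  have sh: "(\<integral>\<^sup>+t. ennreal (norm (f (t - s))) \<partial>lborel) = (\<integral>\<^sup>+t. ennreal (norm (f t)) \<partial>lborel)"
    if [measurable]: "f \<in> borel_measurable borel" for f :: "real \<Rightarrow> complex" and s
    using nn_integral_real_affine[of "\<lambda>t. ennreal (norm (f t))" 1 "- s"] by simp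
  let ?N = "\<lambda>t. \<integral>\<^sup>+s. \<integral>\<^sup>+r. ennreal (norm (a (t - s))) * (ennreal (norm (b (s - r))) * ennreal (norm (c r))) \<partial>lborel \<partial>lborel"
  have "(\<integral>\<^sup>+t. ?N t \<partial>lborel) = (\<integral>\<^sup>+s. \<integral>\<^sup>+t. \<integral>\<^sup>+r. ennreal (norm (a (t - s))) * (ennreal (norm (b (s - r))) * ennreal (norm (c r))) \<partial>lborel \<partial>lborel \<partial>lborel)"
    by (rule lborel_pair.Fubini'[symmetric]) measurable
  also have "\<dots> = (\<integral>\<^sup>+s. \<integral>\<^sup>+t. ennreal (norm (a (t - s))) * (\<integral>\<^sup>+r. ennreal (norm (b (s - r))) * ennreal (norm (c r)) \<partial>lborel) \<partial>lborel \<partial>lborel)"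
    by (simp add: nn_integral_cmult)
  also have "\<dots> = (\<integral>\<^sup>+s. (\<integral>\<^sup>+t. ennreal (norm (a t)) \<partial>lborel) * (\<integral>\<^sup>+r. ennreal (norm (b (s - r))) * ennreal (norm (c r)) \<partial>lborel) \<partial>lborel)"
    by (simp add: nn_integral_multc sh)
  also have "\<dots> = (\<integral>\<^sup>+t. ennreal (norm (a t)) \<partial>lborel) * (\<integral>\<^sup>+s. \<integral>\<^sup>+r. ennreal (norm (b (s - r))) * ennreal (norm (c r)) \<partial>lborel \<partial>lborel)"
    by (rule nn_integral_cmult) measurable
  also have "(\<integral>\<^sup>+s. \<integral>\<^sup>+r. ennreal (norm (b (s - r))) * ennreal (norm (c r)) \<partial>lborel \<partial>lborel)
    = (\<integral>\<^sup>+r. \<integral>\<^sup>+s. ennreal (norm (b (s - r))) * ennreal (norm (c r)) \<partial>lborel \<partial>lborel)"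
    by (rule lborel_pair.Fubini'[symmetric]) measurable
  also have "\<dots> = (\<integral>\<^sup>+t. ennreal (norm (b t)) \<partial>lborel) * (\<integral>\<^sup>+t. ennreal (norm (c t)) \<partial>lborel)"
    by (simp add: nn_integral_multc nn_integral_cmult sh)
  also have "(\<integral>\<^sup>+t. ennreal (norm (a t)) \<partial>lborel) * \<dots> < \<infinity>"
    using a b c by (auto simp: integrable_iff_bounded ennreal_mult_less_top)
  finally have "AE t in lborel. ?N t \<noteq> \<infinity>"
    by (intro nn_integral_PInf_AE) (auto simp: less_top)
  then show ?thesis
  proof eventually_elim
    case (elim t)
    let ?f = "\<lambda>(s, r). a (t - s) * (b (s - r) * c r)"
    have F: "integrable (lborel \<Otimes>\<^sub>M lborel) ?f"
    proof (rule integrableI_bounded)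
      have "(\<integral>\<^sup>+x. ennreal (norm (?f x)) \<partial>(lborel \<Otimes>\<^sub>M lborel)) = (\<integral>\<^sup>+s. \<integral>\<^sup>+r. ennreal (norm (?f (s, r))) \<partial>lborel \<partial>lborel)"
        by (rule lborel.nn_integral_fst[symmetric]) measurable
      also have "\<dots> = ?N t" by (simp add: norm_mult ennreal_mult)
      finally show "(\<integral>\<^sup>+x. ennreal (norm (?f x)) \<partial>(lborel \<Otimes>\<^sub>M lborel)) < \<infinity>" using elim by (simp add: less_top)
    qed measurable
    have "line_conv a (line_conv b c) t = (LINT s|lborel. LINT r|lborel. a (t - s) * (b (s - r) * c r))"
      by (simp add: line_conv_def)
    also have "\<dots> = (LINT r|lborel. LINT s|lborel. a (t - s) * (b (s - r) * c r))"
      using lborel_pair.Fubini_integral[OF F] by simp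
    also have "\<dots> = (LINT r|lborel. line_conv a b (t - r) * c r)"
    proof (rule Bochner_Integration.integral_cong[OF refl])
      fix r
      have "(LINT s|lborel. a (t - s) * (b (s - r) * c r)) = (LINT s|lborel. a (t - (r + s)) * (b s * c r))"
        using lborel_integral_real_affine[of 1 "\<lambda>s. a (t - s) * (b (s - r) * c r)" r] by simp
      also have "\<dots> = line_conv a b (t - r) * c r"
        by (simp add: line_conv_def mult.assoc[symmetric] diff_diff_eq)
      finally show "(LINT s|lborel. a (t - s) * (b (s - r) * c r)) = line_conv a b (t - r) * c r" .
    qed
    finally show ?case by (simp add: line_conv_def)
  qed
qed

lemma conv_cut:
  assumes "t < T"
  shows "conv a b t = line_conv (cut T a) (cut T b) t"
    and "integrable lborel (\<lambda>s. cut T a (t - s) * cut T b s) \<longleftrightarrow> set_integrable lborel {0<..<t} (\<lambda>s. a (t - s) * b s)"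
proof -
  have "(\<lambda>s. cut T a (t - s) * cut T b s) = (\<lambda>s. indicator {0<..<t} s *\<^sub>R (a (t - s) * b s))"
    using assms by (auto simp: cut_def indicator_def fun_eq_iff)
  then show "conv a b t = line_conv (cut T a) (cut T b) t"
    and "integrable lborel (\<lambda>s. cut T a (t - s) * cut T b s) \<longleftrightarrow> set_integrable lborel {0<..<t} (\<lambda>s. a (t - s) * b s)"
    by (simp_all add: conv_def set_lebesgue_integral_def line_conv_def set_integrable_def)
qed

lemma conv_nonpos: "t \<le> 0 \<Longrightarrow> conv a b t = 0"
  by (simp add: conv_def set_lebesgue_integral_def)

lemma cut_conv: "cut T (conv a b) = cut T (line_conv (cut T a) (cut T b))"
  by (auto simp: cut_def fun_eq_iff indicator_def conv_cut(1)[of _ T])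

lemma integrable_cut:
  fixes f :: "real \<Rightarrow> 'b::{banach, second_countable_topology}"
  shows "integrable lborel f \<Longrightarrow> integrable lborel (cut T f)"
  unfolding cut_def[abs_def] by (rule integrable_mult_indicator) auto

lemma cut_cut [simp]: "cut T (cut T f) = cut T f"
  by (auto simp: cut_def fun_eq_iff indicator_def)

lemma L1_on_conv: "L1_on T a \<Longrightarrow> L1_on T b \<Longrightarrow> L1_on T (conv a b)"
  unfolding L1_on_def cut_conv by (rule integrable_cut[OF line_conv_integrable(3)])

lemma conv_commute: "conv a b t = conv b a t"
  using conv_cut(1)[of t "t + 1" a b] conv_cut(1)[of t "t + 1" b a] line_conv_commute by auto

lemma conv_integrable_AE:
  assumes "L1_on T a" "L1_on T b"
  shows "AE t in lborel. 0 < t \<and> t < T \<longrightarrow> set_integrable lborel {0<..<t} (\<lambda>s. a (t - s) * b s)"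
  using line_conv_integrable(2)[OF assms[unfolded L1_on_def]]
  by eventually_elim (auto simp: conv_cut(2))

lemma conv_assoc:
  assumes "L1_on T a" "L1_on T b" "L1_on T c"
  shows "AE t in lborel. 0 < t \<and> t < T \<longrightarrow> conv (conv a b) c t = conv a (conv b c) t"
  using line_conv_assoc[OF assms[unfolded L1_on_def]]
proof eventually_elim
  case (elim t)
  \<comment> \<open>The inner \<open>cut\<close> is harmless: the factor
    \<open>cut T f (t - s)\<close> vanishes unless s < t < T, and the inner convolution vanishes for
    s \<le> 0.\<close>
  have eq: "line_conv (cut T f) (cut T (line_conv (cut T g) (cut T h))) t = line_conv (cut T f) (line_conv (cut T g) (cut T h)) t"
    if "t < T" for f g h
    unfolding line_conv_def
  proof (rule Bochner_Integration.integral_cong[OF refl])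
    fix s
    have "line_conv (cut T g) (cut T h) s = 0" if "s \<le> 0"
      using conv_nonpos[OF that, of g h] conv_cut(1)[of s T g h] that \<open>t < T\<close>
      by (cases "s < T") (auto simp: line_conv_def cut_def indicator_def intro!: integral_eq_zero_AE)
    then show "cut T f (t - s) * cut T (\<lambda>t. LINT s|lborel. cut T g (t - s) * cut T h s) s
      = cut T f (t - s) * (LINT sa|lborel. cut T g (s - sa) * cut T h sa)"
      using that by (auto simp: cut_def indicator_def line_conv_def)
  qed
  show ?case
  proof
    assume t: "0 < t \<and> t < T"
    have "conv (conv a b) c t = line_conv (cut T c) (cut T (line_conv (cut T a) (cut T b))) t"
      using t by (simp add: conv_cut(1)[of t T] cut_conv line_conv_commute)
    also have "\<dots> = line_conv (line_conv (cut T a) (cut T b)) (cut T c) t"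
      using t by (simp add: eq line_conv_commute)
    also have "\<dots> = line_conv (cut T a) (line_conv (cut T b) (cut T c)) t" by (rule elim)
    also have "\<dots> = conv a (conv b c) t"
      using t by (simp add: conv_cut(1)[of t T] cut_conv eq)
    finally show "conv (conv a b) c t = conv a (conv b c) t" .
  qed
qed

lemma conv_cong_AE:
  assumes "AE s in lborel. 0 < s \<and> s < T \<longrightarrow> b s = b' s" "t \<le> T"
    and [measurable]: "cut T a \<in> borel_measurable borel" "cut T b \<in> borel_measurable borel" "cut T b' \<in> borel_measurable borel"
  shows "conv a b t = conv a b' t"
proof -
  have e: "conv a f t = (LINT s|lborel. cut T a (t - s) * cut T f s)" for f
    unfolding conv_def set_lebesgue_integral_def
    using assms(2) by (intro Bochner_Integration.integral_cong) (auto simp: cut_def indicator_def)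
  show ?thesis unfolding e
  proof (rule integral_cong_AE)
    show "AE s in lborel. cut T a (t - s) * cut T b s = cut T a (t - s) * cut T b' s"
      using assms(1) by eventually_elim (auto simp: cut_def indicator_def)
  qed measurable
qed

lemma conv_linear:
  assumes "L1_on T a" "L1_on T b" "L1_on T c"
  shows "AE t in lborel. 0 < t \<and> t < T \<longrightarrow> conv a (\<lambda>s. b s + k * c s) t = conv a b t + k * conv a c t"
  using conv_integrable_AE[OF assms(1,2)] conv_integrable_AE[OF assms(1,3)]
proof eventually_elim
  case (elim t)
  then show ?case
    unfolding conv_def
    by (auto simp: distrib_left mult.left_commute[of _ k] set_integral_add(2)[OF _ set_integrable_mult_right])
qed

text \<open>Fubini followed by the reflection of t in T. Under the pairing with a time-reversed
  factor, convolution with \<open>a\<close> is its own transpose. This moves fractional integrals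
  between a solution and a test function; boundedness of \<open>w\<close> secures absolute
  convergence.\<close>

lemma conv_bilinear:
  assumes a: "L1_on T a" and b: "L1_on T b" and [measurable]: "cut T w \<in> borel_measurable borel"
    and w: "\<And>t. 0 < t \<Longrightarrow> t < T \<Longrightarrow> cmod (w t) \<le> M"
  shows "(LINT t:{0<..<T}|lborel. conv a b t * w (T - t)) = (LINT s:{0<..<T}|lborel. b s * conv a w (T - s))"
proof -
  have [measurable]: "cut T a \<in> borel_measurable borel" "cut T b \<in> borel_measurable borel"
    using a b by (auto simp: L1_on_def dest: borel_measurable_integrable)
  have F: "integrable (lborel \<Otimes>\<^sub>M lborel) (\<lambda>(s, t). cut T w (T - t) * (cut T a (t - s) * cut T b s))"
  proof (rule Bochner_Integration.integrable_bound)
    show "integrable (lborel \<Otimes>\<^sub>M lborel) (\<lambda>x. M * norm (case x of (s, t) \<Rightarrow> cut T a (t - s) * cut T b s))"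
      using line_conv_integrable(1)[OF a[unfolded L1_on_def] b[unfolded L1_on_def]] by simp
    have "cmod (cut T w (T - t)) \<le> \<bar>M\<bar>" for t
      using w[of "T - t"] by (auto simp: cut_def indicator_def)
    then show "AE x in lborel \<Otimes>\<^sub>M lborel. norm (case x of (s, t) \<Rightarrow> cut T w (T - t) * (cut T a (t - s) * cut T b s))
      \<le> norm (M * norm (case x of (s, t) \<Rightarrow> cut T a (t - s) * cut T b s))"
      by (intro always_eventually allI) (auto simp: norm_mult abs_mult intro!: mult_right_mono)
  qed measurable
  have "(LINT t:{0<..<T}|lborel. conv a b t * w (T - t)) = (LINT t|lborel. cut T w (T - t) * line_conv (cut T a) (cut T b) t)"
    unfolding set_lebesgue_integral_def
    by (rule Bochner_Integration.integral_cong) (auto simp: cut_def[of T w] indicator_def conv_cut(1)[of _ T])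
  also have "\<dots> = (LINT t|lborel. LINT s|lborel. cut T w (T - t) * (cut T a (t - s) * cut T b s))"
    by (simp add: line_conv_def)
  also have "\<dots> = (LINT s|lborel. LINT t|lborel. cut T w (T - t) * (cut T a (t - s) * cut T b s))"
    using lborel_pair.Fubini_integral[OF F] by simp
  also have "\<dots> = (LINT s|lborel. cut T b s * line_conv (cut T a) (cut T w) (T - s))"
  proof (rule Bochner_Integration.integral_cong[OF refl])
    fix s
    have "(LINT t|lborel. cut T w (T - t) * (cut T a (t - s) * cut T b s))
      = (LINT t|lborel. cut T w t * (cut T a (T - t - s) * cut T b s))"
      using lborel_integral_real_affine[of "- 1" "\<lambda>t. cut T w (T - t) * (cut T a (t - s) * cut T b s)" T] by simp
    also have "\<dots> = (LINT t|lborel. cut T b s * (cut T a (T - s - t) * cut T w t))"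
      by (rule Bochner_Integration.integral_cong) (auto simp: algebra_simps)
    finally show "(LINT t|lborel. cut T w (T - t) * (cut T a (t - s) * cut T b s)) = cut T b s * line_conv (cut T a) (cut T w) (T - s)"
      by (simp add: line_conv_def)
  qed
  also have "\<dots> = (LINT s:{0<..<T}|lborel. b s * conv a w (T - s))"
    unfolding set_lebesgue_integral_def
    by (rule Bochner_Integration.integral_cong) (auto simp: cut_def[of T b] indicator_def conv_cut(1)[of _ T])
  finally show ?thesis .
qed

section \<open>Moments determine integrable functions\<close>

text \<open>The positive and negative parts of \<open>h\<close> are densities of two finite measures
  that agree on all half-lines, hence everywhere, so the densities agree almost everywhere.\<close>

lemma AE_zero_real:
  fixes h :: "real \<Rightarrow> real"
  assumes h: "integrable lborel h" and z: "\<And>x. (LINT y:{x<..}|lborel. h y) = 0"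
  shows "AE x in lborel. h x = 0"
proof -
  have [measurable]: "h \<in> borel_measurable borel" using h by (auto dest: borel_measurable_integrable)
  let ?p = "\<lambda>x. ennreal (max 0 (h x))" and ?m = "\<lambda>x. ennreal (max 0 (- h x))"
  have i: "integrable lborel (\<lambda>x. max 0 (h x))" "integrable lborel (\<lambda>x. max 0 (- h x))"
    using h by (auto intro: Bochner_Integration.integrable_max)
  have e: "emeasure (density lborel (\<lambda>y. ennreal (f y))) {x<..} = ennreal (LINT y|lborel. indicator {x<..} y * f y)"
    if "integrable lborel f" "\<And>y. 0 \<le> f y" for f :: "real \<Rightarrow> real" and x
  proof -
    have [measurable]: "f \<in> borel_measurable borel" using that by (auto dest: borel_measurable_integrable)
    have "emeasure (density lborel (\<lambda>y. ennreal (f y))) {x<..} = (\<integral>\<^sup>+y. ennreal (indicator {x<..} y * f y) \<partial>lborel)"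
      by (subst emeasure_density) (auto intro!: nn_integral_cong simp: indicator_def)
    also have "\<dots> = ennreal (LINT y|lborel. indicator {x<..} y * f y)"
      using that integrable_mult_indicator[of "{x<..}" lborel f] by (intro nn_integral_eq_integral) auto
    finally show ?thesis .
  qed
  have eq: "(LINT y|lborel. indicator {x<..} y * max 0 (h y)) = (LINT y|lborel. indicator {x<..} y * max 0 (- h y))" for x
  proof -
    have "(LINT y|lborel. indicator {x<..} y * max 0 (h y)) - (LINT y|lborel. indicator {x<..} y * max 0 (- h y))
      = (LINT y|lborel. indicator {x<..} y * max 0 (h y) - indicator {x<..} y * max 0 (- h y))"
      using integrable_mult_indicator[OF _ i(1), of "{x<..}"] integrable_mult_indicator[OF _ i(2), of "{x<..}"]
      by (intro Bochner_Integration.integral_diff[symmetric]) simp_all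
    also have "\<dots> = (LINT y|lborel. indicator {x<..} y * h y)"
      by (intro Bochner_Integration.integral_cong) (auto simp: indicator_def)
    finally show ?thesis using z[of x] by (simp add: set_lebesgue_integral_def)
  qed
  have "density lborel ?p = density lborel ?m"
    by (rule measure_eqI_lessThan) (use i e eq in auto)
  then have "AE x in lborel. ?p x = ?m x"
    by (intro sigma_finite_measure.density_unique[OF sigma_finite_lborel]) auto
  then show ?thesis
    by eventually_elim (auto simp: max_def split: if_splits)
qed

lemma AE_zero_complex:
  fixes h :: "real \<Rightarrow> complex"
  assumes h: "integrable lborel h" and z: "\<And>x. (LINT y:{x<..}|lborel. h y) = 0"
  shows "AE x in lborel. h x = 0"
proof -
  have i: "integrable lborel (\<lambda>y. indicator {x<..} y *\<^sub>R h y)" for x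
    using h by (intro integrable_mult_indicator) auto
  have "(LINT y:{x<..}|lborel. Re (h y)) = 0" "(LINT y:{x<..}|lborel. Im (h y)) = 0" for x
    using arg_cong[OF z[of x], of Re] arg_cong[OF z[of x], of Im] integral_Re[OF i[of x]] integral_Im[OF i[of x]]
    unfolding set_lebesgue_integral_def by simp_all
  then have "AE x in lborel. Re (h x) = 0" "AE x in lborel. Im (h x) = 0"
    using h by (auto intro!: AE_zero_real integrable_Re integrable_Im)
  then show ?thesis by eventually_elim (simp add: complex_eq_iff)
qed

text \<open>Weierstrass approximation: the hypothesis annihilates all polynomials vanishing at
  \<open>T\<close>, hence all continuous functions vanishing at \<open>T\<close>, and these
  approximate indicators of half-lines. The powers start at \<open>Suc k\<close> because test
  functions have to vanish at \<open>T\<close>.\<close>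

lemma moments_zero:
  assumes h: "L1_on T h" and T: "0 < T"
    and m: "\<And>k. (LINT s:{0<..<T}|lborel. h s * of_real ((T - s) ^ Suc k)) = 0"
  shows "AE s in lborel. 0 < s \<and> s < T \<longrightarrow> h s = 0"
proof -
  define h0 where "h0 = cut T h"
  have hi: "integrable lborel h0" using h by (simp add: h0_def L1_on_def)
  then have [measurable]: "h0 \<in> borel_measurable borel" by (auto dest: borel_measurable_integrable)
  have bnd: "integrable lborel (\<lambda>s. h0 s * of_real (f s))"
    if "\<And>s. 0 < s \<Longrightarrow> s < T \<Longrightarrow> \<bar>f s\<bar> \<le> M" "f \<in> borel_measurable borel" for f M
  proof (rule Bochner_Integration.integrable_bound)
    show "integrable lborel (\<lambda>s. M * norm (h0 s))" using hi by simp
    show "AE s in lborel. norm (h0 s * of_real (f s)) \<le> norm (M * norm (h0 s))"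
    proof (intro always_eventually allI)
      fix s
      have "cmod (h0 s) * \<bar>f s\<bar> \<le> \<bar>M\<bar> * cmod (h0 s)"
      proof (cases "0 < s \<and> s < T")
        case True
        then have "\<bar>f s\<bar> \<le> \<bar>M\<bar>" using that(1)[of s] by auto
        then show ?thesis by (subst mult.commute) (rule mult_right_mono, auto)
      qed (auto simp: h0_def cut_def)
      then show "norm (h0 s * of_real (f s)) \<le> norm (M * norm (h0 s))" by (simp add: norm_mult abs_mult)
    qed
  qed (use that(2) in measurable)
  have cont: "(LINT s|lborel. h0 s * of_real (f s)) = 0" if f: "continuous_on UNIV f" "f T = 0" for f :: "real \<Rightarrow> real"
  proof -
    have [measurable]: "f \<in> borel_measurable borel" using f(1) by (rule borel_measurable_continuous_onI)
    have "cmod (LINT s|lborel. h0 s * of_real (f s)) \<le> 2 * e * (LINT s|lborel. norm (h0 s))" if e: "e > 0" for e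
    proof -
      have "continuous_on {0..T} (\<lambda>y. f (T - y))" by (intro continuous_on_compose2[OF f(1)] continuous_intros) auto
      from Stone_Weierstrass_real_polynomial_function[OF compact_Icc this e] obtain p where p: "real_polynomial_function p"
        "\<And>y. y \<in> {0..T} \<Longrightarrow> \<bar>f (T - y) - p y\<bar> < e" by auto
      obtain c n where c: "p = (\<lambda>x. \<Sum>i\<le>n. c i * x ^ i)" using p(1) real_polynomial_function_iff_sum by auto
      define q where "q s = (\<Sum>i<n. c (Suc i) * (T - s) ^ Suc i)" for s
      have pq: "p y = c 0 + q (T - y)" for y
        unfolding c q_def lessThan_Suc_atMost[symmetric] sum.lessThan_Suc_shift by simp
      \<comment> \<open>As \<open>f T = 0\<close>, the constant term of the approximating polynomial
        is itself below \<open>e\<close>. Dropping it makes the polynomial vanish at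
        \<open>T\<close> and costs another \<open>e\<close>, whence the bound
        \<open>2 * e\<close>.\<close>
      have c0: "\<bar>c 0\<bar> < e" using p(2)[of 0] T f(2) by (simp add: pq q_def)
      have close: "\<bar>f s - q s\<bar> \<le> 2 * e" if "0 < s" "s < T" for s
        using p(2)[of "T - s"] that c0 pq[of "T - s"] by auto
      have [measurable]: "q \<in> borel_measurable borel" unfolding q_def[abs_def] by measurable
      have ti: "integrable lborel (\<lambda>s. h0 s * of_real ((T - s) ^ Suc i))" for i
      proof (rule bnd[of _ "T ^ Suc i"])
        show "\<bar>(T - s) ^ Suc i\<bar> \<le> T ^ Suc i" if "0 < s" "s < T" for s
          unfolding power_abs using that by (intro power_mono) auto
      qed measurable
      have mz: "(LINT s|lborel. h0 s * of_real ((T - s) ^ Suc i)) = 0" for i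
        using m[of i] by (simp add: h0_def cut_def set_lebesgue_integral_def)
      have "(\<lambda>s. h0 s * of_real (q s)) = (\<lambda>s. \<Sum>i<n. of_real (c (Suc i)) * (h0 s * of_real ((T - s) ^ Suc i)))"
        unfolding q_def by (simp add: sum_distrib_left ac_simps del: power_Suc)
      moreover have "(LINT s|lborel. (\<Sum>i<n. of_real (c (Suc i)) * (h0 s * of_real ((T - s) ^ Suc i)))) = 0"
        by (subst Bochner_Integration.integral_sum, rule integrable_mult_right[OF ti])
          (simp only: integral_mult_right_zero mz mult_zero_right sum.neutral_const)
      ultimately have q0: "(LINT s|lborel. h0 s * of_real (q s)) = 0" "integrable lborel (\<lambda>s. h0 s * of_real (q s))"
        by (auto simp only: intro!: Bochner_Integration.integrable_sum integrable_mult_right ti)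
      have fi: "integrable lborel (\<lambda>s. h0 s * of_real (f s - q s))" by (rule bnd[of _ "2 * e"]) (use close in auto)
      have "(LINT s|lborel. h0 s * of_real (f s)) = (LINT s|lborel. h0 s * of_real (f s - q s) + h0 s * of_real (q s))"
        by (intro Bochner_Integration.integral_cong) (auto simp: algebra_simps)
      also have "\<dots> = (LINT s|lborel. h0 s * of_real (f s - q s))"
        using q0 fi by (subst Bochner_Integration.integral_add) auto
      finally have "cmod (LINT s|lborel. h0 s * of_real (f s)) \<le> (LINT s|lborel. norm (h0 s * of_real (f s - q s)))"
        by (simp only: integral_norm_bound)
      also have "\<dots> \<le> (LINT s|lborel. 2 * e * norm (h0 s))"
      proof (rule integral_mono)
        fix s
        show "norm (h0 s * of_real (f s - q s)) \<le> 2 * e * norm (h0 s)"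
        proof (cases "0 < s \<and> s < T")
          case True
          then show ?thesis using close[of s] mult_right_mono[of "\<bar>f s - q s\<bar>" "2 * e" "cmod (h0 s)"]
            by (simp add: norm_mult mult.commute del: of_real_diff)
        qed (auto simp: h0_def cut_def)
      qed (use fi hi in auto)
      finally show ?thesis by simp
    qed
    note b = this
    define n where "n = (LINT s|lborel. norm (h0 s))"
    have n0: "0 \<le> n" by (simp add: n_def)
    have "cmod (LINT s|lborel. h0 s * of_real (f s)) \<le> 0"
    proof (rule field_le_epsilon)
      fix e :: real assume "0 < e"
      then have "0 < e / (2 * (n + 1))" using n0 by simp
      from b[OF this] have "cmod (LINT s|lborel. h0 s * of_real (f s)) \<le> 2 * (e / (2 * (n + 1))) * n"
        unfolding n_def .
      also have "\<dots> \<le> e" using n0 \<open>0 < e\<close> by (simp add: field_simps)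
      finally show "cmod (LINT s|lborel. h0 s * of_real (f s)) \<le> 0 + e" by simp
    qed
    then show ?thesis by simp
  qed
  have "(LINT y:{x<..}|lborel. h0 y) = 0" for x
  proof -
    \<comment> \<open>The first ramp rises to the indicator of the half-line. The second forces the
      value 0 at \<open>T\<close>, as \<open>cont\<close> requires, and tends to 1 at every point of
      (0,T), which carries \<open>h0\<close>.\<close>
    let ?f = "\<lambda>n s. max 0 (min 1 (real n * (s - x))) * max 0 (min 1 (real n * (T - s)))"
    have "(\<lambda>n. LINT s|lborel. h0 s * of_real (?f n s)) \<longlonglongrightarrow> (LINT s|lborel. indicator {x<..} s *\<^sub>R h0 s)"
    proof (rule integral_dominated_convergence[where w="\<lambda>s. norm (h0 s)"])
      show "AE s in lborel. (\<lambda>n. h0 s * of_real (?f n s)) \<longlonglongrightarrow> indicator {x<..} s *\<^sub>R h0 s"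
      proof (intro always_eventually allI)
        fix s
        have one: "(\<lambda>n. max 0 (min 1 (real n * d))) \<longlonglongrightarrow> 1" if "d > 0" for d
        proof (rule tendsto_eventually)
          obtain N where N: "1 / d < real N" using reals_Archimedean2 by blast
          show "eventually (\<lambda>n. max 0 (min 1 (real n * d)) = 1) sequentially"
            using eventually_ge_at_top[of N]
          proof eventually_elim
            case (elim n)
            then have "1 / d < real n" using N by (meson less_le_trans of_nat_le_iff)
            then have "1 \<le> real n * d" using that by (simp add: field_simps)
            then show ?case by simp
          qed
        qed
        show "(\<lambda>n. h0 s * of_real (?f n s)) \<longlonglongrightarrow> indicator {x<..} s *\<^sub>R h0 s"
        proof (cases "0 < s \<and> s < T")
          case True
          show ?thesis
          proof (cases "x < s")
            case True
            have "(\<lambda>n. h0 s * of_real (?f n s)) \<longlonglongrightarrow> h0 s * of_real (1 * 1)"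
              using True \<open>0 < s \<and> s < T\<close> by (intro tendsto_intros one) auto
            then show ?thesis using True by simp
          next
            case False
            then have "real n * (s - x) \<le> 0" for n by (intro mult_nonneg_nonpos) auto
            then have "max 0 (min 1 (real n * (s - x))) = 0" for n by (simp add: max_absorb1 min.coboundedI2)
            then have "?f n s = 0" for n by (simp only: mult_zero_left)
            then show ?thesis using False by (simp only:) simp
          qed
        qed (auto simp: h0_def cut_def)
      qed
      show "AE s in lborel. norm (h0 s * of_real (?f n s)) \<le> norm (h0 s)" for n
      proof (intro always_eventually allI)
        fix s
        have "\<bar>?f n s\<bar> \<le> 1 * 1" unfolding abs_mult by (intro mult_mono) auto
        then show "norm (h0 s * of_real (?f n s)) \<le> norm (h0 s)" unfolding norm_mult norm_of_real by (intro mult_left_le) auto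
      qed
    qed (use hi in auto)
    moreover have "(LINT s|lborel. h0 s * of_real (?f n s)) = 0" for n
      by (intro cont continuous_intros) auto
    ultimately show ?thesis by (simp add: LIMSEQ_const_iff set_lebesgue_integral_def)
  qed
  then have "AE s in lborel. h0 s = 0" using hi by (intro AE_zero_complex)
  then show ?thesis by eventually_elim (auto simp: h0_def cut_def)
qed

section \<open>Integrals along rays\<close>

lemma nn_integral_Gamma_scaled:
  assumes "0 < a" "0 < c"
  shows "(\<integral>\<^sup>+x. (if 0 < x then ennreal (x powr (a - 1) * exp (- (c * x))) else 0) \<partial>lborel) = ennreal (Gamma a / c powr a)"
proof -
  let ?f = "\<lambda>x. if 0 < x then ennreal (x powr (a - 1) * exp (- (c * x))) else 0"
  have "ennreal (Gamma a) = (\<integral>\<^sup>+t. ennreal (indicator {0..} t * t powr (a - 1) / exp t) \<partial>lborel)"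
    using assms by (intro Gamma_conv_nn_integral_real)
  also have "\<dots> = ennreal c * (\<integral>\<^sup>+t. ennreal (indicator {0..} (0 + c * t) * (0 + c * t) powr (a - 1) / exp (0 + c * t)) \<partial>lborel)"
    using assms by (subst nn_integral_real_affine[of _ c 0]) auto
  also have "\<dots> = ennreal c * (\<integral>\<^sup>+t. ennreal (c powr (a - 1)) * ?f t \<partial>lborel)"
    using assms
    by (intro arg_cong2[where f="(*)"] refl nn_integral_cong)
      (auto simp: ennreal_mult[symmetric] powr_mult exp_minus field_simps indicator_def zero_le_mult_iff not_less)
  also have "\<dots> = ennreal c * (ennreal (c powr (a - 1)) * (\<integral>\<^sup>+t. ?f t \<partial>lborel))"
    by (subst nn_integral_cmult) auto
  also have "\<dots> = ennreal (c powr a) * (\<integral>\<^sup>+t. ?f t \<partial>lborel)"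
    using assms by (simp add: mult.assoc[symmetric] ennreal_mult[symmetric] powr_diff)
  finally have e: "ennreal (c powr a) * (\<integral>\<^sup>+t. ?f t \<partial>lborel) = ennreal (Gamma a)" by simp
  have "(\<integral>\<^sup>+t. ?f t \<partial>lborel) = ennreal (1 / c powr a) * (ennreal (c powr a) * (\<integral>\<^sup>+t. ?f t \<partial>lborel))"
    using assms by (simp add: mult.assoc[symmetric] ennreal_mult[symmetric])
  then show ?thesis unfolding e using assms by (simp add: ennreal_mult[symmetric] Gamma_real_pos less_imp_le)
qed

lemma set_integral_Gamma:
  fixes a c :: real
  assumes "0 < a" "0 < c"
  shows "set_integrable lborel {0<..} (\<lambda>x. x powr (a - 1) * exp (- (c * x)))"
    and "(LINT x:{0<..}|lborel. x powr (a - 1) * exp (- (c * x))) = Gamma a / c powr a"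
proof -
  let ?f = "\<lambda>x::real. indicator {0<..} x *\<^sub>R (x powr (a - 1) * exp (- (c * x)))"
  have n: "(\<integral>\<^sup>+x. ennreal (?f x) \<partial>lborel) = ennreal (Gamma a / c powr a)"
    unfolding nn_integral_Gamma_scaled[OF assms, symmetric] by (intro nn_integral_cong) auto
  have "has_bochner_integral lborel ?f (Gamma a / c powr a)"
    using assms by (intro has_bochner_integral_nn_integral n) (auto simp: Gamma_real_pos less_imp_le)
  then show "set_integrable lborel {0<..} (\<lambda>x. x powr (a - 1) * exp (- (c * x)))"
    and "(LINT x:{0<..}|lborel. x powr (a - 1) * exp (- (c * x))) = Gamma a / c powr a"
    by (auto simp: set_integrable_def set_lebesgue_integral_def has_bochner_integral_iff)
qed

lemma set_integrable_min_powr: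
  assumes "d < 1" "1 < e"
  shows "set_integrable lborel {0<..} (\<lambda>x::real. min (x powr - d) (x powr - e))"
proof -
  have "(\<lambda>x. x powr - d) integrable_on {0..1}"
    using assms has_integral_powr_from_0[of "- d" 1] by (auto simp: integrable_on_def)
  then have "(\<lambda>x. x powr - d) absolutely_integrable_on {0..1}"
    by (intro nonnegative_absolutely_integrable_1) auto
  then have 1: "set_integrable lborel {0..1} (\<lambda>x. x powr - d)"
    by (simp add: set_integrable_def integrable_completion)
  have "(\<lambda>x. x powr - e) integrable_on {1..}"
    using assms has_integral_powr_to_inf[of "- e" 1] by (auto simp: integrable_on_def)
  then have "(\<lambda>x. x powr - e) absolutely_integrable_on {1..}"
    by (intro nonnegative_absolutely_integrable_1) auto
  then have 2: "set_integrable lborel {1..} (\<lambda>x. x powr - e)"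
    by (simp add: set_integrable_def integrable_completion)
  have "integrable lborel (\<lambda>x. indicator {0..1} x *\<^sub>R (x powr - d) + indicator {1..} x *\<^sub>R (x powr - e))"
    using 1 2 unfolding set_integrable_def by (rule Bochner_Integration.integrable_add)
  then show ?thesis
    unfolding set_integrable_def
    by (rule Bochner_Integration.integrable_bound) (auto simp: indicator_def)
qed

lemma set_integrable_dominated:
  fixes f :: "real \<Rightarrow> 'b::{banach, second_countable_topology}" and g :: "real \<Rightarrow> real"
  assumes "set_integrable lborel A g" "set_borel_measurable lborel A f" "\<And>x. x \<in> A \<Longrightarrow> norm (f x) \<le> g x"
  shows "set_integrable lborel A f"
  using assms unfolding set_integrable_def set_borel_measurable_def
  by (elim Bochner_Integration.integrable_bound) (force simp: indicator_def)+

lemma tendsto_powr_at_top_neg: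
  assumes "c < 0" shows "(\<lambda>n. real (Suc n) powr c) \<longlonglongrightarrow> 0"
  using assms by (intro tendsto_neg_powr filterlim_compose[OF filterlim_real_sequentially filterlim_Suc])

text \<open>A convex domain gives \<open>F\<close> a primitive \<open>P\<close>, so the integrals
  over two truncated rays differ by the increments of \<open>P\<close> along the two chords joining
  the rays at radius \<open>Suc n\<close> and at its inverse. A chord at radius R has length of
  order R, and \<open>F\<close> there is of order R powr - x; the product tends to 0 at infinity
  because \<open>e > 1\<close> and at the origin because \<open>d < 1\<close>. Chords replace the
  usual arcs since convexity keeps them inside \<open>S\<close>.\<close>

lemma ray_rotation:
  fixes F :: "complex \<Rightarrow> complex"
  assumes S: "convex S" "S \<subseteq> U" "open U" "F holomorphic_on U" "0 \<notin> S"
    and cone: "\<And>z r. z \<in> S \<Longrightarrow> 0 < r \<Longrightarrow> complex_of_real r * z \<in> S"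
    and ab: "a \<in> S" "b \<in> S" "cmod a = 1" "cmod b = 1"
    and near: "\<And>z. z \<in> S \<Longrightarrow> cmod (F z) \<le> M * cmod z powr - d"
    and far: "\<And>z. z \<in> S \<Longrightarrow> cmod (F z) \<le> M * cmod z powr - e"
    and de: "0 \<le> d" "d < 1" "1 < e" and M: "0 \<le> M"
  shows "set_integrable lborel {0<..} (\<lambda>r. a * F (of_real r * a))"
    and "(LINT r:{0<..}|lborel. a * F (of_real r * a)) = (LINT r:{0<..}|lborel. b * F (of_real r * b))"
proof -
  have contF: "continuous_on S F" using S holomorphic_on_imp_continuous_on continuous_on_subset by blast
  have int: "set_integrable lborel {0<..} (\<lambda>r. c * F (of_real r * c))" if c: "c \<in> S" "cmod c = 1" for c
  proof (rule set_integrable_dominated)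
    show "set_integrable lborel {0<..} (\<lambda>x. M * min (x powr - d) (x powr - e))"
      using set_integrable_min_powr[OF de(2,3)] unfolding set_integrable_def
      by (subst mult_scaleR_right[symmetric]) (rule integrable_mult_right)
    have "continuous_on {0<..} (\<lambda>r::real. c * F (of_real r * c))"
      using cone[OF c(1)] by (intro continuous_intros continuous_on_compose2[OF contF]) auto
    then show "set_borel_measurable lborel {0<..} (\<lambda>r. c * F (of_real r * c))"
      unfolding set_borel_measurable_def
      using borel_measurable_continuous_on_indicator[of "{0<..}" "\<lambda>r. c * F (of_real r * c)"] by simp
    fix r :: real assume "r \<in> {0<..}"
    then show "cmod (c * F (of_real r * c)) \<le> M * min (r powr - d) (r powr - e)"
      using near[OF cone[OF c(1), of r]] far[OF cone[OF c(1), of r]] c(2)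
      by (auto simp: norm_mult min_def)
  qed
  show "set_integrable lborel {0<..} (\<lambda>r. a * F (of_real r * a))" by (rule int[OF ab(1,3)])
  obtain P where P: "\<And>x. x \<in> S \<Longrightarrow> (P has_field_derivative F x) (at x within S)"
  proof (rule holomorphic_convex_primitive[OF S(1) _ contF, of "{}"])
    show "F field_differentiable at x" if "x \<in> interior S - {}" for x
    proof -
      have "x \<in> U" using that interior_subset S(2) by auto
      then show ?thesis using S(3,4) holomorphic_on_imp_differentiable_at by blast
    qed
  qed auto
  define A where "A n = {inverse (real (Suc n))..real (Suc n)}" for n
  have UA: "(\<Union>n. A n) = {0<..}"
  proof (intro equalityI subsetI)
    fix x :: real assume "x \<in> {0<..}"
    then obtain n m where "inverse (real (Suc n)) < x" "x < real m" using reals_Archimedean reals_Archimedean2 by force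
    moreover have "inverse (real (Suc (max n m))) \<le> inverse (real (Suc n))" by (intro le_imp_inverse_le) auto
    moreover have "real m \<le> real (Suc (max n m))" by simp
    ultimately have "inverse (real (Suc (max n m))) \<le> x" "x \<le> real (Suc (max n m))" by linarith+
    then have "x \<in> A (max n m)" unfolding A_def by simp
    then show "x \<in> (\<Union>n. A n)" by blast
  next
    fix x :: real assume "x \<in> (\<Union>n. A n)"
    then obtain n where "inverse (real (Suc n)) \<le> x" by (auto simp: A_def)
    moreover have "0 < inverse (real (Suc n))" by simp
    ultimately have "0 < x" by linarith
    then show "x \<in> {0<..}" by simp
  qed
  have incA: "incseq A"
  proof (rule incseq_SucI)
    fix n
    have "inverse (real (Suc (Suc n))) \<le> inverse (real (Suc n))" by (intro le_imp_inverse_le) auto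
    then show "A n \<subseteq> A (Suc n)" unfolding A_def by auto
  qed
  have fin: "(LINT r:A n|lborel. c * F (of_real r * c)) = P (of_real (real (Suc n)) * c) - P (of_real (inverse (real (Suc n))) * c)"
    if c: "c \<in> S" "cmod c = 1" for c n
  proof -
    have "((\<lambda>r. c * F (of_real r * c)) has_integral
      (P (of_real (real (Suc n)) * c) - P (of_real (inverse (real (Suc n))) * c))) {inverse (real (Suc n))..real (Suc n)}"
    proof (rule fundamental_theorem_of_calculus)
      show "inverse (real (Suc n)) \<le> real (Suc n)"
        by (rule order_trans[of _ 1]) (auto simp: field_simps)
      fix x assume x: "x \<in> {inverse (real (Suc n))..real (Suc n)}"
      have sub: "{inverse (real (Suc n))..real (Suc n)} \<subseteq> {0<..}"
      proof
        fix y assume "y \<in> {inverse (real (Suc n))..real (Suc n)}"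
        moreover have "0 < inverse (real (Suc n))" by simp
        ultimately show "y \<in> {0<..}" unfolding atLeastAtMost_iff greaterThan_iff by linarith
      qed
      then have x0: "0 < x" using x by blast
      have "(P \<circ> (\<lambda>r. of_real r * c) has_vector_derivative (c * F (of_real x * c))) (at x within {0<..})"
      proof (rule field_vector_diff_chain_within)
        show "((\<lambda>r. of_real r * c) has_vector_derivative c) (at x within {0<..})"
          by (auto intro!: derivative_eq_intros simp: has_vector_derivative_def scaleR_conv_of_real)
        show "(P has_field_derivative F (of_real x * c)) (at (of_real x * c) within (\<lambda>r. of_real r * c) ` {0<..})"
          using cone[OF c(1)] x0 by (intro DERIV_subset[OF P]) auto
      qed
      then show "((\<lambda>r. P (of_real r * c)) has_vector_derivative c * F (of_real x * c)) (at x within {inverse (real (Suc n))..real (Suc n)})"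
        unfolding o_def by (rule has_vector_derivative_within_subset) (rule sub)
    qed
    moreover have "set_integrable lborel (A n) (\<lambda>r. c * F (of_real r * c))"
      by (rule set_integrable_subset[OF int[OF c]]) (use UA in \<open>auto simp: A_def\<close>)
    ultimately show ?thesis
      unfolding A_def by (intro trans[OF set_borel_integral_eq_integral(2) integral_unique])
  qed
  have lim: "(\<lambda>n. P (of_real (real (Suc n)) * c) - P (of_real (inverse (real (Suc n))) * c)) \<longlonglongrightarrow> (LINT r:{0<..}|lborel. c * F (of_real r * c))"
    if c: "c \<in> S" "cmod c = 1" for c
  proof -
    have "(\<lambda>n. LINT r:A n|lborel. c * F (of_real r * c)) \<longlonglongrightarrow> (LINT r:(\<Union>n. A n)|lborel. c * F (of_real r * c))"
    proof (rule set_integral_cont_up)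
      show "A i \<in> sets lborel" for i by (simp add: A_def)
    qed (use int[OF c] UA incA in simp_all)
    then show ?thesis unfolding UA fin[OF c] .
  qed
  have seg: "closed_segment a b \<subseteq> S" using ab S(1) by (simp add: closed_segment_subset)
  \<comment> \<open>The chord from \<open>a\<close> to \<open>b\<close> avoids 0, so its modulus has
    a positive minimum \<open>m\<close>; by homogeneity the chord at radius \<open>R\<close> stays
    at distance at least \<open>R * m\<close> from the origin.\<close>
  obtain m where m: "0 < m" "\<And>z. z \<in> closed_segment a b \<Longrightarrow> m \<le> cmod z"
  proof -
    have "\<exists>x\<in>closed_segment a b. \<forall>y\<in>closed_segment a b. cmod x \<le> cmod y"
      by (rule continuous_attains_inf) (auto intro!: continuous_intros)
    then obtain x where "x \<in> closed_segment a b" "\<And>y. y \<in> closed_segment a b \<Longrightarrow> cmod x \<le> cmod y" by blast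
    moreover from this seg S(5) have "0 < cmod x" by auto
    ultimately show ?thesis using that by blast
  qed
  have gap: "cmod (P (of_real R * a) - P (of_real R * b)) \<le> M * (m powr - x * cmod (a - b)) * R powr (1 - x)"
    if R: "0 < R" and x: "0 \<le> x" "\<And>z. z \<in> S \<Longrightarrow> cmod (F z) \<le> M * cmod z powr - x" for R x
  proof -
    have sub: "closed_segment (of_real R * a) (of_real R * b) \<subseteq> S"
      using S(1) cone R ab by (intro closed_segment_subset) auto
    have "cmod (P (of_real R * a) - P (of_real R * b)) \<le> M * (R * m) powr - x * cmod (of_real R * a - of_real R * b)"
    proof (rule field_differentiable_bound[where S="closed_segment (of_real R * a) (of_real R * b)" and f'=F])
      fix z assume z: "z \<in> closed_segment (of_real R * a) (of_real R * b)"
      then show "(P has_field_derivative F z) (at z within closed_segment (of_real R * a) (of_real R * b))"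
        using sub by (intro DERIV_subset[OF P]) auto
      from z obtain u where u: "0 \<le> u" "u \<le> 1" "z = (1 - u) *\<^sub>R (of_real R * a) + u *\<^sub>R (of_real R * b)"
        by (auto simp: in_segment)
      then have "z = of_real R * ((1 - u) *\<^sub>R a + u *\<^sub>R b)" by (simp add: scaleR_conv_of_real algebra_simps)
      moreover have "m \<le> cmod ((1 - u) *\<^sub>R a + u *\<^sub>R b)" using u by (intro m(2)) (auto simp: in_segment)
      ultimately have "R * m \<le> cmod z" using R by (simp add: norm_mult)
      then have "cmod z powr - x \<le> (R * m) powr - x" using R m(1) x(1) by (intro powr_mono2') auto
      moreover have "cmod (F z) \<le> M * cmod z powr - x" using z sub x(2) by auto
      ultimately show "cmod (F z) \<le> M * (R * m) powr - x" using M by (meson mult_left_mono order_trans)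
    qed auto
    also have "cmod (of_real R * a - of_real R * b) = R * cmod (a - b)"
      using R by (simp add: norm_mult flip: right_diff_distrib)
    also have "M * (R * m) powr - x * (R * cmod (a - b)) = M * (m powr - x * cmod (a - b)) * (R powr - x * R)"
      using R m(1) by (simp add: powr_mult)
    also have "R powr - x * R = R powr (1 - x)" using R by (simp add: powr_diff powr_minus field_simps)
    finally show ?thesis .
  qed
  define D where "D n = (P (of_real (real (Suc n)) * a) - P (of_real (inverse (real (Suc n))) * a))
    - (P (of_real (real (Suc n)) * b) - P (of_real (inverse (real (Suc n))) * b))" for n
  have "D \<longlonglongrightarrow> 0"
  proof (rule Lim_null_comparison)
    let ?c = "\<lambda>x. M * (m powr - x * cmod (a - b))"
    show "(\<lambda>n. ?c e * real (Suc n) powr (1 - e) + ?c d * real (Suc n) powr (d - 1)) \<longlonglongrightarrow> 0"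
      using tendsto_add[OF tendsto_mult_left[OF tendsto_powr_at_top_neg[of "1 - e"], of "?c e"]
          tendsto_mult_left[OF tendsto_powr_at_top_neg[of "d - 1"], of "?c d"]] de by simp
    show "eventually (\<lambda>n. norm (D n) \<le> ?c e * real (Suc n) powr (1 - e) + ?c d * real (Suc n) powr (d - 1)) sequentially"
    proof (rule always_eventually, rule allI)
      fix n
      let ?R = "real (Suc n)"
      have "cmod (P (of_real ?R * a) - P (of_real ?R * b)) \<le> ?c e * ?R powr (1 - e)"
        using de by (intro gap far) auto
      moreover have "cmod (P (of_real (inverse ?R) * a) - P (of_real (inverse ?R) * b)) \<le> ?c d * inverse ?R powr (1 - d)"
        using de by (intro gap near) auto
      ultimately have "cmod (P (of_real ?R * a) - P (of_real ?R * b))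
        + cmod (P (of_real (inverse ?R) * a) - P (of_real (inverse ?R) * b)) \<le> ?c e * ?R powr (1 - e) + ?c d * inverse ?R powr (1 - d)"
        by (rule add_mono)
      moreover have "inverse ?R powr (1 - d) = ?R powr (d - 1)"
        unfolding powr_def by (simp add: ln_inverse algebra_simps del: of_nat_Suc)
      moreover have "D n = (P (of_real ?R * a) - P (of_real ?R * b)) - (P (of_real (inverse ?R) * a) - P (of_real (inverse ?R) * b))"
        unfolding D_def by simp
      ultimately show "norm (D n) \<le> ?c e * ?R powr (1 - e) + ?c d * ?R powr (d - 1)"
        using norm_triangle_ineq4[of "P (of_real ?R * a) - P (of_real ?R * b)"
            "P (of_real (inverse ?R) * a) - P (of_real (inverse ?R) * b)"]
        by (auto intro: order_trans)
    qed
  qed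
  moreover have "D \<longlonglongrightarrow> (LINT r:{0<..}|lborel. a * F (of_real r * a)) - (LINT r:{0<..}|lborel. b * F (of_real r * b))"
    unfolding D_def by (intro tendsto_diff lim ab)
  ultimately show "(LINT r:{0<..}|lborel. a * F (of_real r * a)) = (LINT r:{0<..}|lborel. b * F (of_real r * b))"
    using LIMSEQ_unique by fastforce
qed

section \<open>The resolvent kernel of the fractional derivative\<close>

lemma set_Fubini:
  fixes f :: "real \<Rightarrow> real \<Rightarrow> 'b::{banach, second_countable_topology}"
  assumes [measurable]: "A \<in> sets borel" "B \<in> sets borel" "(\<lambda>(x, y). f x y) \<in> borel_measurable (borel \<Otimes>\<^sub>M borel)"
    and inner: "\<And>x. x \<in> A \<Longrightarrow> set_integrable lborel B (f x)"
    and outer: "set_integrable lborel A (\<lambda>x. LINT y:B|lborel. norm (f x y))"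
  shows "(LINT x:A|lborel. LINT y:B|lborel. f x y) = (LINT y:B|lborel. LINT x:A|lborel. f x y)"
    and "set_integrable lborel B (\<lambda>y. LINT x:A|lborel. f x y)"
    and "AE y in lborel. y \<in> B \<longrightarrow> set_integrable lborel A (\<lambda>x. f x y)"
proof -
  let ?F = "\<lambda>(x, y). indicator A x *\<^sub>R (indicator B y *\<^sub>R f x y)"
  have F: "integrable (lborel \<Otimes>\<^sub>M lborel) ?F"
  proof (rule lborel_pair.Fubini_integrable)
    show "?F \<in> borel_measurable (lborel \<Otimes>\<^sub>M lborel)" by measurable
    have "(\<lambda>x. LINT y|lborel. norm (?F (x, y))) = (\<lambda>x. indicator A x *\<^sub>R (LINT y:B|lborel. norm (f x y)))"
      unfolding set_lebesgue_integral_def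
      by (auto simp: fun_eq_iff indicator_def intro!: Bochner_Integration.integral_cong)
    then show "integrable lborel (\<lambda>x. LINT y|lborel. norm (?F (x, y)))"
      using outer by (simp add: set_integrable_def)
    show "AE x in lborel. integrable lborel (\<lambda>y. ?F (x, y))"
      using inner by (intro always_eventually allI) (auto simp: indicator_def set_integrable_def)
  qed
  have e0: "(LINT y|lborel. indicator A x *\<^sub>R indicator B y *\<^sub>R f x y) = indicator A x *\<^sub>R (LINT y|lborel. indicator B y *\<^sub>R f x y)" for x
    by (rule integral_scaleR_right)
  have e: "(LINT x|lborel. indicator A x *\<^sub>R indicator B y *\<^sub>R f x y) = indicator B y *\<^sub>R (LINT x|lborel. indicator A x *\<^sub>R f x y)" for y
    by (subst scaleR_left_commute) (rule integral_scaleR_right)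
  show "(LINT x:A|lborel. LINT y:B|lborel. f x y) = (LINT y:B|lborel. LINT x:A|lborel. f x y)"
    using lborel_pair.Fubini_integral[of "\<lambda>x y. ?F (x, y)"] F
    unfolding set_lebesgue_integral_def by (simp only: prod.case e e0)
  show "set_integrable lborel B (\<lambda>y. LINT x:A|lborel. f x y)"
    using lborel_pair.integrable_snd[of "\<lambda>x y. ?F (x, y)"] F
    unfolding set_lebesgue_integral_def set_integrable_def by (simp only: prod.case e)
  have "AE y in lborel. integrable lborel (\<lambda>x. ?F (x, y))"
    using lborel_pair.AE_integrable_snd[of "\<lambda>x y. ?F (x, y)"] F by simp
  then show "AE y in lborel. y \<in> B \<longrightarrow> set_integrable lborel A (\<lambda>x. f x y)"
    by eventually_elim (auto simp: set_integrable_def)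
qed

text \<open>Write 1 / (x + r) as the integral of exp (- (x + r) s) over s > 0 and exchange by
  Tonelli: two Gamma integrals remain.\<close>

lemma LINT_powr_inverse_add:
  fixes a x :: real
  assumes a: "0 < a" "a < 1" and x: "0 < x"
  shows "(LINT r:{0<..}|lborel. r powr - a / (x + r)) = Gamma a * Gamma (1 - a) * x powr - a"
proof -
  let ?f = "\<lambda>(r::real) (s::real). if 0 < r \<and> 0 < s then ennreal (r powr - a * exp (- ((x + r) * s))) else 0"
  have "(\<integral>\<^sup>+r. ennreal (indicator {0<..} r * (r powr - a / (x + r))) \<partial>lborel) = (\<integral>\<^sup>+r. (\<integral>\<^sup>+s. ?f r s \<partial>lborel) \<partial>lborel)"
  proof (rule nn_integral_cong)
    fix r :: real
    show "ennreal (indicator {0<..} r * (r powr - a / (x + r))) = (\<integral>\<^sup>+s. ?f r s \<partial>lborel)"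
    proof (cases "0 < r")
      case True
      have "(\<integral>\<^sup>+s. ?f r s \<partial>lborel) = (\<integral>\<^sup>+s. ennreal (r powr - a) * (if 0 < s then ennreal (s powr (1 - 1) * exp (- ((x + r) * s))) else 0) \<partial>lborel)"
        using True by (intro nn_integral_cong) (auto simp: ennreal_mult[symmetric])
      also have "\<dots> = ennreal (r powr - a) * ennreal (Gamma 1 / (x + r) powr 1)"
        using True x by (subst nn_integral_cmult) (auto simp: nn_integral_Gamma_scaled)
      also have "\<dots> = ennreal (r powr - a / (x + r))" using True x by (simp add: ennreal_mult[symmetric])
      finally show ?thesis using True by simp
    qed simp
  qed
  also have "\<dots> = (\<integral>\<^sup>+s. (\<integral>\<^sup>+r. ?f r s \<partial>lborel) \<partial>lborel)"
    by (rule lborel_pair.Fubini'[symmetric]) measurable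
  also have "\<dots> = (\<integral>\<^sup>+s. ennreal (Gamma (1 - a)) * (if 0 < s then ennreal (s powr (a - 1) * exp (- (x * s))) else 0) \<partial>lborel)"
  proof (rule nn_integral_cong)
    fix s :: real
    show "(\<integral>\<^sup>+r. ?f r s \<partial>lborel) = ennreal (Gamma (1 - a)) * (if 0 < s then ennreal (s powr (a - 1) * exp (- (x * s))) else 0)"
    proof (cases "0 < s")
      case True
      have "(\<integral>\<^sup>+r. ?f r s \<partial>lborel) = (\<integral>\<^sup>+r. ennreal (exp (- (x * s))) * (if 0 < r then ennreal (r powr (1 - a - 1) * exp (- (s * r))) else 0) \<partial>lborel)"
        using True by (intro nn_integral_cong) (auto simp: ennreal_mult[symmetric] exp_add[symmetric] algebra_simps)
      also have "\<dots> = ennreal (exp (- (x * s))) * ennreal (Gamma (1 - a) / s powr (1 - a))"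
        using True a by (subst nn_integral_cmult) (auto simp: nn_integral_Gamma_scaled)
      also have "\<dots> = ennreal (exp (- (x * s)) * (Gamma (1 - a) / s powr (1 - a)))"
        using a by (intro ennreal_mult[symmetric]) (auto simp: Gamma_real_pos less_imp_le)
      also have "exp (- (x * s)) * (Gamma (1 - a) / s powr (1 - a)) = Gamma (1 - a) * (s powr (a - 1) * exp (- (x * s)))"
        using True by (simp add: powr_diff field_simps)
      also have "ennreal \<dots> = ennreal (Gamma (1 - a)) * ennreal (s powr (a - 1) * exp (- (x * s)))"
        using a by (intro ennreal_mult) (auto simp: Gamma_real_pos less_imp_le)
      finally show ?thesis using True by simp
    qed simp
  qed
  also have "\<dots> = ennreal (Gamma (1 - a)) * ennreal (Gamma a / x powr a)"
    using a x by (subst nn_integral_cmult) (auto simp: nn_integral_Gamma_scaled)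
  also have "\<dots> = ennreal (Gamma a * Gamma (1 - a) * x powr - a)"
    using a x by (simp add: ennreal_mult[symmetric] Gamma_real_pos less_imp_le powr_minus field_simps)
  finally have "has_bochner_integral lborel (\<lambda>r. indicator {0<..} r * (r powr - a / (x + r))) (Gamma a * Gamma (1 - a) * x powr - a)"
    using a x by (intro has_bochner_integral_nn_integral)
      (auto simp: Gamma_real_pos less_imp_le indicator_def intro!: mult_nonneg_nonneg)
  then show ?thesis by (simp add: set_lebesgue_integral_def has_bochner_integral_iff)
qed

section \<open>Geometry of the sector that contains the bent contour\<close>

locale frac_order =
  fixes \<alpha> :: real
  assumes \<alpha>: "0 < \<alpha>" "\<alpha> < 1"
begin

text \<open>The choice is \<open>\<theta> + \<alpha> * \<theta> = pi\<close>. With \<alpha> < 1 it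
  gives \<theta> > pi / 2, so exponentials decay along the rays of arguments \<theta> and -
  \<theta>, and also \<alpha> \<theta> < pi / 2, so \<open>z powr \<alpha>\<close> stays in the open
  right half plane.\<close>

definition \<theta> :: real where "\<theta> = pi / (1 + \<alpha>)"

lemma \<theta>: "pi / 2 < \<theta>" "\<theta> < pi" "0 < \<theta>" "\<alpha> * \<theta> < pi / 2" "0 < \<alpha> * \<theta>"
  using \<alpha> by (auto simp: \<theta>_def field_simps)

text \<open>The decay rate along the rays: \<open>Re (W \<sigma>) = - c0\<close>.\<close>

definition c0 :: real where "c0 = - cos \<theta>"

definition c1 :: real where "c1 = cos (\<theta> / 2)"

definition c2 :: real where "c2 = 1 + 2 / cos (\<alpha> * \<theta>)"

lemma c_pos: "0 < c0" "0 < c1" "0 < c2" "0 < cos (\<alpha> * \<theta>)"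
proof -
  have "cos \<theta> < cos (pi / 2)" using \<theta> by (intro cos_monotone_0_pi) auto
  then show "0 < c0" by (simp add: c0_def)
  show "0 < c1" using \<theta> unfolding c1_def by (intro cos_gt_zero_pi) auto
  show c: "0 < cos (\<alpha> * \<theta>)" using \<theta> by (intro cos_gt_zero_pi) auto
  then show "0 < c2" unfolding c2_def by (simp add: add_pos_pos)
qed

text \<open>By the law of cosines the square of the right-hand side is (\<bar>z\<bar> + r)^2 minus 2
  \<bar>z\<bar> r (1 - cos (arg z)). Bounding 4 \<bar>z\<bar> r by (\<bar>z\<bar> + r)^2 and cos
  (arg z) below by cos \<theta> leaves the factor (1 + cos \<theta>) / 2, which is \<open>c1\<close>
  squared.\<close>

lemma norm_add_sector:
  assumes "z \<noteq> 0" "\<bar>Im (Ln z)\<bar> \<le> \<theta>" "0 < r"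
  shows "c1 * (cmod z + r) \<le> cmod (z + of_real r)"
proof -
  have z: "Re z = cmod z * cos (Im (Ln z))" "Im z = cmod z * sin (Im (Ln z))"
    using exp_Ln[OF assms(1)] norm_exp_eq_Re[of "Ln z"] by (metis Re_exp, metis exp_Ln[OF assms(1)] Im_exp norm_exp_eq_Re)
  have "cos \<theta> \<le> cos \<bar>Im (Ln z)\<bar>" using assms \<theta> by (intro cos_monotone_0_pi_le) auto
  then have c: "cos \<theta> \<le> cos (Im (Ln z))" by simp
  have "(c1 * (cmod z + r))\<^sup>2 = (cmod z + r)\<^sup>2 * ((1 + cos \<theta>) / 2)"
    using cos_double_cos[of "\<theta> / 2"] by (simp add: c1_def power_mult_distrib)
  also have "\<dots> = (cmod z + r)\<^sup>2 - (cmod z + r)\<^sup>2 / 2 * (1 - cos \<theta>)" by (simp add: field_simps)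
  also have "\<dots> \<le> (cmod z + r)\<^sup>2 - 2 * cmod z * r * (1 - cos \<theta>)"
  proof -
    have "4 * cmod z * r \<le> (cmod z + r)\<^sup>2" using sum_squares_bound[of "cmod z" r] by (simp add: power2_sum algebra_simps)
    then have "2 * cmod z * r * (1 - cos \<theta>) \<le> (cmod z + r)\<^sup>2 / 2 * (1 - cos \<theta>)"
      by (intro mult_right_mono) auto
    then show ?thesis by simp
  qed
  also have "\<dots> \<le> (cmod z + r)\<^sup>2 - 2 * cmod z * r * (1 - cos (Im (Ln z)))"
    using c assms by (intro diff_left_mono mult_left_mono) auto
  also have "\<dots> = (cmod z)\<^sup>2 + 2 * Re z * r + r\<^sup>2"
    unfolding z(1) power2_sum by (simp only: right_diff_distrib mult_1_right) simp
  also have "\<dots> = (cmod (z + of_real r))\<^sup>2"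
    by (simp add: cmod_power2 power2_sum)
  finally show ?thesis by (rule power2_le_imp_le) simp
qed

lemma powr_sector:
  assumes "z \<noteq> 0" "\<bar>Im (Ln z)\<bar> \<le> \<theta>"
  shows "cos (\<alpha> * \<theta>) * cmod z powr \<alpha> \<le> Re (z powr of_real \<alpha>)"
proof -
  have "cos (\<alpha> * \<theta>) \<le> cos \<bar>\<alpha> * Im (Ln z)\<bar>"
    using assms \<theta> \<alpha> by (intro cos_monotone_0_pi_le) (auto simp: abs_mult)
  then have "cos (\<alpha> * \<theta>) \<le> cos (\<alpha> * Im (Ln z))" by simp
  moreover have "Re (z powr of_real \<alpha>) = cmod z powr \<alpha> * cos (\<alpha> * Im (Ln z))"
    using assms by (simp add: powr_def Re_exp)
  ultimately show ?thesis by (simp add: mult.commute mult_left_mono)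
qed

text \<open>This is the quantitative absence of a pole. Adding an imaginary number leaves the real
  part of \<open>y\<close> unchanged, and in the sector that part controls the modulus
  \<open>x\<close>; then \<open>l\<close> is bounded by the triangle inequality. Adding x \<le> N /
  cos (\<alpha> \<theta>) and l \<le> N + x, with N the modulus on the right, produces
  \<open>c2\<close>.\<close>

lemma resolvent_bound:
  assumes "cos (\<alpha> * \<theta>) * x \<le> Re y" "cmod y = x" "0 \<le> x" "0 < l"
  shows "x + l \<le> c2 * cmod (y + \<i> * of_real l)"
proof -
  have "Re y \<le> cmod (y + \<i> * of_real l)" using complex_Re_le_cmod[of "y + \<i> * of_real l"] by simp
  then have "cos (\<alpha> * \<theta>) * x \<le> cmod (y + \<i> * of_real l)" using assms by simp
  then have 1: "x \<le> cmod (y + \<i> * of_real l) / cos (\<alpha> * \<theta>)" using c_pos by (simp add: field_simps)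
  have "l = cmod ((y + \<i> * of_real l) - y)" using assms by (simp add: norm_mult)
  also have "\<dots> \<le> cmod (y + \<i> * of_real l) + x" using assms norm_triangle_ineq4 by metis
  finally show ?thesis using 1 by (simp add: c2_def algebra_simps)
qed

definition W :: "real \<Rightarrow> complex" where "W \<sigma> = cis (\<sigma> * \<theta>)"

text \<open>The closed sector between the arguments 0 and \<sigma> \<theta>, without its vertex, for
  \<sigma> = 1 or - 1. It is written as an intersection of half planes so that convexity is
  immediate; the strict half plane around the bisector removes the origin and the opposite
  directions.\<close>

definition sector :: "real \<Rightarrow> complex set" where
  "sector \<sigma> = {z. 0 \<le> \<sigma> * Im z \<and> \<sigma> * Im (z * cis (- (\<sigma> * \<theta>))) \<le> 0 \<and> 0 < Re (z * cis (- (\<sigma> * \<theta> / 2)))}"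

definition sgn_pm :: "real \<Rightarrow> bool" where "sgn_pm \<sigma> \<longleftrightarrow> \<sigma> = 1 \<or> \<sigma> = - 1"

lemma sgn_pm_minus: "sgn_pm \<sigma> \<Longrightarrow> sgn_pm (- \<sigma>)" by (auto simp: sgn_pm_def)

lemma sector_convex: "convex (sector \<sigma>)"
proof -
  have lin: "linear (\<lambda>z. \<sigma> * Im z)" "linear (\<lambda>z. \<sigma> * Im (z * w))" "linear (\<lambda>z. Re (z * w))" for w
    by (auto intro!: linearI simp: algebra_simps)
  have "sector \<sigma> = (\<lambda>z. \<sigma> * Im z) -` {0..} \<inter> (\<lambda>z. \<sigma> * Im (z * cis (- (\<sigma> * \<theta>)))) -` {..0}
    \<inter> (\<lambda>z. Re (z * cis (- (\<sigma> * \<theta> / 2)))) -` {0<..}"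
    by (auto simp: sector_def)
  also have "convex \<dots>" by (intro convex_Int convex_linear_vimage lin) auto
  finally show ?thesis .
qed

lemma sector_cone: "z \<in> sector \<sigma> \<Longrightarrow> 0 < r \<Longrightarrow> of_real r * z \<in> sector \<sigma>"
proof -
  assume a: "z \<in> sector \<sigma>" "0 < r"
  have e: "Im (of_real r * z * w) = r * Im (z * w)" "Re (of_real r * z * w) = r * Re (z * w)" for w
    by (auto simp: algebra_simps)
  from a have "0 \<le> r * (\<sigma> * Im z)" "r * (\<sigma> * Im (z * cis (- (\<sigma> * \<theta>)))) \<le> 0" "0 < r * Re (z * cis (- (\<sigma> * \<theta> / 2)))"
    unfolding sector_def by (auto intro: mult_nonneg_nonpos)
  then show ?thesis unfolding sector_def mem_Collect_eq e by (simp add: ac_simps)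
qed

lemma one_sector: "sgn_pm \<sigma> \<Longrightarrow> 1 \<in> sector \<sigma>"
  using \<theta> c_pos sin_gt_zero[of \<theta>] by (auto simp: sector_def sgn_pm_def c1_def)

lemma W_sector: "sgn_pm \<sigma> \<Longrightarrow> W \<sigma> \<in> sector \<sigma>"
proof -
  assume \<sigma>: "sgn_pm \<sigma>"
  have "W \<sigma> * cis (- (\<sigma> * \<theta>)) = 1" "W \<sigma> * cis (- (\<sigma> * \<theta> / 2)) = cis (\<sigma> * \<theta> / 2)"
    by (simp_all add: W_def cis_mult)
  then show ?thesis
    unfolding sector_def mem_Collect_eq using \<theta> c_pos sin_gt_zero[of \<theta>] \<sigma>
    by (auto simp: sgn_pm_def c1_def W_def)
qed

lemma zero_sector: "0 \<notin> sector \<sigma>" by (simp add: sector_def)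

lemma Ln_sector:
  assumes "sgn_pm \<sigma>" "z \<in> sector \<sigma>"
  shows "\<bar>Im (Ln z)\<bar> \<le> \<theta>"
proof -
  have z0: "z \<noteq> 0" using assms zero_sector by auto
  define f where "f = \<sigma> * Im (Ln z)"
  have z: "z = of_real (cmod z) * cis (Im (Ln z))"
    using exp_Ln[OF z0] by (metis exp_eq_polar norm_exp_eq_Re)
  have pos: "0 < cmod z" using z0 by simp
  have \<sigma>: "\<sigma> * \<sigma> = 1" using assms by (auto simp: sgn_pm_def)
  have f: "\<bar>f\<bar> \<le> pi" using assms Im_Ln_le_pi[OF z0] mpi_less_Im_Ln[OF z0] by (auto simp: f_def sgn_pm_def)
  have zc: "z * cis x = of_real (cmod z) * cis (Im (Ln z) + x)" for x
    by (subst z) (simp add: cis_mult mult.assoc)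
  have odd: "\<sigma> * sin x = sin (\<sigma> * x)" "cos (\<sigma> * x) = cos x" for x using assms by (auto simp: sgn_pm_def)
  have "Im z = cmod z * sin (Im (Ln z))" using arg_cong[OF z, of Im] by simp
  then have "0 \<le> cmod z * (\<sigma> * sin (Im (Ln z)))" using assms(2) by (simp add: sector_def ac_simps)
  then have 1: "0 \<le> sin f" using pos unfolding odd f_def by (simp add: zero_le_mult_iff)
  have "cmod z * (\<sigma> * sin (Im (Ln z) - \<sigma> * \<theta>)) \<le> 0" using assms(2) unfolding sector_def mem_Collect_eq zc by (simp add: ac_simps)
  then have 2: "sin (f - \<theta>) \<le> 0" using pos \<sigma> unfolding odd f_def by (simp add: mult_le_0_iff right_diff_distrib mult.assoc[symmetric])
  have "0 < cmod z * cos (Im (Ln z) - \<sigma> * \<theta> / 2)" using assms(2) unfolding sector_def mem_Collect_eq zc by (simp add: ac_simps)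
  then have "0 < cos (\<sigma> * (Im (Ln z) - \<sigma> * \<theta> / 2))" using pos unfolding odd by (simp add: zero_less_mult_iff)
  then have 3: "0 < cos (f - \<theta> / 2)" using \<sigma> by (simp add: f_def right_diff_distrib mult.assoc[symmetric])
  have "\<not> \<theta> < f" using sin_gt_zero[of "f - \<theta>"] 2 f \<theta> by auto
  moreover have "\<not> f < - \<theta>"
  proof
    assume a: "f < - \<theta>"
    then have "0 \<le> - f" "- f \<le> pi" using f \<theta> by auto
    \<comment> \<open>Between - pi and - \<theta> the sine is negative, so only the endpoint - pi
      survives; it is excluded by the half plane around the bisector.\<close>
    then have "f = - pi" using sin_gt_zero[of "- f"] 1 a \<theta> by (cases "- f = pi") auto
    then have "cos (f - \<theta> / 2) = - cos (\<theta> / 2)" using cos_minus[of "pi + \<theta> / 2"] by (simp add: cos_add)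
    then show False using 3 c_pos by (simp add: c1_def)
  qed
  moreover have "\<bar>f\<bar> = \<bar>Im (Ln z)\<bar>" using assms(1) by (auto simp: f_def sgn_pm_def)
  ultimately show ?thesis by auto
qed

lemma sector_slit: "sgn_pm \<sigma> \<Longrightarrow> sector \<sigma> \<subseteq> - \<real>\<^sub>\<le>\<^sub>0"
proof
  fix z assume a: "sgn_pm \<sigma>" "z \<in> sector \<sigma>"
  then have z0: "z \<noteq> 0" using zero_sector by auto
  show "z \<in> - \<real>\<^sub>\<le>\<^sub>0"
  proof
    assume "z \<in> \<real>\<^sub>\<le>\<^sub>0"
    then have "Im (Ln z) = pi" using z0 Im_Ln_eq_pi[OF z0] complex_nonpos_Reals_iff
      by (metis complex_eq_iff less_eq_real_def zero_complex.sel)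
    then show False using Ln_sector[OF a] \<theta> by simp
  qed
qed

lemma norm_W [simp]: "cmod (W \<sigma>) = 1" by (simp add: W_def)

lemma powr_ray:
  assumes "0 < r" "\<bar>x\<bar> < pi"
  shows "(of_real r * cis x) powr of_real e = of_real (r powr e) * cis (e * x)"
proof -
  have "Ln (of_real r * cis x) = of_real (ln r) + \<i> * of_real x"
  proof -
    have "exp (of_real (ln r) + \<i> * of_real x) = of_real r * cis x"
      using assms by (simp add: exp_add cis_conv_exp exp_of_real)
    then show ?thesis using Ln_exp[of "of_real (ln r) + \<i> * of_real x"] assms by auto
  qed
  then show ?thesis
    using assms by (simp add: powr_def exp_add[symmetric] cis_conv_exp algebra_simps exp_of_real[symmetric])
qed

lemma W_bound: "sgn_pm \<sigma> \<Longrightarrow> \<bar>\<sigma> * \<theta>\<bar> < pi"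
  using \<theta> by (auto simp: sgn_pm_def)

lemma Re_W: "sgn_pm \<sigma> \<Longrightarrow> Re (W \<sigma>) = - c0"
  by (auto simp: W_def c0_def sgn_pm_def)

lemma norm_exp_W: "sgn_pm \<sigma> \<Longrightarrow> cmod (exp (of_real x * W \<sigma>)) = exp (- (c0 * x))"
  by (simp add: Re_W)

text \<open>The ray is rotated onto the negative real axis, where the integral is a Gamma integral.
  The integrand uses a power of - z because the negative axis is the branch cut of
  \<open>powr\<close>; returning to the power of r produces the phase. This is the only explicit
  inverse Laplace transform in the argument, that of a pure power.\<close>

lemma ray_exp:
  assumes \<sigma>: "sgn_pm \<sigma>" and t: "0 < t" and g: "0 \<le> g" "g < 1"
  shows "(LINT r:{0<..}|lborel. W \<sigma> * exp (of_real (t * r) * W \<sigma>) * of_real (r powr - g))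
    = - cis (\<sigma> * g * (\<theta> - pi)) * of_real (Gamma (1 - g) * t powr (g - 1))"
    (is "?L = _")
proof -
  define F :: "complex \<Rightarrow> complex" where "F z = exp (of_real t * z) * (- z) powr of_real (- g)" for z
  \<comment> \<open>The cone around the negative axis bounded by the rays of arguments \<theta> and
    - \<theta>. The inequality is convex in z because the norm is, and it yields decay of exp (t z)
    at rate \<open>c0 * t\<close>.\<close>
  define Q where "Q = {z. Re z + c0 * cmod z \<le> 0 \<and> Re z < 0}"
  have Q: "cmod (F z) = exp (t * Re z) * cmod z powr - g" if "z \<in> Q" for z
    by (simp add: F_def norm_mult norm_powr_real_powr')
  have eq: "(LINT r:{0<..}|lborel. W \<sigma> * F (of_real r * W \<sigma>)) = (LINT r:{0<..}|lborel. (- 1) * F (of_real r * (- 1)))"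
  \<comment> \<open>At the origin only the power singularity of order \<open>g\<close> counts. At
    infinity exp x \<ge> x^2 / 2 turns the exponential decay into two additional powers, which gives
    the second entry of \<open>M\<close>.\<close>
  proof (rule ray_rotation(2)[where S=Q and U="{z. Re z < 0}" and M="max 1 (2 / (c0 * t)\<^sup>2)" and d=g and e="2 + g"])
    have 1: "convex {z. Re z + c0 * cmod z \<le> 0}"
    proof (rule convexI)
      fix x y and u v :: real
      assume a: "x \<in> {z. Re z + c0 * cmod z \<le> 0}" "y \<in> {z. Re z + c0 * cmod z \<le> 0}" "0 \<le> u" "0 \<le> v" "u + v = 1"
      have "cmod (u *\<^sub>R x + v *\<^sub>R y) \<le> u * cmod x + v * cmod y"
        using a by (intro norm_triangle_le) simp
      then have "c0 * cmod (u *\<^sub>R x + v *\<^sub>R y) \<le> c0 * (u * cmod x + v * cmod y)"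
        using c_pos by (intro mult_left_mono) auto
      moreover have "u * (Re x + c0 * cmod x) \<le> 0" "v * (Re y + c0 * cmod y) \<le> 0"
        using a by (auto intro: mult_nonneg_nonpos)
      ultimately show "u *\<^sub>R x + v *\<^sub>R y \<in> {z. Re z + c0 * cmod z \<le> 0}" by (simp add: algebra_simps)
    qed
    have "convex (Re -` {..<0})" by (intro convex_linear_vimage) (auto intro!: linearI)
    then show "convex Q" using convex_Int[OF 1] by (simp add: Q_def vimage_def Collect_conj_eq)
    show "open {z. Re z < 0}" by (rule open_halfspace_Re_lt)
    have nn: "- z \<notin> \<real>\<^sub>\<le>\<^sub>0" if "Re z < 0" for z using that by (auto simp: complex_nonpos_Reals_iff)
    show "F holomorphic_on {z. Re z < 0}"
      unfolding F_def using nn by (auto intro!: holomorphic_intros)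
    show "of_real r * z \<in> Q" if "z \<in> Q" "0 < r" for z r
    proof -
      have "r * (Re z + c0 * cmod z) \<le> 0" using that by (auto simp: Q_def intro: mult_nonneg_nonpos)
      then show ?thesis using that by (auto simp: Q_def norm_mult algebra_simps mult_pos_neg)
    qed
    show "W \<sigma> \<in> Q" using c_pos Re_W[OF \<sigma>] by (simp add: Q_def)
    show "- 1 \<in> Q" using cos_ge_minus_one[of \<theta>] by (simp add: Q_def c0_def)
    show "cmod (F z) \<le> max 1 (2 / (c0 * t)\<^sup>2) * cmod z powr - g" if z: "z \<in> Q" for z
    proof -
      have "exp (t * Re z) \<le> 1" using z t by (simp add: Q_def mult_le_0_iff)
      then have "exp (t * Re z) \<le> max 1 (2 / (c0 * t)\<^sup>2)" by linarith
      then have "exp (t * Re z) * cmod z powr - g \<le> max 1 (2 / (c0 * t)\<^sup>2) * cmod z powr - g"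
        by (intro mult_right_mono) auto
      then show ?thesis using Q[OF z] by simp
    qed
    show "cmod (F z) \<le> max 1 (2 / (c0 * t)\<^sup>2) * cmod z powr - (2 + g)" if z: "z \<in> Q" for z
    proof -
      have z0: "0 < cmod z" using z by (auto simp: Q_def)
      define x where "x = c0 * t * cmod z"
      have x: "0 < x" using z0 c_pos t by (simp add: x_def)
      have "x\<^sup>2 / 2 \<le> exp x" using exp_lower_Taylor_quadratic[of x] x by simp
      have "t * Re z \<le> - x" using z t mult_left_mono[of "Re z" "- (c0 * cmod z)" t] by (simp add: Q_def x_def algebra_simps)
      then have "exp (t * Re z) \<le> exp (- x)" by simp
      also have "\<dots> \<le> 2 / x\<^sup>2" using \<open>x\<^sup>2 / 2 \<le> exp x\<close> x by (simp add: exp_minus field_simps)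
      also have "\<dots> = 2 / (c0 * t)\<^sup>2 * cmod z powr - 2"
        using z0 by (simp add: x_def power_mult_distrib powr_minus powr_numeral field_simps)
      also have "\<dots> \<le> max 1 (2 / (c0 * t)\<^sup>2) * cmod z powr - 2" by (intro mult_right_mono) auto
      finally have "exp (t * Re z) * cmod z powr - g \<le> max 1 (2 / (c0 * t)\<^sup>2) * cmod z powr - 2 * cmod z powr - g"
        by (intro mult_right_mono) auto
      then show ?thesis using Q[OF z] by (simp add: powr_add[symmetric] mult.assoc)
    qed
  qed (use g in \<open>auto simp: Q_def\<close>)
  have s: "W \<sigma> * F (of_real r * W \<sigma>) = cis (- (\<sigma> * g * (\<theta> - pi))) * (W \<sigma> * exp (of_real (t * r) * W \<sigma>) * of_real (r powr - g))"
    if "r \<in> {0<..}" for r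
  proof -
    have "- (of_real r * W \<sigma>) = of_real r * cis (\<sigma> * (\<theta> - pi))"
    proof -
      have "cis (\<sigma> * (\<theta> - pi)) = W \<sigma> * cis (- (\<sigma> * pi))" by (simp add: W_def cis_mult right_diff_distrib)
      also have "cis (- (\<sigma> * pi)) = - 1" using \<sigma> by (auto simp: sgn_pm_def complex_eq_iff)
      finally show ?thesis by simp
    qed
    moreover have "\<bar>\<sigma> * (\<theta> - pi)\<bar> < pi" using \<sigma> \<theta> by (auto simp: sgn_pm_def)
    ultimately have "(- (of_real r * W \<sigma>)) powr of_real (- g) = of_real (r powr - g) * cis (- g * (\<sigma> * (\<theta> - pi)))"
      using powr_ray[of r "\<sigma> * (\<theta> - pi)" "- g"] that by simp
    then show ?thesis by (simp add: F_def ac_simps)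
  qed
  have "(LINT r:{0<..}|lborel. W \<sigma> * F (of_real r * W \<sigma>)) = cis (- (\<sigma> * g * (\<theta> - pi))) * ?L"
    unfolding set_integral_mult_right[symmetric]
    by (rule set_lebesgue_integral_cong) (simp, use s in blast)
  moreover have "(LINT r:{0<..}|lborel. (- 1) * F (of_real r * (- 1))) = (LINT r:{0<..}|lborel. of_real ((- 1) * (r powr (1 - g - 1) * exp (- (t * r)))))"
    by (intro set_lebesgue_integral_cong) (auto simp: F_def powr_of_real exp_of_real mult.commute simp flip: of_real_minus of_real_mult)
  moreover have "\<dots> = of_real (- (Gamma (1 - g) * t powr (g - 1)))"
  proof -
    have "(LINT r:{0<..}|lborel. r powr (1 - g - 1) * exp (- (t * r))) = Gamma (1 - g) * t powr (g - 1)"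
      using set_integral_Gamma(2)[of "1 - g" t] t g by (simp add: powr_diff field_simps)
    then show ?thesis unfolding set_integral_complex_of_real set_integral_mult_right by simp
  qed
  ultimately have "cis (- (\<sigma> * g * (\<theta> - pi))) * ?L = - of_real (Gamma (1 - g) * t powr (g - 1))"
    using eq by simp
  then have "cis (\<sigma> * g * (\<theta> - pi)) * (cis (- (\<sigma> * g * (\<theta> - pi))) * ?L) = - cis (\<sigma> * g * (\<theta> - pi)) * of_real (Gamma (1 - g) * t powr (g - 1))"
    by simp
  then show ?thesis by (simp add: mult.assoc[symmetric] cis_mult)
qed

end

lemma set_integrable_powr_from_0:
  fixes a t :: real
  assumes "0 < a"
  shows "set_integrable lborel {0<..<t} (\<lambda>s. s powr (a - 1))"
    and "set_integrable lborel {0<..<t} (\<lambda>s. (t - s) powr (a - 1))"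
proof -
  have "set_integrable lborel {0<..<t} (\<lambda>s. exp t * (s powr (a - 1) * exp (- (1 * s))))"
    by (rule set_integrable_subset[OF set_integrable_mult_right[OF set_integral_Gamma(1)]]) (use assms in auto)
  then show 1: "set_integrable lborel {0<..<t} (\<lambda>s. s powr (a - 1))"
  proof (rule set_integrable_dominated)
    show "norm (s powr (a - 1)) \<le> exp t * (s powr (a - 1) * exp (- (1 * s)))" if "s \<in> {0<..<t}" for s
    proof -
      have "s powr (a - 1) * 1 \<le> s powr (a - 1) * exp (t - s)" using that by (intro mult_left_mono) auto
      then show ?thesis by (simp add: exp_diff exp_minus field_simps)
    qed
  qed (simp add: set_borel_measurable_def)
  have "integrable lborel (\<lambda>s. indicator {0<..<t} (t + (- 1) * s) *\<^sub>R ((t + (- 1) * s) powr (a - 1)))"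
    using 1 unfolding set_integrable_def by (rule lborel_integrable_real_affine) simp
  moreover have "indicator {0<..<t} (t + (- 1) * s) = (indicator {0<..<t} s :: real)" for s :: real
    by (auto simp: indicator_def)
  ultimately show "set_integrable lborel {0<..<t} (\<lambda>s. (t - s) powr (a - 1))"
    by (simp add: set_integrable_def)
qed

section \<open>The kernel as a difference of two ray integrals, and its bounds\<close>

context frac_order
begin

text \<open>The kernel of the fractional integral J^\<alpha>.\<close>

definition g :: "real \<Rightarrow> real" where "g t = t powr (\<alpha> - 1) / Gamma \<alpha>"

definition K :: "real \<Rightarrow> complex \<Rightarrow> complex" where "K l z = 1 / (z powr of_real \<alpha> + \<i> * of_real l)"

text \<open>The symbol on the ray of argument \<sigma> \<theta>, multiplied by the direction of the
  ray; for r > 0 it equals \<open>W \<sigma> * K l (of_real r * W \<sigma>)\<close>. Writing the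
  complex power in polar form makes measurability and the bounds immediate.\<close>

definition L :: "real \<Rightarrow> real \<Rightarrow> real \<Rightarrow> complex"
  where "L l \<sigma> r = W \<sigma> / (of_real (r powr \<alpha>) * cis (\<sigma> * \<alpha> * \<theta>) + \<i> * of_real l)"

definition ray_part :: "real \<Rightarrow> real \<Rightarrow> real \<Rightarrow> complex"
  where "ray_part l \<sigma> t = (LINT r:{0<..}|lborel. exp (of_real (t * r) * W \<sigma>) * L l \<sigma> r)"

text \<open>The inverse Laplace transform of \<open>1 / (z powr \<alpha> + \<i> l)\<close>, with the contour of integration
  bent into the two rays of arguments \<open>\<plusminus>\<theta>\<close>, where \<open>pi / 2 < \<theta> < pi\<close> and
  \<open>\<alpha> \<theta> < pi / 2\<close>: no pole is crossed.\<close>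

definition kernel :: "real \<Rightarrow> real \<Rightarrow> complex"
  where "kernel l t = (ray_part l 1 t - ray_part l (- 1) t) / (2 * of_real pi * \<i>)"

lemma Gamma_pos: "0 < Gamma \<alpha>" "0 < Gamma (1 - \<alpha>)" "0 < Gamma (1 + \<alpha>)"
  using \<alpha> by (auto intro: Gamma_real_pos)

lemma L_measurable [measurable]: "L l \<sigma> \<in> borel_measurable borel"
  unfolding L_def[abs_def] by measurable

lemma L_eq: "sgn_pm \<sigma> \<Longrightarrow> 0 < r \<Longrightarrow> L l \<sigma> r = W \<sigma> * K l (of_real r * W \<sigma>)"
  using powr_ray[OF _ W_bound, of r \<sigma> \<alpha>] by (simp add: L_def K_def W_def ac_simps)

lemma den_bound:
  assumes "sgn_pm \<sigma>" "0 < l"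
  shows "r powr \<alpha> + l \<le> c2 * cmod (of_real (r powr \<alpha>) * cis (\<sigma> * \<alpha> * \<theta>) + \<i> * of_real l)"
proof (rule resolvent_bound)
  have "cos (\<sigma> * \<alpha> * \<theta>) = cos (\<alpha> * \<theta>)" using assms by (auto simp: sgn_pm_def)
  then show "cos (\<alpha> * \<theta>) * r powr \<alpha> \<le> Re (of_real (r powr \<alpha>) * cis (\<sigma> * \<alpha> * \<theta>))" by simp
qed (use assms in \<open>auto simp: norm_mult\<close>)

lemma norm_L:
  assumes "sgn_pm \<sigma>" "0 < l"
  shows "cmod (L l \<sigma> r) \<le> c2 / (r powr \<alpha> + l)"
proof -
  have "0 < r powr \<alpha> + l" using assms by (simp add: add_nonneg_pos)
  moreover from this den_bound[OF assms, of r] c_pos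
  have "0 < cmod (of_real (r powr \<alpha>) * cis (\<sigma> * \<alpha> * \<theta>) + \<i> * of_real l)"
    by (metis less_le_trans zero_less_mult_pos)
  ultimately show ?thesis using den_bound[OF assms, of r] by (simp add: L_def norm_divide field_simps)
qed

lemma norm_L_powr:
  assumes "sgn_pm \<sigma>" "0 < l" "0 < r"
  shows "cmod (L l \<sigma> r) \<le> c2 * r powr - \<alpha>"
proof -
  have "c2 / (r powr \<alpha> + l) \<le> c2 / r powr \<alpha>" using assms c_pos by (intro divide_left_mono) (auto simp: add_pos_pos)
  then show ?thesis using norm_L[OF assms(1,2), of r] by (simp add: powr_minus_divide)
qed

lemma ray_integrand:
  assumes "sgn_pm \<sigma>" "0 < l" "0 < t"
  shows "set_integrable lborel {0<..} (\<lambda>r. exp (of_real (t * r) * W \<sigma>) * L l \<sigma> r)"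
    and "0 < r \<Longrightarrow> cmod (exp (of_real (t * r) * W \<sigma>) * L l \<sigma> r) \<le> c2 * (r powr (1 - \<alpha> - 1) * exp (- ((c0 * t) * r)))"
proof -
  show b: "cmod (exp (of_real (t * r) * W \<sigma>) * L l \<sigma> r) \<le> c2 * (r powr (1 - \<alpha> - 1) * exp (- ((c0 * t) * r)))" if "0 < r" for r
  proof -
    have "cmod (exp (of_real (t * r) * W \<sigma>) * L l \<sigma> r) = exp (- ((c0 * t) * r)) * cmod (L l \<sigma> r)"
      using norm_exp_W[OF assms(1), of "t * r"] by (simp add: norm_mult ac_simps)
    also have "\<dots> \<le> exp (- ((c0 * t) * r)) * (c2 * r powr - \<alpha>)"
      using norm_L_powr[OF assms(1,2) that] by (intro mult_left_mono) auto
    finally show ?thesis by (simp add: ac_simps)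
  qed
  show "set_integrable lborel {0<..} (\<lambda>r. exp (of_real (t * r) * W \<sigma>) * L l \<sigma> r)"
  proof (rule set_integrable_dominated)
    show "set_integrable lborel {0<..} (\<lambda>r. c2 * (r powr (1 - \<alpha> - 1) * exp (- ((c0 * t) * r))))"
      using \<alpha> c_pos assms by (intro set_integrable_mult_right set_integral_Gamma) auto
  qed (use b in \<open>auto simp: set_borel_measurable_def\<close>)
qed

lemma set_integral_real_nonneg:
  fixes f :: "real \<Rightarrow> real"
  shows "(\<And>x. x \<in> A \<Longrightarrow> 0 \<le> f x) \<Longrightarrow> 0 \<le> (LINT x:A|M. f x)"
  unfolding set_lebesgue_integral_def
  by (rule Bochner_Integration.integral_nonneg) (auto simp: indicator_def)

lemma norm_set_integral_le:
  fixes f :: "real \<Rightarrow> complex" and h :: "real \<Rightarrow> real"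
  assumes "set_integrable lborel A h" "A \<in> sets borel" "\<And>x. x \<in> A \<Longrightarrow> cmod (f x) \<le> h x"
  shows "cmod (LINT x:A|lborel. f x) \<le> (LINT x:A|lborel. h x)"
proof (cases "set_integrable lborel A f")
  case True
  then have "cmod (LINT x:A|lborel. f x) \<le> (LINT x:A|lborel. cmod (f x))"
    using assms by (intro set_integral_norm_bound) auto
  also have "\<dots> \<le> (LINT x:A|lborel. h x)"
    using assms True by (intro set_integral_mono set_integrable_norm) auto
  finally show ?thesis .
next
  case False
  then have "(LINT x:A|lborel. f x) = 0"
    unfolding set_integrable_def set_lebesgue_integral_def by (rule not_integrable_integral_eq)
  moreover have "0 \<le> (LINT x:A|lborel. h x)"
    by (rule set_integral_real_nonneg) (auto intro: order_trans[OF norm_ge_zero assms(3)])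
  ultimately show ?thesis by simp
qed

text \<open>Dropping \<open>l\<close> from the denominator leaves
  \<open>c2 * r powr - \<alpha>\<close> against exp (- c0 t r), a Gamma integral. The bound is
  uniform in \<open>l\<close> and is the sharp one for small times.\<close>

lemma ray_part_bound:
  assumes "sgn_pm \<sigma>" "0 < l" "0 < t"
  shows "cmod (ray_part l \<sigma> t) \<le> c2 * Gamma (1 - \<alpha>) * c0 powr (\<alpha> - 1) * t powr (\<alpha> - 1)"
proof -
  have "cmod (ray_part l \<sigma> t) \<le> (LINT r:{0<..}|lborel. c2 * (r powr (1 - \<alpha> - 1) * exp (- ((c0 * t) * r))))"
    unfolding ray_part_def using \<alpha> c_pos assms ray_integrand(2)[OF assms]
    by (intro norm_set_integral_le set_integrable_mult_right set_integral_Gamma) auto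
  also have "\<dots> = c2 * (Gamma (1 - \<alpha>) / (c0 * t) powr (1 - \<alpha>))"
    using \<alpha> c_pos assms by (simp add: set_integral_Gamma(2)[of "1 - \<alpha>" "c0 * t", simplified])
  also have "\<dots> = c2 * Gamma (1 - \<alpha>) * c0 powr (\<alpha> - 1) * t powr (\<alpha> - 1)"
    using c_pos assms by (simp add: powr_mult powr_diff field_simps)
  finally show ?thesis .
qed

text \<open>Subtract from the symbol its value 1 / (\<i> l) at the origin. By \<open>ray_exp\<close>
  with exponent 0 the subtracted part integrates to - 1 / (\<i> l t) on either ray, so it cancels in
  the difference. The remainder is bounded by c2 r^\<alpha> / l^2, and the factor r^\<alpha> becomes
  the decay t^(- \<alpha> - 1).\<close>

lemma ray_part_diff_bound:
  assumes "0 < l" "0 < t"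
  shows "cmod (ray_part l 1 t - ray_part l (- 1) t) \<le> 2 * (c2 * Gamma (1 + \<alpha>) * c0 powr (- \<alpha> - 1) / l\<^sup>2 * t powr (- \<alpha> - 1))"
proof -
  define J where "J \<sigma> = (LINT r:{0<..}|lborel. exp (of_real (t * r) * W \<sigma>) * (L l \<sigma> r - W \<sigma> / (\<i> * of_real l)))" for \<sigma>
  have J: "ray_part l \<sigma> t = J \<sigma> - of_real (t powr - 1) / (\<i> * of_real l)" and
    Jb: "cmod (J \<sigma>) \<le> c2 * Gamma (1 + \<alpha>) * c0 powr (- \<alpha> - 1) / l\<^sup>2 * t powr (- \<alpha> - 1)" if \<sigma>: "sgn_pm \<sigma>" for \<sigma>
  proof -
    have i2: "set_integrable lborel {0<..} (\<lambda>r. exp (of_real (t * r) * W \<sigma>) * (W \<sigma> / (\<i> * of_real l)))"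
    proof (rule set_integrable_dominated)
      show "set_integrable lborel {0<..} (\<lambda>r. (1 / l) * (r powr (1 - 1) * exp (- ((c0 * t) * r))))"
        using c_pos assms by (intro set_integrable_mult_right set_integral_Gamma) auto
      show "cmod (exp (of_real (t * r) * W \<sigma>) * (W \<sigma> / (\<i> * of_real l))) \<le> (1 / l) * (r powr (1 - 1) * exp (- ((c0 * t) * r)))"
        if "r \<in> {0<..}" for r
        using norm_exp_W[OF \<sigma>, of "t * r"] that assms by (simp add: norm_mult norm_divide ac_simps)
    qed (simp add: set_borel_measurable_def)
    have "J \<sigma> = ray_part l \<sigma> t - (LINT r:{0<..}|lborel. exp (of_real (t * r) * W \<sigma>) * (W \<sigma> / (\<i> * of_real l)))"
      unfolding J_def ray_part_def right_diff_distrib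
      by (rule set_integral_diff(2)[OF ray_integrand(1)[OF \<sigma> assms] i2])
    also have "(LINT r:{0<..}|lborel. exp (of_real (t * r) * W \<sigma>) * (W \<sigma> / (\<i> * of_real l)))
      = (LINT r:{0<..}|lborel. (1 / (\<i> * of_real l)) * (W \<sigma> * exp (of_real (t * r) * W \<sigma>) * of_real (r powr - 0)))"
      by (rule set_lebesgue_integral_cong) auto
    also have "\<dots> = (1 / (\<i> * of_real l)) * (- of_real (t powr - 1))"
      unfolding set_integral_mult_right using ray_exp[OF \<sigma> assms(2), of 0] by simp
    finally show "ray_part l \<sigma> t = J \<sigma> - of_real (t powr - 1) / (\<i> * of_real l)" by simp
    have "cmod (J \<sigma>) \<le> (LINT r:{0<..}|lborel. (c2 / l\<^sup>2) * (r powr (1 + \<alpha> - 1) * exp (- ((c0 * t) * r))))"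
      unfolding J_def
    proof (rule norm_set_integral_le)
      show "set_integrable lborel {0<..} (\<lambda>r. (c2 / l\<^sup>2) * (r powr (1 + \<alpha> - 1) * exp (- ((c0 * t) * r))))"
        using \<alpha> c_pos assms by (intro set_integrable_mult_right set_integral_Gamma) auto
      fix r :: real assume r: "r \<in> {0<..}"
      let ?y = "of_real (r powr \<alpha>) * cis (\<sigma> * \<alpha> * \<theta>)"
      have pos: "0 < r powr \<alpha> + l" using assms by (simp add: add_nonneg_pos)
      with den_bound[OF \<sigma> assms(1), of r] c_pos have d: "0 < cmod (?y + \<i> * of_real l)"
        by (metis less_le_trans zero_less_mult_pos)
      then have "L l \<sigma> r - W \<sigma> / (\<i> * of_real l) = - W \<sigma> * ?y / ((?y + \<i> * of_real l) * (\<i> * of_real l))"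
        unfolding L_def using assms by (subst diff_frac_eq) (auto simp: algebra_simps)
      then have "cmod (L l \<sigma> r - W \<sigma> / (\<i> * of_real l)) = r powr \<alpha> / l * (1 / cmod (?y + \<i> * of_real l))"
        using assms by (simp add: norm_mult norm_divide)
      moreover have "1 / cmod (?y + \<i> * of_real l) \<le> c2 / (r powr \<alpha> + l)"
        using d pos den_bound[OF \<sigma> assms(1), of r] by (simp add: field_simps)
      moreover have "c2 / (r powr \<alpha> + l) \<le> c2 / l" using assms c_pos pos by (intro divide_left_mono mult_pos_pos) auto
      moreover have "0 \<le> r powr \<alpha> / l" using assms by simp
      ultimately have "cmod (L l \<sigma> r - W \<sigma> / (\<i> * of_real l)) \<le> r powr \<alpha> / l * (c2 / l)"
        by (simp only:) (rule mult_left_mono[OF order_trans])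
      then have "exp (- (c0 * (t * r))) * cmod (L l \<sigma> r - W \<sigma> / (\<i> * of_real l)) \<le> exp (- (c0 * (t * r))) * (r powr \<alpha> / l * (c2 / l))"
        by (rule mult_left_mono) simp
      then show "cmod (exp (of_real (t * r) * W \<sigma>) * (L l \<sigma> r - W \<sigma> / (\<i> * of_real l)))
        \<le> (c2 / l\<^sup>2) * (r powr (1 + \<alpha> - 1) * exp (- ((c0 * t) * r)))"
        using norm_exp_W[OF \<sigma>, of "t * r"] by (simp add: norm_mult power2_eq_square ac_simps)
    qed simp
    also have "\<dots> = (c2 / l\<^sup>2) * (Gamma (1 + \<alpha>) / (c0 * t) powr (1 + \<alpha>))"
      unfolding set_integral_mult_right using set_integral_Gamma(2)[of "1 + \<alpha>" "c0 * t"] \<alpha> c_pos assms by simp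
    also have "\<dots> = c2 * Gamma (1 + \<alpha>) * c0 powr (- \<alpha> - 1) / l\<^sup>2 * t powr (- \<alpha> - 1)"
    proof -
      have "1 / (c0 * t) powr (1 + \<alpha>) = (c0 * t) powr - (1 + \<alpha>)" by (rule powr_minus_divide[symmetric])
      also have "- (1 + \<alpha>) = - \<alpha> - 1" by simp
      also have "(c0 * t) powr (- \<alpha> - 1) = c0 powr (- \<alpha> - 1) * t powr (- \<alpha> - 1)"
        using c_pos assms by (simp add: powr_mult)
      finally have "1 / (c0 * t) powr (1 + \<alpha>) = c0 powr (- \<alpha> - 1) * t powr (- \<alpha> - 1)" .
      then show ?thesis by (simp add: divide_inverse)
    qed
    finally show "cmod (J \<sigma>) \<le> \<dots>" .
  qed
  have "cmod (J 1 - J (- 1)) \<le> cmod (J 1) + cmod (J (- 1))" by (rule norm_triangle_ineq4)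
  then show ?thesis using J[of 1] J[of "- 1"] Jb[of 1] Jb[of "- 1"] by (simp add: sgn_pm_def)
qed

lemma kernel_bounds:
  "\<exists>C>0. \<forall>l>0. \<forall>t>0. cmod (kernel l t) \<le> C * t powr (\<alpha> - 1) \<and> cmod (kernel l t) \<le> C / l\<^sup>2 * t powr (- \<alpha> - 1)"
proof -
  define a where "a = c2 * Gamma (1 - \<alpha>) * c0 powr (\<alpha> - 1)"
  define b where "b = c2 * Gamma (1 + \<alpha>) * c0 powr (- \<alpha> - 1)"
  have ab: "0 < a" "0 < b" using c_pos Gamma_pos by (auto simp: a_def b_def)
  have n: "cmod (kernel l t) \<le> cmod (ray_part l 1 t - ray_part l (- 1) t) / 2" for l t
  proof -
    have "cmod (kernel l t) = cmod (ray_part l 1 t - ray_part l (- 1) t) / (2 * pi)"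
      by (simp add: kernel_def norm_divide norm_mult)
    also have "\<dots> \<le> cmod (ray_part l 1 t - ray_part l (- 1) t) / 2"
      using pi_gt3 by (intro divide_left_mono) auto
    finally show ?thesis .
  qed
  show ?thesis
  proof (intro exI[of _ "a + b"] conjI allI impI)
    fix l t :: real assume lt: "0 < l" "0 < t"
    have "cmod (ray_part l 1 t - ray_part l (- 1) t) \<le> 2 * (a * t powr (\<alpha> - 1))"
      using norm_triangle_ineq4[of "ray_part l 1 t" "ray_part l (- 1) t"] ray_part_bound[of 1, OF _ lt] ray_part_bound[of "- 1", OF _ lt]
      by (simp add: sgn_pm_def a_def)
    also have "\<dots> \<le> 2 * ((a + b) * t powr (\<alpha> - 1))" using ab by (intro mult_left_mono mult_right_mono) auto
    finally show "cmod (kernel l t) \<le> (a + b) * t powr (\<alpha> - 1)" using n[of l t] by simp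
    have "cmod (ray_part l 1 t - ray_part l (- 1) t) \<le> 2 * (b / l\<^sup>2 * t powr (- \<alpha> - 1))"
      using ray_part_diff_bound[OF lt] by (simp add: b_def)
    also have "\<dots> \<le> 2 * ((a + b) / l\<^sup>2 * t powr (- \<alpha> - 1))" using ab by (intro mult_left_mono mult_right_mono divide_right_mono) auto
    finally show "cmod (kernel l t) \<le> (a + b) / l\<^sup>2 * t powr (- \<alpha> - 1)" using n[of l t] by simp
  qed (use ab in auto)
qed

lemma ray_part_measurable [measurable]: "ray_part l \<sigma> \<in> borel_measurable borel"
  unfolding ray_part_def[abs_def] set_lebesgue_integral_def by measurable

lemma kernel_measurable [measurable]: "kernel l \<in> borel_measurable borel"
  unfolding kernel_def[abs_def] by measurable


section \<open>Rotating auxiliary integrals to the positive real axis\<close>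

lemma slit_open: "open (- (\<real>\<^sub>\<le>\<^sub>0 :: complex set))"
  by (simp add: open_Compl)

lemma add_real_slit: "z \<notin> \<real>\<^sub>\<le>\<^sub>0 \<Longrightarrow> 0 < r \<Longrightarrow> z + complex_of_real r \<noteq> 0"
  by (auto simp: complex_nonpos_Reals_iff complex_eq_iff)

lemma ray_add_bound:
  assumes "sgn_pm \<sigma>" "0 < x" "0 < r"
  shows "c1 * (x + r) \<le> cmod (of_real x * W \<sigma> + of_real r)" "0 < cmod (of_real x * W \<sigma> + of_real r)"
proof -
  have "of_real x * W \<sigma> \<in> sector \<sigma>" using sector_cone[OF W_sector] assms by blast
  moreover from this have "of_real x * W \<sigma> \<noteq> 0" using zero_sector by metis
  ultimately have "c1 * (cmod (of_real x * W \<sigma>) + r) \<le> cmod (of_real x * W \<sigma> + of_real r)"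
    by (intro norm_add_sector Ln_sector[OF assms(1)] assms(3))
  moreover have "cmod (of_real x * W \<sigma>) = x" using assms(2) by (simp add: norm_mult)
  ultimately show 1: "c1 * (x + r) \<le> cmod (of_real x * W \<sigma> + of_real r)" by simp
  have "0 < c1 * (x + r)" using c_pos assms by simp
  with 1 show "0 < cmod (of_real x * W \<sigma> + of_real r)" by linarith
qed

text \<open>The analogue of \<open>LINT_powr_inverse_add\<close> for the complex point x W instead
  of x > 0. Factoring out \<open>W \<sigma>\<close> moves the rotation to the integration variable:
  the ray of argument - \<sigma> \<theta> is turned onto the positive axis, and the branch of the
  power leaves a phase.\<close>

lemma ray_beta:
  assumes \<sigma>: "sgn_pm \<sigma>" and x: "0 < x"
  shows "set_integrable lborel {0<..} (\<lambda>r. of_real (r powr - \<alpha>) / (of_real x * W \<sigma> + of_real r))"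
    and "(LINT r:{0<..}|lborel. of_real (r powr - \<alpha>) / (of_real x * W \<sigma> + of_real r))
      = cis (- (\<sigma> * \<alpha> * \<theta>)) * of_real (Gamma \<alpha> * Gamma (1 - \<alpha>) * x powr - \<alpha>)"
proof -
  define F :: "complex \<Rightarrow> complex" where "F z = z powr of_real (- \<alpha>) / (z + of_real x)" for z
  define M where "M = max (1 / (c1 * x)) (1 / c1)"
  have b: "cmod (F z) \<le> cmod z powr - \<alpha> / (c1 * (cmod z + x))" if z: "z \<in> sector (- \<sigma>)" for z
  proof -
    have z0: "z \<noteq> 0" using z zero_sector by auto
    have "c1 * (cmod z + x) \<le> cmod (z + of_real x)"
      by (rule norm_add_sector[OF z0 Ln_sector[OF sgn_pm_minus[OF \<sigma>] z] x])
    moreover have "0 < c1 * (cmod z + x)" using c_pos x by (simp add: add_nonneg_pos)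
    ultimately have "cmod z powr - \<alpha> / cmod (z + of_real x) \<le> cmod z powr - \<alpha> / (c1 * (cmod z + x))"
      by (intro frac_le) auto
    then show ?thesis by (simp add: F_def norm_divide norm_powr_real_powr')
  qed
  note rot = ray_rotation[where S="sector (- \<sigma>)" and U="- \<real>\<^sub>\<le>\<^sub>0" and F=F and a="W (- \<sigma>)" and b=1 and M=M and d=\<alpha> and e="1 + \<alpha>"]
  have prem: "convex (sector (- \<sigma>))" "sector (- \<sigma>) \<subseteq> - \<real>\<^sub>\<le>\<^sub>0" "open (- \<real>\<^sub>\<le>\<^sub>0 :: complex set)" "F holomorphic_on - \<real>\<^sub>\<le>\<^sub>0"
    "0 \<notin> sector (- \<sigma>)" "\<And>z r. z \<in> sector (- \<sigma>) \<Longrightarrow> 0 < r \<Longrightarrow> complex_of_real r * z \<in> sector (- \<sigma>)"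
    "W (- \<sigma>) \<in> sector (- \<sigma>)" "1 \<in> sector (- \<sigma>)" "cmod (W (- \<sigma>)) = 1" "cmod 1 = 1"
    "\<And>z. z \<in> sector (- \<sigma>) \<Longrightarrow> cmod (F z) \<le> M * cmod z powr - \<alpha>"
    "\<And>z. z \<in> sector (- \<sigma>) \<Longrightarrow> cmod (F z) \<le> M * cmod z powr - (1 + \<alpha>)" "0 \<le> \<alpha>" "\<alpha> < 1" "1 < 1 + \<alpha>" "0 \<le> M"
  proof -
    show "F holomorphic_on - \<real>\<^sub>\<le>\<^sub>0"
      unfolding F_def using add_real_slit[OF _ x] by (auto intro!: holomorphic_intros)
    show "0 \<le> M" using c_pos by (auto simp: M_def le_max_iff_disj less_imp_le)
    fix z assume z: "z \<in> sector (- \<sigma>)"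
    then have z0: "0 < cmod z" using zero_sector by auto
    have "cmod z powr - \<alpha> / (c1 * (cmod z + x)) \<le> cmod z powr - \<alpha> / (c1 * x)"
      using c_pos x z0 by (intro frac_le) auto
    also have "\<dots> = 1 / (c1 * x) * cmod z powr - \<alpha>" by simp
    also have "\<dots> \<le> M * cmod z powr - \<alpha>" by (intro mult_right_mono) (auto simp: M_def)
    finally show "cmod (F z) \<le> M * cmod z powr - \<alpha>" using b[OF z] by linarith
    have "cmod z powr - \<alpha> / (c1 * (cmod z + x)) \<le> cmod z powr - \<alpha> / (c1 * cmod z)"
      using c_pos x z0 by (intro frac_le) auto
    also have "\<dots> = 1 / c1 * cmod z powr - (1 + \<alpha>)" using z0 by (simp add: powr_diff powr_minus field_simps)
    also have "\<dots> \<le> M * cmod z powr - (1 + \<alpha>)" by (intro mult_right_mono) (auto simp: M_def)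
    finally show "cmod (F z) \<le> M * cmod z powr - (1 + \<alpha>)" using b[OF z] by linarith
  qed (use \<alpha> \<sigma> in \<open>auto simp: sector_convex sector_slit[OF sgn_pm_minus] slit_open zero_sector sector_cone
      one_sector[OF sgn_pm_minus] W_sector[OF sgn_pm_minus] subsetD[OF sector_slit[OF sgn_pm_minus[OF \<sigma>]]]\<close>)
  have int: "set_integrable lborel {0<..} (\<lambda>r. W (- \<sigma>) * F (of_real r * W (- \<sigma>)))"
    by (rule rot(1)[OF prem])
  have eq: "(LINT r:{0<..}|lborel. W (- \<sigma>) * F (of_real r * W (- \<sigma>))) = (LINT r:{0<..}|lborel. 1 * F (of_real r * 1))"
    by (rule rot(2)[OF prem])
  have s: "W (- \<sigma>) * F (of_real r * W (- \<sigma>)) = cis (\<sigma> * \<alpha> * \<theta>) * (of_real (r powr - \<alpha>) / (of_real x * W \<sigma> + of_real r))"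
    if r: "r \<in> {0<..}" for r
  proof -
    have "(of_real r * W (- \<sigma>)) powr of_real (- \<alpha>) = of_real (r powr - \<alpha>) * cis (\<sigma> * \<alpha> * \<theta>)"
      using powr_ray[of r "- \<sigma> * \<theta>" "- \<alpha>"] r W_bound[OF \<sigma>] by (simp add: W_def ac_simps)
    moreover have W1: "W (- \<sigma>) * W \<sigma> = 1" by (simp add: W_def cis_mult)
    have "of_real r * W (- \<sigma>) + of_real x = W (- \<sigma>) * (of_real x * W \<sigma> + of_real r)"
      using W1 by (simp add: algebra_simps)
    moreover have "W (- \<sigma>) \<noteq> 0" using norm_W[of "- \<sigma>"] by force
    ultimately show ?thesis by (simp add: F_def)
  qed
  have "set_integrable lborel {0<..} (\<lambda>r. cis (\<sigma> * \<alpha> * \<theta>) * (of_real (r powr - \<alpha>) / (of_real x * W \<sigma> + of_real r)))"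
    using int s by (subst set_integrable_cong[OF refl]) auto
  then show "set_integrable lborel {0<..} (\<lambda>r. of_real (r powr - \<alpha>) / (of_real x * W \<sigma> + of_real r))"
    by (subst (asm) set_integrable_mult_right_iff) (auto simp: cis_neq_zero)
  have "(LINT r:{0<..}|lborel. W (- \<sigma>) * F (of_real r * W (- \<sigma>)))
    = (LINT r:{0<..}|lborel. cis (\<sigma> * \<alpha> * \<theta>) * (of_real (r powr - \<alpha>) / (of_real x * W \<sigma> + of_real r)))"
    by (rule set_lebesgue_integral_cong) (simp, use s in blast)
  also have "\<dots> = cis (\<sigma> * \<alpha> * \<theta>) * (LINT r:{0<..}|lborel. of_real (r powr - \<alpha>) / (of_real x * W \<sigma> + of_real r))"
    by (rule set_integral_mult_right)
  also have "(LINT r:{0<..}|lborel. W (- \<sigma>) * F (of_real r * W (- \<sigma>))) = (LINT r:{0<..}|lborel. of_real (r powr - \<alpha> / (x + r)))"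
    unfolding eq by (rule set_lebesgue_integral_cong) (auto simp: F_def powr_of_real add.commute simp flip: of_real_minus of_real_add of_real_divide)
  also have "\<dots> = of_real (Gamma \<alpha> * Gamma (1 - \<alpha>) * x powr - \<alpha>)"
    unfolding set_integral_complex_of_real LINT_powr_inverse_add[OF \<alpha> x] ..
  finally have "cis (- (\<sigma> * \<alpha> * \<theta>)) * of_real (Gamma \<alpha> * Gamma (1 - \<alpha>) * x powr - \<alpha>)
    = (cis (- (\<sigma> * \<alpha> * \<theta>)) * cis (\<sigma> * \<alpha> * \<theta>)) * (LINT r:{0<..}|lborel. of_real (r powr - \<alpha>) / (of_real x * W \<sigma> + of_real r))"
    by (simp only: mult.assoc)
  then show "(LINT r:{0<..}|lborel. of_real (r powr - \<alpha>) / (of_real x * W \<sigma> + of_real r))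
      = cis (- (\<sigma> * \<alpha> * \<theta>)) * of_real (Gamma \<alpha> * Gamma (1 - \<alpha>) * x powr - \<alpha>)"
    by (simp only: cis_mult) simp
qed

text \<open>The integrand is holomorphic between the ray and the positive axis, as
  \<open>resolvent_bound\<close> excludes zeros of the denominator there. The point is that the
  right-hand side does not contain \<sigma>: the term it represents is the same for both rays and
  cancels in \<open>kernel_volterra\<close>.\<close>

lemma ray_resolvent:
  assumes \<sigma>: "sgn_pm \<sigma>" and l: "0 < l" and r: "0 < r"
  shows "(LINT x:{0<..}|lborel. L l \<sigma> x / (of_real x * W \<sigma> + of_real r))
    = (LINT x:{0<..}|lborel. K l (of_real x) / (of_real x + of_real r))"
proof -
  define F :: "complex \<Rightarrow> complex" where "F z = K l z / (z + of_real r)" for z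
  define M where "M = max (c2 / (l * (c1 * r))) (c2 / c1)"
  \<comment> \<open>The slit plane without the zeros of the denominator of \<open>K\<close>: an open
    set containing the sector on which \<open>F\<close> is holomorphic.\<close>
  define U :: "complex set" where "U = - \<real>\<^sub>\<le>\<^sub>0 \<inter> (\<lambda>z. z powr of_real \<alpha> + \<i> * of_real l) -` (- {0})"
  have den: "cmod z powr \<alpha> + l \<le> c2 * cmod (z powr of_real \<alpha> + \<i> * of_real l)" if z: "z \<in> sector \<sigma>" for z
  proof (rule resolvent_bound)
    have z0: "z \<noteq> 0" using z zero_sector by auto
    show "cos (\<alpha> * \<theta>) * cmod z powr \<alpha> \<le> Re (z powr of_real \<alpha>)"
      by (rule powr_sector[OF z0 Ln_sector[OF \<sigma> z]])
  qed (use l in \<open>auto simp: norm_powr_real_powr'\<close>)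
  have den0: "0 < cmod (z powr of_real \<alpha> + \<i> * of_real l)" if z: "z \<in> sector \<sigma>" for z
  proof -
    have "0 < c2 * cmod (z powr of_real \<alpha> + \<i> * of_real l)"
      using den[OF z] l by (smt (verit) powr_ge_zero)
    then show ?thesis using c_pos by (simp add: zero_less_mult_iff)
  qed
  have b: "cmod (F z) \<le> c2 / (cmod z powr \<alpha> + l) / (c1 * (cmod z + r))" if z: "z \<in> sector \<sigma>" for z
  proof -
    have z0: "z \<noteq> 0" using z zero_sector by auto
    have 1: "c1 * (cmod z + r) \<le> cmod (z + of_real r)"
      by (rule norm_add_sector[OF z0 Ln_sector[OF \<sigma> z] r])
    have 2: "0 < c1 * (cmod z + r)" using c_pos r by (simp add: add_nonneg_pos)
    have 3: "0 < cmod z powr \<alpha> + l" using l by (simp add: add_nonneg_pos)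
    have "cmod (K l z) \<le> c2 / (cmod z powr \<alpha> + l)"
      using den[OF z] den0[OF z] 3 by (simp add: K_def norm_divide field_simps)
    then show ?thesis unfolding F_def norm_divide using 1 2 3 c_pos by (intro frac_le) auto
  qed
  note rot = ray_rotation[where S="sector \<sigma>" and U=U and F=F and a="W \<sigma>" and b=1 and M=M and d=0 and e="1 + \<alpha>"]
  have prem: "convex (sector \<sigma>)" "sector \<sigma> \<subseteq> U" "open U" "F holomorphic_on U"
    "0 \<notin> sector \<sigma>" "\<And>z r. z \<in> sector \<sigma> \<Longrightarrow> 0 < r \<Longrightarrow> complex_of_real r * z \<in> sector \<sigma>"
    "W \<sigma> \<in> sector \<sigma>" "1 \<in> sector \<sigma>" "cmod (W \<sigma>) = 1" "cmod 1 = 1"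
    "\<And>z. z \<in> sector \<sigma> \<Longrightarrow> cmod (F z) \<le> M * cmod z powr - 0"
    "\<And>z. z \<in> sector \<sigma> \<Longrightarrow> cmod (F z) \<le> M * cmod z powr - (1 + \<alpha>)" "0 \<le> (0::real)" "0 < (1::real)" "1 < 1 + \<alpha>" "0 \<le> M"
  proof -
    have "continuous_on (- \<real>\<^sub>\<le>\<^sub>0) (\<lambda>z. z powr of_real \<alpha> + \<i> * of_real l)"
      by (intro holomorphic_on_imp_continuous_on) (auto intro!: holomorphic_intros)
    then show "open U" unfolding U_def by (intro continuous_open_preimage slit_open) auto
    show "sector \<sigma> \<subseteq> U" using sector_slit[OF \<sigma>] den0 by (auto simp: U_def)
    show "F holomorphic_on U"
      unfolding F_def K_def U_def using add_real_slit[OF _ r] by (auto intro!: holomorphic_intros)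
    show "0 \<le> M" using c_pos by (auto simp: M_def le_max_iff_disj less_imp_le)
    fix z assume z: "z \<in> sector \<sigma>"
    then have z0: "0 < cmod z" using zero_sector by auto
    have "c2 / (cmod z powr \<alpha> + l) / (c1 * (cmod z + r)) \<le> c2 / l / (c1 * r)"
      using c_pos r l z0 by (intro frac_le) (auto intro: divide_left_mono add_nonneg_pos)
    also have "\<dots> \<le> M * cmod z powr - 0" using z0 by (simp add: M_def)
    finally show "cmod (F z) \<le> M * cmod z powr - 0" using b[OF z] by linarith
    have "c2 / (cmod z powr \<alpha> + l) / (c1 * (cmod z + r)) \<le> c2 / cmod z powr \<alpha> / (c1 * cmod z)"
      using c_pos r l z0 by (intro frac_le) (auto intro!: divide_left_mono add_pos_pos mult_pos_pos)
    also have "\<dots> = c2 / c1 * cmod z powr - (1 + \<alpha>)" using z0 by (simp add: powr_diff powr_minus field_simps)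
    also have "\<dots> \<le> M * cmod z powr - (1 + \<alpha>)" by (intro mult_right_mono) (auto simp: M_def)
    finally show "cmod (F z) \<le> M * cmod z powr - (1 + \<alpha>)" using b[OF z] by linarith
  qed (use \<alpha> \<sigma> in \<open>auto simp: sector_convex zero_sector sector_cone one_sector W_sector\<close>)
  have "(LINT x:{0<..}|lborel. L l \<sigma> x / (of_real x * W \<sigma> + of_real r)) = (LINT x:{0<..}|lborel. W \<sigma> * F (of_real x * W \<sigma>))"
    by (rule set_lebesgue_integral_cong) (auto simp: F_def L_eq[OF \<sigma>])
  also have "\<dots> = (LINT x:{0<..}|lborel. 1 * F (of_real x * 1))" by (rule rot(2)[OF prem])
  finally show ?thesis by (simp add: F_def)
qed

section \<open>The Volterra equation of the kernel\<close>

definition cc :: real where "cc = 1 / (Gamma \<alpha> * Gamma (1 - \<alpha>))"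

lemma cc_pos: "0 < cc" using Gamma_pos by (simp add: cc_def)

text \<open>This writes the kernel of J^\<alpha> as a superposition of decaying exponentials, with
  \<open>cc\<close> as the normalising constant. Convolving it with an exponential then only
  requires integrating exponentials.\<close>

lemma g_laplace:
  assumes "0 < t"
  shows "set_integrable lborel {0<..} (\<lambda>r. cc * r powr - \<alpha> * exp (- (r * t)))"
    and "(LINT r:{0<..}|lborel. cc * r powr - \<alpha> * exp (- (r * t))) = g t"
proof -
  have e: "(\<lambda>r. cc * r powr - \<alpha> * exp (- (r * t))) = (\<lambda>r. cc * (r powr (1 - \<alpha> - 1) * exp (- (t * r))))"
    by (auto simp: fun_eq_iff ac_simps)
  show "set_integrable lborel {0<..} (\<lambda>r. cc * r powr - \<alpha> * exp (- (r * t)))"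
    unfolding e using \<alpha> assms by (intro set_integrable_mult_right set_integral_Gamma) auto
  have "(LINT r:{0<..}|lborel. cc * (r powr (1 - \<alpha> - 1) * exp (- (t * r)))) = cc * (Gamma (1 - \<alpha>) / t powr (1 - \<alpha>))"
    unfolding set_integral_mult_right using set_integral_Gamma(2)[of "1 - \<alpha>" t] \<alpha> assms by simp
  then show "(LINT r:{0<..}|lborel. cc * r powr - \<alpha> * exp (- (r * t))) = g t"
    unfolding e using Gamma_pos assms by (simp add: cc_def g_def powr_diff field_simps)
qed

lemma g_nonneg: "0 \<le> g t" using Gamma_pos by (simp add: g_def)

lemma g_measurable [measurable]: "g \<in> borel_measurable borel"
  unfolding g_def[abs_def] by measurable

lemma g_integrable: "set_integrable lborel {0<..<t} g" "set_integrable lborel {0<..<t} (\<lambda>s. g (t - s))"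
  unfolding g_def[abs_def] using \<alpha>
  by (auto intro!: set_integrable_divide set_integrable_powr_from_0)


text \<open>Insert \<open>g_laplace\<close> and integrate in \<open>s\<close> explicitly. The upper
  limit gives, through \<open>ray_beta\<close>, the exponential times the power (x W)^(- \<alpha>),
  as for an exact fractional integral. The lower limit leaves a correction due to starting at time
  0.\<close>

lemma conv_ray_exp:
  assumes \<sigma>: "sgn_pm \<sigma>" and x: "0 < x" and t: "0 < t"
  shows "(LINT s:{0<..<t}|lborel. of_real (g (t - s)) * exp (of_real (s * x) * W \<sigma>))
    = exp (of_real (t * x) * W \<sigma>) * (of_real (x powr - \<alpha>) * cis (- (\<sigma> * \<alpha> * \<theta>)))
      - (LINT r:{0<..}|lborel. of_real (cc * r powr - \<alpha> * exp (- (r * t))) / (of_real x * W \<sigma> + of_real r))"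
    (is "_ = ?A - _")
proof -
  let ?e = "\<lambda>s. exp (of_real (s * x) * W \<sigma>)"
  let ?f = "\<lambda>s r. of_real (cc * r powr - \<alpha> * exp (- (r * (t - s)))) * ?e s"
  have ne: "cmod (?e s) \<le> 1" if "0 < s" for s
    using norm_exp_W[OF \<sigma>, of "s * x"] c_pos x that by simp
  have inner: "set_integrable lborel {0<..} (?f s)" if "s \<in> {0<..<t}" for s
    using g_laplace(1)[of "t - s"] that
    by (intro set_integrable_mult_left) (simp add: set_integrable_def scaleR_conv_of_real flip: of_real_mult)
  have nf: "(LINT r:{0<..}|lborel. norm (?f s r)) = g (t - s) * cmod (?e s)" if "s \<in> {0<..<t}" for s
  proof -
    have "(LINT r:{0<..}|lborel. norm (?f s r)) = (LINT r:{0<..}|lborel. cc * r powr - \<alpha> * exp (- (r * (t - s))) * cmod (?e s))"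
      using cc_pos by (intro set_lebesgue_integral_cong) (auto simp: norm_mult abs_mult)
    also have "\<dots> = (LINT r:{0<..}|lborel. cc * r powr - \<alpha> * exp (- (r * (t - s)))) * cmod (?e s)"
      by (rule set_integral_mult_left)
    finally show ?thesis using g_laplace(2)[of "t - s"] that by simp
  qed
  have outer: "set_integrable lborel {0<..<t} (\<lambda>s. LINT r:{0<..}|lborel. norm (?f s r))"
  proof (rule set_integrable_dominated[OF g_integrable(2)])
    show "norm (LINT r:{0<..}|lborel. norm (?f s r)) \<le> g (t - s)" if "s \<in> {0<..<t}" for s
      using nf[OF that] ne[of s] that g_nonneg[of "t - s"] by (simp add: mult_left_le)
    show "set_borel_measurable lborel {0<..<t} (\<lambda>s. LINT r:{0<..}|lborel. norm (?f s r))"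
      \<comment> \<open>The dominating function is g (t - s), since the exponential along the ray
        has modulus at most 1.\<close>
      unfolding set_borel_measurable_def set_lebesgue_integral_def by measurable
  qed
  have meas: "(\<lambda>(s, r). ?f s r) \<in> borel_measurable (borel \<Otimes>\<^sub>M borel)" by measurable
  have "(LINT s:{0<..<t}|lborel. of_real (g (t - s)) * ?e s) = (LINT s:{0<..<t}|lborel. LINT r:{0<..}|lborel. ?f s r)"
  proof (rule set_lebesgue_integral_cong)
    show "\<forall>s. s \<in> {0<..<t} \<longrightarrow> of_real (g (t - s)) * ?e s = (LINT r:{0<..}|lborel. ?f s r)"
    proof (intro allI impI)
      fix s assume s: "s \<in> {0<..<t}"
      have "(LINT r:{0<..}|lborel. ?f s r) = (LINT r:{0<..}|lborel. complex_of_real (cc * r powr - \<alpha> * exp (- (r * (t - s))))) * ?e s"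
        by (rule set_integral_mult_left)
      then show "of_real (g (t - s)) * ?e s = (LINT r:{0<..}|lborel. ?f s r)"
        unfolding set_integral_complex_of_real using g_laplace(2)[of "t - s"] s by simp
    qed
  qed simp
  also have "\<dots> = (LINT r:{0<..}|lborel. LINT s:{0<..<t}|lborel. ?f s r)"
    by (rule set_Fubini(1)[OF _ _ meas inner outer]) auto
  also have "\<dots> = (LINT r:{0<..}|lborel. of_real cc * (?e t * (of_real (r powr - \<alpha>) / (of_real x * W \<sigma> + of_real r)))
      - of_real (cc * r powr - \<alpha> * exp (- (r * t))) / (of_real x * W \<sigma> + of_real r))"
  proof (rule set_lebesgue_integral_cong)
    show "\<forall>r. r \<in> {0<..} \<longrightarrow> (LINT s:{0<..<t}|lborel. ?f s r)
      = of_real cc * (?e t * (of_real (r powr - \<alpha>) / (of_real x * W \<sigma> + of_real r)))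
        - of_real (cc * r powr - \<alpha> * exp (- (r * t))) / (of_real x * W \<sigma> + of_real r)"
    proof (intro allI impI)
      fix r :: real assume r: "r \<in> {0<..}"
      let ?z = "of_real x * W \<sigma> + of_real r"
      have z: "?z \<noteq> 0" using ray_add_bound(2)[OF \<sigma> x, of r] r by auto
      let ?p = "of_real (cc * r powr - \<alpha> * exp (- (r * t))) / ?z"
      let ?F = "\<lambda>s::real. ?p * exp (of_real s * ?z)"
      have fs: "?f s r = of_real (cc * r powr - \<alpha> * exp (- (r * t))) * exp (of_real s * ?z)" for s
      proof -
        have "exp (of_real s * ?z) = ?e s * of_real (exp (r * s))"
          by (simp add: exp_of_real[symmetric] exp_add[symmetric] algebra_simps)
        moreover have "exp (- (r * (t - s))) = exp (- (r * t)) * exp (r * s)"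
          by (simp add: exp_add[symmetric] algebra_simps)
        ultimately show ?thesis by simp
      qed
      have d: "(?F has_vector_derivative ?f s r) (at s within {0..t})" for s
      proof -
        have "((\<lambda>w. ?p * exp (w * ?z)) has_field_derivative ?p * (exp (of_real s * ?z) * ?z)) (at (of_real s))"
          by (auto intro!: derivative_eq_intros)
        then show ?thesis unfolding fs using z by (intro has_vector_derivative_real_field) (simp add: mult.assoc)
      qed
      have "((\<lambda>s. ?f s r) has_integral (?F t - ?F 0)) {0..t}"
        using t d by (intro fundamental_theorem_of_calculus) auto
      then have I: "integral {0..t} (\<lambda>s. ?f s r) = ?F t - ?F 0" by (rule integral_unique)
      have c: "continuous_on {0..t} (\<lambda>s. ?f s r)" by (intro continuous_intros)
      have "(LINT s:{0<..<t}|lborel. ?f s r) = (LINT s:{0..t}|lborel. ?f s r)"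
      proof (rule set_integral_cong_set)
        show "AE s in lborel. (s \<in> {0..t}) = (s \<in> {0<..<t})"
          using AE_lborel_singleton[of 0] AE_lborel_singleton[of t] by eventually_elim auto
      qed (simp_all add: set_borel_measurable_def)
      also have "\<dots> = integral {0..t} (\<lambda>s. ?f s r)"
        by (rule set_borel_integral_eq_integral(2)) (rule borel_integrable_atLeastAtMost'[OF c])
      also have "\<dots> = ?p * exp (of_real t * ?z) - ?p" unfolding I by simp
      also have "?p * exp (of_real t * ?z) = of_real cc * (?e t * (of_real (r powr - \<alpha>) / ?z))"
      proof -
        have "exp (of_real t * ?z) = ?e t * of_real (exp (r * t))"
          by (simp add: exp_of_real[symmetric] exp_add[symmetric] algebra_simps)
        moreover have "exp (- (r * t)) * exp (r * t) = 1" by (simp add: exp_add[symmetric])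
        then have "of_real (exp (- (r * t))) * complex_of_real (exp (r * t)) = 1"
          by (simp flip: of_real_mult)
        moreover have "?p * (?e t * of_real (exp (r * t)))
          = of_real cc * (?e t * (of_real (r powr - \<alpha>) / ?z)) * (of_real (exp (- (r * t))) * of_real (exp (r * t)))" by simp
        ultimately show ?thesis using \<open>exp (of_real t * ?z) = _\<close> by simp
      qed
      finally show "(LINT s:{0<..<t}|lborel. ?f s r) = of_real cc * (?e t * (of_real (r powr - \<alpha>) / ?z)) - ?p" .
    qed
  qed simp
  also have "\<dots> = (LINT r:{0<..}|lborel. of_real cc * (?e t * (of_real (r powr - \<alpha>) / (of_real x * W \<sigma> + of_real r))))
    - (LINT r:{0<..}|lborel. of_real (cc * r powr - \<alpha> * exp (- (r * t))) / (of_real x * W \<sigma> + of_real r))"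
  proof (rule set_integral_diff(2))
    show "set_integrable lborel {0<..} (\<lambda>r. of_real cc * (?e t * (of_real (r powr - \<alpha>) / (of_real x * W \<sigma> + of_real r))))"
      by (intro set_integrable_mult_right ray_beta(1) \<sigma> x)
    have "set_integrable lborel {0<..} (\<lambda>r. cc * norm (of_real (r powr - \<alpha>) / (of_real x * W \<sigma> + of_real r)))"
      by (intro set_integrable_mult_right set_integrable_norm ray_beta(1) \<sigma> x)
    then show "set_integrable lborel {0<..} (\<lambda>r. of_real (cc * r powr - \<alpha> * exp (- (r * t))) / (of_real x * W \<sigma> + of_real r))"
    proof (rule set_integrable_dominated)
      fix r :: real assume r: "r \<in> {0<..}"
      have "exp (- (r * t)) \<le> 1" using r t by simp
      then have "cc * r powr - \<alpha> * exp (- (r * t)) \<le> cc * r powr - \<alpha> * 1" using cc_pos by (intro mult_left_mono) auto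
      then show "norm (of_real (cc * r powr - \<alpha> * exp (- (r * t))) / (of_real x * W \<sigma> + of_real r))
        \<le> cc * norm (of_real (r powr - \<alpha>) / (of_real x * W \<sigma> + of_real r))"
        using cc_pos by (auto simp: norm_divide norm_mult abs_mult intro!: divide_right_mono)
    qed (simp add: set_borel_measurable_def)
  qed
  also have "(LINT r:{0<..}|lborel. of_real cc * (?e t * (of_real (r powr - \<alpha>) / (of_real x * W \<sigma> + of_real r)))) = ?A"
    unfolding set_integral_mult_right ray_beta(2)[OF \<sigma> x] using Gamma_pos by (simp add: cc_def)
  finally show ?thesis .
qed

text \<open>\<open>conv_ray_exp\<close> integrated against the symbol along the ray. The main term
  is the ray integral with an extra factor z^(- \<alpha>). In the correction term the order of
  integration is exchanged so that \<open>ray_resolvent\<close> applies and removes its dependence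
  on \<sigma>.\<close>

lemma conv_ray_part:
  assumes \<sigma>: "sgn_pm \<sigma>" and l: "0 < l" and t: "0 < t"
  shows "set_integrable lborel {0<..} (\<lambda>x. exp (of_real (t * x) * W \<sigma>) * L l \<sigma> x * (of_real (x powr - \<alpha>) * cis (- (\<sigma> * \<alpha> * \<theta>))))"
    and "set_integrable lborel {0<..<t} (\<lambda>s. of_real (g (t - s)) * ray_part l \<sigma> s)"
    and "(LINT s:{0<..<t}|lborel. of_real (g (t - s)) * ray_part l \<sigma> s)
    = (LINT x:{0<..}|lborel. exp (of_real (t * x) * W \<sigma>) * L l \<sigma> x * (of_real (x powr - \<alpha>) * cis (- (\<sigma> * \<alpha> * \<theta>))))
      - (LINT r:{0<..}|lborel. of_real (cc * r powr - \<alpha> * exp (- (r * t))) *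
          (LINT x:{0<..}|lborel. K l (of_real x) / (of_real x + of_real r)))"
    (is "?lhs = ?A - ?B")
proof -
  show int1: "set_integrable lborel {0<..} (\<lambda>x. exp (of_real (t * x) * W \<sigma>) * L l \<sigma> x * (of_real (x powr - \<alpha>) * cis (- (\<sigma> * \<alpha> * \<theta>))))"
  proof (rule set_integrable_dominated)
    show "set_integrable lborel {0<..} (\<lambda>x. (c2 / l) * (x powr (1 - \<alpha> - 1) * exp (- ((c0 * t) * x))))"
      using \<alpha> c_pos t by (intro set_integrable_mult_right set_integral_Gamma) auto
    fix x :: real assume x: "x \<in> {0<..}"
    have "cmod (L l \<sigma> x) \<le> c2 / (x powr \<alpha> + l)" by (rule norm_L[OF \<sigma> l])
    also have "\<dots> \<le> c2 / l" using c_pos l by (intro divide_left_mono) (auto simp: add_nonneg_pos)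
    finally have "exp (- (c0 * (t * x))) * cmod (L l \<sigma> x) * x powr - \<alpha> \<le> exp (- (c0 * (t * x))) * (c2 / l) * x powr - \<alpha>"
      by (intro mult_right_mono mult_left_mono) auto
    then show "cmod (exp (of_real (t * x) * W \<sigma>) * L l \<sigma> x * (of_real (x powr - \<alpha>) * cis (- (\<sigma> * \<alpha> * \<theta>))))
      \<le> (c2 / l) * (x powr (1 - \<alpha> - 1) * exp (- ((c0 * t) * x)))"
      using norm_exp_W[OF \<sigma>, of "t * x"] by (simp add: norm_mult ac_simps)
  qed (simp add: set_borel_measurable_def)
  let ?f = "\<lambda>s x. of_real (g (t - s)) * (exp (of_real (s * x) * W \<sigma>) * L l \<sigma> x)"
  define R where "R = c2 * (Gamma (1 - \<alpha>) * c0 powr (\<alpha> - 1))"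
  have inner: "set_integrable lborel {0<..} (?f s)" if "s \<in> {0<..<t}" for s
    using that by (intro set_integrable_mult_right ray_integrand(1)[OF \<sigma> l]) auto
  have nf: "norm (LINT x:{0<..}|lborel. norm (?f s x)) \<le> g (t - s) * (R * s powr (\<alpha> - 1))" if s: "s \<in> {0<..<t}" for s
  proof -
    have "(LINT x:{0<..}|lborel. norm (?f s x)) \<le> (LINT x:{0<..}|lborel. g (t - s) * (c2 * (x powr (1 - \<alpha> - 1) * exp (- ((c0 * s) * x)))))"
    proof (rule set_integral_mono)
      show "set_integrable lborel {0<..} (\<lambda>x. norm (?f s x))" by (rule set_integrable_norm[OF inner[OF s]])
      show "set_integrable lborel {0<..} (\<lambda>x. g (t - s) * (c2 * (x powr (1 - \<alpha> - 1) * exp (- ((c0 * s) * x)))))"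
        using \<alpha> c_pos s by (intro set_integrable_mult_right set_integral_Gamma) auto
      show "norm (?f s x) \<le> g (t - s) * (c2 * (x powr (1 - \<alpha> - 1) * exp (- ((c0 * s) * x))))" if "x \<in> {0<..}" for x
        using ray_integrand(2)[OF \<sigma> l, of s x] s that g_nonneg[of "t - s"]
        by (subst norm_mult) (auto intro!: mult_left_mono)
    qed
    also have "\<dots> = g (t - s) * (c2 * (Gamma (1 - \<alpha>) / (c0 * s) powr (1 - \<alpha>)))"
      unfolding set_integral_mult_right using set_integral_Gamma(2)[of "1 - \<alpha>" "c0 * s"] \<alpha> c_pos s by simp
    also have "(c0 * s) powr (1 - \<alpha>) = 1 / (c0 powr (\<alpha> - 1) * s powr (\<alpha> - 1))"
      using c_pos s powr_minus_divide[of "c0 * s" "\<alpha> - 1"] by (simp add: powr_mult)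
    finally have "(LINT x:{0<..}|lborel. norm (?f s x)) \<le> g (t - s) * (R * s powr (\<alpha> - 1))" by (simp add: R_def ac_simps)
    moreover have "0 \<le> (LINT x:{0<..}|lborel. norm (?f s x))" by (rule set_integral_real_nonneg) auto
    ultimately show ?thesis by simp
  qed
  \<comment> \<open>One of \<open>s\<close> and \<open>t - s\<close> is at least t / 2, so one of
    the two singular factors is at most (t / 2) powr (\<alpha> - 1) and the product is dominated by
    a sum of integrable powers.\<close>
  have gs: "set_integrable lborel {0<..<t} (\<lambda>s. g (t - s) * (R * s powr (\<alpha> - 1)))"
  proof (rule set_integrable_dominated)
    let ?c = "(t / 2) powr (\<alpha> - 1) * \<bar>R\<bar> / Gamma \<alpha>"
    show "set_integrable lborel {0<..<t} (\<lambda>s. ?c * ((t - s) powr (\<alpha> - 1) + s powr (\<alpha> - 1)))"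
      by (intro set_integrable_mult_right set_integral_add set_integrable_powr_from_0 \<alpha>)
    fix s assume s: "s \<in> {0<..<t}"
    have "(t - s) powr (\<alpha> - 1) * s powr (\<alpha> - 1) \<le> (t / 2) powr (\<alpha> - 1) * ((t - s) powr (\<alpha> - 1) + s powr (\<alpha> - 1))"
    proof (cases "s \<le> t / 2")
      case True
      then have "(t - s) powr (\<alpha> - 1) \<le> (t / 2) powr (\<alpha> - 1)" using s \<alpha> by (intro powr_mono2') auto
      then have "(t - s) powr (\<alpha> - 1) * s powr (\<alpha> - 1) \<le> (t / 2) powr (\<alpha> - 1) * s powr (\<alpha> - 1)" by (intro mult_right_mono) auto
      moreover have "0 \<le> (t / 2) powr (\<alpha> - 1) * (t - s) powr (\<alpha> - 1)" by simp
      ultimately show ?thesis unfolding distrib_left by linarith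
    next
      case False
      then have "s powr (\<alpha> - 1) \<le> (t / 2) powr (\<alpha> - 1)" using s \<alpha> by (intro powr_mono2') auto
      then have "s powr (\<alpha> - 1) * (t - s) powr (\<alpha> - 1) \<le> (t / 2) powr (\<alpha> - 1) * (t - s) powr (\<alpha> - 1)" by (intro mult_right_mono) auto
      moreover have "0 \<le> (t / 2) powr (\<alpha> - 1) * s powr (\<alpha> - 1)" by simp
      ultimately show ?thesis unfolding distrib_left mult.commute[of "(t - s) powr _" "s powr _"] by linarith
    qed
    then have "\<bar>R\<bar> / Gamma \<alpha> * ((t - s) powr (\<alpha> - 1) * s powr (\<alpha> - 1)) \<le> \<bar>R\<bar> / Gamma \<alpha> * ((t / 2) powr (\<alpha> - 1) * ((t - s) powr (\<alpha> - 1) + s powr (\<alpha> - 1)))"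
      using Gamma_pos by (intro mult_left_mono) auto
    then show "norm (g (t - s) * (R * s powr (\<alpha> - 1))) \<le> ?c * ((t - s) powr (\<alpha> - 1) + s powr (\<alpha> - 1))"
      using Gamma_pos by (simp add: g_def abs_mult ac_simps)
  qed (simp add: set_borel_measurable_def)
  have outer: "set_integrable lborel {0<..<t} (\<lambda>s. LINT x:{0<..}|lborel. norm (?f s x))"
  proof (rule set_integrable_dominated[OF gs _ nf])
    show "set_borel_measurable lborel {0<..<t} (\<lambda>s. LINT x:{0<..}|lborel. norm (?f s x))"
      unfolding set_borel_measurable_def set_lebesgue_integral_def by measurable
  qed
  have Rb: "cmod (ray_part l \<sigma> s) \<le> R * s powr (\<alpha> - 1)" if "0 < s" for s
    using ray_part_bound[OF \<sigma> l that] by (simp add: R_def ac_simps)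
  show "set_integrable lborel {0<..<t} (\<lambda>s. of_real (g (t - s)) * ray_part l \<sigma> s)"
    using Rb g_nonneg by (intro set_integrable_dominated[OF gs])
      (auto simp: set_borel_measurable_def norm_mult abs_mult intro!: mult_left_mono)
  have meas: "(\<lambda>(s, x). ?f s x) \<in> borel_measurable (borel \<Otimes>\<^sub>M borel)" by measurable
  let ?h = "\<lambda>x r. L l \<sigma> x * (of_real (cc * r powr - \<alpha> * exp (- (r * t))) / (of_real x * W \<sigma> + of_real r))"
  \<comment> \<open>An exponent strictly between 0 and both \<alpha> and 1 - \<alpha>: e > 0 gives
    integrability in x at 0, e < \<alpha> gives it in x at infinity, and e < 1 - \<alpha> gives it
    in r at 0.\<close>
  define e where "e = \<alpha> * (1 - \<alpha>)"
  have e: "0 < e" "e < \<alpha>" "e < 1 - \<alpha>"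
    using \<alpha> mult_strict_right_mono[of \<alpha> 1 "1 - \<alpha>"] by (auto simp: e_def)
  then have "e < 1" using \<alpha> by linarith
  note e = e this
  define k where "k r = cc / c1 * (r powr (1 - \<alpha> - e - 1) * exp (- (t * r)))" for r
  have kint: "set_integrable lborel {0<..} k"
    unfolding k_def[abs_def] using e t by (intro set_integrable_mult_right set_integral_Gamma) auto
  have hb: "cmod (?h x r) \<le> (c2 / (x powr \<alpha> + l) * x powr (e - 1)) * k r" if xr: "0 < x" "0 < r" for x r
  proof -
    \<comment> \<open>Young's inequality separates the variables: the denominator x + r is replaced
      by a product of powers, so the double integral is dominated by a product of two single
      ones.\<close>
    have "x powr (1 - e) * r powr e \<le> (1 - e) * x + e * r" using e xr by (intro Youngs_inequality_0) auto
    also have "\<dots> \<le> x + r"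
    proof -
      have "(1 - e) * x \<le> 1 * x" "e * r \<le> 1 * r" using e xr by (intro mult_right_mono; simp)+
      then show ?thesis by simp
    qed
    finally have y: "c1 * (x powr (1 - e) * r powr e) \<le> cmod (of_real x * W \<sigma> + of_real r)"
      using ray_add_bound(1)[OF \<sigma> xr] c_pos by (meson mult_left_mono less_imp_le order_trans)
    have "cmod (?h x r) = cmod (L l \<sigma> x) * (cc * r powr - \<alpha> * exp (- (r * t)) / cmod (of_real x * W \<sigma> + of_real r))"
      using cc_pos by (simp add: norm_mult norm_divide)
    also have "\<dots> \<le> c2 / (x powr \<alpha> + l) * (cc * r powr - \<alpha> * exp (- (r * t)) / (c1 * (x powr (1 - e) * r powr e)))"
      using norm_L[OF \<sigma> l, of x] y cc_pos c_pos xr l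
      by (intro mult_mono frac_le) (auto intro!: divide_nonneg_pos add_nonneg_pos mult_pos_pos)
    also have "\<dots> = (c2 / (x powr \<alpha> + l) * x powr (e - 1)) * k r"
    proof -
      have "r powr - \<alpha> / r powr e = r powr (1 - \<alpha> - e - 1)" using xr by (simp add: powr_diff[symmetric])
      moreover have "1 / x powr (1 - e) = x powr (e - 1)" using xr by (simp add: powr_minus_divide[symmetric])
      ultimately show ?thesis
        unfolding k_def by (simp add: divide_inverse algebra_simps)
    qed
    finally show ?thesis .
  qed
  have meas2: "(\<lambda>(x, r). ?h x r) \<in> borel_measurable (borel \<Otimes>\<^sub>M borel)" by measurable
  have inner2: "set_integrable lborel {0<..} (?h x)" if x: "x \<in> {0<..}" for x
    by (rule set_integrable_dominated[OF set_integrable_mult_right[OF kint, of "c2 / (x powr \<alpha> + l) * x powr (e - 1)"]])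
      (use hb x in \<open>auto simp: set_borel_measurable_def\<close>)
  define kk where "kk = (LINT r:{0<..}|lborel. k r)"
  have kk: "0 \<le> kk" unfolding kk_def k_def using cc_pos c_pos by (intro set_integral_real_nonneg) auto
  have outer2: "set_integrable lborel {0<..} (\<lambda>x. LINT r:{0<..}|lborel. norm (?h x r))"
  proof (rule set_integrable_dominated)
    show "set_integrable lborel {0<..} (\<lambda>x. (max (c2 / l) c2 * kk) * min (x powr - (1 - e)) (x powr - (1 + (\<alpha> - e))))"
      using e by (intro set_integrable_mult_right set_integrable_min_powr) auto
    show "set_borel_measurable lborel {0<..} (\<lambda>x. LINT r:{0<..}|lborel. norm (?h x r))"
      unfolding set_borel_measurable_def set_lebesgue_integral_def by measurable
    fix x :: real assume x: "x \<in> {0<..}"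
    have "(LINT r:{0<..}|lborel. norm (?h x r)) \<le> (LINT r:{0<..}|lborel. (c2 / (x powr \<alpha> + l) * x powr (e - 1)) * k r)"
      using hb x kint by (intro set_integral_mono set_integrable_norm inner2 set_integrable_mult_right) auto
    also have "\<dots> = (c2 / (x powr \<alpha> + l) * x powr (e - 1)) * kk" unfolding kk_def by (rule set_integral_mult_right)
    also have "c2 / (x powr \<alpha> + l) * x powr (e - 1) \<le> max (c2 / l) c2 * min (x powr - (1 - e)) (x powr - (1 + (\<alpha> - e)))"
    proof -
      have "c2 / (x powr \<alpha> + l) * x powr (e - 1) \<le> c2 / l * x powr (e - 1)"
        using c_pos l by (intro mult_right_mono divide_left_mono) (auto simp: add_nonneg_pos)
      also have "\<dots> \<le> max (c2 / l) c2 * x powr (e - 1)" by (intro mult_right_mono) auto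
      finally have 1: "c2 / (x powr \<alpha> + l) * x powr (e - 1) \<le> max (c2 / l) c2 * x powr - (1 - e)" by simp
      have "c2 / (x powr \<alpha> + l) * x powr (e - 1) \<le> c2 / x powr \<alpha> * x powr (e - 1)"
        using c_pos l x by (intro mult_right_mono divide_left_mono) (auto simp: add_pos_pos)
      also have "\<dots> = c2 * x powr - (1 + (\<alpha> - e))"
        using x by (simp add: powr_diff powr_minus field_simps powr_add)
      also have "\<dots> \<le> max (c2 / l) c2 * x powr - (1 + (\<alpha> - e))" by (intro mult_right_mono) auto
      finally show ?thesis using 1 by (auto simp: min_def)
    qed
    finally have "(LINT r:{0<..}|lborel. norm (?h x r)) \<le> (max (c2 / l) c2 * kk) * min (x powr - (1 - e)) (x powr - (1 + (\<alpha> - e)))"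
      using kk by (simp add: mult_right_mono ac_simps)
    moreover have "0 \<le> (LINT r:{0<..}|lborel. norm (?h x r))" by (rule set_integral_real_nonneg) auto
    ultimately show "norm (LINT r:{0<..}|lborel. norm (?h x r)) \<le> (max (c2 / l) c2 * kk) * min (x powr - (1 - e)) (x powr - (1 + (\<alpha> - e)))"
      by simp
  qed
  have "?lhs = (LINT s:{0<..<t}|lborel. LINT x:{0<..}|lborel. ?f s x)"
    unfolding ray_part_def set_integral_mult_right ..
  also have "\<dots> = (LINT x:{0<..}|lborel. LINT s:{0<..<t}|lborel. ?f s x)"
    by (rule set_Fubini(1)[OF _ _ meas inner outer]) auto
  also have "\<dots> = (LINT x:{0<..}|lborel. exp (of_real (t * x) * W \<sigma>) * L l \<sigma> x * (of_real (x powr - \<alpha>) * cis (- (\<sigma> * \<alpha> * \<theta>)))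
      - (LINT r:{0<..}|lborel. ?h x r))"
  proof (rule set_lebesgue_integral_cong)
    show "\<forall>x. x \<in> {0<..} \<longrightarrow> (LINT s:{0<..<t}|lborel. ?f s x)
      = exp (of_real (t * x) * W \<sigma>) * L l \<sigma> x * (of_real (x powr - \<alpha>) * cis (- (\<sigma> * \<alpha> * \<theta>))) - (LINT r:{0<..}|lborel. ?h x r)"
    proof (intro allI impI)
      fix x :: real assume x: "x \<in> {0<..}"
      have "(LINT s:{0<..<t}|lborel. ?f s x) = L l \<sigma> x * (LINT s:{0<..<t}|lborel. of_real (g (t - s)) * exp (of_real (s * x) * W \<sigma>))"
        unfolding set_integral_mult_right[symmetric] by (simp add: ac_simps)
      then show "(LINT s:{0<..<t}|lborel. ?f s x)
        = exp (of_real (t * x) * W \<sigma>) * L l \<sigma> x * (of_real (x powr - \<alpha>) * cis (- (\<sigma> * \<alpha> * \<theta>))) - (LINT r:{0<..}|lborel. ?h x r)"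
        using conv_ray_exp[OF \<sigma> _ t, of x] x unfolding set_integral_mult_right by (simp add: right_diff_distrib ac_simps)
    qed
  qed simp
  also have "\<dots> = ?A - (LINT x:{0<..}|lborel. LINT r:{0<..}|lborel. ?h x r)"
  proof (rule set_integral_diff(2)[OF int1])
    show "set_integrable lborel {0<..} (\<lambda>x. LINT r:{0<..}|lborel. ?h x r)"
    proof (rule set_integrable_dominated[OF outer2])
      show "set_borel_measurable lborel {0<..} (\<lambda>x. LINT r:{0<..}|lborel. ?h x r)"
        unfolding set_borel_measurable_def set_lebesgue_integral_def by measurable
      show "norm (LINT r:{0<..}|lborel. ?h x r) \<le> (LINT r:{0<..}|lborel. norm (?h x r))" if "x \<in> {0<..}" for x
        by (rule set_integral_norm_bound[OF inner2[OF that]])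
    qed
  qed
  also have "(LINT x:{0<..}|lborel. LINT r:{0<..}|lborel. ?h x r) = (LINT r:{0<..}|lborel. LINT x:{0<..}|lborel. ?h x r)"
    by (rule set_Fubini(1)[OF _ _ meas2 inner2 outer2]) auto
  also have "\<dots> = ?B"
  proof (rule set_lebesgue_integral_cong)
    show "\<forall>r. r \<in> {0<..} \<longrightarrow> (LINT x:{0<..}|lborel. ?h x r)
      = of_real (cc * r powr - \<alpha> * exp (- (r * t))) * (LINT x:{0<..}|lborel. K l (of_real x) / (of_real x + of_real r))"
    proof (intro allI impI)
      fix r :: real assume r: "r \<in> {0<..}"
      have "(LINT x:{0<..}|lborel. ?h x r) = of_real (cc * r powr - \<alpha> * exp (- (r * t))) * (LINT x:{0<..}|lborel. L l \<sigma> x / (of_real x * W \<sigma> + of_real r))"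
        unfolding set_integral_mult_right[symmetric] by (simp add: ac_simps)
      then show "(LINT x:{0<..}|lborel. ?h x r)
        = of_real (cc * r powr - \<alpha> * exp (- (r * t))) * (LINT x:{0<..}|lborel. K l (of_real x) / (of_real x + of_real r))"
        using ray_resolvent[OF \<sigma> l, of r] r by simp
    qed
  qed simp
  finally show "?lhs = ?A - ?B" .
qed

text \<open>The symbol satisfies K + \<i> l z^(- \<alpha>) K = z^(- \<alpha>), so on each ray the
  sum reduces to the ray integral of exp (t z) z^(- \<alpha>), known from \<open>ray_exp\<close>,
  minus the term \<open>Z\<close> common to both rays. In the difference \<open>Z\<close> cancels,
  the two phases combine to 2 \<i> sin (pi \<alpha>), and the reflection formula turns the constant
  into 1 / Gamma \<alpha>.\<close>

theorem kernel_volterra: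
  assumes l: "0 < l" and t: "0 < t"
  shows "kernel l t + \<i> * of_real l * (LINT s:{0<..<t}|lborel. of_real (g (t - s)) * kernel l s) = of_real (g t)"
proof -
  define Z where "Z = (LINT r:{0<..}|lborel. of_real (cc * r powr - \<alpha> * exp (- (r * t))) *
          (LINT x:{0<..}|lborel. K l (of_real x) / (of_real x + of_real r)))"
  define H where "H \<sigma> = (LINT s:{0<..<t}|lborel. of_real (g (t - s)) * ray_part l \<sigma> s)" for \<sigma>
  have main: "ray_part l \<sigma> t + \<i> * of_real l * H \<sigma> = - cis (- (\<sigma> * \<alpha> * pi)) * of_real (Gamma (1 - \<alpha>) * t powr (\<alpha> - 1)) - \<i> * of_real l * Z"
    if \<sigma>: "sgn_pm \<sigma>" for \<sigma>
  proof -
    let ?q = "\<lambda>x. of_real (x powr - \<alpha>) * cis (- (\<sigma> * \<alpha> * \<theta>))"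
    let ?e = "\<lambda>x. exp (of_real (t * x) * W \<sigma>)"
    note int = conv_ray_part(1)[OF \<sigma> l t]
    have "ray_part l \<sigma> t + \<i> * of_real l * H \<sigma> =
      ray_part l \<sigma> t + \<i> * of_real l * (LINT x:{0<..}|lborel. ?e x * L l \<sigma> x * ?q x) - \<i> * of_real l * Z"
      unfolding H_def conv_ray_part(3)[OF \<sigma> l t] Z_def by (simp add: right_diff_distrib)
    also have "ray_part l \<sigma> t + \<i> * of_real l * (LINT x:{0<..}|lborel. ?e x * L l \<sigma> x * ?q x)
      = (LINT x:{0<..}|lborel. ?e x * L l \<sigma> x + \<i> * of_real l * (?e x * L l \<sigma> x * ?q x))"
      unfolding ray_part_def set_integral_mult_right[symmetric]
      by (rule set_integral_add(2)[symmetric]) (intro ray_integrand(1)[OF \<sigma> l t] set_integrable_mult_right int)+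
    also have "\<dots> = (LINT x:{0<..}|lborel. cis (- (\<sigma> * \<alpha> * \<theta>)) * (W \<sigma> * ?e x * of_real (x powr - \<alpha>)))"
    proof (rule set_lebesgue_integral_cong)
      show "\<forall>x. x \<in> {0<..} \<longrightarrow> ?e x * L l \<sigma> x + \<i> * of_real l * (?e x * L l \<sigma> x * ?q x)
        = cis (- (\<sigma> * \<alpha> * \<theta>)) * (W \<sigma> * ?e x * of_real (x powr - \<alpha>))"
      proof (intro allI impI)
        fix x :: real assume x: "x \<in> {0<..}"
        let ?y = "of_real (x powr \<alpha>) * cis (\<sigma> * \<alpha> * \<theta>)"
        have "0 < x powr \<alpha> + l" using l by (simp add: add_nonneg_pos)
        with den_bound[OF \<sigma> l, of x] have d: "?y + \<i> * of_real l \<noteq> 0" by auto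
        have y1: "?y * ?q x = 1"
        proof -
          have "?y * ?q x = of_real (x powr \<alpha> * x powr - \<alpha>) * (cis (\<sigma> * \<alpha> * \<theta>) * cis (- (\<sigma> * \<alpha> * \<theta>)))"
            by (simp add: ac_simps)
          then show ?thesis using x by (simp add: cis_mult powr_add[symmetric] del: of_real_mult)
        qed
        have "L l \<sigma> x + \<i> * of_real l * (L l \<sigma> x * ?q x) = W \<sigma> * ?q x"
        proof -
          have "L l \<sigma> x + \<i> * of_real l * (L l \<sigma> x * ?q x) = L l \<sigma> x * (?y * ?q x + \<i> * of_real l * ?q x)"
            unfolding y1 by (simp add: algebra_simps)
          also have "\<dots> = L l \<sigma> x * (?y + \<i> * of_real l) * ?q x" by (simp only: ring_distribs mult.assoc)
          also have "L l \<sigma> x * (?y + \<i> * of_real l) = W \<sigma>" using d by (simp add: L_def)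
          finally show ?thesis .
        qed
        then have "?e x * (L l \<sigma> x + \<i> * of_real l * (L l \<sigma> x * ?q x)) = ?e x * (W \<sigma> * ?q x)" by simp
        then show "?e x * L l \<sigma> x + \<i> * of_real l * (?e x * L l \<sigma> x * ?q x)
          = cis (- (\<sigma> * \<alpha> * \<theta>)) * (W \<sigma> * ?e x * of_real (x powr - \<alpha>))" by (simp add: distrib_left ac_simps)
      qed
    qed simp
    also have "\<dots> = cis (- (\<sigma> * \<alpha> * \<theta>)) * (- cis (\<sigma> * \<alpha> * (\<theta> - pi)) * of_real (Gamma (1 - \<alpha>) * t powr (\<alpha> - 1)))"
      unfolding set_integral_mult_right using ray_exp[OF \<sigma> t, of \<alpha>] \<alpha> by simp
    also have "\<dots> = - (cis (- (\<sigma> * \<alpha> * \<theta>)) * cis (\<sigma> * \<alpha> * (\<theta> - pi))) * of_real (Gamma (1 - \<alpha>) * t powr (\<alpha> - 1))"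
      by (simp add: mult.assoc)
    also have "cis (- (\<sigma> * \<alpha> * \<theta>)) * cis (\<sigma> * \<alpha> * (\<theta> - pi)) = cis (- (\<sigma> * \<alpha> * pi))"
      by (simp add: cis_mult right_diff_distrib)
    finally show ?thesis .
  qed
  have "(LINT s:{0<..<t}|lborel. of_real (g (t - s)) * kernel l s)
    = (LINT s:{0<..<t}|lborel. (1 / (2 * of_real pi * \<i>)) * (of_real (g (t - s)) * ray_part l 1 s - of_real (g (t - s)) * ray_part l (- 1) s))"
    by (rule set_lebesgue_integral_cong) (auto simp: kernel_def field_simps)
  also have "\<dots> = (1 / (2 * of_real pi * \<i>)) * (H 1 - H (- 1))"
    unfolding set_integral_mult_right H_def
    by (subst set_integral_diff(2)) (auto intro!: conv_ray_part(2) l t simp: sgn_pm_def)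
  finally have k: "(LINT s:{0<..<t}|lborel. of_real (g (t - s)) * kernel l s) = (1 / (2 * of_real pi * \<i>)) * (H 1 - H (- 1))" .
  have "kernel l t + \<i> * of_real l * (LINT s:{0<..<t}|lborel. of_real (g (t - s)) * kernel l s)
    = ((ray_part l 1 t + \<i> * of_real l * H 1) - (ray_part l (- 1) t + \<i> * of_real l * H (- 1))) / (2 * of_real pi * \<i>)"
    unfolding k unfolding kernel_def by (simp add: field_simps)
  also have "\<dots> = (cis (\<alpha> * pi) - cis (- (\<alpha> * pi))) * of_real (Gamma (1 - \<alpha>) * t powr (\<alpha> - 1)) / (2 * of_real pi * \<i>)"
    using main[of 1] main[of "- 1"] by (simp add: sgn_pm_def left_diff_distrib)
  also have "cis (\<alpha> * pi) - cis (- (\<alpha> * pi)) = 2 * \<i> * of_real (sin (pi * \<alpha>))"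
    by (simp add: complex_eq_iff mult.commute)
  also have "2 * \<i> * of_real (sin (pi * \<alpha>)) * of_real (Gamma (1 - \<alpha>) * t powr (\<alpha> - 1)) / (2 * of_real pi * \<i>)
    = of_real (sin (pi * \<alpha>) / pi * Gamma (1 - \<alpha>) * t powr (\<alpha> - 1))"
    by (simp add: field_simps)
  also have "sin (pi * \<alpha>) / pi * Gamma (1 - \<alpha>) * t powr (\<alpha> - 1) = g t"
  proof -
    have "complex_of_real (Gamma \<alpha> * Gamma (1 - \<alpha>)) = complex_of_real (pi / sin (pi * \<alpha>))"
      using Gamma_reflection_complex[of "of_real \<alpha>"] Gamma_complex_of_real[of \<alpha>] Gamma_complex_of_real[of "1 - \<alpha>"]
      by (simp add: sin_of_real[symmetric])
    then have "Gamma \<alpha> * Gamma (1 - \<alpha>) = pi / sin (pi * \<alpha>)" by (rule iffD1[OF of_real_eq_iff])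
    moreover have "sin (pi * \<alpha>) \<noteq> 0" using sin_gt_zero[of "pi * \<alpha>"] \<alpha> by auto
    ultimately show ?thesis using Gamma_pos by (simp add: g_def field_simps)
  qed
  finally show ?thesis .
qed

end

section \<open>The maximal function on the line\<close>

text \<open>The centred Hardy-Littlewood maximal function, with rational radii so that it is a
  countable supremum of measurable functions.\<close>

definition maximal :: "(real \<Rightarrow> ennreal) \<Rightarrow> real \<Rightarrow> ennreal"
  where "maximal w t = (SUP q\<in>\<rat> \<inter> {0<..}.
    (\<integral>\<^sup>+s. (if \<bar>s - t\<bar> < q then w s else 0) \<partial>lborel) / ennreal (2 * q))"

lemma maximal_measurable [measurable]:
  assumes [measurable]: "w \<in> borel_measurable borel"
  shows "maximal w \<in> borel_measurable borel"
proof -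
  have "countable (\<rat> \<inter> {0<..} :: real set)"
    using countable_rat by blast
  then show ?thesis
    unfolding maximal_def[abs_def] by (intro borel_measurable_SUP) measurable
qed

lemma ennreal_mult_divide_cancel: "x \<noteq> 0 \<Longrightarrow> x \<noteq> top \<Longrightarrow> x * (y / x) = (y::ennreal)"
  by (simp add: ennreal_times_divide mult.commute[of x] ennreal_mult_divide_eq)

text \<open>A rational radius between \<open>r\<close> and \<open>2 * r\<close> is admissible in the
  supremum; the enlargement accounts for 4 instead of 2.\<close>

lemma average_le_maximal:
  assumes "0 < r"
  shows "(\<integral>\<^sup>+s. (if \<bar>s - t\<bar> < r then w s else 0) \<partial>lborel) \<le> ennreal (4 * r) * maximal w t"
proof -
  obtain q where q: "q \<in> \<rat>" "r < q" "q < 2 * r" using Rats_dense_in_real[of r "2 * r"] assms by auto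
  have "(\<integral>\<^sup>+s. (if \<bar>s - t\<bar> < r then w s else 0) \<partial>lborel) \<le> (\<integral>\<^sup>+s. (if \<bar>s - t\<bar> < q then w s else 0) \<partial>lborel)"
    (is "_ \<le> ?I") using q by (intro nn_integral_mono) auto
  also have "?I = ennreal (2 * q) * (?I / ennreal (2 * q))"
  proof -
    have "0 < q" using q(2) assms by linarith
    then show ?thesis by (intro ennreal_mult_divide_cancel[symmetric]) (auto simp: ennreal_eq_0_iff)
  qed
  also have "\<dots> \<le> ennreal (4 * r) * maximal w t"
  proof (rule mult_mono)
    show "?I / ennreal (2 * q) \<le> maximal w t"
      unfolding maximal_def by (rule SUP_upper2[of q]) (use q assms in auto)
  qed (use q assms in \<open>auto intro!: ennreal_leI\<close>)
  finally show ?thesis .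
qed

lemma emeasure_lborel_ball_real: "0 \<le> r \<Longrightarrow> emeasure lborel (ball (t::real) r) = ennreal (2 * r)"
  by (simp add: ball_eq_greaterThanLessThan)

text \<open>Vitali covering: each point of the level set is the centre of a ball whose mass exceeds
  \<open>a\<close> times its length, and finiteness of the integral bounds the radii. A countable
  disjoint subfamily covers the set after dilation by 5. Disjointness means that each point is
  counted at most once when the masses are added; the addition is an integral over
  \<open>count_space C\<close>.\<close>

lemma maximal_weak_type:
  assumes [measurable]: "w \<in> borel_measurable borel" and a: "0 < a"
  shows "emeasure lborel {t. ennreal a < maximal w t} \<le> ennreal (5 / a) * (\<integral>\<^sup>+s. w s \<partial>lborel)"
proof (cases "(\<integral>\<^sup>+s. w s \<partial>lborel) = \<infinity>")
  case True
  then show ?thesis using a by (simp add: ennreal_mult_top)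
next
  case False
  then obtain i where i: "(\<integral>\<^sup>+s. w s \<partial>lborel) = ennreal i" "0 \<le> i"
    by (cases "\<integral>\<^sup>+s. w s \<partial>lborel") auto
  define S where "S = {t. ennreal a < maximal w t}"
  have "\<exists>r. 0 < r \<and> ennreal (2 * r * a) < (\<integral>\<^sup>+s. (if \<bar>s - t\<bar> < r then w s else 0) \<partial>lborel)" if "t \<in> S" for t
  proof -
    from that obtain q where q: "q \<in> \<rat>" "q > 0"
      "ennreal a < (\<integral>\<^sup>+s. (if \<bar>s - t\<bar> < q then w s else 0) \<partial>lborel) / ennreal (2 * q)" (is "_ < ?I / _")
      unfolding S_def maximal_def less_SUP_iff mem_Collect_eq by auto
    have "\<not> ?I \<le> ennreal (2 * q) * ennreal a"
      using q divide_le_posI_ennreal[of "ennreal (2 * q)" ?I "ennreal a"] by auto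
    then show ?thesis using q a by (intro exI[of _ q]) (auto simp: ennreal_mult not_le)
  qed
  then obtain r where r: "\<And>t. t \<in> S \<Longrightarrow> 0 < r t"
    "\<And>t. t \<in> S \<Longrightarrow> ennreal (2 * r t * a) < (\<integral>\<^sup>+s. (if \<bar>s - t\<bar> < r t then w s else 0) \<partial>lborel)"
    by metis
  have bound: "r t \<le> i / (2 * a)" if "t \<in> S" for t
  proof -
    have "ennreal (2 * r t * a) \<le> (\<integral>\<^sup>+s. (if \<bar>s - t\<bar> < r t then w s else 0) \<partial>lborel)"
      using r(2)[OF that] by simp
    also have "\<dots> \<le> (\<integral>\<^sup>+s. w s \<partial>lborel)" by (intro nn_integral_mono) auto
    finally have "2 * r t * a \<le> i" using i by simp
    then show ?thesis using a by (simp add: field_simps)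
  qed
  have "S \<subseteq> (\<Union>t\<in>S. ball t (r t))" using r(1) by force
  moreover have "0 < r t \<and> r t \<le> i / (2 * a)" if "t \<in> S" for t using r(1) bound that by auto
  ultimately obtain C where C: "countable C" "C \<subseteq> S"
    "pairwise (\<lambda>i j. disjnt (ball i (r i)) (ball j (r j))) C"
    "S \<subseteq> (\<Union>i\<in>C. ball i (5 * r i))"
    by (rule Vitali_covering_lemma_balls[of S "\<lambda>t. t" r S])
  have "emeasure lborel S = (\<integral>\<^sup>+x. indicator S x \<partial>lborel)" unfolding S_def by simp
  also have "\<dots> \<le> (\<integral>\<^sup>+x. (\<integral>\<^sup>+t. indicator (ball t (5 * r t)) x \<partial>count_space C) \<partial>lborel)"
  proof (rule nn_integral_mono)
    fix x
    show "indicator S x \<le> (\<integral>\<^sup>+t. indicator (ball t (5 * r t)) x \<partial>count_space C)"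
    proof (cases "x \<in> S")
      case True
      then obtain t0 where t0: "t0 \<in> C" "x \<in> ball t0 (5 * r t0)" using C(4) by blast
      have "1 = (\<integral>\<^sup>+t. indicator {t0} t \<partial>count_space C)" using t0 by simp
      also have "\<dots> \<le> (\<integral>\<^sup>+t. indicator (ball t (5 * r t)) x \<partial>count_space C)"
        using t0 by (intro nn_integral_mono) (auto simp: indicator_def)
      finally show ?thesis using True by simp
    qed simp
  qed
  also have "\<dots> = (\<integral>\<^sup>+t. (\<integral>\<^sup>+x. indicator (ball t (5 * r t)) x \<partial>lborel) \<partial>count_space C)"
    by (rule nn_integral_count_space_nn_integral[OF C(1)]) (rule borel_measurable_indicator, simp)
  also have "\<dots> \<le> (\<integral>\<^sup>+t. (\<integral>\<^sup>+x. ennreal (5 / a) * (if \<bar>x - t\<bar> < r t then w x else 0) \<partial>lborel) \<partial>count_space C)"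
  proof (rule nn_integral_mono)
    fix t assume "t \<in> space (count_space C)"
    then have t: "t \<in> S" using C(2) by auto
    have "(\<integral>\<^sup>+x. indicator (ball t (5 * r t)) x \<partial>lborel) = ennreal (2 * (5 * r t))"
      using r(1)[OF t] by (simp add: emeasure_lborel_ball_real)
    also have "\<dots> = ennreal (5 / a) * ennreal (2 * r t * a)"
      using r(1)[OF t] a by (simp add: ennreal_mult[symmetric])
    also have "\<dots> \<le> ennreal (5 / a) * (\<integral>\<^sup>+x. (if \<bar>x - t\<bar> < r t then w x else 0) \<partial>lborel)"
      using r(2)[OF t] by (intro mult_left_mono) auto
    also have "\<dots> = (\<integral>\<^sup>+x. ennreal (5 / a) * (if \<bar>x - t\<bar> < r t then w x else 0) \<partial>lborel)"
      by (rule nn_integral_cmult[symmetric]) measurable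
    finally show "(\<integral>\<^sup>+x. indicator (ball t (5 * r t)) x \<partial>lborel) \<le> \<dots>" .
  qed
  also have "\<dots> = (\<integral>\<^sup>+x. (\<integral>\<^sup>+t. ennreal (5 / a) * (if \<bar>x - t\<bar> < r t then w x else 0) \<partial>count_space C) \<partial>lborel)"
    by (rule nn_integral_count_space_nn_integral[OF C(1), symmetric]) measurable
  also have "\<dots> \<le> (\<integral>\<^sup>+x. ennreal (5 / a) * w x \<partial>lborel)"
  proof (rule nn_integral_mono)
    fix x
    show "(\<integral>\<^sup>+t. ennreal (5 / a) * (if \<bar>x - t\<bar> < r t then w x else 0) \<partial>count_space C) \<le> ennreal (5 / a) * w x"
    proof (cases "\<exists>t\<in>C. \<bar>x - t\<bar> < r t")
      case True
      then obtain t0 where t0: "t0 \<in> C" "\<bar>x - t0\<bar> < r t0" by blast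
      have "t = t0" if "t \<in> C" "\<bar>x - t\<bar> < r t" for t
      proof (rule ccontr)
        assume "t \<noteq> t0"
        then have "disjnt (ball t (r t)) (ball t0 (r t0))" using C(3) that t0 by (auto simp: pairwise_def)
        moreover have "x \<in> ball t (r t)" "x \<in> ball t0 (r t0)" using that t0 by (auto simp: dist_real_def)
        ultimately show False by (auto simp: disjnt_def)
      qed
      then have "(\<integral>\<^sup>+t. ennreal (5 / a) * (if \<bar>x - t\<bar> < r t then w x else 0) \<partial>count_space C)
        \<le> (\<integral>\<^sup>+t. ennreal (5 / a) * w x * indicator {t0} t \<partial>count_space C)"
        by (intro nn_integral_mono) (auto simp: indicator_def)
      also have "\<dots> = ennreal (5 / a) * w x" using t0 by (subst nn_integral_cmult_indicator) auto
      finally show ?thesis .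
    next
      case False
      then have "(\<integral>\<^sup>+t. ennreal (5 / a) * (if \<bar>x - t\<bar> < r t then w x else 0) \<partial>count_space C)
        = (\<integral>\<^sup>+t. 0 \<partial>count_space C)"
        by (intro nn_integral_cong) auto
      then show ?thesis by simp
    qed
  qed
  also have "\<dots> = ennreal (5 / a) * (\<integral>\<^sup>+s. w s \<partial>lborel)" by (rule nn_integral_cmult) measurable
  finally show ?thesis unfolding S_def .
qed

lemma nn_integral_powr_from_0:
  assumes "0 < s" "0 \<le> y"
  shows "(\<integral>\<^sup>+a. (if 0 < a \<and> a < y then ennreal (a powr (s - 1)) else 0) \<partial>lborel) = ennreal (y powr s / s)"
proof -
  have "((\<lambda>x. x powr (s - 1)) has_integral (y powr (s - 1 + 1) / (s - 1 + 1))) {0..y}"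
    using assms by (intro has_integral_powr_from_0) auto
  then have "(\<integral>\<^sup>+x. ennreal (indicator {0..y} x * x powr (s - 1)) \<partial>lborel) = ennreal (y powr s / s)"
    by (intro nn_integral_has_integral_lebesgue) auto
  moreover have "AE x in lborel. x \<noteq> (y::real)" by (rule AE_lborel_singleton)
  then have "(\<integral>\<^sup>+a. (if 0 < a \<and> a < y then ennreal (a powr (s - 1)) else 0) \<partial>lborel) =
    (\<integral>\<^sup>+x. ennreal (indicator {0..y} x * x powr (s - 1)) \<partial>lborel)"
    by (intro nn_integral_cong_AE) (auto simp: indicator_def)
  ultimately show ?thesis by simp
qed

text \<open>Marcinkiewicz interpolation between the weak type and the trivial bound for bounded
  functions: at level 2 a only the part of \<open>w\<close> above \<open>a\<close> matters, and the
  weak type for it is integrated over all levels. The result is stated with a real function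
  \<open>V\<close> that equals the maximal function almost everywhere, so that real powers can be
  taken.\<close>

lemma maximal_strong_type:
  assumes [measurable]: "w \<in> borel_measurable borel" and w0: "\<And>t. 0 \<le> w t" and r: "1 < r"
    and fin: "(\<integral>\<^sup>+t. ennreal (w t powr r) \<partial>lborel) < \<infinity>"
  obtains V where "V \<in> borel_measurable borel" "\<And>t. 0 \<le> V t"
    "AE t in lborel. maximal (\<lambda>s. ennreal (w s)) t = ennreal (V t)"
    "(\<integral>\<^sup>+t. ennreal (V t powr r) \<partial>lborel)
      \<le> ennreal (2 powr r * 5 * r / (r - 1)) * (\<integral>\<^sup>+t. ennreal (w t powr r) \<partial>lborel)"
proof -
  define M where "M = maximal (\<lambda>s. ennreal (w s))"
  \<comment> \<open>The layer-cake form of (M t / 2) powr r. It remains meaningful where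
    \<open>M t\<close> is infinite, before finiteness of \<open>M\<close> is known.\<close>
  define L where "L t = (\<integral>\<^sup>+a. (if 0 < a \<and> ennreal (2 * a) < M t then ennreal (r * a powr (r - 1)) else 0) \<partial>lborel)" for t
  have [measurable]: "M \<in> borel_measurable borel" unfolding M_def by measurable
  have [measurable]: "L \<in> borel_measurable borel" unfolding L_def by measurable
  have trunc: "emeasure lborel {t. ennreal (2 * a) < M t}
      \<le> ennreal (5 / a) * (\<integral>\<^sup>+s. (if a < w s then ennreal (w s) else 0) \<partial>lborel)" if a: "0 < a" for a
  proof -
    define w1 where "w1 s = (if a < w s then ennreal (w s) else 0)" for s
    have [measurable]: "w1 \<in> borel_measurable borel" unfolding w1_def by measurable
    have "M t \<le> maximal w1 t + ennreal a" for t
      unfolding M_def maximal_def[of "\<lambda>s. ennreal (w s)"]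
    proof (rule SUP_least)
      fix q :: real assume q: "q \<in> \<rat> \<inter> {0<..}"
      have [measurable]: "ball t q \<in> sets borel" by simp
      have "(\<integral>\<^sup>+s. (if \<bar>s - t\<bar> < q then ennreal (w s) else 0) \<partial>lborel)
        \<le> (\<integral>\<^sup>+s. (if \<bar>s - t\<bar> < q then w1 s else 0) + ennreal a * indicator (ball t q) s \<partial>lborel)"
        using w0 a by (intro nn_integral_mono) (auto simp: w1_def indicator_def dist_real_def ennreal_leI)
      also have "\<dots> = (\<integral>\<^sup>+s. (if \<bar>s - t\<bar> < q then w1 s else 0) \<partial>lborel) + ennreal a * ennreal (2 * q)"
        using q by (subst nn_integral_add) (auto simp: nn_integral_cmult_indicator emeasure_lborel_ball_real)
      finally have "(\<integral>\<^sup>+s. (if \<bar>s - t\<bar> < q then ennreal (w s) else 0) \<partial>lborel) / ennreal (2 * q) \<le> \<dots> / ennreal (2 * q)"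
        by (rule divide_right_mono_ennreal)
      also have "\<dots> = (\<integral>\<^sup>+s. (if \<bar>s - t\<bar> < q then w1 s else 0) \<partial>lborel) / ennreal (2 * q) + ennreal a"
        using q by (simp add: add_divide_distrib_ennreal ennreal_mult_divide_eq)
      also have "\<dots> \<le> maximal w1 t + ennreal a"
        using q unfolding maximal_def by (intro add_right_mono SUP_upper) auto
      finally show "(\<integral>\<^sup>+s. (if \<bar>s - t\<bar> < q then ennreal (w s) else 0) \<partial>lborel) / ennreal (2 * q) \<le> \<dots>" .
    qed
    then have "ennreal a < maximal w1 t" if "ennreal (2 * a) < M t" for t
    proof -
      have "ennreal a + ennreal a < maximal w1 t + ennreal a"
        using that \<open>M t \<le> _\<close> a by (simp add: ennreal_plus[symmetric] less_le_trans del: ennreal_plus)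
      then show ?thesis by (cases "maximal w1 t") (auto simp: a ennreal_plus[symmetric] ennreal_less_iff simp del: ennreal_plus)
    qed
    then have "emeasure lborel {t. ennreal (2 * a) < M t} \<le> emeasure lborel {t. ennreal a < maximal w1 t}"
      by (intro emeasure_mono) auto
    also have "\<dots> \<le> ennreal (5 / a) * (\<integral>\<^sup>+s. w1 s \<partial>lborel)" by (rule maximal_weak_type[OF _ a]) simp
    finally show ?thesis unfolding w1_def .
  qed
  have "(\<integral>\<^sup>+t. L t \<partial>lborel) = (\<integral>\<^sup>+a. (\<integral>\<^sup>+t. (if 0 < a \<and> ennreal (2 * a) < M t then ennreal (r * a powr (r - 1)) else 0) \<partial>lborel) \<partial>lborel)"
    unfolding L_def by (rule lborel_pair.Fubini'[symmetric]) measurable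
  also have "\<dots> \<le> (\<integral>\<^sup>+a. (\<integral>\<^sup>+s. ennreal (5 * r) * (ennreal (w s) * (if 0 < a \<and> a < w s then ennreal (a powr (r - 1 - 1)) else 0)) \<partial>lborel) \<partial>lborel)"
  proof (rule nn_integral_mono)
    fix a :: real
    show "(\<integral>\<^sup>+t. (if 0 < a \<and> ennreal (2 * a) < M t then ennreal (r * a powr (r - 1)) else 0) \<partial>lborel)
      \<le> (\<integral>\<^sup>+s. ennreal (5 * r) * (ennreal (w s) * (if 0 < a \<and> a < w s then ennreal (a powr (r - 1 - 1)) else 0)) \<partial>lborel)"
    proof (cases "0 < a")
      case True
      have "(\<integral>\<^sup>+t. (if 0 < a \<and> ennreal (2 * a) < M t then ennreal (r * a powr (r - 1)) else 0) \<partial>lborel)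
        = (\<integral>\<^sup>+t. ennreal (r * a powr (r - 1)) * indicator {t. ennreal (2 * a) < M t} t \<partial>lborel)"
        using True by (intro nn_integral_cong) auto
      also have "\<dots> = ennreal (r * a powr (r - 1)) * emeasure lborel {t. ennreal (2 * a) < M t}"
        by (subst nn_integral_cmult_indicator) auto
      also have "\<dots> \<le> ennreal (r * a powr (r - 1)) * (ennreal (5 / a) * (\<integral>\<^sup>+s. (if a < w s then ennreal (w s) else 0) \<partial>lborel))"
        by (intro mult_left_mono trunc True) auto
      also have "\<dots> = ennreal (5 * r * a powr (r - 1 - 1)) * (\<integral>\<^sup>+s. (if a < w s then ennreal (w s) else 0) \<partial>lborel)"
      proof -
        have "r * a powr (r - 1) * (5 / a) = 5 * r * a powr (r - 1 - 1)"
          using True by (simp add: powr_diff power2_eq_square)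
        then show ?thesis using True r by (simp add: mult.assoc[symmetric] ennreal_mult[symmetric])
      qed
      also have "\<dots> = (\<integral>\<^sup>+s. ennreal (5 * r * a powr (r - 1 - 1)) * (if a < w s then ennreal (w s) else 0) \<partial>lborel)"
        by (rule nn_integral_cmult[symmetric]) measurable
      also have "\<dots> = (\<integral>\<^sup>+s. ennreal (5 * r) * (ennreal (w s) * (if 0 < a \<and> a < w s then ennreal (a powr (r - 1 - 1)) else 0)) \<partial>lborel)"
        using True r w0 by (intro nn_integral_cong) (auto simp: ennreal_mult[symmetric] algebra_simps)
      finally show ?thesis by simp
    qed simp
  qed
  also have "\<dots> = (\<integral>\<^sup>+s. (\<integral>\<^sup>+a. ennreal (5 * r) * (ennreal (w s) * (if 0 < a \<and> a < w s then ennreal (a powr (r - 1 - 1)) else 0)) \<partial>lborel) \<partial>lborel)"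
    by (rule lborel_pair.Fubini') measurable
  also have "\<dots> = (\<integral>\<^sup>+s. ennreal (5 * r / (r - 1)) * ennreal (w s powr r) \<partial>lborel)"
  proof (rule nn_integral_cong)
    fix s
    have "(\<integral>\<^sup>+a. ennreal (5 * r) * (ennreal (w s) * (if 0 < a \<and> a < w s then ennreal (a powr (r - 1 - 1)) else 0)) \<partial>lborel)
      = ennreal (5 * r) * (ennreal (w s) * ennreal (w s powr (r - 1) / (r - 1)))"
      using nn_integral_powr_from_0[of "r - 1" "w s"] w0[of s] r by (simp add: nn_integral_cmult)
    also have "\<dots> = ennreal (5 * r / (r - 1)) * ennreal (w s powr r)"
      using w0[of s] r by (cases "w s = 0") (auto simp: ennreal_mult[symmetric] powr_diff field_simps)
    finally show "(\<integral>\<^sup>+a. ennreal (5 * r) * (ennreal (w s) * (if 0 < a \<and> a < w s then ennreal (a powr (r - 1 - 1)) else 0)) \<partial>lborel) = \<dots>" .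
  qed
  also have "\<dots> = ennreal (5 * r / (r - 1)) * (\<integral>\<^sup>+t. ennreal (w t powr r) \<partial>lborel)"
    by (rule nn_integral_cmult) measurable
  finally have L: "(\<integral>\<^sup>+t. L t \<partial>lborel) \<le> ennreal (5 * r / (r - 1)) * (\<integral>\<^sup>+t. ennreal (w t powr r) \<partial>lborel)" .
  have Lval: "ennreal ((y / 2) powr r) \<le> L t" if "ennreal y \<le> M t" "0 \<le> y" for t y
  proof -
    have "ennreal ((y / 2) powr r) = ennreal r * ennreal ((y / 2) powr r / r)"
      using r by (simp add: ennreal_mult[symmetric])
    also have "\<dots> = ennreal r * (\<integral>\<^sup>+a. (if 0 < a \<and> a < y / 2 then ennreal (a powr (r - 1)) else 0) \<partial>lborel)"
      using r that by (subst nn_integral_powr_from_0) auto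
    also have "\<dots> = (\<integral>\<^sup>+a. ennreal r * (if 0 < a \<and> a < y / 2 then ennreal (a powr (r - 1)) else 0) \<partial>lborel)"
      by (rule nn_integral_cmult[symmetric]) measurable
    also have "\<dots> \<le> L t" unfolding L_def
    proof (rule nn_integral_mono)
      fix a
      have "ennreal (2 * a) < M t" if "0 < a" "a < y / 2"
        using that \<open>ennreal y \<le> M t\<close> by (intro less_le_trans[OF _ \<open>ennreal y \<le> M t\<close>]) (auto simp: ennreal_less_iff)
      then show "ennreal r * (if 0 < a \<and> a < y / 2 then ennreal (a powr (r - 1)) else 0)
        \<le> (if 0 < a \<and> ennreal (2 * a) < M t then ennreal (r * a powr (r - 1)) else 0)"
        using r by (auto simp: ennreal_mult[symmetric])
    qed
    finally show ?thesis .
  qed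
  have "(\<integral>\<^sup>+t. L t \<partial>lborel) < \<infinity>"
    using L fin by (simp add: ennreal_mult_less_top order_le_less_trans)
  then have "AE t in lborel. L t \<noteq> \<infinity>" by (intro nn_integral_PInf_AE) auto
  then have Mfin: "AE t in lborel. M t \<noteq> \<infinity>"
  proof eventually_elim
    case (elim t)
    show ?case
    proof
      assume inf: "M t = \<infinity>"
      obtain l where l: "L t = ennreal l" "0 \<le> l" using elim by (cases "L t") auto
      \<comment> \<open>The level y = 2 (l + 1) powr (1 / r) is chosen so that (y / 2) powr r = l +
        1, above the supposed finite value \<open>l\<close>.\<close>
      have "ennreal ((2 * (l + 1) powr (1 / r) / 2) powr r) \<le> L t"
        using inf by (intro Lval) auto
      then have "l + 1 \<le> l" using l r by (simp add: powr_powr)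
      then show False by simp
    qed
  qed
  show ?thesis
  proof (rule that[of "\<lambda>t. enn2real (M t)"])
    show "AE t in lborel. maximal (\<lambda>s. ennreal (w s)) t = ennreal (enn2real (M t))"
      using Mfin by eventually_elim (simp add: M_def less_top)
    have "(\<integral>\<^sup>+t. ennreal (enn2real (M t) powr r) \<partial>lborel) \<le> (\<integral>\<^sup>+t. ennreal (2 powr r) * L t \<partial>lborel)"
    proof (intro nn_integral_mono_AE, use Mfin in eventually_elim)
      case (elim t)
      have "ennreal (enn2real (M t) powr r) = ennreal (2 powr r) * ennreal ((enn2real (M t) / 2) powr r)"
        by (simp add: ennreal_mult[symmetric] powr_divide)
      also have "\<dots> \<le> ennreal (2 powr r) * L t"
        using elim by (intro mult_left_mono Lval) (auto simp: less_top)
      finally show ?case .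
    qed
    also have "\<dots> = ennreal (2 powr r) * (\<integral>\<^sup>+t. L t \<partial>lborel)" by (rule nn_integral_cmult) measurable
    also have "\<dots> \<le> ennreal (2 powr r) * (ennreal (5 * r / (r - 1)) * (\<integral>\<^sup>+t. ennreal (w t powr r) \<partial>lborel))"
      by (intro mult_left_mono L) auto
    also have "\<dots> = ennreal (2 powr r * 5 * r / (r - 1)) * (\<integral>\<^sup>+t. ennreal (w t powr r) \<partial>lborel)"
      using r by (simp add: mult.assoc[symmetric] ennreal_mult[symmetric])
    finally show "(\<integral>\<^sup>+t. ennreal (enn2real (M t) powr r) \<partial>lborel) \<le> \<dots>" .
  qed auto
qed

section \<open>Square functions of convolutions with mixtures of averages\<close>

text \<open>Convolution with \<open>mix_kernel m\<close> integrates \<open>2 * r * m r\<close> times the average over the interval of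
  half-length \<open>r\<close>; hence the weight \<open>r * m r\<close> in the definition of \<open>mixture\<close>.\<close>

definition mix_kernel :: "(real \<Rightarrow> real) \<Rightarrow> real \<Rightarrow> ennreal"
  where "mix_kernel m s = (\<integral>\<^sup>+r. (if \<bar>s\<bar> < r then ennreal (m r) else 0) \<partial>lborel)"

definition mixture :: "real \<Rightarrow> (real \<Rightarrow> real) \<Rightarrow> bool"
  where "mixture B m \<longleftrightarrow> m \<in> borel_measurable borel \<and> (\<forall>r. 0 \<le> m r) \<and>
    (\<integral>\<^sup>+r. (if 0 < r then ennreal (r * m r) else 0) \<partial>lborel) \<le> ennreal B"

lemma mix_kernel_measurable [measurable]:
  assumes [measurable]: "m \<in> borel_measurable borel"
  shows "mix_kernel m \<in> borel_measurable borel"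
  unfolding mix_kernel_def by measurable

lemma mix_kernel_commute: "mix_kernel m (t - s) = mix_kernel m (s - t)"
  unfolding mix_kernel_def by (simp add: abs_minus_commute)

lemma mix_kernel_conv:
  assumes m: "mixture B m" and [measurable]: "w \<in> borel_measurable borel"
  shows "(\<integral>\<^sup>+s. mix_kernel m (t - s) * w s \<partial>lborel)
    = (\<integral>\<^sup>+r. ennreal (m r) * (\<integral>\<^sup>+s. (if \<bar>s - t\<bar> < r then w s else 0) \<partial>lborel) \<partial>lborel)"
proof -
  have [measurable]: "m \<in> borel_measurable borel" using m by (simp add: mixture_def)
  have "(\<integral>\<^sup>+s. mix_kernel m (t - s) * w s \<partial>lborel)
    = (\<integral>\<^sup>+s. (\<integral>\<^sup>+r. ennreal (m r) * (if \<bar>s - t\<bar> < r then w s else 0) \<partial>lborel) \<partial>lborel)"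
  proof (rule nn_integral_cong)
    fix s
    have "mix_kernel m (t - s) * w s = (\<integral>\<^sup>+r. (if \<bar>t - s\<bar> < r then ennreal (m r) else 0) * w s \<partial>lborel)"
      unfolding mix_kernel_def by (rule nn_integral_multc[symmetric]) measurable
    also have "\<dots> = (\<integral>\<^sup>+r. ennreal (m r) * (if \<bar>s - t\<bar> < r then w s else 0) \<partial>lborel)"
      by (intro nn_integral_cong) (auto simp: abs_minus_commute)
    finally show "mix_kernel m (t - s) * w s = \<dots>" .
  qed
  also have "\<dots> = (\<integral>\<^sup>+r. (\<integral>\<^sup>+s. ennreal (m r) * (if \<bar>s - t\<bar> < r then w s else 0) \<partial>lborel) \<partial>lborel)"
    by (rule lborel_pair.Fubini') measurable
  finally show ?thesis by (simp add: nn_integral_cmult)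
qed

text \<open>The integral over each interval of half-length \<open>r\<close> is at most 4 r times the
  maximal function, and the weight r m r has total mass at most \<open>B\<close>.\<close>

lemma mix_kernel_conv_le_maximal:
  assumes m: "mixture B m" and [measurable]: "w \<in> borel_measurable borel"
  shows "(\<integral>\<^sup>+s. mix_kernel m (t - s) * w s \<partial>lborel) \<le> ennreal (4 * B) * maximal w t"
proof -
  have [measurable]: "m \<in> borel_measurable borel" and m0: "\<And>r. 0 \<le> m r"
    and mB: "(\<integral>\<^sup>+r. (if 0 < r then ennreal (r * m r) else 0) \<partial>lborel) \<le> ennreal B"
    using m by (auto simp: mixture_def)
  have "(\<integral>\<^sup>+r. ennreal (m r) * (\<integral>\<^sup>+s. (if \<bar>s - t\<bar> < r then w s else 0) \<partial>lborel) \<partial>lborel)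
    \<le> (\<integral>\<^sup>+r. (if 0 < r then ennreal (r * m r) else 0) * (4 * maximal w t) \<partial>lborel)"
  proof (rule nn_integral_mono)
    fix r :: real
    show "ennreal (m r) * (\<integral>\<^sup>+s. (if \<bar>s - t\<bar> < r then w s else 0) \<partial>lborel)
      \<le> (if 0 < r then ennreal (r * m r) else 0) * (4 * maximal w t)"
    proof (cases "0 < r")
      case True
      have "ennreal (m r) * (\<integral>\<^sup>+s. (if \<bar>s - t\<bar> < r then w s else 0) \<partial>lborel)
        \<le> ennreal (m r) * (ennreal (4 * r) * maximal w t)"
        by (intro mult_left_mono average_le_maximal True) auto
      also have "\<dots> = ennreal (r * m r) * (4 * maximal w t)"
        using True m0[of r] by (simp add: ennreal_mult ac_simps)
      finally show ?thesis using True by simp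
    next
      case False
      then have "(\<lambda>s. if \<bar>s - t\<bar> < r then w s else 0) = (\<lambda>_. 0)" by auto
      then show ?thesis by simp
    qed
  qed
  also have "\<dots> = (\<integral>\<^sup>+r. (if 0 < r then ennreal (r * m r) else 0) \<partial>lborel) * (4 * maximal w t)"
    by (rule nn_integral_multc) measurable
  also have "\<dots> \<le> ennreal B * (4 * maximal w t)" by (intro mult_right_mono mB) auto
  also have "\<dots> = ennreal (4 * B) * maximal w t"
    by (cases "0 \<le> B") (auto simp: ennreal_mult ac_simps ennreal_neg)
  finally show ?thesis using mix_kernel_conv[OF assms] by simp
qed

lemma mix_kernel_mass:
  assumes m: "mixture B m"
  shows "(\<integral>\<^sup>+s. mix_kernel m (t - s) \<partial>lborel) \<le> ennreal (2 * B)"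
proof -
  have [measurable]: "m \<in> borel_measurable borel" and m0: "\<And>r. 0 \<le> m r"
    and mB: "(\<integral>\<^sup>+r. (if 0 < r then ennreal (r * m r) else 0) \<partial>lborel) \<le> ennreal B"
    using m by (auto simp: mixture_def)
  have "(\<integral>\<^sup>+s. mix_kernel m (t - s) \<partial>lborel)
    = (\<integral>\<^sup>+r. ennreal (m r) * (\<integral>\<^sup>+s. (if \<bar>s - t\<bar> < r then 1 else 0) \<partial>lborel) \<partial>lborel)"
    using mix_kernel_conv[OF m, of "\<lambda>_. 1" t] by simp
  also have "\<dots> = (\<integral>\<^sup>+r. 2 * (if 0 < r then ennreal (r * m r) else 0) \<partial>lborel)"
  proof (rule nn_integral_cong)
    fix r :: real
    have "(\<integral>\<^sup>+s. (if \<bar>s - t\<bar> < r then 1 else 0) \<partial>lborel) = (\<integral>\<^sup>+s. indicator (ball t r) s \<partial>lborel)"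
      by (intro nn_integral_cong) (auto simp: indicator_def dist_real_def)
    also have "\<dots> = (if 0 < r then ennreal (2 * r) else 0)"
      by (cases "0 < r") (auto simp: emeasure_lborel_ball_real ball_empty)
    finally show "ennreal (m r) * (\<integral>\<^sup>+s. (if \<bar>s - t\<bar> < r then 1 else 0) \<partial>lborel)
      = 2 * (if 0 < r then ennreal (r * m r) else 0)"
      using m0[of r] by (auto simp: ennreal_mult ac_simps)
  qed
  also have "\<dots> = 2 * (\<integral>\<^sup>+r. (if 0 < r then ennreal (r * m r) else 0) \<partial>lborel)"
    by (rule nn_integral_cmult) measurable
  also have "\<dots> \<le> 2 * ennreal B" by (intro mult_left_mono mB) auto
  finally show ?thesis by (cases "0 \<le> B") (auto simp: ennreal_mult ennreal_neg)
qed

text \<open>\<open>G\<close> is real-valued although the convolution may be infinite, and the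
  mixtures differ from mode to mode while sharing the mass bound \<open>B\<close>. The square
  function estimates hold with a constant depending only on \<open>B\<close> and the exponent, so
  that \<open>N\<close> can later tend to infinity.\<close>

definition dominated :: "real \<Rightarrow> nat \<Rightarrow> (nat \<Rightarrow> real \<Rightarrow> real) \<Rightarrow> (nat \<Rightarrow> real \<Rightarrow> real) \<Rightarrow>
    (nat \<Rightarrow> real \<Rightarrow> real) \<Rightarrow> bool"
  where "dominated B N m f G \<longleftrightarrow> (\<forall>n<N. mixture B (m n) \<and>
    f n \<in> borel_measurable borel \<and> (\<forall>s. 0 \<le> f n s) \<and>
    G n \<in> borel_measurable borel \<and> (\<forall>t. 0 \<le> G n t) \<and>
    (\<forall>t. ennreal (G n t) \<le> (\<integral>\<^sup>+s. mix_kernel (m n) (t - s) * ennreal (f n s) \<partial>lborel)))"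

text \<open>Cauchy-Schwarz with respect to the measure of density \<open>mix_kernel\<close>, whose
  mass is at most \<open>2 * B\<close>. The square thus passes inside the convolution and the
  estimate becomes linear in the squares.\<close>

lemma dominated_sq:
  assumes "dominated B N m f G" "n < N"
  shows "ennreal ((G n t)\<^sup>2)
    \<le> ennreal (2 * B) * (\<integral>\<^sup>+s. mix_kernel (m n) (t - s) * ennreal ((f n s)\<^sup>2) \<partial>lborel)"
proof -
  have m: "mixture B (m n)" and [measurable]: "f n \<in> borel_measurable borel" and f0: "\<And>s. 0 \<le> f n s"
    and G0: "0 \<le> G n t"
    and G: "ennreal (G n t) \<le> (\<integral>\<^sup>+s. mix_kernel (m n) (t - s) * ennreal (f n s) \<partial>lborel)"
    using assms by (auto simp: dominated_def)
  have [measurable]: "m n \<in> borel_measurable borel" using m by (simp add: mixture_def)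
  define M where "M = density lborel (\<lambda>s. mix_kernel (m n) (t - s))"
  have "ennreal ((G n t)\<^sup>2) = (ennreal (G n t))\<^sup>2" using G0 by (simp add: ennreal_power)
  also have "\<dots> \<le> (\<integral>\<^sup>+s. mix_kernel (m n) (t - s) * ennreal (f n s) \<partial>lborel)\<^sup>2"
    using G by (rule power_mono) simp
  also have "\<dots> = (\<integral>\<^sup>+s. ennreal (f n s) * 1 \<partial>M)\<^sup>2"
    unfolding M_def by (subst nn_integral_density) auto
  also have "\<dots> \<le> (\<integral>\<^sup>+s. (ennreal (f n s))\<^sup>2 \<partial>M) * (\<integral>\<^sup>+s. 1\<^sup>2 \<partial>M)"
    by (rule Cauchy_Schwarz_nn_integral) (auto simp: M_def)
  also have "(\<integral>\<^sup>+s. (ennreal (f n s))\<^sup>2 \<partial>M) = (\<integral>\<^sup>+s. mix_kernel (m n) (t - s) * ennreal ((f n s)\<^sup>2) \<partial>lborel)"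
    unfolding M_def by (subst nn_integral_density) (auto simp: f0 ennreal_power)
  also have "(\<integral>\<^sup>+s. 1\<^sup>2 \<partial>M) = (\<integral>\<^sup>+s. mix_kernel (m n) (t - s) \<partial>lborel)"
    unfolding M_def by (subst nn_integral_density) auto
  also have "(\<integral>\<^sup>+s. mix_kernel (m n) (t - s) * ennreal ((f n s)\<^sup>2) \<partial>lborel) * \<dots>
    \<le> (\<integral>\<^sup>+s. mix_kernel (m n) (t - s) * ennreal ((f n s)\<^sup>2) \<partial>lborel) * ennreal (2 * B)"
    by (intro mult_left_mono mix_kernel_mass[OF m]) auto
  finally show ?thesis by (simp add: mult.commute)
qed

lemma sum_powr_le:
  fixes a :: "nat \<Rightarrow> real"
  assumes "\<And>n. n < N \<Longrightarrow> 0 \<le> a n" "0 < p"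
  shows "(\<Sum>n<N. a n) powr p \<le> real N powr p * (\<Sum>n<N. a n powr p)"
proof (cases "N = 0")
  case False
  then have "Max (a ` {..<N}) \<in> a ` {..<N}" by (intro Max_in) auto
  then obtain k where k: "k < N" "a k = Max (a ` {..<N})" by auto
  have "(\<Sum>n<N. a n) \<le> real (card {..<N}) * a k"
    unfolding k by (rule sum_bounded_above) auto
  then have "(\<Sum>n<N. a n) powr p \<le> (real N * a k) powr p"
    using assms by (intro powr_mono2 sum_nonneg) auto
  also have "\<dots> = real N powr p * a k powr p" using assms k by (simp add: powr_mult)
  also have "\<dots> \<le> real N powr p * (\<Sum>n<N. a n powr p)"
    using k by (intro mult_left_mono member_le_sum) auto
  finally show ?thesis .
qed simp

text \<open>Young's inequality for (a / d) (d b), where \<open>d\<close> is tuned so that d powr q /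
  q equals the prescribed \<open>e\<close>.\<close>

lemma Young_absorb:
  fixes p q e :: real
  assumes "1 < p" "1 < q" "1 / p + 1 / q = 1" "0 < e"
  shows "\<exists>K>0. \<forall>a\<ge>0. \<forall>b\<ge>0. a * b \<le> K * a powr p + e * b powr q"
proof -
  define d where "d = (e * q) powr (1 / q)"
  have d: "d > 0" "d powr q = e * q" using assms by (auto simp: d_def powr_powr)
  show ?thesis
  proof (intro exI[of _ "1 / (d powr p * p)"] conjI allI impI)
    fix a b :: real assume ab: "0 \<le> a" "0 \<le> b"
    have "a * b = (a / d) * (d * b)" using d by simp
    also have "\<dots> \<le> (a / d) powr p / p + (d * b) powr q / q"
      using assms d ab by (intro Youngs_inequality) auto
    also have "\<dots> = 1 / (d powr p * p) * a powr p + e * b powr q"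
      using assms d ab by (simp add: powr_divide powr_mult field_simps)
    finally show "a * b \<le> 1 / (d powr p * p) * a powr p + e * b powr q" .
  qed (use d assms in auto)
qed

lemma dominated_maximal:
  assumes m: "mixture B m" and B: "0 < B" and [measurable]: "f \<in> borel_measurable borel"
    and f0: "\<And>s. 0 \<le> f s" and p: "1 < p" and fin: "(\<integral>\<^sup>+s. ennreal (f s powr p) \<partial>lborel) < \<infinity>"
  obtains V where "V \<in> borel_measurable borel" "\<And>t. 0 \<le> V t"
    "AE t in lborel. (\<integral>\<^sup>+s. mix_kernel m (t - s) * ennreal (f s) \<partial>lborel) \<le> ennreal (V t)"
    "(\<integral>\<^sup>+t. ennreal (V t powr p) \<partial>lborel) < \<infinity>"
proof -
  from maximal_strong_type[OF _ f0 p fin] obtain V where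
    V [measurable]: "V \<in> borel_measurable borel" and V0: "\<And>t. 0 \<le> V t" and
    V1: "AE t in lborel. maximal (\<lambda>s. ennreal (f s)) t = ennreal (V t)" and
    V2: "(\<integral>\<^sup>+t. ennreal (V t powr p) \<partial>lborel)
      \<le> ennreal (2 powr p * 5 * p / (p - 1)) * (\<integral>\<^sup>+t. ennreal (f t powr p) \<partial>lborel)"
    by auto
  show ?thesis
  proof (rule that[of "\<lambda>t. 4 * B * V t"])
    show "AE t in lborel. (\<integral>\<^sup>+s. mix_kernel m (t - s) * ennreal (f s) \<partial>lborel) \<le> ennreal (4 * B * V t)"
      using V1
    proof eventually_elim
      case (elim t)
      have "(\<integral>\<^sup>+s. mix_kernel m (t - s) * ennreal (f s) \<partial>lborel) \<le> ennreal (4 * B) * maximal (\<lambda>s. ennreal (f s)) t"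
        by (rule mix_kernel_conv_le_maximal[OF m]) measurable
      then show ?case using elim B V0[of t] by (simp add: ennreal_mult[symmetric])
    qed
    have "(\<integral>\<^sup>+t. ennreal ((4 * B * V t) powr p) \<partial>lborel) = ennreal ((4 * B) powr p) * (\<integral>\<^sup>+t. ennreal (V t powr p) \<partial>lborel)"
      using V0 B by (subst nn_integral_cmult[symmetric]) (auto simp: powr_mult ennreal_mult[symmetric])
    also have "\<dots> < \<infinity>"
      using V2 fin by (auto simp: ennreal_mult_less_top order_le_less_trans)
    finally show "(\<integral>\<^sup>+t. ennreal ((4 * B * V t) powr p) \<partial>lborel) < \<infinity>" .
  qed (use V0 B in auto)
qed

lemma powr_half_square: "0 \<le> x \<Longrightarrow> (x\<^sup>2) powr (p / 2) = x powr (p::real)"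
  by (cases "x = 0") (auto simp: powr_powr simp flip: powr_numeral)

lemma powr_component_le:
  fixes f :: "nat \<Rightarrow> real"
  assumes "n < N" "0 \<le> f n" "0 < p"
  shows "f n powr p \<le> (\<Sum>k<N. (f k)\<^sup>2) powr (p / 2)"
proof -
  have "f n powr p = ((f n)\<^sup>2) powr (p / 2)" using assms by (simp add: powr_half_square)
  also have "\<dots> \<le> (\<Sum>k<N. (f k)\<^sup>2) powr (p / 2)"
    using assms by (intro powr_mono2 member_le_sum) auto
  finally show ?thesis .
qed

text \<open>Each single mode is controlled by the maximal function. Adding finitely many modes costs
  a factor depending on \<open>N\<close>, which is harmless because only finiteness is claimed; it
  is what makes absorption legitimate.\<close>

lemma dominated_finite:
  assumes d: "dominated B N m f G" and B: "0 < B" and p: "1 < p"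
    and fin: "(\<integral>\<^sup>+s. ennreal ((\<Sum>n<N. (f n s)\<^sup>2) powr (p / 2)) \<partial>lborel) < \<infinity>"
  shows "(\<integral>\<^sup>+t. ennreal ((\<Sum>n<N. (G n t)\<^sup>2) powr (p / 2)) \<partial>lborel) < \<infinity>"
proof -
  have [measurable]: "G n \<in> borel_measurable borel" "f n \<in> borel_measurable borel" if "n < N" for n
    using d that by (auto simp: dominated_def)
  have fin1: "(\<integral>\<^sup>+t. ennreal (G n t powr p) \<partial>lborel) < \<infinity>" if n: "n < N" for n
  proof -
    have m: "mixture B (m n)" and f0: "\<And>s. 0 \<le> f n s" and [measurable]: "f n \<in> borel_measurable borel"
      and G0: "\<And>t. 0 \<le> G n t"
      and G: "\<And>t. ennreal (G n t) \<le> (\<integral>\<^sup>+s. mix_kernel (m n) (t - s) * ennreal (f n s) \<partial>lborel)"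
      using d n by (auto simp: dominated_def)
    have "(\<integral>\<^sup>+s. ennreal (f n s powr p) \<partial>lborel) \<le> (\<integral>\<^sup>+s. ennreal ((\<Sum>n<N. (f n s)\<^sup>2) powr (p / 2)) \<partial>lborel)"
      using n p f0 by (intro nn_integral_mono ennreal_leI powr_component_le) auto
    then have "(\<integral>\<^sup>+s. ennreal (f n s powr p) \<partial>lborel) < \<infinity>" using fin by (rule order_le_less_trans)
    from dominated_maximal[OF m B _ f0 p this] obtain V where V: "V \<in> borel_measurable borel" "\<And>t. 0 \<le> V t"
      "AE t in lborel. (\<integral>\<^sup>+s. mix_kernel (m n) (t - s) * ennreal (f n s) \<partial>lborel) \<le> ennreal (V t)"
      "(\<integral>\<^sup>+t. ennreal (V t powr p) \<partial>lborel) < \<infinity>" by auto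
    have "(\<integral>\<^sup>+t. ennreal (G n t powr p) \<partial>lborel) \<le> (\<integral>\<^sup>+t. ennreal (V t powr p) \<partial>lborel)"
    proof (intro nn_integral_mono_AE, use V(3) in eventually_elim)
      case (elim t)
      then have "ennreal (G n t) \<le> ennreal (V t)" using G[of t] by (rule order_trans[rotated])
      then have "G n t \<le> V t" using V(2)[of t] by simp
      then show ?case using G0[of t] p by (intro ennreal_leI powr_mono2) auto
    qed
    then show ?thesis using V(4) by (rule order_le_less_trans)
  qed
  have "(\<integral>\<^sup>+t. ennreal ((\<Sum>n<N. (G n t)\<^sup>2) powr (p / 2)) \<partial>lborel)
    \<le> (\<integral>\<^sup>+t. (\<Sum>n<N. ennreal (real N powr (p / 2)) * ennreal (G n t powr p)) \<partial>lborel)"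
  proof (rule nn_integral_mono)
    fix t
    have G0: "0 \<le> G n t" if "n < N" for n using d that by (auto simp: dominated_def)
    have "(\<Sum>n<N. (G n t)\<^sup>2) powr (p / 2) \<le> real N powr (p / 2) * (\<Sum>n<N. ((G n t)\<^sup>2) powr (p / 2))"
      using p by (intro sum_powr_le) auto
    also have "\<dots> = (\<Sum>n<N. real N powr (p / 2) * G n t powr p)"
      using G0 by (simp add: powr_half_square sum_distrib_left)
    finally show "ennreal ((\<Sum>n<N. (G n t)\<^sup>2) powr (p / 2))
      \<le> (\<Sum>n<N. ennreal (real N powr (p / 2)) * ennreal (G n t powr p))"
      by (simp add: ennreal_mult[symmetric] ennreal_leI)
  qed
  also have "\<dots> = (\<Sum>n<N. ennreal (real N powr (p / 2)) * (\<integral>\<^sup>+t. ennreal (G n t powr p) \<partial>lborel))"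
    by (subst nn_integral_sum) (auto simp: nn_integral_cmult)
  also have "\<dots> < \<infinity>"
    using fin1 by (auto simp: ennreal_mult_eq_top_iff less_top[symmetric])
  finally show ?thesis .
qed

lemma ennreal_absorb_half:
  assumes "Y \<le> ennreal a * X + ennreal (1 / 2) * Y" "Y < \<infinity>" "0 < a"
  shows "Y \<le> ennreal (2 * a) * X"
proof (cases X)
  case (real x)
  obtain y where y: "Y = ennreal y" "0 \<le> y" using assms(2) by (cases Y) auto
  have "ennreal a * ennreal x + ennreal (1 / 2) * ennreal y = ennreal (a * x + 1 / 2 * y)"
    using assms(3) real y by (simp only: ennreal_mult[symmetric] ennreal_plus[symmetric] mult_nonneg_nonneg)
  then have "ennreal y \<le> ennreal (a * x + 1 / 2 * y)"
    using assms(1) real y by simp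
  then have "y \<le> a * x + 1 / 2 * y" using assms real y by (subst (asm) ennreal_le_iff) auto
  then show ?thesis using assms real y by (simp add: ennreal_mult[symmetric] ennreal_leI)
next
  case top
  then show ?thesis
    using assms by (auto simp: ennreal_mult_top)
qed

text \<open>The square function to the power \<open>p\<close> is the integral of \<open>S = \<Sum>n<N. (G n)\<^sup>2\<close> against the weight
  \<open>S powr (p / 2 - 1)\<close>, which is moved to the maximal function of the weight and absorbed by Young's
  inequality; finiteness of the absorbed term is \<open>dominated_finite\<close>.\<close>

lemma square_function_gt2:
  assumes p: "2 < p" and B: "0 < B"
  shows "\<exists>C>0. \<forall>N m f G. dominated B N m f G \<longrightarrow>
    (\<integral>\<^sup>+t. ennreal ((\<Sum>n<N. (G n t)\<^sup>2) powr (p / 2)) \<partial>lborel)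
    \<le> ennreal C * (\<integral>\<^sup>+s. ennreal ((\<Sum>n<N. (f n s)\<^sup>2) powr (p / 2)) \<partial>lborel)"
proof -
  define P where "P = p / 2"
  define r where "r = P / (P - 1)"
  have P: "1 < P" using p by (simp add: P_def)
  have r: "1 < r" "1 / P + 1 / r = 1" "(P - 1) * r = P" using P by (auto simp: r_def field_simps)
  define Cr where "Cr = 2 powr r * 5 * r / (r - 1)"
  have Cr: "0 < Cr" using r by (simp add: Cr_def)
  \<comment> \<open>The coefficient is chosen for the absorption: multiplied by 8 B^2 from the
    transfer of the weight and by \<open>Cr\<close> from the maximal theorem, it is exactly 1 /
    2.\<close>
  obtain K where K: "K > 0"
    "\<And>a b. 0 \<le> a \<Longrightarrow> 0 \<le> b \<Longrightarrow> a * b \<le> K * a powr P + 1 / (16 * B\<^sup>2 * Cr) * b powr r"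
    using Young_absorb[OF P r(1,2), of "1 / (16 * B\<^sup>2 * Cr)"] B Cr by auto
  show ?thesis
  proof (intro exI[of _ "2 * (8 * B\<^sup>2 * K)"] conjI allI impI)
    fix N m f G assume d: "dominated B N m f G"
    define S where "S t = (\<Sum>n<N. (G n t)\<^sup>2)" for t
    define X where "X t = (\<Sum>n<N. (f n t)\<^sup>2)" for t
    have S0: "0 \<le> S t" and X0: "0 \<le> X t" for t by (auto simp: S_def X_def sum_nonneg)
    have f_meas [measurable]: "f n \<in> borel_measurable borel" and G_meas [measurable]: "G n \<in> borel_measurable borel"
      and m: "mixture B (m n)" if "n < N" for n using d that by (auto simp: dominated_def)
    have [measurable]: "S \<in> borel_measurable borel" "X \<in> borel_measurable borel"
      unfolding S_def[abs_def] X_def[abs_def] by (auto intro!: borel_measurable_sum borel_measurable_power)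
    have "(\<integral>\<^sup>+t. ennreal (S t powr P) \<partial>lborel) \<le> ennreal (2 * (8 * B\<^sup>2 * K)) * (\<integral>\<^sup>+s. ennreal (X s powr P) \<partial>lborel)"
    proof (cases "(\<integral>\<^sup>+s. ennreal (X s powr P) \<partial>lborel) = \<infinity>")
      case True
      then show ?thesis using B K by (simp add: ennreal_mult_top)
    next
      case False
      then have "(\<integral>\<^sup>+s. ennreal ((\<Sum>n<N. (f n s)\<^sup>2) powr (p / 2)) \<partial>lborel) < \<infinity>"
        by (simp add: X_def P_def less_top)
      from dominated_finite[OF d B _ this] p
      have Sfin: "(\<integral>\<^sup>+t. ennreal (S t powr P) \<partial>lborel) < \<infinity>" by (simp add: S_def P_def)
      \<comment> \<open>With \<open>r\<close> conjugate to \<open>P\<close>, the power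
        \<open>w powr r\<close> is again \<open>S powr P\<close>, so the maximal theorem bounds the
        weight by the quantity to be absorbed.\<close>
      define w where "w t = S t powr (P - 1)" for t
      have [measurable]: "w \<in> borel_measurable borel" unfolding w_def by measurable
      have wr: "w t powr r = S t powr P" for t by (simp add: w_def powr_powr r)
      have "(\<integral>\<^sup>+t. ennreal (w t powr r) \<partial>lborel) < \<infinity>" using Sfin by (simp add: wr)
      from maximal_strong_type[OF _ _ r(1) this] obtain V where
        V [measurable]: "V \<in> borel_measurable borel" and V0: "\<And>t. 0 \<le> V t" and
        V1: "AE t in lborel. maximal (\<lambda>s. ennreal (w s)) t = ennreal (V t)" and
        V2: "(\<integral>\<^sup>+t. ennreal (V t powr r) \<partial>lborel) \<le> ennreal Cr * (\<integral>\<^sup>+t. ennreal (S t powr P) \<partial>lborel)"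
        by (auto simp: w_def[symmetric] wr Cr_def) (auto simp: w_def)
      have step: "(\<integral>\<^sup>+t. ennreal ((G n t)\<^sup>2) * ennreal (w t) \<partial>lborel)
        \<le> ennreal (8 * B\<^sup>2) * (\<integral>\<^sup>+s. ennreal ((f n s)\<^sup>2) * maximal (\<lambda>s. ennreal (w s)) s \<partial>lborel)" if n: "n < N" for n
      proof -
        have [measurable]: "m n \<in> borel_measurable borel" using m[OF n] by (simp add: mixture_def)
        note [measurable] = f_meas[OF n] G_meas[OF n]
        have "(\<integral>\<^sup>+t. ennreal ((G n t)\<^sup>2) * ennreal (w t) \<partial>lborel)
          \<le> (\<integral>\<^sup>+t. ennreal (2 * B) * (\<integral>\<^sup>+s. mix_kernel (m n) (t - s) * ennreal ((f n s)\<^sup>2) \<partial>lborel) * ennreal (w t) \<partial>lborel)"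
          by (rule nn_integral_mono) (rule mult_right_mono[OF dominated_sq[OF d n]], simp)
        also have "\<dots> = (\<integral>\<^sup>+t. (\<integral>\<^sup>+s. ennreal (2 * B) * ennreal ((f n s)\<^sup>2) * (mix_kernel (m n) (s - t) * ennreal (w t)) \<partial>lborel) \<partial>lborel)"
          by (rule nn_integral_cong)
            (simp add: nn_integral_cmult[symmetric] nn_integral_multc[symmetric] mix_kernel_commute[of "m n"] ac_simps)
        also have "\<dots> = (\<integral>\<^sup>+s. (\<integral>\<^sup>+t. ennreal (2 * B) * ennreal ((f n s)\<^sup>2) * (mix_kernel (m n) (s - t) * ennreal (w t)) \<partial>lborel) \<partial>lborel)"
          by (rule lborel_pair.Fubini') measurable
        also have "\<dots> = (\<integral>\<^sup>+s. ennreal (2 * B) * ennreal ((f n s)\<^sup>2) * (\<integral>\<^sup>+t. mix_kernel (m n) (s - t) * ennreal (w t) \<partial>lborel) \<partial>lborel)"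
          by (simp add: nn_integral_cmult)
        also have "\<dots> \<le> (\<integral>\<^sup>+s. ennreal (2 * B) * ennreal ((f n s)\<^sup>2) * (ennreal (4 * B) * maximal (\<lambda>s. ennreal (w s)) s) \<partial>lborel)"
          by (rule nn_integral_mono) (rule mult_left_mono[OF mix_kernel_conv_le_maximal[OF m[OF n]]], auto)
        also have "\<dots> = (\<integral>\<^sup>+s. ennreal (8 * B\<^sup>2) * (ennreal ((f n s)\<^sup>2) * maximal (\<lambda>s. ennreal (w s)) s) \<partial>lborel)"
        proof (rule nn_integral_cong)
          fix s
          have "ennreal (8 * B\<^sup>2) = ennreal (2 * B) * ennreal (4 * B)"
            using B by (simp add: ennreal_mult[symmetric] power2_eq_square)
          then show "ennreal (2 * B) * ennreal ((f n s)\<^sup>2) * (ennreal (4 * B) * maximal (\<lambda>s. ennreal (w s)) s)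
            = ennreal (8 * B\<^sup>2) * (ennreal ((f n s)\<^sup>2) * maximal (\<lambda>s. ennreal (w s)) s)" by (simp only: ac_simps)
        qed
        also have "\<dots> = ennreal (8 * B\<^sup>2) * (\<integral>\<^sup>+s. ennreal ((f n s)\<^sup>2) * maximal (\<lambda>s. ennreal (w s)) s \<partial>lborel)"
          by (rule nn_integral_cmult) measurable
        finally show ?thesis .
      qed
      have "ennreal (S t powr P) = (\<Sum>n<N. ennreal ((G n t)\<^sup>2) * ennreal (w t))" for t
      proof -
        have "S t powr P = S t * w t" using S0[of t] P by (cases "S t = 0") (auto simp: w_def powr_diff)
        also have "\<dots> = (\<Sum>n<N. (G n t)\<^sup>2 * w t)" by (simp add: S_def sum_distrib_right)
        finally show ?thesis by (simp add: ennreal_mult[symmetric] w_def)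
      qed
      then have "(\<integral>\<^sup>+t. ennreal (S t powr P) \<partial>lborel) = (\<Sum>n<N. \<integral>\<^sup>+t. ennreal ((G n t)\<^sup>2) * ennreal (w t) \<partial>lborel)"
        by (subst nn_integral_sum[symmetric]) auto
      also have "\<dots> \<le> (\<Sum>n<N. ennreal (8 * B\<^sup>2) * (\<integral>\<^sup>+s. ennreal ((f n s)\<^sup>2) * maximal (\<lambda>s. ennreal (w s)) s \<partial>lborel))"
        by (rule sum_mono) (rule step, simp)
      also have "\<dots> = ennreal (8 * B\<^sup>2) * (\<integral>\<^sup>+s. (\<Sum>n<N. ennreal ((f n s)\<^sup>2) * maximal (\<lambda>s. ennreal (w s)) s) \<partial>lborel)"
        by (subst nn_integral_sum) (auto simp: sum_distrib_left)
      also have "(\<integral>\<^sup>+s. (\<Sum>n<N. ennreal ((f n s)\<^sup>2) * maximal (\<lambda>s. ennreal (w s)) s) \<partial>lborel)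
        = (\<integral>\<^sup>+s. ennreal (X s * V s) \<partial>lborel)"
      proof (rule nn_integral_cong_AE, use V1 in eventually_elim)
        case (elim s)
        then show ?case using V0[of s]
          by (simp add: X_def sum_distrib_right ennreal_mult[symmetric])
      qed
      also have "\<dots> \<le> (\<integral>\<^sup>+s. ennreal K * ennreal (X s powr P) + ennreal (1 / (16 * B\<^sup>2 * Cr)) * ennreal (V s powr r) \<partial>lborel)"
      proof (rule nn_integral_mono)
        fix s
        have "ennreal (X s * V s) \<le> ennreal (K * X s powr P + 1 / (16 * B\<^sup>2 * Cr) * V s powr r)"
          by (intro ennreal_leI K(2) X0 V0)
        also have "\<dots> = ennreal K * ennreal (X s powr P) + ennreal (1 / (16 * B\<^sup>2 * Cr)) * ennreal (V s powr r)"
          using K(1) Cr B by (subst ennreal_plus) (auto simp del: ennreal_plus simp flip: ennreal_mult)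
        finally show "ennreal (X s * V s) \<le> \<dots>" .
      qed
      also have "\<dots> = ennreal K * (\<integral>\<^sup>+s. ennreal (X s powr P) \<partial>lborel)
        + ennreal (1 / (16 * B\<^sup>2 * Cr)) * (\<integral>\<^sup>+s. ennreal (V s powr r) \<partial>lborel)"
        by (subst nn_integral_add) (auto simp: nn_integral_cmult)
      also have "\<dots> \<le> ennreal K * (\<integral>\<^sup>+s. ennreal (X s powr P) \<partial>lborel)
        + ennreal (1 / (16 * B\<^sup>2 * Cr)) * (ennreal Cr * (\<integral>\<^sup>+t. ennreal (S t powr P) \<partial>lborel))"
        by (intro add_left_mono mult_left_mono V2) auto
      finally have "(\<integral>\<^sup>+t. ennreal (S t powr P) \<partial>lborel) \<le> ennreal (8 * B\<^sup>2) * (ennreal K * (\<integral>\<^sup>+s. ennreal (X s powr P) \<partial>lborel)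
        + ennreal (1 / (16 * B\<^sup>2 * Cr)) * (ennreal Cr * (\<integral>\<^sup>+t. ennreal (S t powr P) \<partial>lborel)))"
        by (simp add: mult_left_mono)
      also have "\<dots> = ennreal (8 * B\<^sup>2 * K) * (\<integral>\<^sup>+s. ennreal (X s powr P) \<partial>lborel) + ennreal (1 / 2) * (\<integral>\<^sup>+t. ennreal (S t powr P) \<partial>lborel)"
      proof -
        have "ennreal (8 * B\<^sup>2) * (ennreal (1 / (16 * B\<^sup>2 * Cr)) * ennreal Cr) = ennreal (8 * B\<^sup>2 * (1 / (16 * B\<^sup>2 * Cr) * Cr))"
          using B Cr by (simp only: ennreal_mult zero_le_power2 mult_nonneg_nonneg zero_le_numeral less_imp_le divide_nonneg_nonneg zero_le_one)
        also have "8 * B\<^sup>2 * (1 / (16 * B\<^sup>2 * Cr) * Cr) = 1 / 2" using B Cr by (simp add: field_simps)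
        finally have e: "ennreal (8 * B\<^sup>2) * (ennreal (1 / (16 * B\<^sup>2 * Cr)) * ennreal Cr) = ennreal (1 / 2)" .
        have e2: "ennreal (8 * B\<^sup>2 * K) = ennreal (8 * B\<^sup>2) * ennreal K" using B K(1) by (intro ennreal_mult) auto
        show ?thesis unfolding e2 e[symmetric] by (simp only: distrib_left mult.assoc)
      qed
      finally show ?thesis using Sfin B K(1) by (intro ennreal_absorb_half) auto
    qed
    then show "(\<integral>\<^sup>+t. ennreal ((\<Sum>n<N. (G n t)\<^sup>2) powr (p / 2)) \<partial>lborel)
      \<le> ennreal (2 * (8 * B\<^sup>2 * K)) * (\<integral>\<^sup>+s. ennreal ((\<Sum>n<N. (f n s)\<^sup>2) powr (p / 2)) \<partial>lborel)"
      by (simp add: S_def X_def P_def)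
  qed (use B K(1) in auto)
qed

text \<open>At exponent 2 the weight is constant and only the mass of the kernels enters: a factor
  \<open>2 * B\<close> from Cauchy-Schwarz and another from integrating the kernel in the other
  variable.\<close>

lemma square_function_2:
  assumes B: "0 < B" and d: "dominated B N m f G"
  shows "(\<integral>\<^sup>+t. ennreal (\<Sum>n<N. (G n t)\<^sup>2) \<partial>lborel) \<le> ennreal (4 * B\<^sup>2) * (\<integral>\<^sup>+s. ennreal (\<Sum>n<N. (f n s)\<^sup>2) \<partial>lborel)"
proof -
  have step: "(\<integral>\<^sup>+t. ennreal ((G n t)\<^sup>2) \<partial>lborel) \<le> ennreal (4 * B\<^sup>2) * (\<integral>\<^sup>+s. ennreal ((f n s)\<^sup>2) \<partial>lborel)" if n: "n < N" for n
  proof -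
    have m: "mixture B (m n)" and [measurable]: "f n \<in> borel_measurable borel"
      using d n by (auto simp: dominated_def)
    have [measurable]: "m n \<in> borel_measurable borel" using m by (simp add: mixture_def)
    have "(\<integral>\<^sup>+t. ennreal ((G n t)\<^sup>2) \<partial>lborel)
      \<le> (\<integral>\<^sup>+t. ennreal (2 * B) * (\<integral>\<^sup>+s. mix_kernel (m n) (t - s) * ennreal ((f n s)\<^sup>2) \<partial>lborel) \<partial>lborel)"
      by (rule nn_integral_mono) (rule dominated_sq[OF d n])
    also have "\<dots> = (\<integral>\<^sup>+t. (\<integral>\<^sup>+s. ennreal (2 * B) * ennreal ((f n s)\<^sup>2) * mix_kernel (m n) (s - t) \<partial>lborel) \<partial>lborel)"
      by (rule nn_integral_cong)
        (simp add: nn_integral_cmult[symmetric] mix_kernel_commute[of "m n"] ac_simps)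
    also have "\<dots> = (\<integral>\<^sup>+s. (\<integral>\<^sup>+t. ennreal (2 * B) * ennreal ((f n s)\<^sup>2) * mix_kernel (m n) (s - t) \<partial>lborel) \<partial>lborel)"
      by (rule lborel_pair.Fubini') measurable
    also have "\<dots> = (\<integral>\<^sup>+s. ennreal (2 * B) * ennreal ((f n s)\<^sup>2) * (\<integral>\<^sup>+t. mix_kernel (m n) (s - t) \<partial>lborel) \<partial>lborel)"
      by (simp add: nn_integral_cmult)
    also have "\<dots> \<le> (\<integral>\<^sup>+s. ennreal (2 * B) * ennreal ((f n s)\<^sup>2) * ennreal (2 * B) \<partial>lborel)"
      by (rule nn_integral_mono) (rule mult_left_mono[OF mix_kernel_mass[OF m]], auto)
    also have "\<dots> = (\<integral>\<^sup>+s. ennreal (4 * B\<^sup>2) * ennreal ((f n s)\<^sup>2) \<partial>lborel)"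
    proof -
      have "ennreal (4 * B\<^sup>2) = ennreal (2 * B) * ennreal (2 * B)"
        using B by (simp add: ennreal_mult[symmetric] power2_eq_square)
      then show ?thesis by (simp only: ac_simps)
    qed
    also have "\<dots> = ennreal (4 * B\<^sup>2) * (\<integral>\<^sup>+s. ennreal ((f n s)\<^sup>2) \<partial>lborel)"
      by (rule nn_integral_cmult) measurable
    finally show ?thesis .
  qed
  have [measurable]: "f n \<in> borel_measurable borel" "G n \<in> borel_measurable borel" if "n < N" for n
    using d that by (auto simp: dominated_def)
  have "(\<integral>\<^sup>+t. ennreal (\<Sum>n<N. (G n t)\<^sup>2) \<partial>lborel) = (\<Sum>n<N. \<integral>\<^sup>+t. ennreal ((G n t)\<^sup>2) \<partial>lborel)"
    by (subst nn_integral_sum[symmetric]) auto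
  also have "\<dots> \<le> (\<Sum>n<N. ennreal (4 * B\<^sup>2) * (\<integral>\<^sup>+s. ennreal ((f n s)\<^sup>2) \<partial>lborel))"
    by (rule sum_mono) (rule step, simp)
  also have "\<dots> = ennreal (4 * B\<^sup>2) * (\<integral>\<^sup>+s. ennreal (\<Sum>n<N. (f n s)\<^sup>2) \<partial>lborel)"
    by (subst sum_distrib_left[symmetric], subst nn_integral_sum[symmetric]) auto
  finally show ?thesis .
qed

text \<open>The case \<open>p < 2\<close> follows by duality, as the mixture kernels are even.\<close>

lemma square_function_less2:
  assumes p: "1 < p" "p < 2" and B: "0 < B"
  shows "\<exists>C>0. \<forall>N m f G. dominated B N m f G \<longrightarrow>
    (\<integral>\<^sup>+t. ennreal ((\<Sum>n<N. (G n t)\<^sup>2) powr (p / 2)) \<partial>lborel)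
    \<le> ennreal C * (\<integral>\<^sup>+s. ennreal ((\<Sum>n<N. (f n s)\<^sup>2) powr (p / 2)) \<partial>lborel)"
proof -
  define q where "q = p / (p - 1)"
  have q: "2 < q" "1 < q" "1 / p + 1 / q = 1" "(p - 1) * q = p" using p by (auto simp: q_def field_simps)
  obtain Cq where Cq: "Cq > 0" "\<And>N m f G. dominated B N m f G \<Longrightarrow>
    (\<integral>\<^sup>+t. ennreal ((\<Sum>n<N. (G n t)\<^sup>2) powr (q / 2)) \<partial>lborel)
    \<le> ennreal Cq * (\<integral>\<^sup>+s. ennreal ((\<Sum>n<N. (f n s)\<^sup>2) powr (q / 2)) \<partial>lborel)"
    using square_function_gt2[OF q(1) B] by blast
  \<comment> \<open>The bound at the dual exponent costs \<open>Cq\<close>; the coefficient 1 / (2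
    Cq) leaves exactly one half to be absorbed.\<close>
  obtain K where K: "K > 0"
    "\<And>a b. 0 \<le> a \<Longrightarrow> 0 \<le> b \<Longrightarrow> a * b \<le> K * a powr p + 1 / (2 * Cq) * b powr q"
    using Young_absorb[OF p(1) q(2,3), of "1 / (2 * Cq)"] Cq by auto
  show ?thesis
  proof (intro exI[of _ "2 * K"] conjI allI impI)
    fix N m f G assume d: "dominated B N m f G"
    define S where "S t = (\<Sum>n<N. (G n t)\<^sup>2)" for t
    define X where "X t = (\<Sum>n<N. (f n t)\<^sup>2)" for t
    have S0: "0 \<le> S t" and X0: "0 \<le> X t" for t by (auto simp: S_def X_def sum_nonneg)
    have f_meas [measurable]: "f n \<in> borel_measurable borel" and G_meas [measurable]: "G n \<in> borel_measurable borel"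
      and m: "mixture B (m n)" and f0: "\<And>t. 0 \<le> f n t" and G0: "\<And>t. 0 \<le> G n t" if "n < N" for n
      using d that by (auto simp: dominated_def)
    have [measurable]: "S \<in> borel_measurable borel" "X \<in> borel_measurable borel"
      unfolding S_def[abs_def] X_def[abs_def] by (auto intro!: borel_measurable_sum borel_measurable_power)
    have "(\<integral>\<^sup>+t. ennreal (S t powr (p / 2)) \<partial>lborel) \<le> ennreal (2 * K) * (\<integral>\<^sup>+s. ennreal (X s powr (p / 2)) \<partial>lborel)"
    proof (cases "(\<integral>\<^sup>+s. ennreal (X s powr (p / 2)) \<partial>lborel) = \<infinity>")
      case True
      then show ?thesis using K by (simp add: ennreal_mult_top)
    next
      case False
      then have "(\<integral>\<^sup>+s. ennreal ((\<Sum>n<N. (f n s)\<^sup>2) powr (p / 2)) \<partial>lborel) < \<infinity>"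
        by (simp add: X_def less_top)
      from dominated_finite[OF d B p(1) this]
      have Sfin: "(\<integral>\<^sup>+t. ennreal (S t powr (p / 2)) \<partial>lborel) < \<infinity>" by (simp add: S_def)
      \<comment> \<open>The extremal dual family: its pairing with \<open>G\<close> is S powr (p /
        2), and the q-th power of its square function is S powr (p / 2) as well. Where
        \<open>S\<close> vanishes both sides are 0, because 0 \<open>powr\<close> anything is
        0.\<close>
      define h where "h n t = S t powr (p / 2 - 1) * G n t" for n t
      have h_meas [measurable]: "h n \<in> borel_measurable borel" if "n < N" for n
        using G_meas[OF that] unfolding h_def by measurable
      have h0: "0 \<le> h n t" if "n < N" for n t using G0[OF that] by (simp add: h_def)
      have hsum: "(\<Sum>n<N. (h n t)\<^sup>2) powr (q / 2) = S t powr (p / 2)" for t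
      proof -
        have "(\<Sum>n<N. (h n t)\<^sup>2) = (S t powr (p / 2 - 1))\<^sup>2 * S t"
          by (simp add: h_def power_mult_distrib S_def sum_distrib_left)
        also have "\<dots> = S t powr (p - 1)"
          using S0[of t] p
          by (cases "S t = 0") (auto simp: powr_diff power2_eq_square powr_add[symmetric])
        finally show ?thesis using q by (simp add: powr_powr)
      qed
      have hprod: "S t powr (p / 2) = (\<Sum>n<N. G n t * h n t)" for t
      proof -
        have "(\<Sum>n<N. G n t * h n t) = S t powr (p / 2 - 1) * S t"
          unfolding S_def[of t] sum_distrib_left
          by (intro sum.cong) (auto simp: h_def S_def power2_eq_square)
        also have "\<dots> = S t powr (p / 2)"
          using S0[of t] p by (cases "S t = 0") (auto simp: powr_diff)
        finally show ?thesis by simp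
      qed
      define E where "E n s = (\<integral>\<^sup>+t. mix_kernel (m n) (s - t) * ennreal (h n t) \<partial>lborel)" for n s
      \<comment> \<open>The definition of \<open>dominated\<close> asks for real values, hence
        \<open>enn2real\<close>. The maximal theorem at exponent \<open>q\<close> shows that
        \<open>E\<close> is finite almost everywhere, so nothing is lost under the integral.\<close>
      define H where "H n s = enn2real (E n s)" for n s
      have E_meas [measurable]: "E n \<in> borel_measurable borel" if n: "n < N" for n
      proof -
        have [measurable]: "m n \<in> borel_measurable borel" using m[OF n] by (simp add: mixture_def)
        note [measurable] = h_meas[OF n]
        show ?thesis unfolding E_def by measurable
      qed
      have Hd: "dominated B N m h H"
        unfolding dominated_def
      proof (intro allI impI conjI)
        fix n assume n: "n < N"
        note [measurable] = E_meas[OF n]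
        show "H n \<in> borel_measurable borel" unfolding H_def by measurable
        show "ennreal (H n t) \<le> (\<integral>\<^sup>+s. mix_kernel (m n) (t - s) * ennreal (h n s) \<partial>lborel)" for t
          unfolding H_def E_def[symmetric] by (cases "E n t") auto
      qed (auto simp: m h_meas h0 H_def)
      have H_meas [measurable]: "H n \<in> borel_measurable borel" if "n < N" for n
        using Hd that by (auto simp: dominated_def)
      have EH: "AE s in lborel. E n s = ennreal (H n s)" if n: "n < N" for n
      proof -
        have "(\<integral>\<^sup>+s. ennreal (h n s powr q) \<partial>lborel) \<le> (\<integral>\<^sup>+s. ennreal ((\<Sum>n<N. (h n s)\<^sup>2) powr (q / 2)) \<partial>lborel)"
          using n q h0 by (intro nn_integral_mono ennreal_leI powr_component_le) auto
        also have "\<dots> < \<infinity>" using Sfin by (simp add: hsum)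
        finally have "(\<integral>\<^sup>+s. ennreal (h n s powr q) \<partial>lborel) < \<infinity>" .
        from dominated_maximal[OF m[OF n] B h_meas[OF n] h0[OF n] q(2) this]
        obtain V where "AE t in lborel. E n t \<le> ennreal (V t)" unfolding E_def by blast
        then show ?thesis
        proof eventually_elim
          case (elim t)
          then have "E n t < top" using ennreal_less_top by (rule order_le_less_trans)
          then show ?case by (simp add: H_def)
        qed
      qed
      have step: "(\<integral>\<^sup>+t. ennreal (G n t) * ennreal (h n t) \<partial>lborel) \<le> (\<integral>\<^sup>+s. ennreal (f n s) * ennreal (H n s) \<partial>lborel)"
        if n: "n < N" for n
      proof -
        have [measurable]: "m n \<in> borel_measurable borel" using m[OF n] by (simp add: mixture_def)
        note [measurable] = f_meas[OF n] h_meas[OF n]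
        have "(\<integral>\<^sup>+t. ennreal (G n t) * ennreal (h n t) \<partial>lborel)
          \<le> (\<integral>\<^sup>+t. (\<integral>\<^sup>+s. mix_kernel (m n) (t - s) * ennreal (f n s) \<partial>lborel) * ennreal (h n t) \<partial>lborel)"
          by (rule nn_integral_mono, rule mult_right_mono) (use d n in \<open>auto simp: dominated_def\<close>)
        also have "\<dots> = (\<integral>\<^sup>+t. (\<integral>\<^sup>+s. ennreal (f n s) * (mix_kernel (m n) (s - t) * ennreal (h n t)) \<partial>lborel) \<partial>lborel)"
        proof (rule nn_integral_cong)
          fix t
          have "(\<integral>\<^sup>+s. mix_kernel (m n) (t - s) * ennreal (f n s) \<partial>lborel) * ennreal (h n t)
            = (\<integral>\<^sup>+s. mix_kernel (m n) (t - s) * ennreal (f n s) * ennreal (h n t) \<partial>lborel)"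
            by (rule nn_integral_multc[symmetric]) measurable
          then show "(\<integral>\<^sup>+s. mix_kernel (m n) (t - s) * ennreal (f n s) \<partial>lborel) * ennreal (h n t)
            = (\<integral>\<^sup>+s. ennreal (f n s) * (mix_kernel (m n) (s - t) * ennreal (h n t)) \<partial>lborel)"
            by (simp only: mix_kernel_commute[of "m n" t] ac_simps)
        qed
        also have "\<dots> = (\<integral>\<^sup>+s. (\<integral>\<^sup>+t. ennreal (f n s) * (mix_kernel (m n) (s - t) * ennreal (h n t)) \<partial>lborel) \<partial>lborel)"
          by (rule lborel_pair.Fubini') measurable
        also have "\<dots> = (\<integral>\<^sup>+s. ennreal (f n s) * E n s \<partial>lborel)"
          unfolding E_def by (simp add: nn_integral_cmult)
        also have "\<dots> = (\<integral>\<^sup>+s. ennreal (f n s) * ennreal (H n s) \<partial>lborel)"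
          by (rule nn_integral_cong_AE) (use EH[OF n] in eventually_elim, simp)
        finally show ?thesis .
      qed
      have "(\<integral>\<^sup>+t. ennreal (S t powr (p / 2)) \<partial>lborel) = (\<integral>\<^sup>+t. (\<Sum>n<N. ennreal (G n t) * ennreal (h n t)) \<partial>lborel)"
        unfolding hprod using G0 h0
        by (intro nn_integral_cong) (subst sum_ennreal[symmetric], auto simp: ennreal_mult)
      also have "\<dots> = (\<Sum>n<N. \<integral>\<^sup>+t. ennreal (G n t) * ennreal (h n t) \<partial>lborel)"
        by (rule nn_integral_sum) auto
      also have "\<dots> \<le> (\<Sum>n<N. \<integral>\<^sup>+s. ennreal (f n s) * ennreal (H n s) \<partial>lborel)"
        by (rule sum_mono) (rule step, simp)
      also have "\<dots> = (\<integral>\<^sup>+s. (\<Sum>n<N. ennreal (f n s) * ennreal (H n s)) \<partial>lborel)"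
        by (rule nn_integral_sum[symmetric]) auto
      also have "\<dots> \<le> (\<integral>\<^sup>+s. ennreal K * ennreal (X s powr (p / 2)) + ennreal (1 / (2 * Cq)) * ennreal ((\<Sum>n<N. (H n s)\<^sup>2) powr (q / 2)) \<partial>lborel)"
      proof (rule nn_integral_mono)
        fix s
        have H0: "0 \<le> H n s" for n by (simp add: H_def)
        let ?Y = "\<Sum>n<N. (H n s)\<^sup>2"
        have Y0: "0 \<le> ?Y" by (simp add: sum_nonneg)
        have "(\<Sum>n<N. ennreal (f n s) * ennreal (H n s)) = ennreal (\<Sum>n<N. f n s * H n s)"
          using f0 H0 by (subst sum_ennreal[symmetric]) (auto simp: ennreal_mult)
        also have "\<dots> \<le> ennreal (sqrt (X s) * sqrt ?Y)"
        proof (rule ennreal_leI)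
          have "(\<Sum>n<N. f n s * H n s)\<^sup>2 \<le> X s * ?Y"
            unfolding X_def by (rule Cauchy_Schwarz_ineq_sum)
          then have "(\<Sum>n<N. f n s * H n s) \<le> sqrt (X s * ?Y)" by (rule real_le_rsqrt)
          then show "(\<Sum>n<N. f n s * H n s) \<le> sqrt (X s) * sqrt ?Y" by (simp only: real_sqrt_mult)
        qed
        also have "\<dots> \<le> ennreal (K * sqrt (X s) powr p + 1 / (2 * Cq) * sqrt ?Y powr q)"
          by (intro ennreal_leI K(2)) (auto simp: X0 Y0)
        also have "\<dots> = ennreal (K * X s powr (p / 2) + 1 / (2 * Cq) * ?Y powr (q / 2))"
          using X0[of s] Y0 by (simp add: powr_half_sqrt[symmetric] powr_powr)
        also have "\<dots> = ennreal K * ennreal (X s powr (p / 2)) + ennreal (1 / (2 * Cq)) * ennreal (?Y powr (q / 2))"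
          using K(1) Cq(1) by (subst ennreal_plus) (auto simp del: ennreal_plus simp flip: ennreal_mult)
        finally show "(\<Sum>n<N. ennreal (f n s) * ennreal (H n s)) \<le> \<dots>" .
      qed
      also have "\<dots> = ennreal K * (\<integral>\<^sup>+s. ennreal (X s powr (p / 2)) \<partial>lborel)
        + ennreal (1 / (2 * Cq)) * (\<integral>\<^sup>+s. ennreal ((\<Sum>n<N. (H n s)\<^sup>2) powr (q / 2)) \<partial>lborel)"
        by (subst nn_integral_add) (auto simp: nn_integral_cmult)
      also have "\<dots> \<le> ennreal K * (\<integral>\<^sup>+s. ennreal (X s powr (p / 2)) \<partial>lborel)
        + ennreal (1 / (2 * Cq)) * (ennreal Cq * (\<integral>\<^sup>+s. ennreal ((\<Sum>n<N. (h n s)\<^sup>2) powr (q / 2)) \<partial>lborel))"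
        by (intro add_left_mono mult_left_mono Cq(2)[OF Hd]) auto
      also have "\<dots> = ennreal K * (\<integral>\<^sup>+s. ennreal (X s powr (p / 2)) \<partial>lborel) + ennreal (1 / 2) * (\<integral>\<^sup>+t. ennreal (S t powr (p / 2)) \<partial>lborel)"
      proof -
        have "ennreal (1 / (2 * Cq)) * ennreal Cq = ennreal (1 / (2 * Cq) * Cq)"
          using Cq by (intro ennreal_mult[symmetric]) auto
        also have "1 / (2 * Cq) * Cq = 1 / 2" using Cq by simp
        finally show ?thesis unfolding hsum mult.assoc[symmetric] by simp
      qed
      finally show ?thesis using Sfin K(1) by (intro ennreal_absorb_half) auto
    qed
    then show "(\<integral>\<^sup>+t. ennreal ((\<Sum>n<N. (G n t)\<^sup>2) powr (p / 2)) \<partial>lborel)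
      \<le> ennreal (2 * K) * (\<integral>\<^sup>+s. ennreal ((\<Sum>n<N. (f n s)\<^sup>2) powr (p / 2)) \<partial>lborel)"
      by (simp add: S_def X_def)
  qed (use K(1) in auto)
qed

theorem square_function:
  assumes p: "1 < p" and B: "0 < B"
  shows "\<exists>C>0. \<forall>N m f G. dominated B N m f G \<longrightarrow>
    (\<integral>\<^sup>+t. ennreal ((\<Sum>n<N. (G n t)\<^sup>2) powr (p / 2)) \<partial>lborel)
    \<le> ennreal C * (\<integral>\<^sup>+s. ennreal ((\<Sum>n<N. (f n s)\<^sup>2) powr (p / 2)) \<partial>lborel)"
proof -
  consider "p < 2" | "p = 2" | "2 < p" by linarith
  then show ?thesis
  proof cases
    case 2
    then show ?thesis
      using square_function_2[OF B] B by (intro exI[of _ "4 * B\<^sup>2"]) (auto simp: sum_nonneg)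
  qed (use square_function_less2 square_function_gt2 p B in blast)+
qed

section \<open>Fractional calculus in coordinates\<close>

text \<open>The complex-valued kernel of J^a for arbitrary order. At order 1 it is constantly 1 for
  positive times, so convolution with it is the primitive; the orders a and 1 - a compose to order
  1.\<close>

definition frac_ker :: "real \<Rightarrow> real \<Rightarrow> complex"
  where "frac_ker a t = of_real (t powr (a - 1) / Gamma a)"

lemma L1_on_frac_ker: "0 < a \<Longrightarrow> L1_on T (frac_ker a)"
proof -
  assume "0 < a"
  then have "integrable lborel (\<lambda>t. complex_of_real (indicator {0<..<T} t * (t powr (a - 1) / Gamma a)))"
    using set_integrable_divide[OF set_integrable_powr_from_0(1)[of a T], of "Gamma a"]
    by (intro integrable_of_real) (simp add: set_integrable_def)
  then show ?thesis by (simp add: L1_on_def cut_def[abs_def] frac_ker_def[abs_def] scaleR_conv_of_real)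
qed

lemma frac_ker_1: "0 < t \<Longrightarrow> frac_ker 1 t = 1"
  by (simp add: frac_ker_def)

lemma conv_frac_ker_1: "conv (frac_ker 1) h t = (LINT s:{0<..<t}|lborel. h s)"
  unfolding conv_def by (rule set_lebesgue_integral_cong) (auto simp: frac_ker_1)

text \<open>The substitution s = t x removes \<open>t\<close>, since the exponents a - 1 and - a
  together with the Jacobian have degree 0. What remains is Beta (1 - a) a = Gamma a Gamma (1 - a),
  the normalisation.\<close>

lemma conv_frac_ker_complement:
  assumes a: "0 < a" "a < 1" and t: "0 < t"
  shows "conv (frac_ker a) (frac_ker (1 - a)) t = 1"
proof -
  let ?f = "\<lambda>s. (t - s) powr (a - 1) * s powr - a"
  have "((\<lambda>x. x powr (1 - a - 1) * (1 - x) powr (a - 1)) has_integral Beta (1 - a) a) {0..1}"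
    using a by (intro has_integral_Beta_real) auto
  then have B: "(\<integral>\<^sup>+x. ennreal (indicator {0..1} x * (x powr (1 - a - 1) * (1 - x) powr (a - 1))) \<partial>lborel) = ennreal (Beta (1 - a) a)"
    by (intro nn_integral_has_integral_lebesgue) auto
  have Bval: "Beta (1 - a) a = Gamma a * Gamma (1 - a)" by (simp add: Beta_def)
  have G: "0 < Gamma a" "0 < Gamma (1 - a)" using a by (auto intro: Gamma_real_pos)
  have "(\<integral>\<^sup>+s. ennreal (indicator {0<..<t} s * ?f s) \<partial>lborel)
    = ennreal t * (\<integral>\<^sup>+x. ennreal (indicator {0<..<t} (0 + t * x) * ?f (0 + t * x)) \<partial>lborel)"
    using t by (subst nn_integral_real_affine[of _ t 0]) auto
  also have "(\<integral>\<^sup>+x. ennreal (indicator {0<..<t} (0 + t * x) * ?f (0 + t * x)) \<partial>lborel)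
    = (\<integral>\<^sup>+x. ennreal (1 / t) * ennreal (indicator {0..1} x * (x powr (1 - a - 1) * (1 - x) powr (a - 1))) \<partial>lborel)"
  proof (rule nn_integral_cong_AE, use AE_lborel_singleton[of 0] AE_lborel_singleton[of 1] in eventually_elim)
    case (elim x)
    show ?case
    proof (cases "0 < x \<and> x < 1")
      case True
      have "t - t * x = t * (1 - x)" by (simp add: algebra_simps)
      then have "?f (t * x) = t powr (a - 1) * t powr - a * ((1 - x) powr (a - 1) * x powr - a)"
        using True t by (simp add: powr_mult ac_simps)
      also have "t powr (a - 1) * t powr - a = 1 / t" using t by (simp add: powr_diff powr_minus_divide)
      finally show ?thesis using True t by (simp add: ennreal_mult[symmetric] indicator_def mult.commute)
    next
      case False
      then have "\<not> (0 < t * x \<and> t * x < t)" "\<not> (0 \<le> x \<and> x \<le> 1)" using t elim by (auto simp: zero_less_mult_iff)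
      then show ?thesis by (auto simp: indicator_def)
    qed
  qed
  also have "\<dots> = ennreal (1 / t) * ennreal (Gamma a * Gamma (1 - a))"
    using B Bval by (simp add: nn_integral_cmult)
  also have "ennreal t * \<dots> = ennreal (Gamma a * Gamma (1 - a))"
    using t G by (simp add: mult.assoc[symmetric] ennreal_mult[symmetric] less_imp_le)
  finally have "has_bochner_integral lborel (\<lambda>s. indicator {0<..<t} s * ?f s) (Gamma a * Gamma (1 - a))"
    using G by (intro has_bochner_integral_nn_integral) auto
  then have L: "(LINT s:{0<..<t}|lborel. ?f s) = Gamma a * Gamma (1 - a)"
    by (simp add: set_lebesgue_integral_def has_bochner_integral_iff)
  have "conv (frac_ker a) (frac_ker (1 - a)) t = (LINT s:{0<..<t}|lborel. complex_of_real (?f s / (Gamma a * Gamma (1 - a))))"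
    unfolding conv_def frac_ker_def by (rule set_lebesgue_integral_cong) auto
  also have "\<dots> = of_real ((LINT s:{0<..<t}|lborel. ?f s) / (Gamma a * Gamma (1 - a)))"
    unfolding set_integral_complex_of_real by (subst set_integral_divide_zero) simp
  also have "\<dots> = 1" unfolding L using G by simp
  finally show ?thesis .
qed

lemma cut_borel: "L1_on T a \<Longrightarrow> cut T a \<in> borel_measurable borel"
  by (auto simp: L1_on_def dest: borel_measurable_integrable)

text \<open>A vanishing primitive annihilates all moments: (T - s) ^ Suc k is itself a primitive of
  \<open>w\<close>, read backwards from \<open>T\<close>, and transposition moves that integration
  onto \<open>h\<close>.\<close>

lemma conv_1_eq_zero:
  assumes h: "L1_on T h" and T: "0 < T" and z: "AE t in lborel. 0 < t \<and> t < T \<longrightarrow> conv (frac_ker 1) h t = 0"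
  shows "AE t in lborel. 0 < t \<and> t < T \<longrightarrow> h t = 0"
proof (rule moments_zero[OF h T])
  fix k
  define w :: "real \<Rightarrow> complex" where "w t = of_real (real (Suc k) * t ^ k)" for t
  have w: "conv (frac_ker 1) w t = of_real (t ^ Suc k)" if t: "0 < t" for t
  proof -
    have "((\<lambda>s. real (Suc k) * s ^ k) has_integral (t ^ Suc k - 0 ^ Suc k)) {0..t}"
      using t by (intro fundamental_theorem_of_calculus)
        (auto intro!: derivative_eq_intros simp flip: has_real_derivative_iff_has_vector_derivative simp del: power_Suc)
    then have "integral {0..t} (\<lambda>s. real (Suc k) * s ^ k) = t ^ Suc k - 0 ^ Suc k" by (rule integral_unique)
    then have I: "integral {0..t} (\<lambda>s. real (Suc k) * s ^ k) = t ^ Suc k" by (simp only: power_0_Suc diff_zero)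
    have "(LINT s:{0<..<t}|lborel. real (Suc k) * s ^ k) = (LINT s:{0..t}|lborel. real (Suc k) * s ^ k)"
    proof (rule set_integral_cong_set)
      show "AE s in lborel. (s \<in> {0..t}) = (s \<in> {0<..<t})"
        using AE_lborel_singleton[of 0] AE_lborel_singleton[of t] by eventually_elim auto
    qed (simp_all add: set_borel_measurable_def)
    also have "\<dots> = t ^ Suc k"
      unfolding I[symmetric] by (rule set_borel_integral_eq_integral(2)) (intro borel_integrable_atLeastAtMost' continuous_intros)
    finally show ?thesis unfolding conv_frac_ker_1 w_def set_integral_complex_of_real by simp
  qed
  have "(LINT s:{0<..<T}|lborel. h s * of_real ((T - s) ^ Suc k)) = (LINT s:{0<..<T}|lborel. h s * conv (frac_ker 1) w (T - s))"
    by (rule set_lebesgue_integral_cong) (auto simp: w simp del: power_Suc)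
  also have "\<dots> = (LINT t:{0<..<T}|lborel. conv (frac_ker 1) h t * w (T - t))"
  proof (rule conv_bilinear[symmetric, OF L1_on_frac_ker h])
    show "cut T w \<in> borel_measurable borel" unfolding cut_def w_def by measurable
    show "cmod (w t) \<le> real (Suc k) * T ^ k" if "0 < t" "t < T" for t
      using that power_mono[of t T k] by (auto simp: w_def norm_mult norm_power simp del: of_nat_Suc intro!: mult_left_mono)
  qed simp
  also have "\<dots> = 0"
    unfolding set_lebesgue_integral_def
  proof (rule integral_eq_zero_AE)
    show "AE t in lborel. indicator {0<..<T} t *\<^sub>R (conv (frac_ker 1) h t * w (T - t)) = 0"
      using z by eventually_elim (simp add: indicator_def)
  qed
  finally show "(LINT s:{0<..<T}|lborel. h s * of_real ((T - s) ^ Suc k)) = 0" .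
qed

lemma conv_frac_ker_compose:
  assumes a: "0 < a" "a < 1" and h: "L1_on T h"
  shows "AE t in lborel. 0 < t \<and> t < T \<longrightarrow> conv (frac_ker a) (conv (frac_ker (1 - a)) h) t = conv (frac_ker 1) h t"
proof -
  note k = L1_on_frac_ker[of a T] L1_on_frac_ker[of "1 - a" T] L1_on_frac_ker[of 1 T]
  have "conv (conv (frac_ker a) (frac_ker (1 - a))) h t = conv (frac_ker 1) h t" if "t \<le> T" for t
    unfolding conv_commute[of _ h]
  proof (rule conv_cong_AE[OF _ that])
    show "AE s in lborel. 0 < s \<and> s < T \<longrightarrow> conv (frac_ker a) (frac_ker (1 - a)) s = frac_ker 1 s"
      using conv_frac_ker_complement[of a] a by (intro always_eventually) (auto simp: frac_ker_1)
  qed (use h k a L1_on_conv cut_borel in auto)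
  then show ?thesis
    using conv_assoc[of T "frac_ker a" "frac_ker (1 - a)" h] h k a by (auto elim: eventually_mono)
qed

text \<open>Convolving with the complementary kernel of order 1 - a turns both sides into
  primitives, and a primitive determines its integrand.\<close>

lemma conv_frac_ker_inj:
  assumes a: "0 < a" "a < 1" and T: "0 < T" and h: "L1_on T h1" "L1_on T h2"
    and e: "AE t in lborel. 0 < t \<and> t < T \<longrightarrow> conv (frac_ker a) h1 t = conv (frac_ker a) h2 t"
  shows "AE t in lborel. 0 < t \<and> t < T \<longrightarrow> h1 t = h2 t"
proof -
  note k = L1_on_frac_ker[of a T] L1_on_frac_ker[of "1 - a" T] L1_on_frac_ker[of 1 T]
  have one: "AE t in lborel. 0 < t \<and> t < T \<longrightarrow> conv (frac_ker (1 - a)) (conv (frac_ker a) h) t = conv (frac_ker 1) h t"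
    if "L1_on T h" for h
    using conv_frac_ker_compose[of "1 - a" T h] a that by simp
  have "AE t in lborel. 0 < t \<and> t < T \<longrightarrow> conv (frac_ker (1 - a)) (conv (frac_ker a) h1) t = conv (frac_ker (1 - a)) (conv (frac_ker a) h2) t"
    using h k a by (intro always_eventually allI impI conv_cong_AE[OF e]) (auto intro: L1_on_conv cut_borel)
  moreover have "AE t in lborel. 0 < t \<and> t < T \<longrightarrow> conv (frac_ker 1) (\<lambda>s. h1 s + (- 1) * h2 s) t = conv (frac_ker 1) h1 t + (- 1) * conv (frac_ker 1) h2 t"
    using h k by (intro conv_linear) auto
  ultimately have "AE t in lborel. 0 < t \<and> t < T \<longrightarrow> conv (frac_ker 1) (\<lambda>s. h1 s + (- 1) * h2 s) t = 0"
    using one[OF h(1)] one[OF h(2)] by eventually_elim simp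
  moreover have "L1_on T (\<lambda>s. h1 s + (- 1) * h2 s)"
    using h by (auto simp: L1_on_set)
  ultimately have "AE t in lborel. 0 < t \<and> t < T \<longrightarrow> h1 t + (- 1) * h2 t = 0"
    using conv_1_eq_zero[OF _ T] by blast
  then show ?thesis by (auto elim: eventually_mono)
qed

lemma conv_cnj: "conv (\<lambda>t. cnj (a t)) (\<lambda>t. cnj (b t)) t = cnj (conv a b t)"
proof -
  have "(\<lambda>s. indicator {0<..<t} s *\<^sub>R (cnj (a (t - s)) * cnj (b s))) = (\<lambda>s. cnj (indicator {0<..<t} s *\<^sub>R (a (t - s) * b s)))"
    by (auto simp: fun_eq_iff indicator_def)
  then show ?thesis unfolding conv_def set_lebesgue_integral_def
    by (simp only: Bochner_Integration.integral_cnj)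
qed

lemma cnj_frac_ker: "cnj (frac_ker a t) = frac_ker a t"
  by (simp add: frac_ker_def)

section \<open>Lebesgue norms and vector-valued fractional integrals\<close>

definition Lp_mass :: "real \<Rightarrow> real \<Rightarrow> (real \<Rightarrow> 'a::{complex_hilbert, second_countable_topology}) \<Rightarrow> ennreal"
  where "Lp_mass p T v = (\<integral>\<^sup>+t. ennreal (norm (cut T v t) powr p) \<partial>lborel)"

lemma cut_norm_powr: "cut T (\<lambda>t. norm (v t) powr p) t = norm (cut T v t) powr p"
  by (auto simp: cut_def indicator_def)

lemma Lp_space_iff: "v \<in> Lp_space p T \<longleftrightarrow> cut T v \<in> borel_measurable borel \<and> Lp_mass p T v < \<infinity>"
proof (cases "cut T v \<in> borel_measurable borel")
  case True
  then have [measurable]: "(\<lambda>t. norm (cut T v t) powr p) \<in> borel_measurable borel" by measurable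
  have "integrable (interval_lborel T) (\<lambda>t. norm (v t) powr p) \<longleftrightarrow> Lp_mass p T v < \<infinity>"
    unfolding integrable_interval unfolding Lp_mass_def integrable_iff_bounded cut_norm_powr[abs_def] by simp
  then show ?thesis using True by (simp add: Lp_space_def cut_measurable)
qed (simp add: Lp_space_def cut_measurable)

lemma Lp_norm_eq:
  assumes "cut T v \<in> borel_measurable borel"
  shows "Lp_norm p T v = enn2real (Lp_mass p T v) powr (1 / p)"
  using assms unfolding Lp_norm_def Lp_mass_def integral_interval cut_norm_powr[abs_def]
  by (subst integral_eq_nn_integral) auto

lemma Lp_norm_mono:
  assumes "cut T v \<in> borel_measurable borel" "f \<in> Lp_space p T" "Lp_mass p T v \<le> ennreal c * Lp_mass p T f" "0 \<le> c" "0 < p"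
  shows "Lp_norm p T v \<le> c powr (1 / p) * Lp_norm p T f"
proof -
  have f: "cut T f \<in> borel_measurable borel" "Lp_mass p T f < \<infinity>" using assms(2) by (auto simp: Lp_space_iff)
  have "enn2real (Lp_mass p T v) \<le> enn2real (ennreal c * Lp_mass p T f)"
    using assms(3) f by (intro enn2real_mono) (auto simp: ennreal_mult_less_top)
  also have "\<dots> = c * enn2real (Lp_mass p T f)" using assms(4) by (simp add: enn2real_mult)
  finally have "enn2real (Lp_mass p T v) powr (1 / p) \<le> (c * enn2real (Lp_mass p T f)) powr (1 / p)"
    using assms by (intro powr_mono2) auto
  also have "\<dots> = c powr (1 / p) * enn2real (Lp_mass p T f) powr (1 / p)" using assms by (simp add: powr_mult)
  finally show ?thesis using assms f by (simp add: Lp_norm_eq)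
qed

lemma Lp_mass_cong_AE:
  assumes "AE t in lborel. 0 < t \<and> t < T \<longrightarrow> norm (v t) = norm (w t)"
  shows "Lp_mass p T v = Lp_mass p T w"
  unfolding Lp_mass_def
  by (rule nn_integral_cong_AE) (use assms in eventually_elim, auto simp: cut_def indicator_def)

lemma Lp_norm_cong_AE:
  assumes "cut T v \<in> borel_measurable borel" "cut T w \<in> borel_measurable borel"
    "AE t in lborel. 0 < t \<and> t < T \<longrightarrow> norm (v t) = norm (w t)"
  shows "Lp_norm p T v = Lp_norm p T w"
  using assms Lp_mass_cong_AE[OF assms(3)] by (simp add: Lp_norm_eq)

lemma Lp_L1:
  assumes v: "v \<in> Lp_space p T" and p: "1 \<le> p" and T: "0 < T"
  shows "integrable lborel (cut T v)"
proof (rule Bochner_Integration.integrable_bound)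
  have v': "cut T v \<in> borel_measurable borel" "Lp_mass p T v < \<infinity>" using v by (auto simp: Lp_space_iff)
  then show "cut T v \<in> borel_measurable lborel" by simp
  have "integrable lborel (\<lambda>t. norm (cut T v t) powr p)"
    using v' by (auto simp: integrable_iff_bounded Lp_mass_def)
  moreover have "integrable lborel (\<lambda>t. indicator {0<..<T} t :: real)"
    using T by (intro integrable_real_indicator) auto
  ultimately show "integrable lborel (\<lambda>t. norm (cut T v t) powr p + indicator {0<..<T} t)" by simp
  have x: "x \<le> x powr p + 1" if "0 \<le> x" for x :: real
    using that p powr_mono[of 1 p x] by (cases "x \<le> 1") (auto intro: order_trans[of _ 1])
  show "AE t in lborel. norm (cut T v t) \<le> norm (norm (cut T v t) powr p + indicator {0<..<T} t)"
    using x by (intro always_eventually allI) (auto simp: cut_def indicator_def)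
qed

lemma L1_on_norm: "integrable lborel (cut T v) \<Longrightarrow> L1_on T (\<lambda>t. complex_of_real (norm (v t)))"
  for v :: "real \<Rightarrow> 'a::{complex_hilbert, second_countable_topology}"
proof -
  assume "integrable lborel (cut T v)"
  then have "integrable lborel (\<lambda>t. complex_of_real (norm (cut T v t)))" by simp
  then show ?thesis by (simp add: L1_on_def cut_def[abs_def] norm_scaleR scaleR_conv_of_real)
qed

context hilbert_basis
begin

lemma cut_coord: "cut T (\<lambda>t. coord n (v t)) t = coord n (cut T v t)"
  by (auto simp: cut_def coord_simps indicator_def)

lemma L1_on_coord: "integrable lborel (cut T v) \<Longrightarrow> L1_on T (\<lambda>t. coord n (v t))"
  unfolding L1_on_def cut_coord[abs_def]
  by (rule integrable_bounded_linear[OF bounded_linear_coord])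

text \<open>Where the scalar convolution with the norm of \<open>v\<close> converges, the Bochner
  integral exists and every coordinate functional passes inside it. The exceptional null set comes
  from the norm alone, so it serves all \<open>n\<close> at once.\<close>

lemma coord_frac_integral:
  assumes v: "integrable lborel (cut T v)" and a: "0 < a"
  shows "AE t in lborel. 0 < t \<and> t < T \<longrightarrow> (\<forall>n. coord n (frac_integral a v t) = conv (frac_ker a) (\<lambda>s. coord n (v s)) t)"
  using conv_integrable_AE[OF L1_on_frac_ker[OF a] L1_on_norm[OF v]]
proof eventually_elim
  case (elim t)
  have [measurable]: "cut T v \<in> borel_measurable borel" using v by (auto dest: borel_measurable_integrable)
  have G: "Gamma a > 0" using a by (rule Gamma_real_pos)
  show ?case
  proof (intro impI allI)
    fix n assume t: "0 < t \<and> t < T"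
    let ?g = "\<lambda>s. indicator {0<..<t} s *\<^sub>R ((t - s) powr (a - 1) *\<^sub>R v s)"
    have i: "integrable lborel ?g"
    proof (rule Bochner_Integration.integrable_bound)
      show "integrable lborel (\<lambda>s. Gamma a *\<^sub>R (indicator {0<..<t} s *\<^sub>R (frac_ker a (t - s) * complex_of_real (norm (v s)))))"
        using elim t unfolding set_integrable_def by (intro integrable_scaleR_right) auto
      have "?g = (\<lambda>s. indicator {0<..<t} s *\<^sub>R ((t - s) powr (a - 1) *\<^sub>R cut T v s))"
        using t by (auto simp: fun_eq_iff cut_def indicator_def)
      then show "?g \<in> borel_measurable lborel" by simp
      show "AE s in lborel. norm (?g s) \<le> norm (Gamma a *\<^sub>R (indicator {0<..<t} s *\<^sub>R (frac_ker a (t - s) * complex_of_real (norm (v s)))))"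
        using G by (intro always_eventually allI) (auto simp: frac_ker_def norm_mult norm_divide indicator_def)
    qed
    have "coord n (frac_integral a v t) = of_real (1 / Gamma a) * coord n (LINT s|lborel. ?g s)"
      unfolding frac_integral_def set_lebesgue_integral_def by (simp only: coord_simps)
    also have "coord n (LINT s|lborel. ?g s) = (LINT s|lborel. coord n (?g s))"
      by (rule integral_bounded_linear[OF bounded_linear_coord i, symmetric])
    also have "of_real (1 / Gamma a) * \<dots> = (LINT s|lborel. of_real (1 / Gamma a) * coord n (?g s))"
      by (rule integral_mult_right_zero[symmetric])
    also have "\<dots> = conv (frac_ker a) (\<lambda>s. coord n (v s)) t"
      unfolding conv_def set_lebesgue_integral_def
      by (rule Bochner_Integration.integral_cong) (auto simp: coord_simps frac_ker_def indicator_def)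
    finally show "coord n (frac_integral a v t) = conv (frac_ker a) (\<lambda>s. coord n (v s)) t" .
  qed
qed

lemma frac_integral_inj:
  fixes v1 v2 :: "real \<Rightarrow> 'a"
  assumes v: "integrable lborel (cut T v1)" "integrable lborel (cut T v2)" and a: "0 < a" "a < 1" and T: "0 < T"
    and e: "AE t in lborel. 0 < t \<and> t < T \<longrightarrow> frac_integral a v1 t = frac_integral a v2 t"
  shows "AE t in lborel. 0 < t \<and> t < T \<longrightarrow> v1 t = v2 t"
proof -
  have "AE t in lborel. 0 < t \<and> t < T \<longrightarrow> coord n (v1 t) = coord n (v2 t)" for n
  proof (rule conv_frac_ker_inj[OF a T])
    show "AE t in lborel. 0 < t \<and> t < T \<longrightarrow> conv (frac_ker a) (\<lambda>s. coord n (v1 s)) t = conv (frac_ker a) (\<lambda>s. coord n (v2 s)) t"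
      using e coord_frac_integral[OF v(1) a(1)] coord_frac_integral[OF v(2) a(1)]
      by eventually_elim metis
  qed (use v in \<open>auto intro: L1_on_coord\<close>)
  then have "AE t in lborel. \<forall>n. 0 < t \<and> t < T \<longrightarrow> coord n (v1 t) = coord n (v2 t)"
    by (subst AE_all_countable) blast
  then show ?thesis by eventually_elim (auto intro: coord_eqI)
qed

text \<open>The choice made by \<open>frac_deriv\<close> is one preimage under J^a; injectivity
  identifies it almost everywhere with any known preimage \<open>v\<close>.\<close>

lemma frac_deriv_eq:
  fixes u v :: "real \<Rightarrow> 'a"
  assumes v: "v \<in> Lp_space p T" "AE t in lborel. 0 < t \<and> t < T \<longrightarrow> u t = frac_integral a v t"
    and a: "0 < a" "a < 1" and T: "0 < T" and p: "1 \<le> p"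
  shows "frac_deriv a p T u \<in> Lp_space p T" "AE t in lborel. 0 < t \<and> t < T \<longrightarrow> frac_deriv a p T u t = v t"
proof -
  have "frac_deriv a p T u \<in> Lp_space p T \<and> (AE t in interval_lborel T. u t = frac_integral a (frac_deriv a p T u) t)"
    unfolding frac_deriv_def by (rule someI[of _ v]) (use v in \<open>simp add: AE_interval\<close>)
  then have d: "frac_deriv a p T u \<in> Lp_space p T" "AE t in lborel. 0 < t \<and> t < T \<longrightarrow> u t = frac_integral a (frac_deriv a p T u) t"
    by (auto simp: AE_interval)
  show "frac_deriv a p T u \<in> Lp_space p T" by (rule d(1))
  have "AE t in lborel. 0 < t \<and> t < T \<longrightarrow> frac_integral a (frac_deriv a p T u) t = frac_integral a v t"
    using d(2) v(2) by eventually_elim auto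
  then show "AE t in lborel. 0 < t \<and> t < T \<longrightarrow> frac_deriv a p T u t = v t"
    by (rule frac_integral_inj[OF Lp_L1[OF d(1) p T] Lp_L1[OF v(1) p T] a T])
qed

end

section \<open>The mild solution and its regularity\<close>

text \<open>The density for which averages over the intervals of half-length \<open>r\<close> reproduce, up to a constant,
  the bound \<open>min (l * t powr (a - 1)) (t powr (- a - 1) / l)\<close> on the kernel times \<open>l\<close>.\<close>

definition kernel_mix :: "real \<Rightarrow> real \<Rightarrow> real \<Rightarrow> real"
  where "kernel_mix a l r = (if 0 < r then min (l * r powr (a - 2)) (r powr (- a - 2) / l) else 0)"

lemma nn_integral_powr_to_inf:
  assumes "0 < s" "0 < y"
  shows "(\<integral>\<^sup>+x. (if y \<le> x then ennreal (x powr (- s - 1)) else 0) \<partial>lborel) = ennreal (y powr - s / s)"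
proof -
  have "((\<lambda>x. x powr (- s - 1)) has_integral - (y powr (- s - 1 + 1)) / (- s - 1 + 1)) {y..}"
    using assms by (intro has_integral_powr_to_inf) auto
  then have "(\<integral>\<^sup>+x. ennreal (indicator {y..} x * x powr (- s - 1)) \<partial>lborel) = ennreal (y powr - s / s)"
    by (intro nn_integral_has_integral_lebesgue) auto
  then show ?thesis by (subst (asm) nn_integral_cong[where v="\<lambda>x. if y \<le> x then ennreal (x powr (- s - 1)) else 0"]) auto
qed

text \<open>The two powers cross at R = l powr (- 1 / a). Below and above \<open>R\<close> the
  integral of the respective power contributes exactly 1 / a, so the mass bound 2 / a does not
  depend on \<open>l\<close>.\<close>

lemma kernel_mix_mixture:
  assumes a: "0 < a" and l: "0 < l"
  shows "mixture (2 / a) (kernel_mix a l)"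
proof -
  have [measurable]: "kernel_mix a l \<in> borel_measurable borel" unfolding kernel_mix_def[abs_def] by measurable
  have e: "- 1 - a = - a - 1" by simp
  define R where "R = l powr - (1 / a)"
  have R: "0 < R" using l by (simp add: R_def)
  have Ra: "R powr a = 1 / l" "R powr - a = l" using a l by (simp_all only: R_def powr_powr) (simp_all add: powr_minus_divide)
  have "(\<integral>\<^sup>+r. (if 0 < r then ennreal (r * kernel_mix a l r) else 0) \<partial>lborel)
    \<le> (\<integral>\<^sup>+r. ennreal l * (if 0 < r \<and> r < R then ennreal (r powr (a - 1)) else 0) + ennreal (1 / l) * (if R \<le> r then ennreal (r powr (- a - 1)) else 0) \<partial>lborel)"
  proof (rule nn_integral_mono)
    fix r :: real
    show "(if 0 < r then ennreal (r * kernel_mix a l r) else 0)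
      \<le> ennreal l * (if 0 < r \<and> r < R then ennreal (r powr (a - 1)) else 0) + ennreal (1 / l) * (if R \<le> r then ennreal (r powr (- a - 1)) else 0)"
    proof (cases "0 < r")
      case True
      have i: "r * kernel_mix a l r \<le> r * (l * r powr (a - 2))" "r * kernel_mix a l r \<le> r * (r powr (- a - 2) / l)"
        by (rule mult_left_mono, use True in \<open>simp add: kernel_mix_def\<close>, use True in simp)+
      have q: "r * (l * r powr (a - 2)) = l * r powr (a - 1)" "r * (r powr (- a - 2) / l) = 1 / l * r powr (- a - 1)"
        using True powr_add[of r 1 "a - 2"] powr_add[of r 1 "- a - 2"]
        by (simp_all add: e)
      have "r * kernel_mix a l r \<le> l * r powr (a - 1)" "r * kernel_mix a l r \<le> 1 / l * r powr (- a - 1)"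
        using i unfolding q .
      then show ?thesis using True R l by (cases "r < R") (auto simp: ennreal_mult[symmetric] intro!: ennreal_leI)
    qed simp
  qed
  also have "\<dots> = ennreal l * (\<integral>\<^sup>+r. (if 0 < r \<and> r < R then ennreal (r powr (a - 1)) else 0) \<partial>lborel)
    + ennreal (1 / l) * (\<integral>\<^sup>+r. (if R \<le> r then ennreal (r powr (- a - 1)) else 0) \<partial>lborel)"
    by (subst nn_integral_add) (auto simp: nn_integral_cmult)
  also have "\<dots> = ennreal l * ennreal (R powr a / a) + ennreal (1 / l) * ennreal (R powr - a / a)"
    using a R by (simp add: nn_integral_powr_from_0 nn_integral_powr_to_inf)
  also have "\<dots> = ennreal (2 / a)"
    using a l by (simp add: Ra ennreal_mult[symmetric] ennreal_plus[symmetric] del: ennreal_plus)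
  finally have "(\<integral>\<^sup>+r. (if 0 < r then ennreal (r * kernel_mix a l r) else 0) \<partial>lborel) \<le> ennreal (2 / a)" .
  moreover have "0 \<le> kernel_mix a l r" for r using l by (auto simp: kernel_mix_def)
  ultimately show ?thesis unfolding mixture_def by simp
qed

text \<open>Restrict the mixture to radii in (s, 2 s). Both exponents are at least - 3, so the
  density there is at least an eighth of its value at \<open>s\<close>, and the interval has length
  \<open>s\<close>.\<close>

lemma mix_kernel_kernel_mix:
  assumes a: "0 < a" "a < 1" and l: "0 < l" and s: "0 < s"
  shows "ennreal (min (l * s powr (a - 1)) (s powr (- a - 1) / l)) \<le> 8 * mix_kernel (kernel_mix a l) s"
proof -
  have e: "- 1 - a = - a - 1" by simp
  define c where "c = min (l * s powr (a - 2)) (s powr (- a - 2) / l) / 8"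
  have low: "c \<le> kernel_mix a l r" if r: "s < r" "r < 2 * s" for r
  proof -
    have "(2::real) powr - 3 \<le> 2 powr (a - 2)" "(2::real) powr - 3 \<le> 2 powr (- a - 2)" using a by (auto intro!: powr_mono)
    then have two: "(1 / 8::real) \<le> 2 powr (a - 2)" "(1 / 8::real) \<le> 2 powr (- a - 2)" by (auto simp: powr_minus_divide)
    have p: "s powr e / 8 \<le> r powr e" if "1 / 8 \<le> (2::real) powr e" "e \<le> 0" for e
    proof -
      have "s powr e / 8 \<le> s powr e * 2 powr e" using that mult_left_mono[of "1 / 8" "2 powr e" "s powr e"] by simp
      also have "\<dots> = (2 * s) powr e" using s by (simp add: powr_mult mult.commute)
      also have "\<dots> \<le> r powr e" using r s that by (intro powr_mono2') auto
      finally show ?thesis .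
    qed
    have "l * (s powr (a - 2) / 8) \<le> l * r powr (a - 2)" "s powr (- a - 2) / 8 / l \<le> r powr (- a - 2) / l"
      using mult_left_mono[OF p[OF two(1)], of l] divide_right_mono[OF p[OF two(2)], of l] a l by simp_all
    moreover have "c \<le> l * (s powr (a - 2) / 8)" "c \<le> s powr (- a - 2) / 8 / l"
      unfolding c_def by (auto simp: min_def)
    ultimately show ?thesis using r s unfolding kernel_mix_def by simp
  qed
  have c0: "0 \<le> c" using l by (simp add: c_def)
  have "ennreal c * ennreal s = (\<integral>\<^sup>+r. ennreal c * indicator {s<..<2 * s} r \<partial>lborel)"
    using s by (subst nn_integral_cmult_indicator) auto
  also have "\<dots> \<le> mix_kernel (kernel_mix a l) s"
    unfolding mix_kernel_def using low s by (intro nn_integral_mono) (auto simp: indicator_def intro!: ennreal_leI)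
  finally have "8 * (ennreal c * ennreal s) \<le> 8 * mix_kernel (kernel_mix a l) s" by (intro mult_left_mono) auto
  moreover have "8 * (ennreal c * ennreal s) = ennreal (8 * (c * s))" using c0 s by (simp add: ennreal_mult)
  moreover have "8 * (c * s) = min (l * s powr (a - 2)) (s powr (- a - 2) / l) * s" by (simp add: c_def)
  moreover have "\<dots> = min (l * s powr (a - 1)) (s powr (- a - 1) / l)"
  proof -
    have "l * s powr (a - 2) * s = l * s powr (a - 1)" "s powr (- a - 2) / l * s = s powr (- a - 1) / l"
      using s powr_add[of s 1 "a - 2"] powr_add[of s 1 "- a - 2"] by (simp_all add: e mult.commute)
    moreover have "min x y * s = min (x * s) (y * s)" for x y :: real using s by (auto simp: min_def mult_le_cancel_right)
    ultimately show ?thesis by (simp only:)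
  qed
  ultimately show ?thesis by simp
qed

lemma conv_cong:
  assumes "\<And>s. 0 < s \<Longrightarrow> s < T \<Longrightarrow> b s = b' s" "t \<le> T"
  shows "conv a b t = conv a b' t"
  unfolding conv_def by (rule set_lebesgue_integral_cong) (use assms in auto)

section \<open>Scalar modes and the series solution\<close>

locale diffusion = diagonal_operator \<phi> D A \<mu> + frac_order \<alpha>
  for \<phi> :: "nat \<Rightarrow> 'a::{complex_hilbert, second_countable_topology}" and D A \<mu> and \<alpha> :: real +
  fixes p T :: real
  assumes \<mu>0: "0 < \<mu> 0" and \<mu>inc: "incseq \<mu>" and p: "1 < p" and T: "0 < T"
begin

lemma \<mu>_pos: "0 < \<mu> n"
  using \<mu>0 \<mu>inc by (meson incseqD le0 less_le_trans)

lemma g_frac_ker: "complex_of_real (g t) = frac_ker \<alpha> t"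
  by (simp add: g_def frac_ker_def)

lemma L1_kernel: "L1_on T (kernel (\<mu> n))"
proof -
  obtain C where C: "C > 0" "\<And>l t. 0 < l \<Longrightarrow> 0 < t \<Longrightarrow> cmod (kernel l t) \<le> C * t powr (\<alpha> - 1)"
    using kernel_bounds by blast
  have "set_integrable lborel {0<..<T} (kernel (\<mu> n))"
  proof (rule set_integrable_dominated)
    show "set_integrable lborel {0<..<T} (\<lambda>t. C * t powr (\<alpha> - 1))"
      by (intro set_integrable_mult_right set_integrable_powr_from_0 \<alpha>)
  qed (use C \<mu>_pos in \<open>auto simp: set_borel_measurable_def\<close>)
  then show ?thesis by (simp add: L1_on_set)
qed

lemma volterra: "0 < t \<Longrightarrow> kernel (\<mu> n) t + \<i> * of_real (\<mu> n) * conv (frac_ker \<alpha>) (kernel (\<mu> n)) t = frac_ker \<alpha> t"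
  using kernel_volterra[OF \<mu>_pos, of t n] by (simp add: conv_def g_frac_ker)

text \<open>Both directions of the equivalence between the scalar Volterra equation and the
  representation by the resolvent kernel use associativity of the convolution only.\<close>

lemma mode_solution:
  assumes f: "L1_on T f"
  shows "AE t in lborel. 0 < t \<and> t < T \<longrightarrow>
    conv (frac_ker \<alpha>) (\<lambda>s. f s + (- \<i> * of_real (\<mu> n)) * conv (kernel (\<mu> n)) f s) t = conv (kernel (\<mu> n)) f t"
proof -
  note k = L1_on_frac_ker[OF \<alpha>(1), of T] L1_kernel[of n]
  let ?c = "- \<i> * of_real (\<mu> n)"
  have "AE t in lborel. 0 < t \<and> t < T \<longrightarrow>
      conv (frac_ker \<alpha>) (\<lambda>s. f s + ?c * conv (kernel (\<mu> n)) f s) t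
      = conv (frac_ker \<alpha>) f t + ?c * conv (frac_ker \<alpha>) (conv (kernel (\<mu> n)) f) t"
    by (intro conv_linear k f L1_on_conv)
  moreover have "AE t in lborel. 0 < t \<and> t < T \<longrightarrow>
      conv (conv (frac_ker \<alpha>) (kernel (\<mu> n))) f t = conv (frac_ker \<alpha>) (conv (kernel (\<mu> n)) f) t"
    by (intro conv_assoc k f)
  moreover have "AE t in lborel. 0 < t \<and> t < T \<longrightarrow>
      conv f (\<lambda>s. frac_ker \<alpha> s + ?c * conv (frac_ker \<alpha>) (kernel (\<mu> n)) s) t
      = conv f (frac_ker \<alpha>) t + ?c * conv f (conv (frac_ker \<alpha>) (kernel (\<mu> n))) t"
    by (intro conv_linear k f L1_on_conv)
  moreover have "AE t in lborel. 0 < t \<and> t < T \<longrightarrow>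
      conv f (\<lambda>s. frac_ker \<alpha> s + ?c * conv (frac_ker \<alpha>) (kernel (\<mu> n)) s) t = conv f (kernel (\<mu> n)) t"
    using volterra[of _ n] by (intro always_eventually allI impI conv_cong[of T]) (auto simp: algebra_simps)
  ultimately show ?thesis
    by eventually_elim (auto simp: conv_commute[of f])
qed

lemma mode_unique:
  assumes f: "L1_on T f" and u: "L1_on T u"
    and e: "AE t in lborel. 0 < t \<and> t < T \<longrightarrow> u t + \<i> * of_real (\<mu> n) * conv (frac_ker \<alpha>) u t = conv (frac_ker \<alpha>) f t"
  shows "AE t in lborel. 0 < t \<and> t < T \<longrightarrow> u t = conv (kernel (\<mu> n)) f t"
proof -
  let ?k = "kernel (\<mu> n)" and ?g = "frac_ker \<alpha>" and ?c = "\<i> * of_real (\<mu> n)"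
  note k = L1_on_frac_ker[OF \<alpha>(1), of T] L1_kernel[of n]
  have kg: "AE t in lborel. 0 < t \<and> t < T \<longrightarrow> conv ?g v t = conv ?k v t + ?c * conv ?k (conv ?g v) t" if v: "L1_on T v" for v
  proof -
    have "AE t in lborel. 0 < t \<and> t < T \<longrightarrow> conv v ?g t = conv v (\<lambda>s. ?k s + ?c * conv ?g ?k s) t"
      using volterra[of _ n] by (intro always_eventually allI impI conv_cong[of T]) auto
    moreover have "AE t in lborel. 0 < t \<and> t < T \<longrightarrow> conv v (\<lambda>s. ?k s + ?c * conv ?g ?k s) t = conv v ?k t + ?c * conv v (conv ?g ?k) t"
      by (intro conv_linear k v L1_on_conv)
    moreover have "AE t in lborel. 0 < t \<and> t < T \<longrightarrow> conv (conv ?k ?g) v t = conv ?k (conv ?g v) t"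
      by (intro conv_assoc k v)
    ultimately show ?thesis
    proof eventually_elim
      case (elim t)
      have "conv (conv ?k ?g) = conv (conv ?g ?k)" by (rule arg_cong[of _ _ conv]) (rule ext, rule conv_commute)
      then show ?case using elim by (simp add: conv_commute[of v])
    qed
  qed
  have "AE t in lborel. 0 < t \<and> t < T \<longrightarrow> conv ?k (\<lambda>s. u s + ?c * conv ?g u s) t = conv ?k u t + ?c * conv ?k (conv ?g u) t"
    by (intro conv_linear k u L1_on_conv)
  moreover have "AE t in lborel. 0 < t \<and> t < T \<longrightarrow> conv ?k (\<lambda>s. u s + ?c * conv ?g u s) t = conv ?k (conv ?g f) t"
  proof (rule always_eventually, intro allI impI, rule conv_cong_AE[OF e])
    have [measurable]: "cut T (conv ?g u) \<in> borel_measurable borel" "cut T u \<in> borel_measurable borel"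
      by (intro cut_borel L1_on_conv k u)+
    have "cut T (\<lambda>s. u s + ?c * conv ?g u s) = (\<lambda>s. cut T u s + ?c * cut T (conv ?g u) s)"
      by (auto simp: cut_def fun_eq_iff indicator_def)
    then show "cut T (\<lambda>s. u s + ?c * conv ?g u s) \<in> borel_measurable borel" by simp
  qed (use f k in \<open>auto intro: cut_borel L1_on_conv\<close>)
  ultimately show ?thesis using e kg[OF u] kg[OF f]
  proof eventually_elim
    case (elim t)
    show ?case
    proof
      assume t: "0 < t \<and> t < T"
      have "conv ?g u t = conv ?k (conv ?g f) t" using elim t by simp
      then show "u t = conv ?k f t" using elim t by (simp add: algebra_simps)
    qed
  qed
qed

definition mode :: "(real \<Rightarrow> 'a) \<Rightarrow> nat \<Rightarrow> real \<Rightarrow> complex"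
  where "mode f n = conv (kernel (\<mu> n)) (\<lambda>t. coord n (f t))"

text \<open>Defined with \<open>lim\<close> at every time, whether or not the series converges
  there, so that measurability is automatic; convergence is proved almost everywhere.
  \<open>solution_op\<close> is the same construction for the formal image under
  \<open>A\<close>.\<close>

definition solution :: "(real \<Rightarrow> 'a) \<Rightarrow> real \<Rightarrow> 'a"
  where "solution f t = lim (\<lambda>N. \<Sum>n<N. cut T (mode f n) t *\<^sub>C \<phi> n)"

definition solution_op :: "(real \<Rightarrow> 'a) \<Rightarrow> real \<Rightarrow> 'a"
  where "solution_op f t = lim (\<lambda>N. \<Sum>n<N. (- of_real (\<mu> n) * cut T (mode f n) t) *\<^sub>C \<phi> n)"

lemma L1_mode: "integrable lborel (cut T f) \<Longrightarrow> L1_on T (mode f n)"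
  unfolding mode_def by (intro L1_on_conv L1_kernel L1_on_coord)

lemma solution_measurable:
  assumes "integrable lborel (cut T f)"
  shows "solution f \<in> borel_measurable borel" "solution_op f \<in> borel_measurable borel"
proof -
  have [measurable]: "cut T (mode f n) \<in> borel_measurable borel" for n by (intro cut_borel L1_mode assms)
  show "solution f \<in> borel_measurable borel" "solution_op f \<in> borel_measurable borel"
    unfolding solution_def[abs_def] solution_op_def[abs_def] by measurable
qed

definition mode_bound :: "(real \<Rightarrow> 'a) \<Rightarrow> nat \<Rightarrow> real \<Rightarrow> real"
  where "mode_bound f N t = (\<Sum>n<N. (\<mu> n * cmod (cut T (mode f n) t))\<^sup>2)"

lemma mode_square_function:
  "\<exists>C>0. \<forall>f\<in>Lp_space p T. \<forall>N. (\<integral>\<^sup>+t. ennreal (mode_bound f N t powr (p / 2)) \<partial>lborel) \<le> ennreal C * Lp_mass p T f"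
proof -
  obtain Ck where Ck: "Ck > 0" "\<And>l t. 0 < l \<Longrightarrow> 0 < t \<Longrightarrow> cmod (kernel l t) \<le> Ck * t powr (\<alpha> - 1)"
    "\<And>l t. 0 < l \<Longrightarrow> 0 < t \<Longrightarrow> cmod (kernel l t) \<le> Ck / l\<^sup>2 * t powr (- \<alpha> - 1)"
    using kernel_bounds by blast
  have km: "ennreal (l * cmod (kernel l t)) \<le> ennreal (8 * Ck) * mix_kernel (kernel_mix \<alpha> l) t" if lt: "0 < l" "0 < t" for l t
  proof -
    have "l * cmod (kernel l t) \<le> l * (Ck * t powr (\<alpha> - 1))" "l * cmod (kernel l t) \<le> l * (Ck / l\<^sup>2 * t powr (- \<alpha> - 1))"
      using mult_left_mono[OF Ck(2)[OF lt], of l] mult_left_mono[OF Ck(3)[OF lt], of l] lt by simp_all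
    moreover have "l * (Ck * t powr (\<alpha> - 1)) = Ck * (l * t powr (\<alpha> - 1))"
      "l * (Ck / l\<^sup>2 * t powr (- \<alpha> - 1)) = Ck * (t powr (- \<alpha> - 1) / l)"
      using lt by (simp_all add: power2_eq_square)
    ultimately have "l * cmod (kernel l t) \<le> Ck * min (l * t powr (\<alpha> - 1)) (t powr (- \<alpha> - 1) / l)"
      by (simp only: min_def split: if_split) simp
    then have "ennreal (l * cmod (kernel l t)) \<le> ennreal Ck * ennreal (min (l * t powr (\<alpha> - 1)) (t powr (- \<alpha> - 1) / l))"
      using Ck(1) lt by (simp add: ennreal_mult[symmetric] ennreal_leI)
    also have "\<dots> \<le> ennreal Ck * (8 * mix_kernel (kernel_mix \<alpha> l) t)"
      by (intro mult_left_mono mix_kernel_kernel_mix \<alpha> lt) auto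
    also have "\<dots> = ennreal (8 * Ck) * mix_kernel (kernel_mix \<alpha> l) t" using Ck(1) by (simp add: ennreal_mult ac_simps)
    finally show ?thesis .
  qed
  define c where "c = 8 * Ck"
  have c: "0 < c" using Ck by (simp add: c_def)
  have "0 < 2 / \<alpha>" using \<alpha> by simp
  from square_function[OF p this] obtain C where C: "C > 0" "\<And>N m f G. dominated (2 / \<alpha>) N m f G \<Longrightarrow>
    (\<integral>\<^sup>+t. ennreal ((\<Sum>n<N. (G n t)\<^sup>2) powr (p / 2)) \<partial>lborel)
    \<le> ennreal C * (\<integral>\<^sup>+s. ennreal ((\<Sum>n<N. (f n s)\<^sup>2) powr (p / 2)) \<partial>lborel)" by blast
  show ?thesis
  proof (intro exI[of _ "c powr p * C"] conjI ballI allI)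
    fix f :: "real \<Rightarrow> 'a" and N assume f: "f \<in> Lp_space p T"
    have fi: "integrable lborel (cut T f)" using p T by (intro Lp_L1[OF f]) auto
    then have [measurable]: "cut T f \<in> borel_measurable borel" by (auto dest: borel_measurable_integrable)
    have [measurable]: "cut T (mode f n) \<in> borel_measurable borel" for n by (intro cut_borel L1_mode fi)
    let ?f = "\<lambda>n s. cmod (coord n (cut T f s))" and ?G = "\<lambda>n t. \<mu> n * cmod (cut T (mode f n) t) / c"
    have d: "dominated (2 / \<alpha>) N (\<lambda>n. kernel_mix \<alpha> (\<mu> n)) ?f ?G"
      unfolding dominated_def
    proof (intro allI impI conjI)
      fix n t
      have [measurable]: "kernel_mix \<alpha> (\<mu> n) \<in> borel_measurable borel"
        using kernel_mix_mixture[OF \<alpha>(1) \<mu>_pos, of n] by (simp add: mixture_def)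
      show "ennreal (?G n t) \<le> (\<integral>\<^sup>+s. mix_kernel (kernel_mix \<alpha> (\<mu> n)) (t - s) * ennreal (?f n s) \<partial>lborel)"
      proof (cases "0 < t \<and> t < T")
        case True
        let ?h = "\<lambda>s. indicator {0<..<t} s *\<^sub>R (kernel (\<mu> n) (t - s) * coord n (f s))"
        have "ennreal (cmod (mode f n t)) \<le> (\<integral>\<^sup>+s. ennreal (cmod (?h s)) \<partial>lborel)"
        proof (cases "integrable lborel ?h")
          case True
          then show ?thesis unfolding mode_def conv_def set_lebesgue_integral_def by (rule integral_norm_bound_ennreal)
        next
          \<comment> \<open>A non-integrable integrand gives the Bochner integral the value 0, so
            the inequality is trivial.\<close>
          case False
          then show ?thesis unfolding mode_def conv_def set_lebesgue_integral_def by (simp add: not_integrable_integral_eq)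
        qed
        then have "ennreal (\<mu> n / c) * ennreal (cmod (mode f n t)) \<le> ennreal (\<mu> n / c) * (\<integral>\<^sup>+s. ennreal (cmod (?h s)) \<partial>lborel)"
          by (rule mult_left_mono) simp
        also have "\<dots> \<le> (\<integral>\<^sup>+s. mix_kernel (kernel_mix \<alpha> (\<mu> n)) (t - s) * ennreal (?f n s) \<partial>lborel)"
        proof -
          have e: "?h s = indicator {0<..<t} s *\<^sub>R (kernel (\<mu> n) (t - s) * coord n (cut T f s))" for s
            using True by (auto simp: cut_def indicator_def)
          have "ennreal (\<mu> n / c) * (\<integral>\<^sup>+s. ennreal (cmod (?h s)) \<partial>lborel) = (\<integral>\<^sup>+s. ennreal (\<mu> n / c) * ennreal (cmod (?h s)) \<partial>lborel)"
            unfolding e by (rule nn_integral_cmult[symmetric]) measurable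
          also have "\<dots> \<le> (\<integral>\<^sup>+s. mix_kernel (kernel_mix \<alpha> (\<mu> n)) (t - s) * ennreal (?f n s) \<partial>lborel)"
          proof (rule nn_integral_mono)
            fix s
            show "ennreal (\<mu> n / c) * ennreal (cmod (?h s)) \<le> mix_kernel (kernel_mix \<alpha> (\<mu> n)) (t - s) * ennreal (?f n s)"
            proof (cases "0 < s \<and> s < t")
              case s: True
              have "ennreal (\<mu> n / c) * ennreal (cmod (?h s)) = ennreal (1 / c) * ennreal (\<mu> n * cmod (kernel (\<mu> n) (t - s))) * ennreal (?f n s)"
                unfolding e using s c \<mu>_pos[of n] by (simp add: norm_mult ennreal_mult[symmetric])
              also have "\<dots> \<le> ennreal (1 / c) * (ennreal c * mix_kernel (kernel_mix \<alpha> (\<mu> n)) (t - s)) * ennreal (?f n s)"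
                using km[OF \<mu>_pos, of "t - s" n] s by (intro mult_right_mono mult_left_mono) (auto simp: c_def)
              also have "ennreal (1 / c) * (ennreal c * mix_kernel (kernel_mix \<alpha> (\<mu> n)) (t - s)) = mix_kernel (kernel_mix \<alpha> (\<mu> n)) (t - s)"
                using c by (simp add: mult.assoc[symmetric] ennreal_mult[symmetric])
              finally show ?thesis .
            qed auto
          qed
          finally show ?thesis .
        qed
        also have "ennreal (\<mu> n / c) * ennreal (cmod (mode f n t)) = ennreal (?G n t)"
          using True c \<mu>_pos[of n] by (simp add: cut_def ennreal_mult[symmetric])
        finally show ?thesis .
      qed (simp add: cut_def)
    qed (use kernel_mix_mixture[OF \<alpha>(1) \<mu>_pos] c \<mu>_pos in \<open>auto simp: less_imp_le\<close>)
    have "(\<integral>\<^sup>+t. ennreal (mode_bound f N t powr (p / 2)) \<partial>lborel) = (\<integral>\<^sup>+t. ennreal (c powr p) * ennreal ((\<Sum>n<N. (?G n t)\<^sup>2) powr (p / 2)) \<partial>lborel)"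
    proof (rule nn_integral_cong)
      fix t
      have "mode_bound f N t = c\<^sup>2 * (\<Sum>n<N. (?G n t)\<^sup>2)"
        unfolding mode_bound_def sum_distrib_left using c by (intro sum.cong) (auto simp: power_divide)
      then have "mode_bound f N t powr (p / 2) = c powr p * (\<Sum>n<N. (?G n t)\<^sup>2) powr (p / 2)"
        using c by (simp add: powr_mult sum_nonneg powr_half_square)
      then show "ennreal (mode_bound f N t powr (p / 2)) = ennreal (c powr p) * ennreal ((\<Sum>n<N. (?G n t)\<^sup>2) powr (p / 2))"
        by (simp add: ennreal_mult)
    qed
    also have "\<dots> = ennreal (c powr p) * (\<integral>\<^sup>+t. ennreal ((\<Sum>n<N. (?G n t)\<^sup>2) powr (p / 2)) \<partial>lborel)"
      by (rule nn_integral_cmult) measurable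
    also have "\<dots> \<le> ennreal (c powr p) * (ennreal C * (\<integral>\<^sup>+s. ennreal ((\<Sum>n<N. (?f n s)\<^sup>2) powr (p / 2)) \<partial>lborel))"
      by (intro mult_left_mono C(2)[OF d]) auto
    also have "(\<integral>\<^sup>+s. ennreal ((\<Sum>n<N. (?f n s)\<^sup>2) powr (p / 2)) \<partial>lborel) \<le> Lp_mass p T f"
      unfolding Lp_mass_def
    proof (rule nn_integral_mono)
      fix s
      have "(\<Sum>n<N. (?f n s)\<^sup>2) powr (p / 2) \<le> ((norm (cut T f s))\<^sup>2) powr (p / 2)"
        using p by (intro powr_mono2 bessel) (auto simp: sum_nonneg)
      then show "ennreal ((\<Sum>n<N. (?f n s)\<^sup>2) powr (p / 2)) \<le> ennreal (norm (cut T f s) powr p)"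
        by (simp add: powr_half_square ennreal_leI)
    qed
    finally show "(\<integral>\<^sup>+t. ennreal (mode_bound f N t powr (p / 2)) \<partial>lborel) \<le> ennreal (c powr p * C) * Lp_mass p T f"
      using C(1) by (simp add: ennreal_mult mult.assoc mult_left_mono)
  qed (use c C in auto)
qed

text \<open>Monotone convergence in \<open>N\<close> turns the uniform bounds into a bound for the
  full square function, which is therefore finite almost everywhere. There the coefficients are
  square summable, the series converge by Riesz-Fischer, and Parseval identifies the square function
  with the norm of \<open>solution_op\<close>.\<close>

lemma solution_op_bound:
  "\<exists>C>0. \<forall>f\<in>Lp_space p T.
    (AE t in lborel. 0 < t \<and> t < T \<longrightarrow> (\<forall>n. coord n (solution f t) = mode f n t) \<and>
      (\<forall>n. coord n (solution_op f t) = - of_real (\<mu> n) * mode f n t)) \<and>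
    Lp_mass p T (solution_op f) \<le> ennreal C * Lp_mass p T f"
proof -
  obtain C where C: "C > 0" "\<And>f N. f \<in> Lp_space p T \<Longrightarrow> (\<integral>\<^sup>+t. ennreal (mode_bound f N t powr (p / 2)) \<partial>lborel) \<le> ennreal C * Lp_mass p T f"
    using mode_square_function by blast
  show ?thesis
  proof (intro exI[of _ C] conjI ballI)
    fix f :: "real \<Rightarrow> 'a" assume f: "f \<in> Lp_space p T"
    have fi: "integrable lborel (cut T f)" using p T by (intro Lp_L1[OF f]) auto
    have [measurable]: "cut T (mode f n) \<in> borel_measurable borel" for n by (intro cut_borel L1_mode fi)
    let ?B = "\<lambda>N t. ennreal (mode_bound f N t powr (p / 2))"
    have [measurable]: "mode_bound f N \<in> borel_measurable borel" for N unfolding mode_bound_def[abs_def] by measurable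
    have b0: "0 \<le> mode_bound f N t" for N t by (simp add: mode_bound_def sum_nonneg)
    have inc: "incseq (\<lambda>N. ?B N t)" for t
    proof (rule incseq_SucI)
      show "?B N t \<le> ?B (Suc N) t" for N
        using p b0[of N t] by (intro ennreal_leI powr_mono2) (auto simp: mode_bound_def)
    qed
    have "(\<integral>\<^sup>+t. (SUP N. ?B N t) \<partial>lborel) = (SUP N. \<integral>\<^sup>+t. ?B N t \<partial>lborel)"
      using inc by (intro nn_integral_monotone_convergence_SUP) (auto simp: incseq_def le_fun_def)
    also have "\<dots> \<le> ennreal C * Lp_mass p T f" by (intro SUP_least C f)
    finally have S: "(\<integral>\<^sup>+t. (SUP N. ?B N t) \<partial>lborel) \<le> ennreal C * Lp_mass p T f" .
    moreover have "ennreal C * Lp_mass p T f < \<infinity>" using f by (simp add: Lp_space_iff ennreal_mult_less_top)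
    ultimately have "AE t in lborel. (SUP N. ?B N t) \<noteq> \<infinity>"
      by (intro nn_integral_PInf_AE) (auto dest: order_le_less_trans)
    then have sm: "AE t in lborel. summable (\<lambda>n. (\<mu> n * cmod (cut T (mode f n) t))\<^sup>2)"
    proof eventually_elim
      case (elim t)
      then obtain x where x: "(SUP N. ?B N t) = ennreal x" "0 \<le> x" by (cases "SUP N. ?B N t") auto
      have "mode_bound f N t \<le> x powr (2 / p)" for N
      proof -
        have "?B N t \<le> ennreal x" unfolding x(1)[symmetric] by (rule SUP_upper) simp
        then have "mode_bound f N t powr (p / 2) \<le> x" using x(2) by simp
        then have "(mode_bound f N t powr (p / 2)) powr (2 / p) \<le> x powr (2 / p)" using p by (intro powr_mono2) auto
        then show ?thesis using p b0[of N t] by (simp add: powr_powr)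
      qed
      note b = this
      show ?case
      proof (rule bounded_imp_summable)
        show "(\<Sum>k\<le>n. (\<mu> k * cmod (cut T (mode f k) t))\<^sup>2) \<le> x powr (2 / p)" for n
          using b[of "Suc n"] by (simp only: mode_bound_def lessThan_Suc_atMost)
      qed simp
    qed
    have co: "AE t in lborel. (\<forall>n. coord n (solution f t) = cut T (mode f n) t) \<and>
      (\<forall>n. coord n (solution_op f t) = - of_real (\<mu> n) * cut T (mode f n) t)"
      using sm
    proof eventually_elim
      case (elim t)
      \<comment> \<open>The factor \<mu> n can be removed because it is at least \<mu> 0 >
        0.\<close>
      have "summable (\<lambda>n. (cmod (cut T (mode f n) t))\<^sup>2)"
      proof (rule summable_comparison_test')
        show "summable (\<lambda>n. (1 / (\<mu> 0)\<^sup>2) * (\<mu> n * cmod (cut T (mode f n) t))\<^sup>2)" by (rule summable_mult[OF elim])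
        show "norm ((cmod (cut T (mode f n) t))\<^sup>2) \<le> 1 / (\<mu> 0)\<^sup>2 * (\<mu> n * cmod (cut T (mode f n) t))\<^sup>2" if "n \<ge> 0" for n
        proof -
          have "\<mu> 0 \<le> \<mu> n" using \<mu>inc by (simp add: incseq_def)
          then have "(\<mu> 0)\<^sup>2 * (cmod (cut T (mode f n) t))\<^sup>2 \<le> (\<mu> n)\<^sup>2 * (cmod (cut T (mode f n) t))\<^sup>2"
            using \<mu>0 by (intro mult_right_mono power_mono) auto
          then show ?thesis using \<mu>0 by (simp add: power_mult_distrib field_simps)
        qed
      qed
      moreover have "summable (\<lambda>n. (cmod (- of_real (\<mu> n) * cut T (mode f n) t))\<^sup>2)"
        using elim \<mu>_pos by (simp add: norm_mult less_imp_le abs_of_pos)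
      ultimately show ?case unfolding solution_def solution_op_def by (intro conjI allI riesz_fischer(2))
    qed
    then show "AE t in lborel. 0 < t \<and> t < T \<longrightarrow> (\<forall>n. coord n (solution f t) = mode f n t) \<and>
      (\<forall>n. coord n (solution_op f t) = - of_real (\<mu> n) * mode f n t)"
      by eventually_elim (auto simp: cut_def)
    have "Lp_mass p T (solution_op f) \<le> (\<integral>\<^sup>+t. (SUP N. ?B N t) \<partial>lborel)"
      unfolding Lp_mass_def
    proof (rule nn_integral_mono_AE, use co in eventually_elim)
      case (elim t)
      have "(\<lambda>n. (\<mu> n * cmod (cut T (mode f n) t))\<^sup>2) sums (norm (solution_op f t))\<^sup>2"
        using parseval[of "solution_op f t"] elim \<mu>_pos by (simp add: norm_mult less_imp_le abs_of_pos)
      then have "(\<lambda>N. mode_bound f N t) \<longlonglongrightarrow> (norm (solution_op f t))\<^sup>2" unfolding mode_bound_def sums_def .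
      then have "(\<lambda>N. mode_bound f N t powr (p / 2)) \<longlonglongrightarrow> ((norm (solution_op f t))\<^sup>2) powr (p / 2)"
        using p b0 by (intro tendsto_powr') auto
      then have "(\<lambda>N. ?B N t) \<longlonglongrightarrow> ennreal (norm (solution_op f t) powr p)"
        by (simp add: powr_half_square tendsto_ennrealI)
      then have "ennreal (norm (solution_op f t) powr p) = (SUP N. ?B N t)"
        using LIMSEQ_SUP[OF inc[of t]] LIMSEQ_unique by blast
      moreover have "ennreal (norm (cut T (solution_op f) t) powr p) \<le> ennreal (norm (solution_op f t) powr p)"
        by (auto simp: cut_def indicator_def)
      ultimately show ?case by simp
    qed
    then show "Lp_mass p T (solution_op f) \<le> ennreal C * Lp_mass p T f" using S by (rule order_trans)
  qed (rule C(1))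
qed

end

section \<open>Test functions\<close>

lemma AE_reflect:
  fixes P :: "real \<Rightarrow> bool"
  assumes "AE t in lborel. P t"
  shows "AE t in lborel. P (T - t)"
proof -
  from assms obtain N where N1: "N \<in> null_sets lborel" and N2: "{x \<in> space lborel. \<not> P x} \<subseteq> N"
    unfolding eventually_ae_filter by blast
  have "AE x in lborel. x \<notin> N" using N1 by (rule AE_not_in)
  moreover have "Measurable.pred borel (\<lambda>x. x \<notin> N)"
    using N1 by (auto simp: null_sets_def)
  ultimately have "AE x in lborel. T + (- 1) * x \<notin> N" by (intro AE_borel_affine) auto
  then show ?thesis by eventually_elim (use N2 in auto)
qed

lemma frac_ker_conv_bound:
  assumes a: "0 < a" and w: "\<And>t. 0 < t \<Longrightarrow> t < T \<Longrightarrow> cmod (w t) \<le> M" and t: "0 < t" "t < T"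
  shows "cmod (conv (frac_ker a) w t) \<le> M * (LINT s:{0<..<T}|lborel. s powr (a - 1)) / Gamma a"
proof -
  have G: "Gamma a > 0" using a by (rule Gamma_real_pos)
  have M: "0 \<le> M" using order_trans[OF norm_ge_zero w[OF t]] .
  have "cmod (conv (frac_ker a) w t) = cmod (conv w (frac_ker a) t)" by (subst conv_commute) (rule refl)
  also have "\<dots> = cmod (LINT s:{0<..<t}|lborel. w (t - s) * frac_ker a s)" by (simp only: conv_def)
  also have "\<dots> \<le> (LINT s:{0<..<t}|lborel. M / Gamma a * s powr (a - 1))"
  proof (rule frac_order.norm_set_integral_le)
    \<comment> \<open>\<open>norm_set_integral_le\<close> is stated inside the locale
      \<open>frac_order\<close>; the value 1 / 2 discharges the locale assumption.\<close>
    show "frac_order (1 / 2)" by unfold_locales auto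
    show "set_integrable lborel {0<..<t} (\<lambda>s. M / Gamma a * s powr (a - 1))"
      by (intro set_integrable_mult_right set_integrable_powr_from_0 a)
    show "cmod (w (t - s) * frac_ker a s) \<le> M / Gamma a * s powr (a - 1)" if s: "s \<in> {0<..<t}" for s
      using mult_right_mono[OF w[of "t - s"], of "s powr (a - 1) / Gamma a"] s t G
      by (simp add: norm_mult norm_divide frac_ker_def)
  qed simp
  also have "\<dots> = M / Gamma a * (LINT s:{0<..<t}|lborel. s powr (a - 1))" by (rule set_integral_mult_right)
  also have "\<dots> \<le> M / Gamma a * (LINT s:{0<..<T}|lborel. s powr (a - 1))"
  proof (intro mult_left_mono)
    show "(LINT s:{0<..<t}|lborel. s powr (a - 1)) \<le> (LINT s:{0<..<T}|lborel. s powr (a - 1))"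
      using set_integrable_powr_from_0(1)[OF a, of t] set_integrable_powr_from_0(1)[OF a, of T] t
      unfolding set_lebesgue_integral_def set_integrable_def by (intro integral_mono) (auto simp: indicator_def)
  qed (use M G in auto)
  finally show ?thesis by simp
qed

context diffusion
begin

lemma subspace_D:
  "x \<in> D \<Longrightarrow> y \<in> D \<Longrightarrow> x + y \<in> D" "x \<in> D \<Longrightarrow> y \<in> D \<Longrightarrow> x - y \<in> D" "x \<in> D \<Longrightarrow> a *\<^sub>C x \<in> D" "x \<in> D \<Longrightarrow> r *\<^sub>R x \<in> D" "0 \<in> D"
proof -
  interpret vs: vector_space "scaleC :: complex \<Rightarrow> 'a \<Rightarrow> 'a" by (rule vector_space_scaleC)
  have s: "csubspace D" using linear_op by (simp add: linear_operator_def)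
  show "x \<in> D \<Longrightarrow> y \<in> D \<Longrightarrow> x + y \<in> D" by (rule vs.subspace_add[OF s])
  show "x \<in> D \<Longrightarrow> y \<in> D \<Longrightarrow> x - y \<in> D" by (rule vs.subspace_diff[OF s])
  show sc: "x \<in> D \<Longrightarrow> a *\<^sub>C x \<in> D" for a by (rule vs.subspace_scale[OF s])
  show "x \<in> D \<Longrightarrow> r *\<^sub>R x \<in> D" using sc[of "of_real r"] by (simp add: scaleC_of_real)
  show "0 \<in> D" by (rule vs.subspace_0[OF s])
qed

lemma op_add: "x \<in> D \<Longrightarrow> y \<in> D \<Longrightarrow> A (x + y) = A x + A y"
  using linear_op by (simp add: linear_operator_def)

lemma op_scaleR: "x \<in> D \<Longrightarrow> A (r *\<^sub>R x) = r *\<^sub>R A x"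
  using linear_op by (simp add: linear_operator_def flip: scaleC_of_real)

lemma op_diff: "x \<in> D \<Longrightarrow> y \<in> D \<Longrightarrow> A (x - y) = A x - A y"
  using op_add[of "x - y" y] subspace_D(2)[of x y] by simp

text \<open>In coordinates \<open>A\<close> multiplies by at least \<mu> 0 in modulus. Convergence
  in the norm of D(A) therefore implies convergence in H, which is how derivatives of test functions
  reach H.\<close>

lemma norm_le_op:
  assumes x: "x \<in> D"
  shows "norm x \<le> norm (A x) / \<mu> 0"
proof -
  have s: "(\<lambda>n. (1 / (\<mu> 0)\<^sup>2) * (cmod (coord n (A x)))\<^sup>2) sums ((1 / (\<mu> 0)\<^sup>2) * (norm (A x))\<^sup>2)"
    by (rule sums_mult[OF parseval])
  have "(cmod (coord n x))\<^sup>2 \<le> (1 / (\<mu> 0)\<^sup>2) * (cmod (coord n (A x)))\<^sup>2" for n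
  proof -
    have "\<mu> 0 \<le> \<mu> n" using \<mu>inc by (simp add: incseq_def)
    then have "(\<mu> 0)\<^sup>2 * (cmod (coord n x))\<^sup>2 \<le> (\<mu> n)\<^sup>2 * (cmod (coord n x))\<^sup>2"
      using \<mu>0 by (intro mult_right_mono power_mono) auto
    then show ?thesis using \<mu>0 \<mu>_pos[of n] by (simp add: coord_op[OF x] norm_mult power_mult_distrib field_simps)
  qed
  then have "(norm x)\<^sup>2 \<le> (1 / (\<mu> 0)\<^sup>2) * (norm (A x))\<^sup>2"
    by (rule sums_le[OF _ parseval[of x] s])
  then have "(norm x)\<^sup>2 \<le> (norm (A x) / \<mu> 0)\<^sup>2" by (simp add: power_divide)
  then show ?thesis by (rule power2_le_imp_le) (use \<mu>0 in simp)
qed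

text \<open>Continuous differentiability on the closed interval in the norm of H, one-sided at the
  end points: the form in which a test function enters the fractional calculus.\<close>

definition has_cont_derivative :: "(real \<Rightarrow> 'a) \<Rightarrow> (real \<Rightarrow> 'a) \<Rightarrow> bool"
  where "has_cont_derivative \<psi> \<psi>' \<longleftrightarrow>
    (\<forall>t\<in>{0..T}. (\<psi> has_vector_derivative \<psi>' t) (at t within {0..T})) \<and> continuous_on {0..T} \<psi>'"

text \<open>\<open>norm_le_op\<close> transfers the difference quotients from the norm of D(A) to
  that of H. Continuity of \<open>A (\<psi> t)\<close> comes from writing the increment of \<psi> as
  (s - t) times a family that stays bounded in the norm of D(A) as s tends to t.\<close>

lemma test_function_derivative:
  assumes "\<psi> \<in> test_functions T D A"
  obtains \<psi>' where "has_cont_derivative \<psi> \<psi>'" "\<And>t. t \<in> {0..T} \<Longrightarrow> \<psi> t \<in> D"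
    "continuous_on {0..T} (\<lambda>t. A (\<psi> t))" "\<psi> T = 0"
proof -
  from assms obtain \<Psi> where \<Psi>0: "\<And>t. t \<in> {0..T} \<Longrightarrow> \<Psi> 0 t = \<psi> t" and
    \<Psi>D: "\<And>k t. t \<in> {0..T} \<Longrightarrow> \<Psi> k t \<in> D" and
    lim: "\<And>k t. t \<in> {0..T} \<Longrightarrow> ((\<lambda>s. norm (A ((1 / (s - t)) *\<^sub>R (\<Psi> k s - \<Psi> k t) - \<Psi> (Suc k) t))) \<longlongrightarrow> 0) (at t within {0..T})"
    and \<psi>T: "\<psi> T = 0"
    unfolding test_functions_def smooth_domain_valued_def by blast
  have qD: "(1 / (s - t)) *\<^sub>R (\<Psi> k s - \<Psi> k t) - \<Psi> (Suc k) t \<in> D" if "s \<in> {0..T}" "t \<in> {0..T}" for k s t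
    using that by (intro subspace_D \<Psi>D)
  have der: "(\<Psi> k has_vector_derivative \<Psi> (Suc k) t) (at t within {0..T})" if t: "t \<in> {0..T}" for k t
    unfolding has_vector_derivative_def has_derivative_within
  proof
    show "bounded_linear (\<lambda>x. x *\<^sub>R \<Psi> (Suc k) t)" by (rule bounded_linear_scaleR_left)
    show "((\<lambda>y. (1 / norm (y - t)) *\<^sub>R (\<Psi> k y - (\<Psi> k t + (y - t) *\<^sub>R \<Psi> (Suc k) t))) \<longlongrightarrow> 0) (at t within {0..T})"
    proof (rule Lim_null_comparison)
      show "((\<lambda>s. norm (A ((1 / (s - t)) *\<^sub>R (\<Psi> k s - \<Psi> k t) - \<Psi> (Suc k) t)) / \<mu> 0) \<longlongrightarrow> 0) (at t within {0..T})"
        using tendsto_divide[OF lim[OF t, of k] tendsto_const[of "\<mu> 0"]] \<mu>0 by simp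
      show "eventually (\<lambda>s. norm ((1 / norm (s - t)) *\<^sub>R (\<Psi> k s - (\<Psi> k t + (s - t) *\<^sub>R \<Psi> (Suc k) t)))
        \<le> norm (A ((1 / (s - t)) *\<^sub>R (\<Psi> k s - \<Psi> k t) - \<Psi> (Suc k) t)) / \<mu> 0) (at t within {0..T})"
        unfolding eventually_at_filter
      proof (intro always_eventually allI impI)
        fix s assume s: "s \<noteq> t" "s \<in> {0..T}"
        let ?q = "(1 / (s - t)) *\<^sub>R (\<Psi> k s - \<Psi> k t) - \<Psi> (Suc k) t"
        have "\<Psi> k s - (\<Psi> k t + (s - t) *\<^sub>R \<Psi> (Suc k) t) = (s - t) *\<^sub>R ?q"
          using s by (simp add: scaleR_diff_right algebra_simps)
        then have "norm ((1 / norm (s - t)) *\<^sub>R (\<Psi> k s - (\<Psi> k t + (s - t) *\<^sub>R \<Psi> (Suc k) t))) = norm ?q"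
          using s by simp
        also have "\<dots> \<le> norm (A ?q) / \<mu> 0" by (rule norm_le_op[OF qD[OF s(2) t]])
        finally show "norm ((1 / norm (s - t)) *\<^sub>R (\<Psi> k s - (\<Psi> k t + (s - t) *\<^sub>R \<Psi> (Suc k) t))) \<le> norm (A ?q) / \<mu> 0" .
      qed
    qed
  qed
  have contA: "continuous_on {0..T} (\<lambda>t. A (\<psi> t))"
    unfolding continuous_on_def
  proof
    fix t assume t: "t \<in> {0..T}"
    have "((\<lambda>s. A (\<psi> s) - A (\<psi> t)) \<longlongrightarrow> 0) (at t within {0..T})"
    proof (rule Lim_null_comparison)
      let ?q = "\<lambda>s. (1 / (s - t)) *\<^sub>R (\<Psi> 0 s - \<Psi> 0 t) - \<Psi> (Suc 0) t"
      have "((\<lambda>s. \<bar>s - t\<bar> * (norm (A (?q s)) + norm (A (\<Psi> (Suc 0) t)))) \<longlongrightarrow> \<bar>t - t\<bar> * (0 + norm (A (\<Psi> (Suc 0) t)))) (at t within {0..T})"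
        by (intro tendsto_intros lim[OF t, of 0])
      then show "((\<lambda>s. \<bar>s - t\<bar> * (norm (A (?q s)) + norm (A (\<Psi> (Suc 0) t)))) \<longlongrightarrow> 0) (at t within {0..T})" by simp
      show "eventually (\<lambda>s. norm (A (\<psi> s) - A (\<psi> t)) \<le> \<bar>s - t\<bar> * (norm (A (?q s)) + norm (A (\<Psi> (Suc 0) t)))) (at t within {0..T})"
        unfolding eventually_at_filter
      proof (intro always_eventually allI impI)
        fix s assume s: "s \<noteq> t" "s \<in> {0..T}"
        have "\<psi> s - \<psi> t = (s - t) *\<^sub>R (?q s + \<Psi> (Suc 0) t)"
          using s \<Psi>0[OF t] \<Psi>0[OF s(2)] by simp
        then have "A (\<psi> s) - A (\<psi> t) = A ((s - t) *\<^sub>R (?q s + \<Psi> (Suc 0) t))"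
          using op_diff[of "\<psi> s" "\<psi> t"] \<Psi>D[OF t, of 0] \<Psi>D[OF s(2), of 0] \<Psi>0[OF t] \<Psi>0[OF s(2)] by simp
        also have "\<dots> = (s - t) *\<^sub>R (A (?q s) + A (\<Psi> (Suc 0) t))"
          unfolding op_scaleR[OF subspace_D(1)[OF qD[OF s(2) t, of 0] \<Psi>D[OF t, of "Suc 0"]]]
            op_add[OF qD[OF s(2) t, of 0] \<Psi>D[OF t, of "Suc 0"]] ..
        finally show "norm (A (\<psi> s) - A (\<psi> t)) \<le> \<bar>s - t\<bar> * (norm (A (?q s)) + norm (A (\<Psi> (Suc 0) t)))"
          by (simp add: mult_left_mono norm_triangle_ineq)
      qed
    qed
    then show "((\<lambda>t. A (\<psi> t)) \<longlongrightarrow> A (\<psi> t)) (at t within {0..T})" by (simp add: LIM_zero_cancel)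
  qed
  have "has_cont_derivative \<psi> (\<Psi> (Suc 0))"
    unfolding has_cont_derivative_def
  proof (intro conjI ballI)
    show "(\<psi> has_vector_derivative \<Psi> (Suc 0) t) (at t within {0..T})" if "t \<in> {0..T}" for t
      by (rule has_vector_derivative_transform[OF that _ der[OF that, of 0]]) (simp add: \<Psi>0)
    show "continuous_on {0..T} (\<Psi> (Suc 0))"
      using der[of _ "Suc 0"] has_vector_derivative_continuous continuous_on_eq_continuous_within by blast
  qed
  moreover have "\<psi> t \<in> D" if "t \<in> {0..T}" for t using \<Psi>D[OF that, of 0] \<Psi>0[OF that] by simp
  ultimately show ?thesis using that contA \<psi>T by blast
qed

text \<open>The derivative of the time-reversed function t \<mapsto> \<psi> (T - t), set to 0
  outside (0,T).\<close>

definition rev_deriv :: "(real \<Rightarrow> 'a) \<Rightarrow> real \<Rightarrow> 'a"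
  where "rev_deriv \<psi>' = cut T (\<lambda>t. - \<psi>' (T - t))"

text \<open>Since \<psi> vanishes at \<open>T\<close>, the reversed function starts from 0 and is
  the primitive of \<open>rev_deriv\<close>, without a boundary term.\<close>

lemma rev_deriv_facts:
  assumes d: "has_cont_derivative \<psi> \<psi>'" and \<psi>T: "\<psi> T = 0"
  shows "rev_deriv \<psi>' \<in> borel_measurable borel"
    and "\<exists>M\<ge>0. \<forall>t. norm (rev_deriv \<psi>' t) \<le> M"
    and "integrable lborel (cut T (rev_deriv \<psi>'))"
    and "0 < t \<Longrightarrow> t < T \<Longrightarrow> coord n (\<psi> (T - t)) = conv (frac_ker 1) (\<lambda>s. coord n (rev_deriv \<psi>' s)) t"
proof -
  have c: "continuous_on {0..T} (\<lambda>t. - \<psi>' (T - t))"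
  proof (rule continuous_on_minus, rule continuous_on_compose2[of "{0..T}" \<psi>' "{0..T}" "\<lambda>t. T - t"])
    show "continuous_on {0..T} \<psi>'" using d by (simp add: has_cont_derivative_def)
    show "continuous_on {0..T} (\<lambda>t. T - t)" by (intro continuous_intros)
  qed auto
  have "(\<lambda>t. indicator {0<..<T} t *\<^sub>R - \<psi>' (T - t)) \<in> borel_measurable borel"
    using c by (intro borel_measurable_continuous_on_indicator) (auto intro: continuous_on_subset)
  then show "rev_deriv \<psi>' \<in> borel_measurable borel" by (simp add: rev_deriv_def cut_def[abs_def])
  have "set_integrable lborel {0..T} (\<lambda>t. - \<psi>' (T - t))" by (rule borel_integrable_atLeastAtMost'[OF c])
  then have "set_integrable lborel {0<..<T} (\<lambda>t. - \<psi>' (T - t))" by (rule set_integrable_subset) auto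
  then show "integrable lborel (cut T (rev_deriv \<psi>'))"
    unfolding rev_deriv_def cut_cut by (simp add: cut_def[abs_def] set_integrable_def)
  have "compact ((\<lambda>t. - \<psi>' (T - t)) ` {0..T})" by (rule compact_continuous_image[OF c]) simp
  then obtain M where "\<forall>x\<in>(\<lambda>t. - \<psi>' (T - t)) ` {0..T}. norm x \<le> M" using compact_imp_bounded bounded_iff by metis
  then have M: "\<And>t. t \<in> {0..T} \<Longrightarrow> norm (- \<psi>' (T - t)) \<le> M" by blast
  have "norm (rev_deriv \<psi>' t) \<le> max 0 M" for t
    using M[of t] by (auto simp: rev_deriv_def cut_def indicator_def)
  then show "\<exists>M\<ge>0. \<forall>t. norm (rev_deriv \<psi>' t) \<le> M" by (intro exI[of _ "max 0 M"]) auto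
  assume t: "0 < t" "t < T"
  have "((\<lambda>s. coord n (- \<psi>' (T - s))) has_integral (coord n (\<psi> (T - t)) - coord n (\<psi> (T - 0)))) {0..t}"
  proof (rule fundamental_theorem_of_calculus)
    fix s assume s: "s \<in> {0..t}"
    have "(\<psi> \<circ> (\<lambda>s. T - s) has_vector_derivative (- 1) *\<^sub>R \<psi>' (T - s)) (at s within {0..t})"
    proof (rule vector_diff_chain_within)
      show "((\<lambda>s. T - s) has_vector_derivative - 1) (at s within {0..t})" by (auto intro!: derivative_eq_intros)
      have "(\<psi> has_vector_derivative \<psi>' (T - s)) (at (T - s) within {0..T})"
        using d s t by (auto simp: has_cont_derivative_def)
      then show "(\<psi> has_vector_derivative \<psi>' (T - s)) (at (T - s) within (\<lambda>s. T - s) ` {0..t})"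
        by (rule has_vector_derivative_within_subset) (use t in auto)
    qed
    then show "((\<lambda>s. coord n (\<psi> (T - s))) has_vector_derivative coord n (- \<psi>' (T - s))) (at s within {0..t})"
      using bounded_linear.has_vector_derivative[OF bounded_linear_coord] unfolding o_def by fastforce
  qed (use t in auto)
  then have "integral {0..t} (\<lambda>s. coord n (- \<psi>' (T - s))) = coord n (\<psi> (T - t)) - coord n (\<psi> (T - 0))"
    by (rule integral_unique)
  then have I: "integral {0..t} (\<lambda>s. coord n (- \<psi>' (T - s))) = coord n (\<psi> (T - t))"
    by (simp only: diff_zero \<psi>T coord_simps(6))
  have cc: "continuous_on {0..t} (\<lambda>s. coord n (- \<psi>' (T - s)))"
    using c t by (intro bounded_linear.continuous_on[OF bounded_linear_coord]) (auto intro: continuous_on_subset)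
  have si: "set_integrable lborel {0..t} (\<lambda>s. coord n (- \<psi>' (T - s)))" by (rule borel_integrable_atLeastAtMost'[OF cc])
  have "conv (frac_ker 1) (\<lambda>s. coord n (rev_deriv \<psi>' s)) t = (LINT s:{0<..<t}|lborel. coord n (- \<psi>' (T - s)))"
    unfolding conv_frac_ker_1 using t by (intro set_lebesgue_integral_cong) (auto simp: rev_deriv_def cut_def)
  also have "\<dots> = (LINT s:{0..t}|lborel. coord n (- \<psi>' (T - s)))"
  proof (rule set_integral_cong_set)
    show "AE s in lborel. (s \<in> {0..t}) = (s \<in> {0<..<t})"
      using AE_lborel_singleton[of 0] AE_lborel_singleton[of t] by eventually_elim auto
    show "set_borel_measurable lborel {0..t} (\<lambda>s. coord n (- \<psi>' (T - s)))"
      using si unfolding set_integrable_def set_borel_measurable_def by (rule borel_measurable_integrable)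
    show "set_borel_measurable lborel {0<..<t} (\<lambda>s. coord n (- \<psi>' (T - s)))"
    proof -
      have "set_integrable lborel {0<..<t} (\<lambda>s. coord n (- \<psi>' (T - s)))" by (rule set_integrable_subset[OF si]) auto
      then show ?thesis unfolding set_integrable_def set_borel_measurable_def by (rule borel_measurable_integrable)
    qed
  qed
  also have "\<dots> = coord n (\<psi> (T - t))" unfolding I[symmetric] by (rule set_borel_integral_eq_integral(2)[OF si])
  finally show "coord n (\<psi> (T - t)) = conv (frac_ker 1) (\<lambda>s. coord n (rev_deriv \<psi>' s)) t" by simp
qed

lemma frac_integral_bounded:
  assumes v [measurable]: "v \<in> borel_measurable borel" and M: "0 \<le> M" "\<And>t. norm (v t) \<le> M" and a: "0 < a"
  shows "cut T (frac_integral a v) \<in> borel_measurable borel"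
    and "\<And>t. 0 < t \<Longrightarrow> t < T \<Longrightarrow> norm (frac_integral a v t) \<le> M * (LINT s:{0<..<T}|lborel. s powr (a - 1)) / Gamma a"
proof -
  have G: "Gamma a > 0" using a by (rule Gamma_real_pos)
  \<comment> \<open>The integral over the moving interval is rewritten with a conditional that is
    jointly measurable in both variables, so measurability in \<open>t\<close> follows
    automatically.\<close>
  have "cut T (frac_integral a v) = (\<lambda>t. indicator {0<..<T} t *\<^sub>R
    ((1 / Gamma a) *\<^sub>R (LINT s|lborel. (if 0 < s \<and> s < t then (t - s) powr (a - 1) *\<^sub>R v s else 0))))"
    unfolding cut_def frac_integral_def set_lebesgue_integral_def fun_eq_iff
    by (intro allI arg_cong2[where f=scaleR] refl Bochner_Integration.integral_cong) (auto simp: indicator_def)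
  then show "cut T (frac_integral a v) \<in> borel_measurable borel" by simp
  fix t assume t: "0 < t" "t < T"
  have "norm (LINT s:{0<..<t}|lborel. (t - s) powr (a - 1) *\<^sub>R v s) \<le> (LINT s:{0<..<t}|lborel. (t - s) powr (a - 1) * M)"
  proof -
    have i: "set_integrable lborel {0<..<t} (\<lambda>s. (t - s) powr (a - 1) * M)"
      by (intro set_integrable_mult_left set_integrable_powr_from_0 a)
    have i2: "set_integrable lborel {0<..<t} (\<lambda>s. (t - s) powr (a - 1) *\<^sub>R v s)"
      by (rule set_integrable_dominated[OF i]) (use M in \<open>auto simp: set_borel_measurable_def intro!: mult_left_mono\<close>)
    have "norm (LINT s:{0<..<t}|lborel. (t - s) powr (a - 1) *\<^sub>R v s) \<le> (LINT s:{0<..<t}|lborel. norm ((t - s) powr (a - 1) *\<^sub>R v s))"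
      by (rule set_integral_norm_bound[OF i2])
    also have "\<dots> \<le> (LINT s:{0<..<t}|lborel. (t - s) powr (a - 1) * M)"
      using M by (intro set_integral_mono set_integrable_norm i i2) (auto intro!: mult_left_mono)
    finally show ?thesis .
  qed
  also have "\<dots> = Gamma a * cmod (conv (frac_ker a) (\<lambda>_. of_real M) t)"
  proof -
    have "conv (frac_ker a) (\<lambda>_. of_real M) t = (LINT s:{0<..<t}|lborel. complex_of_real (1 / Gamma a * ((t - s) powr (a - 1) * M)))"
      unfolding conv_def frac_ker_def by (rule set_lebesgue_integral_cong) auto
    also have "\<dots> = of_real (1 / Gamma a * (LINT s:{0<..<t}|lborel. (t - s) powr (a - 1) * M))"
      unfolding set_integral_complex_of_real set_integral_mult_right ..
    finally have "conv (frac_ker a) (\<lambda>_. of_real M) t = of_real (1 / Gamma a * (LINT s:{0<..<t}|lborel. (t - s) powr (a - 1) * M))" .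
    moreover have "0 \<le> (LINT s:{0<..<t}|lborel. (t - s) powr (a - 1) * M)"
      unfolding set_lebesgue_integral_def using M by (intro Bochner_Integration.integral_nonneg) (auto simp: indicator_def)
    ultimately show ?thesis using G by (simp add: norm_divide del: of_real_mult of_real_divide)
  qed
  also have "cmod (conv (frac_ker a) (\<lambda>_. of_real M) t) \<le> M * (LINT s:{0<..<T}|lborel. s powr (a - 1)) / Gamma a"
    using M t a by (intro frac_ker_conv_bound) auto
  finally have "norm (LINT s:{0<..<t}|lborel. (t - s) powr (a - 1) *\<^sub>R v s) \<le> Gamma a * (M * (LINT s:{0<..<T}|lborel. s powr (a - 1)) / Gamma a)"
    using G by (simp add: mult_left_mono)
  then show "norm (frac_integral a v t) \<le> M * (LINT s:{0<..<T}|lborel. s powr (a - 1)) / Gamma a"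
    unfolding frac_integral_def using G by (simp add: field_simps)
qed

text \<open>The reversed test function is J^1 \<xi> = J^\<alpha> (J^(1 - \<alpha>) \<xi>), so by
  injectivity of J^\<alpha> its fractional derivative is J^(1 - \<alpha>) \<xi>. This is the Caputo
  form of the derivative; it is bounded because \<xi> is.\<close>

lemma frac_deriv_adj_test:
  assumes d: "has_cont_derivative \<psi> \<psi>'" and \<psi>T: "\<psi> T = 0" and q: "1 \<le> q"
  defines "\<xi> \<equiv> rev_deriv \<psi>'"
  shows "cut T (frac_deriv_adj \<alpha> q T \<psi>) \<in> borel_measurable borel"
    and "\<exists>M. AE t in lborel. norm (cut T (frac_deriv_adj \<alpha> q T \<psi>) t) \<le> M"
    and "AE t in lborel. 0 < t \<and> t < T \<longrightarrow> (\<forall>n. coord n (frac_deriv_adj \<alpha> q T \<psi> t) = conv (frac_ker (1 - \<alpha>)) (\<lambda>s. coord n (\<xi> s)) (T - t))"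
proof -
  note facts = rev_deriv_facts[OF d \<psi>T, folded \<xi>_def]
  obtain M where M: "0 \<le> M" "\<And>t. norm (\<xi> t) \<le> M" using facts(2) by blast
  have a: "0 < 1 - \<alpha>" using \<alpha> by simp
  define w where "w = frac_integral (1 - \<alpha>) \<xi>"
  define M' where "M' = M * (LINT s:{0<..<T}|lborel. s powr (1 - \<alpha> - 1)) / Gamma (1 - \<alpha>)"
  note wb = frac_integral_bounded[OF facts(1) M a, folded w_def]
  have wM: "norm (cut T w t) \<le> \<bar>M'\<bar>" for t
  proof (cases "0 < t \<and> t < T")
    case True
    then have "norm (w t) \<le> M'" unfolding M'_def by (intro wb(2)) auto
    then show ?thesis using True by (simp add: cut_def indicator_def)
  qed (simp add: cut_def)
  have wL: "w \<in> Lp_space q T"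
  proof -
    have "Lp_mass q T w \<le> (\<integral>\<^sup>+t. ennreal (\<bar>M'\<bar> powr q) * indicator {0<..<T} t \<partial>lborel)"
      unfolding Lp_mass_def
    proof (rule nn_integral_mono)
      fix t
      show "ennreal (norm (cut T w t) powr q) \<le> ennreal (\<bar>M'\<bar> powr q) * indicator {0<..<T} t"
        using wM[of t] q by (cases "t \<in> {0<..<T}") (auto simp: cut_def intro!: ennreal_leI powr_mono2)
    qed
    also have "\<dots> < \<infinity>" using T by (subst nn_integral_cmult_indicator) (auto simp: ennreal_mult_less_top)
    finally show ?thesis using wb(1) by (simp add: Lp_space_iff)
  qed
  have wi: "integrable lborel (cut T w)" by (rule Lp_L1[OF wL q T])
  have wc: "AE t in lborel. 0 < t \<and> t < T \<longrightarrow> (\<forall>n. coord n (w t) = conv (frac_ker (1 - \<alpha>)) (\<lambda>s. coord n (\<xi> s)) t)"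
    unfolding w_def by (rule coord_frac_integral[OF facts(3) a])
  have "AE t in lborel. 0 < t \<and> t < T \<longrightarrow> coord n (time_reversal T \<psi> t) = coord n (frac_integral \<alpha> w t)" for n
  proof -
    have L: "L1_on T (\<lambda>s. coord n (\<xi> s))" by (rule L1_on_coord[OF facts(3)])
    have "AE t in lborel. 0 < t \<and> t < T \<longrightarrow> conv (frac_ker \<alpha>) (\<lambda>s. coord n (w s)) t = conv (frac_ker \<alpha>) (conv (frac_ker (1 - \<alpha>)) (\<lambda>s. coord n (\<xi> s))) t"
    proof (rule always_eventually, intro allI impI, rule conv_cong_AE[where T=T])
      show "AE s in lborel. 0 < s \<and> s < T \<longrightarrow> coord n (w s) = conv (frac_ker (1 - \<alpha>)) (\<lambda>s. coord n (\<xi> s)) s"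
        using wc by eventually_elim auto
    qed (use \<alpha> in \<open>auto intro!: cut_borel L1_on_conv L1_on_frac_ker L L1_on_coord wi\<close>)
    then show ?thesis
      using conv_frac_ker_compose[OF \<alpha> L] coord_frac_integral[OF wi \<alpha>(1)]
      by eventually_elim (auto simp: time_reversal_def facts(4))
  qed
  then have "AE t in lborel. \<forall>n. 0 < t \<and> t < T \<longrightarrow> coord n (time_reversal T \<psi> t) = coord n (frac_integral \<alpha> w t)"
    by (subst AE_all_countable) blast
  then have rep: "AE t in lborel. 0 < t \<and> t < T \<longrightarrow> time_reversal T \<psi> t = frac_integral \<alpha> w t"
    by eventually_elim (auto intro: coord_eqI)
  note fd = frac_deriv_eq[OF wL rep \<alpha> T q]
  define F where "F = frac_deriv \<alpha> q T (time_reversal T \<psi>)"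
  have adj: "frac_deriv_adj \<alpha> q T \<psi> t = F (T - t)" for t by (simp add: frac_deriv_adj_def time_reversal_def F_def)
  have cutadj: "cut T (frac_deriv_adj \<alpha> q T \<psi>) t = cut T F (T - t)" for t
    by (auto simp: cut_def adj indicator_def)
  have [measurable]: "cut T F \<in> borel_measurable borel" using fd(1) by (simp add: Lp_space_iff F_def)
  show "cut T (frac_deriv_adj \<alpha> q T \<psi>) \<in> borel_measurable borel"
    unfolding cutadj[abs_def] by measurable
  have "AE t in lborel. norm (cut T F t) \<le> \<bar>M'\<bar>"
    using fd(2)
  proof eventually_elim
    case (elim t)
    then have "cut T F t = cut T w t" by (auto simp: F_def cut_def indicator_def)
    then show ?case using wM[of t] by simp
  qed
  then have "AE t in lborel. norm (cut T (frac_deriv_adj \<alpha> q T \<psi>) t) \<le> \<bar>M'\<bar>"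
    unfolding cutadj by (rule AE_reflect)
  then show "\<exists>M. AE t in lborel. norm (cut T (frac_deriv_adj \<alpha> q T \<psi>) t) \<le> M" by blast
  have "AE t in lborel. 0 < t \<and> t < T \<longrightarrow> (\<forall>n. coord n (F t) = conv (frac_ker (1 - \<alpha>)) (\<lambda>s. coord n (\<xi> s)) t)"
    using fd(2) wc by eventually_elim (simp add: F_def)
  from AE_reflect[OF this, of T]
  show "AE t in lborel. 0 < t \<and> t < T \<longrightarrow> (\<forall>n. coord n (frac_deriv_adj \<alpha> q T \<psi> t) = conv (frac_ker (1 - \<alpha>)) (\<lambda>s. coord n (\<xi> s)) (T - t))"
    by eventually_elim (auto simp: adj)
qed

end

section \<open>Weak solutions\<close>

lemma conv_1_cancel:
  assumes T: "0 < T" and h: "L1_on T h1" "L1_on T h2"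
    and e: "AE t in lborel. 0 < t \<and> t < T \<longrightarrow> conv (frac_ker 1) h1 t = conv (frac_ker 1) h2 t"
  shows "AE t in lborel. 0 < t \<and> t < T \<longrightarrow> h1 t = h2 t"
proof -
  have "L1_on T (\<lambda>s. h1 s + (- 1) * h2 s)" using h by (auto simp: L1_on_set)
  moreover have "AE t in lborel. 0 < t \<and> t < T \<longrightarrow> conv (frac_ker 1) (\<lambda>s. h1 s + (- 1) * h2 s) t = conv (frac_ker 1) h1 t + (- 1) * conv (frac_ker 1) h2 t"
    using h by (intro conv_linear L1_on_frac_ker) auto
  then have "AE t in lborel. 0 < t \<and> t < T \<longrightarrow> conv (frac_ker 1) (\<lambda>s. h1 s + (- 1) * h2 s) t = 0"
    using e by eventually_elim simp
  ultimately have "AE t in lborel. 0 < t \<and> t < T \<longrightarrow> h1 t + (- 1) * h2 t = 0" using conv_1_eq_zero[OF _ T] by blast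
  then show ?thesis by eventually_elim simp
qed

lemma integrable_times_bounded:
  fixes a b :: "real \<Rightarrow> complex"
  assumes "integrable lborel a" "b \<in> borel_measurable borel" "\<And>t. cmod (b t) \<le> M"
  shows "integrable lborel (\<lambda>t. a t * b t)"
proof (rule Bochner_Integration.integrable_bound)
  show "integrable lborel (\<lambda>t. M * norm (a t))" using assms by simp
  show "AE t in lborel. norm (a t * b t) \<le> norm (M * norm (a t))"
  proof (intro always_eventually allI)
    fix t
    have "cmod (b t) \<le> \<bar>M\<bar>" using assms(3)[of t] by simp
    then show "norm (a t * b t) \<le> norm (M * norm (a t))" using mult_left_mono[of "cmod (b t)" "\<bar>M\<bar>" "cmod (a t)"]
      by (simp add: norm_mult abs_mult mult.commute)
  qed
qed (use assms in \<open>auto dest: borel_measurable_integrable\<close>)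

lemma borel_measurable_cnj [measurable]:
  "f \<in> borel_measurable M \<Longrightarrow> (\<lambda>x. cnj (f x)) \<in> borel_measurable M"
proof -
  have "cnj \<in> borel_measurable borel"
    by (intro borel_measurable_continuous_onI continuous_on_cnj continuous_on_id)
  then show "f \<in> borel_measurable M \<Longrightarrow> (\<lambda>x. cnj (f x)) \<in> borel_measurable M"
    by (rule measurable_compose[rotated])
qed

context hilbert_basis
begin

text \<open>Dominated convergence for the partial sums: since \<open>partial N\<close> is a
  contraction, the product of the norms dominates all of them.\<close>

lemma LINT_cinner:
  assumes [measurable]: "a \<in> borel_measurable borel" "b \<in> borel_measurable borel"
    and i: "integrable lborel (\<lambda>t. norm (a t) * norm (b t))"
  shows "(\<lambda>n. LINT t|lborel. coord n (a t) * cnj (coord n (b t))) sums (LINT t|lborel. cinner (a t) (b t))"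
    and "integrable lborel (\<lambda>t. cinner (a t) (b t))"
    and "integrable lborel (\<lambda>t. coord n (a t) * cnj (coord n (b t)))"
proof -
  show ci: "integrable lborel (\<lambda>t. coord n (a t) * cnj (coord n (b t)))" for n
    by (rule Bochner_Integration.integrable_bound[OF i])
      (auto simp: norm_mult intro!: mult_mono norm_coord)
  show "integrable lborel (\<lambda>t. cinner (a t) (b t))"
    by (rule Bochner_Integration.integrable_bound[OF i]) (auto intro: order_trans[OF Cauchy_Schwarz_cinner])
  have e: "cinner (partial N (a t)) (b t) = (\<Sum>n<N. coord n (a t) * cnj (coord n (b t)))" for N t
  proof -
    have "cinner (\<phi> n) (b t) = cnj (coord n (b t))" for n unfolding coord_def by (rule cinner_commute)
    then show ?thesis by (simp add: partial_def cinner_sum_left cinner_scaleC_left)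
  qed
  have "(\<lambda>N. LINT t|lborel. (\<Sum>n<N. coord n (a t) * cnj (coord n (b t)))) \<longlonglongrightarrow> (LINT t|lborel. cinner (a t) (b t))"
  proof (rule integral_dominated_convergence[OF _ _ i])
    show "AE t in lborel. (\<lambda>N. \<Sum>n<N. coord n (a t) * cnj (coord n (b t))) \<longlonglongrightarrow> cinner (a t) (b t)"
      using cinner_sums by (intro always_eventually allI) (simp add: sums_def)
    show "AE t in lborel. norm (\<Sum>n<N. coord n (a t) * cnj (coord n (b t))) \<le> norm (a t) * norm (b t)" for N
      unfolding e[symmetric]
      by (intro always_eventually allI order_trans[OF Cauchy_Schwarz_cinner] mult_right_mono norm_partial) auto
  qed measurable
  then show "(\<lambda>n. LINT t|lborel. coord n (a t) * cnj (coord n (b t))) sums (LINT t|lborel. cinner (a t) (b t))"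
    unfolding sums_def by (subst (asm) Bochner_Integration.integral_sum) (use ci in auto)
qed

end

section \<open>Weak solutions are determined mode by mode\<close>

context diffusion
begin

definition poly_test :: "nat \<Rightarrow> nat \<Rightarrow> real \<Rightarrow> 'a"
  where "poly_test n m t = ((T - t) ^ Suc m) *\<^sub>R \<phi> n"

lemma norm_op_basis: "norm (A (c *\<^sub>R \<phi> n)) = \<bar>c\<bar> * \<mu> n"
  using op_scaleR[OF basis_in_domain, of c n] \<mu>_pos[of n] by (simp add: eigen abs_mult)

lemma poly_test_function: "poly_test n m \<in> test_functions T D A"
proof -
  define P where "P = [:T, - 1:] ^ Suc m"
  define \<Psi> where "\<Psi> k t = poly ((pderiv ^^ k) P) t *\<^sub>R \<phi> n" for k t
  have "\<Psi> 0 t = poly_test n m t" for t by (simp add: \<Psi>_def P_def poly_test_def poly_power del: power_Suc)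
  moreover have "\<Psi> k t \<in> D" for k t unfolding \<Psi>_def by (intro subspace_D basis_in_domain)
  moreover have "((\<lambda>s. norm (A ((1 / (s - t)) *\<^sub>R (\<Psi> k s - \<Psi> k t) - \<Psi> (Suc k) t))) \<longlongrightarrow> 0) (at t within {0..T})" for k t
  proof -
    let ?p = "(pderiv ^^ k) P"
    have "(poly ?p has_field_derivative poly (pderiv ?p) t) (at t within {0..T})"
      using poly_DERIV[of ?p t] by (rule has_field_derivative_at_within)
    then have "((\<lambda>s. (poly ?p s - poly ?p t) / (s - t)) \<longlongrightarrow> poly (pderiv ?p) t) (at t within {0..T})"
      by (simp add: has_field_derivative_iff)
    then have "((\<lambda>s. \<bar>(poly ?p s - poly ?p t) / (s - t) - poly (pderiv ?p) t\<bar> * \<mu> n) \<longlongrightarrow> \<bar>poly (pderiv ?p) t - poly (pderiv ?p) t\<bar> * \<mu> n) (at t within {0..T})"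
      by (intro tendsto_intros)
    moreover have "norm (A ((1 / (s - t)) *\<^sub>R (\<Psi> k s - \<Psi> k t) - \<Psi> (Suc k) t)) = \<bar>(poly ?p s - poly ?p t) / (s - t) - poly (pderiv ?p) t\<bar> * \<mu> n" for s
    proof -
      have "(1 / (s - t)) *\<^sub>R (\<Psi> k s - \<Psi> k t) - \<Psi> (Suc k) t = ((poly ?p s - poly ?p t) / (s - t) - poly (pderiv ?p) t) *\<^sub>R \<phi> n"
        by (simp add: \<Psi>_def scaleR_diff_left diff_divide_distrib scaleR_diff_right)
      then show ?thesis by (simp only: norm_op_basis)
    qed
    ultimately show ?thesis by simp
  qed
  ultimately have "smooth_domain_valued T D A (poly_test n m)" unfolding smooth_domain_valued_def by blast
  then show ?thesis by (simp add: test_functions_def poly_test_def)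
qed

lemma poly_test_derivative:
  "has_cont_derivative (poly_test n m) (\<lambda>t. (- (real (Suc m) * (T - t) ^ m)) *\<^sub>R \<phi> n)"
  unfolding has_cont_derivative_def poly_test_def
proof (intro conjI ballI)
  fix t
  have "((\<lambda>t. (T - t) ^ Suc m) has_field_derivative - (real (Suc m) * (T - t) ^ m)) (at t within {0..T})"
    by (auto intro!: derivative_eq_intros simp del: power_Suc)
  then show "((\<lambda>t. (T - t) ^ Suc m *\<^sub>R \<phi> n) has_vector_derivative (- (real (Suc m) * (T - t) ^ m)) *\<^sub>R \<phi> n) (at t within {0..T})"
    by (rule has_vector_derivative_scaleR[of _ _ t "{0..T}" "\<lambda>_. \<phi> n" 0, simplified])
qed (intro continuous_intros)

lemma weak_mode_equation:
  assumes f: "f \<in> Lp_space p T" and u: "weak_solution \<alpha> p T D A f u"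
  shows "(LINT t:{0<..<T}|lborel. coord n (u t) * conv (\<lambda>s. frac_ker (1 - \<alpha>) s + (\<i> * of_real (\<mu> n)) * frac_ker 1 s) (\<lambda>s. of_real (real (Suc m) * s ^ m)) (T - t))
    = (LINT t:{0<..<T}|lborel. coord n (f t) * conv (frac_ker 1) (\<lambda>s. of_real (real (Suc m) * s ^ m)) (T - t))"
proof -
  define w :: "real \<Rightarrow> complex" where "w s = of_real (real (Suc m) * s ^ m)" for s
  define q where "q = conjugate_exponent p"
  have q: "1 \<le> q" using p by (simp add: q_def conjugate_exponent_def)
  have uL: "u \<in> Lp_space p T" using u by (simp add: weak_solution_def)
  have [measurable]: "cut T u \<in> borel_measurable borel" "cut T f \<in> borel_measurable borel"
    using uL f by (auto simp: Lp_space_iff)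
  let ?\<psi> = "poly_test n m"
  have \<psi>T: "?\<psi> T = 0" by (simp add: poly_test_def)
  define \<xi> where "\<xi> = rev_deriv (\<lambda>t. (- (real (Suc m) * (T - t) ^ m)) *\<^sub>R \<phi> n)"
  note rd = rev_deriv_facts[OF poly_test_derivative[of n m] \<psi>T, folded \<xi>_def]
    and fd = frac_deriv_adj_test[OF poly_test_derivative[of n m] \<psi>T q, folded \<xi>_def]
  let ?fd = "frac_deriv_adj \<alpha> q T ?\<psi>"
  have \<xi>: "coord k (\<xi> s) = (if k = n then w s else 0)" if "0 < s" "s < T" for k s
    using that by (simp add: \<xi>_def rev_deriv_def cut_def coord_simps coord_basis w_def)
  have cx: "conv a (\<lambda>s. coord k (\<xi> s)) t = (if k = n then conv a w t else 0)" if "t < T" for a k t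
  proof -
    have "conv a (\<lambda>s. coord k (\<xi> s)) t = conv a (\<lambda>s. if k = n then w s else 0) t"
      by (rule conv_cong[where T=T]) (use \<xi> that in auto)
    then show ?thesis by (auto simp: conv_def set_lebesgue_integral_def)
  qed
  have Lw: "L1_on T w"
    unfolding L1_on_set w_def
    by (rule set_integrable_subset[OF borel_integrable_atLeastAtMost'[of 0 T]]) (auto intro!: continuous_intros)
  have lin: "AE t in lborel. 0 < t \<and> t < T \<longrightarrow>
    conv (\<lambda>s. frac_ker (1 - \<alpha>) s + (\<i> * of_real (\<mu> n)) * frac_ker 1 s) w (T - t)
    = conv (frac_ker (1 - \<alpha>)) w (T - t) + (\<i> * of_real (\<mu> n)) * conv (frac_ker 1) w (T - t)"
  proof -
    have "AE t in lborel. 0 < t \<and> t < T \<longrightarrow>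
      conv w (\<lambda>s. frac_ker (1 - \<alpha>) s + (\<i> * of_real (\<mu> n)) * frac_ker 1 s) t
      = conv w (frac_ker (1 - \<alpha>)) t + (\<i> * of_real (\<mu> n)) * conv w (frac_ker 1) t"
      using \<alpha> by (intro conv_linear Lw L1_on_frac_ker) auto
    from AE_reflect[OF this, of T] show ?thesis
      by eventually_elim (auto simp: conv_commute[of w])
  qed
  have c1: "conv (frac_ker 1) w t = of_real (t ^ Suc m)" if "0 < t" "t < T" for t
    using rd(4)[OF that, of n] that by (simp add: cx poly_test_def coord_simps coord_basis)
  have A\<psi>: "A (?\<psi> t) = - ((\<mu> n * (T - t) ^ Suc m) *\<^sub>R \<phi> n)" for t
    using op_scaleR[OF basis_in_domain, of "(T - t) ^ Suc m" n] by (simp add: poly_test_def eigen mult.commute)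
  have single: "cinner x y = coord n x * cnj (coord n y)" if "\<And>k. k \<noteq> n \<Longrightarrow> coord k y = 0" for x y
  proof -
    have "(\<lambda>k. coord k x * cnj (coord k y)) = (\<lambda>k. if k = n then coord k x * cnj (coord k y) else 0)"
      using that by auto
    then have "(\<lambda>k. coord k x * cnj (coord k y)) sums (coord n x * cnj (coord n y))"
      using sums_single[of n "\<lambda>k. coord k x * cnj (coord k y)"] by (simp only:)
    then show ?thesis using cinner_sums[of x y] sums_unique2 by blast
  qed
  have lhs: "(LINT t|interval_lborel T. cinner (u t) (?fd t + \<i> *\<^sub>C A (?\<psi> t)))
    = (LINT t:{0<..<T}|lborel. coord n (u t) * conv (\<lambda>s. frac_ker (1 - \<alpha>) s + (\<i> * of_real (\<mu> n)) * frac_ker 1 s) w (T - t))"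
    unfolding integral_interval set_lebesgue_integral_def
  proof (rule integral_cong_AE)
    show "AE t in lborel. cut T (\<lambda>t. cinner (u t) (?fd t + \<i> *\<^sub>C A (?\<psi> t))) t
      = indicator {0<..<T} t *\<^sub>R (coord n (u t) * conv (\<lambda>s. frac_ker (1 - \<alpha>) s + (\<i> * of_real (\<mu> n)) * frac_ker 1 s) w (T - t))"
      using fd(3) lin
    proof eventually_elim
      case (elim t)
      show ?case
      proof (cases "0 < t \<and> t < T")
        case True
        let ?y = "?fd t + \<i> *\<^sub>C A (?\<psi> t)"
        \<comment> \<open>The minus sign here becomes a plus in the mode equation, because the inner
          product conjugates its second argument.\<close>
        have y: "coord k ?y = (if k = n then conv (frac_ker (1 - \<alpha>)) w (T - t) - \<i> * of_real (\<mu> n) * conv (frac_ker 1) w (T - t) else 0)" for k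
          using elim True by (simp add: coord_simps A\<psi> cx coord_basis c1)
        have "cinner (u t) ?y = coord n (u t) * cnj (coord n ?y)" by (rule single) (simp add: y)
        moreover have "cnj (conv (frac_ker a) w (T - t)) = conv (frac_ker a) w (T - t)" for a
        proof -
          have cw: "(\<lambda>s. cnj (w s)) = w" by (simp add: fun_eq_iff w_def)
          have cf: "(\<lambda>s. cnj (frac_ker a s)) = frac_ker a" by (rule ext) (rule cnj_frac_ker)
          show ?thesis using conv_cnj[of "frac_ker a" w "T - t"] unfolding cw cf by (rule sym)
        qed
        ultimately show ?thesis using elim True by (simp add: cut_def y)
      qed (auto simp: cut_def)
    qed
    have "cut T (\<lambda>t. cinner (u t) (?fd t + \<i> *\<^sub>C A (?\<psi> t))) = (\<lambda>t. cinner (cut T u t) (cut T ?fd t - \<i> *\<^sub>C ((\<mu> n * (T - t) ^ Suc m) *\<^sub>R \<phi> n)))"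
      by (auto simp: fun_eq_iff cut_def indicator_def A\<psi> linear_neg[OF bounded_linear.linear[OF bounded_linear_scaleC]] simp del: power_Suc)
    then show "cut T (\<lambda>t. cinner (u t) (?fd t + \<i> *\<^sub>C A (?\<psi> t))) \<in> borel_measurable lborel"
      using fd(1) by simp
    have "L1_on T (conv (\<lambda>s. frac_ker (1 - \<alpha>) s + (\<i> * of_real (\<mu> n)) * frac_ker 1 s) w)"
    proof (intro L1_on_conv Lw)
      show "L1_on T (\<lambda>s. frac_ker (1 - \<alpha>) s + (\<i> * of_real (\<mu> n)) * frac_ker 1 s)"
        using L1_on_frac_ker[of "1 - \<alpha>" T] L1_on_frac_ker[of 1 T] \<alpha> by (auto simp: L1_on_set)
    qed
    then have [measurable]: "cut T (conv (\<lambda>s. frac_ker (1 - \<alpha>) s + (\<i> * of_real (\<mu> n)) * frac_ker 1 s) w) \<in> borel_measurable borel"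
      by (rule cut_borel)
    have "(\<lambda>t. indicator {0<..<T} t *\<^sub>R (coord n (u t) * conv (\<lambda>s. frac_ker (1 - \<alpha>) s + (\<i> * of_real (\<mu> n)) * frac_ker 1 s) w (T - t)))
      = (\<lambda>t. coord n (cut T u t) * cut T (conv (\<lambda>s. frac_ker (1 - \<alpha>) s + (\<i> * of_real (\<mu> n)) * frac_ker 1 s) w) (T - t))"
      by (auto simp: fun_eq_iff cut_def indicator_def coord_simps)
    then show "(\<lambda>t. indicator {0<..<T} t *\<^sub>R (coord n (u t) * conv (\<lambda>s. frac_ker (1 - \<alpha>) s + (\<i> * of_real (\<mu> n)) * frac_ker 1 s) w (T - t))) \<in> borel_measurable lborel"
      by simp
  qed
  have rhs: "(LINT t|interval_lborel T. cinner (f t) (?\<psi> t)) = (LINT t:{0<..<T}|lborel. coord n (f t) * conv (frac_ker 1) w (T - t))"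
    unfolding integral_interval set_lebesgue_integral_def
  proof (rule Bochner_Integration.integral_cong[OF refl])
    fix t
    show "cut T (\<lambda>t. cinner (f t) (?\<psi> t)) t = indicator {0<..<T} t *\<^sub>R (coord n (f t) * conv (frac_ker 1) w (T - t))"
      by (auto simp: cut_def indicator_def c1 poly_test_def cinner_scaleR_right coord_def simp del: power_Suc)
  qed
  have "(LINT t|interval_lborel T. cinner (u t) (?fd t + \<i> *\<^sub>C A (?\<psi> t))) = (LINT t|interval_lborel T. cinner (f t) (?\<psi> t))"
    using u poly_test_function[of n m] unfolding weak_solution_def q_def by blast
  then show ?thesis unfolding lhs rhs w_def .
qed

text \<open>Transposition puts the kernels back on the coordinates, and the weak equation says that
  all moments of J^(1 - \<alpha>) u + \<i> \<mu> J^1 u - J^1 f vanish. Applying J^\<alpha> makes J^1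
  a common factor; cancelling it leaves the Volterra equation u + \<i> \<mu> J^\<alpha> u =
  J^\<alpha> f, which \<open>mode_unique\<close> solves.\<close>

lemma weak_solution_mode:
  assumes f: "f \<in> Lp_space p T" and u: "weak_solution \<alpha> p T D A f u"
  shows "AE t in lborel. 0 < t \<and> t < T \<longrightarrow> coord n (u t) = mode f n t"
proof -
  have uL: "u \<in> Lp_space p T" using u by (simp add: weak_solution_def)
  have p1: "1 \<le> p" using p by simp
  define un where "un = (\<lambda>t. coord n (u t))"
  define fn where "fn = (\<lambda>t. coord n (f t))"
  have L: "L1_on T un" "L1_on T fn" unfolding un_def fn_def by (intro L1_on_coord Lp_L1[OF _ p1 T] uL f)+
  note k = L1_on_frac_ker[OF \<alpha>(1), of T] L1_on_frac_ker[of "1 - \<alpha>" T] L1_on_frac_ker[of 1 T]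
  let ?c = "\<i> * of_real (\<mu> n)"
  define a where "a = (\<lambda>s. frac_ker (1 - \<alpha>) s + ?c * frac_ker 1 s)"
  have aL: "L1_on T a" unfolding a_def using k \<alpha> by (auto simp: L1_on_set)
  define H where "H t = conv a un t + (- 1) * conv (frac_ker 1) fn t" for t
  have HL: "L1_on T H" unfolding H_def using L1_on_conv[OF aL L(1)] L1_on_conv[OF k(3) L(2)] by (auto simp: L1_on_set)
  have "AE t in lborel. 0 < t \<and> t < T \<longrightarrow> H t = 0"
  proof (rule moments_zero[OF HL T])
    fix k0
    \<comment> \<open>The moment of order \<open>Suc k0\<close> belongs to the test polynomial of
      degree one higher, because \<open>w\<close> is the derivative of a power.\<close>
    define m where "m = Suc k0"
    define w :: "real \<Rightarrow> complex" where "w s = of_real (real (Suc m) * s ^ m)" for s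
    have wm: "cut T w \<in> borel_measurable borel" unfolding cut_def w_def by measurable
    have wb: "cmod (w t) \<le> real (Suc m) * T ^ m" if "0 < t" "t < T" for t
      using that power_mono[of t T m] by (auto simp: w_def norm_mult norm_power simp del: of_nat_Suc intro!: mult_left_mono)
    have int: "set_integrable lborel {0<..<T} (\<lambda>t. conv b h t * w (T - t))" if "L1_on T b" "L1_on T h" for b h
    proof -
      have "integrable lborel (\<lambda>t. cut T (conv b h) t * cut T w (T - t))"
      proof (rule integrable_times_bounded)
        show "integrable lborel (cut T (conv b h))" using L1_on_conv[OF that] by (simp add: L1_on_def)
        show "(\<lambda>t. cut T w (T - t)) \<in> borel_measurable borel" using wm by measurable
        show "cmod (cut T w (T - t)) \<le> real (Suc m) * T ^ m" for t
          using wb[of "T - t"] T by (auto simp: cut_def indicator_def)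
      qed
      moreover have "(\<lambda>t. cut T (conv b h) t * cut T w (T - t)) = (\<lambda>t. indicator {0<..<T} t *\<^sub>R (conv b h t * w (T - t)))"
        by (auto simp: fun_eq_iff cut_def indicator_def)
      ultimately show ?thesis by (simp add: set_integrable_def)
    qed
    have "(LINT t:{0<..<T}|lborel. conv a un t * w (T - t)) = (LINT t:{0<..<T}|lborel. un t * conv a w (T - t))"
      by (rule conv_bilinear[OF aL L(1) wm wb])
    also have "\<dots> = (LINT t:{0<..<T}|lborel. fn t * conv (frac_ker 1) w (T - t))"
      using weak_mode_equation[OF f u, of n m] unfolding a_def un_def fn_def w_def .
    also have "\<dots> = (LINT t:{0<..<T}|lborel. conv (frac_ker 1) fn t * w (T - t))"
      by (rule conv_bilinear[OF _ L(2) wm wb, symmetric]) (use k in auto)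
    finally have "(LINT t:{0<..<T}|lborel. conv a un t * w (T - t) - conv (frac_ker 1) fn t * w (T - t)) = 0"
      using int[OF aL L(1)] int[OF k(3) L(2)] by (subst set_integral_diff(2)) auto
    also have "(LINT t:{0<..<T}|lborel. conv a un t * w (T - t) - conv (frac_ker 1) fn t * w (T - t))
      = (LINT t:{0<..<T}|lborel. of_real (real (Suc m)) * (H t * of_real ((T - t) ^ Suc k0)))"
      by (rule set_lebesgue_integral_cong) (auto simp: H_def w_def m_def algebra_simps simp del: power_Suc of_nat_Suc)
    also have "\<dots> = of_real (real (Suc m)) * (LINT t:{0<..<T}|lborel. H t * of_real ((T - t) ^ Suc k0))"
      by (rule set_integral_mult_right)
    finally show "(LINT s:{0<..<T}|lborel. H s * of_real ((T - s) ^ Suc k0)) = 0"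
      by (simp only: mult_eq_0_iff of_real_eq_0_iff of_nat_eq_0_iff nat.distinct(2) simp_thms)
  qed
  moreover have "AE t in lborel. 0 < t \<and> t < T \<longrightarrow> conv un a t = conv un (frac_ker (1 - \<alpha>)) t + ?c * conv un (frac_ker 1) t"
    unfolding a_def using k \<alpha> by (intro conv_linear L) auto
  ultimately have J: "AE t in lborel. 0 < t \<and> t < T \<longrightarrow> conv (frac_ker (1 - \<alpha>)) un t + ?c * conv (frac_ker 1) un t = conv (frac_ker 1) fn t"
    by eventually_elim (auto simp: H_def conv_commute[of un])
  let ?g = "frac_ker \<alpha>"
  \<comment> \<open>J^\<alpha> is moved inside J^1, so that both sides of the equation become
    primitives and the outer J^1 can be cancelled.\<close>
  have swap: "AE t in lborel. 0 < t \<and> t < T \<longrightarrow> conv ?g (conv (frac_ker 1) h) t = conv (frac_ker 1) (conv ?g h) t" if h: "L1_on T h" for h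
  proof -
    have "conv (conv ?g (frac_ker 1)) = conv (conv (frac_ker 1) ?g)" by (rule arg_cong[of _ _ conv]) (rule ext, rule conv_commute)
    then show ?thesis
      using conv_assoc[OF k(1) k(3) h] conv_assoc[OF k(3) k(1) h] by (auto elim!: eventually_elim2)
  qed
  have g1: "AE t in lborel. 0 < t \<and> t < T \<longrightarrow> conv ?g (\<lambda>s. conv (frac_ker (1 - \<alpha>)) un s + ?c * conv (frac_ker 1) un s) t
      = conv ?g (conv (frac_ker (1 - \<alpha>)) un) t + ?c * conv ?g (conv (frac_ker 1) un) t"
    using k \<alpha> L by (intro conv_linear L1_on_conv) auto
  have L3: "L1_on T (\<lambda>s. conv (frac_ker (1 - \<alpha>)) un s + ?c * conv (frac_ker 1) un s)"
    using L1_on_conv[OF k(2) L(1)] L1_on_conv[OF k(3) L(1)] \<alpha> by (auto simp: L1_on_set)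
  have g2: "AE t in lborel. 0 < t \<and> t < T \<longrightarrow> conv ?g (\<lambda>s. conv (frac_ker (1 - \<alpha>)) un s + ?c * conv (frac_ker 1) un s) t = conv ?g (conv (frac_ker 1) fn) t"
    by (rule always_eventually, intro allI impI, rule conv_cong_AE[OF J])
      (use k L L3 in \<open>auto intro!: cut_borel L1_on_conv\<close>)
  have L4: "L1_on T (\<lambda>s. un s + ?c * conv ?g un s)"
    using L1_on_conv[OF k(1) L(1)] L(1) by (auto simp: L1_on_set)
  have "AE t in lborel. 0 < t \<and> t < T \<longrightarrow> conv (frac_ker 1) (\<lambda>s. un s + ?c * conv ?g un s) t = conv (frac_ker 1) un t + ?c * conv (frac_ker 1) (conv ?g un) t"
    using k L by (intro conv_linear L1_on_conv) auto
  then have "AE t in lborel. 0 < t \<and> t < T \<longrightarrow> conv (frac_ker 1) (\<lambda>s. un s + ?c * conv ?g un s) t = conv (frac_ker 1) (conv ?g fn) t"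
    using g1 g2 swap[OF L(1)] swap[OF L(2)] conv_frac_ker_compose[OF \<alpha> L(1)] by eventually_elim simp
  then have "AE t in lborel. 0 < t \<and> t < T \<longrightarrow> un t + ?c * conv ?g un t = conv ?g fn t"
    by (rule conv_1_cancel[OF T L4 L1_on_conv[OF k(1) L(2)]])
  from mode_unique[OF L(2) L(1) this] show ?thesis by (simp add: mode_def un_def fn_def)
qed

end

section \<open>The series solution as a weak solution, its regularity and uniqueness\<close>

lemma Lp_mass_cmult_le:
  fixes v w :: "real \<Rightarrow> 'a::{complex_hilbert, second_countable_topology}"
  assumes "AE t in lborel. norm (cut T w t) \<le> c * norm (cut T v t)" "0 \<le> c" "0 < p" "cut T v \<in> borel_measurable borel"
  shows "Lp_mass p T w \<le> ennreal (c powr p) * Lp_mass p T v"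
proof -
  have "Lp_mass p T w \<le> (\<integral>\<^sup>+t. ennreal (c powr p) * ennreal (norm (cut T v t) powr p) \<partial>lborel)"
    unfolding Lp_mass_def
  proof (rule nn_integral_mono_AE, use assms(1) in eventually_elim)
    case (elim t)
    have "norm (cut T w t) powr p \<le> (c * norm (cut T v t)) powr p" using elim assms by (intro powr_mono2) auto
    also have "\<dots> = c powr p * norm (cut T v t) powr p" using assms by (simp add: powr_mult)
    finally show ?case by (simp add: ennreal_mult[symmetric] ennreal_leI)
  qed
  also have "\<dots> = ennreal (c powr p) * Lp_mass p T v"
    unfolding Lp_mass_def using assms(4) by (intro nn_integral_cmult) measurable
  finally show ?thesis .
qed

lemma Lp_mass_add_le:
  fixes v w :: "real \<Rightarrow> 'a::{complex_hilbert, second_countable_topology}"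
  assumes z: "\<And>t. 0 < t \<Longrightarrow> t < T \<Longrightarrow> norm (z t) \<le> norm (v t) + norm (w t)" and p: "0 < p"
    and [measurable]: "cut T v \<in> borel_measurable borel" "cut T w \<in> borel_measurable borel"
  shows "Lp_mass p T z \<le> ennreal (2 powr p) * (Lp_mass p T v + Lp_mass p T w)"
proof -
  have "Lp_mass p T z \<le> (\<integral>\<^sup>+t. ennreal (2 powr p) * (ennreal (norm (cut T v t) powr p) + ennreal (norm (cut T w t) powr p)) \<partial>lborel)"
    unfolding Lp_mass_def
  proof (rule nn_integral_mono)
    fix t
    let ?a = "norm (cut T v t)" and ?b = "norm (cut T w t)"
    have "norm (cut T z t) \<le> ?a + ?b" using z[of t] by (auto simp: cut_def indicator_def)
    also have "\<dots> \<le> 2 * max ?a ?b" by auto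
    finally have "norm (cut T z t) powr p \<le> (2 * max ?a ?b) powr p" using p by (intro powr_mono2) auto
    also have "\<dots> = 2 powr p * (max ?a ?b) powr p" by (simp add: powr_mult)
    also have "\<dots> \<le> 2 powr p * (?a powr p + ?b powr p)" by (intro mult_left_mono) (auto simp: max_def)
    finally show "ennreal (norm (cut T z t) powr p) \<le> ennreal (2 powr p) * (ennreal (?a powr p) + ennreal (?b powr p))"
      by (simp add: ennreal_mult[symmetric] ennreal_plus[symmetric] ennreal_leI del: ennreal_plus)
  qed
  also have "\<dots> = ennreal (2 powr p) * (Lp_mass p T v + Lp_mass p T w)"
    unfolding Lp_mass_def by (subst nn_integral_cmult, simp, subst nn_integral_add) auto
  finally show ?thesis .
qed

lemma Lp_cong_AE:
  fixes v w :: "real \<Rightarrow> 'a::{complex_hilbert, second_countable_topology}"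
  assumes "v \<in> Lp_space p T" "cut T w \<in> borel_measurable borel" "AE t in lborel. 0 < t \<and> t < T \<longrightarrow> norm (v t) = norm (w t)"
  shows "w \<in> Lp_space p T"
  using assms Lp_mass_cong_AE[OF assms(3)] by (simp add: Lp_space_iff)

context diffusion
begin

text \<open>For x in \<open>D\<close> the formal image series consists of the partial sums of
  \<open>A x\<close>. Conversely, the limit of a Cauchy series has the coordinates required by
  \<open>in_domainI\<close>. Being Cauchy is a measurable condition, so membership in
  \<open>D\<close> and the value of \<open>A\<close> are measurable along any measurable
  function.\<close>

lemma domain_iff: "x \<in> D \<longleftrightarrow> Cauchy (\<lambda>N. \<Sum>n<N. (- of_real (\<mu> n) * coord n x) *\<^sub>C \<phi> n)" (is "_ \<longleftrightarrow> Cauchy ?S")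
  and op_eq_lim: "x \<in> D \<Longrightarrow> A x = lim (\<lambda>N. \<Sum>n<N. (- of_real (\<mu> n) * coord n x) *\<^sub>C \<phi> n)"
proof -
  have S: "?S = (\<lambda>N. partial N (A x))" if "x \<in> D"
    unfolding partial_def by (simp only: coord_op[OF that])
  have lim: "?S \<longlonglongrightarrow> A x" if "x \<in> D" unfolding S[OF that] by (rule partial_tendsto)
  then show "x \<in> D \<Longrightarrow> A x = lim ?S" by (simp add: limI)
  show "x \<in> D \<longleftrightarrow> Cauchy ?S"
  proof
    assume "x \<in> D"
    then show "Cauchy ?S" using lim LIMSEQ_imp_Cauchy by blast
  next
    assume "Cauchy ?S"
    then obtain y where y: "?S \<longlonglongrightarrow> y" using Cauchy_convergent convergent_def by blast
    have "coord k y = - of_real (\<mu> k) * coord k x" for k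
    proof (rule LIMSEQ_unique)
      show "(\<lambda>N. coord k (?S N)) \<longlonglongrightarrow> coord k y" by (rule bounded_linear.tendsto[OF bounded_linear_coord y])
      show "(\<lambda>N. coord k (?S N)) \<longlonglongrightarrow> - of_real (\<mu> k) * coord k x"
        unfolding coord_sum_basis
        by (rule tendsto_eventually) (use eventually_gt_at_top[of k] in eventually_elim, simp)
    qed
    then show "x \<in> D" by (rule in_domainI(1))
  qed
qed

lemma apply_op_measurable:
  assumes [measurable]: "u \<in> borel_measurable M"
  shows "apply_op D A u \<in> borel_measurable M"
proof -
  let ?S = "\<lambda>t N. \<Sum>n<N. (- of_real (\<mu> n) * coord n (u t)) *\<^sub>C \<phi> n"
  have "apply_op D A u = (\<lambda>t. if Cauchy (?S t) then lim (?S t) else 0)"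
  proof (rule ext)
    show "apply_op D A u t = (if Cauchy (?S t) then lim (?S t) else 0)" for t
      unfolding apply_op_def using domain_iff[of "u t"] op_eq_lim[of "u t"] by presburger
  qed
  moreover have "(\<lambda>t. if Cauchy (?S t) then lim (?S t) else 0) \<in> borel_measurable M"
  proof (rule measurable_If)
    show "{t \<in> space M. Cauchy (?S t)} \<in> sets M" by (rule sets_Collect_Cauchy) measurable
  qed measurable
  ultimately show ?thesis by simp
qed

text \<open>The fractional derivative of the solution as read off from the equation, with
  \<open>solution_op\<close> in place of \<open>A\<close> applied to it.\<close>

definition solution_deriv :: "(real \<Rightarrow> 'a) \<Rightarrow> real \<Rightarrow> 'a"
  where "solution_deriv f t = f t + \<i> *\<^sub>C solution_op f t"

text \<open>The conclusion of \<open>solution_op_bound\<close> as a predicate on the constant, so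
  that one \<open>C\<close> is fixed before any \<open>f\<close> and carried through the remaining
  statements.\<close>

definition regular_bound :: "real \<Rightarrow> bool"
  where "regular_bound C \<longleftrightarrow> 0 < C \<and> (\<forall>f\<in>Lp_space p T.
    (AE t in lborel. 0 < t \<and> t < T \<longrightarrow> (\<forall>n. coord n (solution f t) = mode f n t) \<and>
      (\<forall>n. coord n (solution_op f t) = - of_real (\<mu> n) * mode f n t)) \<and>
    Lp_mass p T (solution_op f) \<le> ennreal C * Lp_mass p T f)"

lemma regular_bound_exists: "\<exists>C. regular_bound C"
  using solution_op_bound unfolding regular_bound_def by blast

text \<open>The representation of the solution as a fractional integral is checked coordinate by
  coordinate through \<open>mode_solution\<close>; countably many null sets are then united. The L^p
  bound of the solution itself follows from that of its image under \<open>A\<close>, by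
  \<open>norm_le_op\<close>.\<close>

lemma solution_facts:
  assumes C: "regular_bound C" and f: "f \<in> Lp_space p T"
  shows "AE t in lborel. 0 < t \<and> t < T \<longrightarrow> (\<forall>n. coord n (solution f t) = mode f n t)"
    and "AE t in lborel. 0 < t \<and> t < T \<longrightarrow> solution f t \<in> D \<and> A (solution f t) = solution_op f t"
    and "solution_op f \<in> Lp_space p T" "solution f \<in> Lp_space p T" "solution_deriv f \<in> Lp_space p T"
    and "Lp_mass p T (solution_deriv f) \<le> ennreal (2 powr p * (1 + C)) * Lp_mass p T f"
    and "AE t in lborel. 0 < t \<and> t < T \<longrightarrow> solution f t = frac_integral \<alpha> (solution_deriv f) t"
proof -
  have p1: "1 \<le> p" using p by simp
  have C0: "0 < C" using C by (simp add: regular_bound_def)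
  have fi: "integrable lborel (cut T f)" by (rule Lp_L1[OF f p1 T])
  have fm [measurable]: "cut T f \<in> borel_measurable borel" and fm2: "Lp_mass p T f < \<infinity>" using f by (auto simp: Lp_space_iff)
  have [measurable]: "solution f \<in> borel_measurable borel" "solution_op f \<in> borel_measurable borel"
    by (rule solution_measurable[OF fi])+
  have cm: "cut T (solution f) \<in> borel_measurable borel" "cut T (solution_op f) \<in> borel_measurable borel"
    unfolding cut_def[abs_def] by measurable
  have co: "AE t in lborel. 0 < t \<and> t < T \<longrightarrow> (\<forall>n. coord n (solution f t) = mode f n t) \<and>
      (\<forall>n. coord n (solution_op f t) = - of_real (\<mu> n) * mode f n t)"
    and mass: "Lp_mass p T (solution_op f) \<le> ennreal C * Lp_mass p T f"
    using C f by (auto simp: regular_bound_def)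
  show "AE t in lborel. 0 < t \<and> t < T \<longrightarrow> (\<forall>n. coord n (solution f t) = mode f n t)"
    using co by eventually_elim auto
  show dom: "AE t in lborel. 0 < t \<and> t < T \<longrightarrow> solution f t \<in> D \<and> A (solution f t) = solution_op f t"
    using co
  proof eventually_elim
    case (elim t)
    have "coord n (solution_op f t) = - of_real (\<mu> n) * coord n (solution f t)" if "0 < t \<and> t < T" for n
      using elim that by simp
    then show ?case using in_domainI[of "solution_op f t" "solution f t"] by blast
  qed
  have "Lp_mass p T (solution_op f) < \<infinity>"
    using mass fm2 by (auto simp: ennreal_mult_less_top order_le_less_trans)
  with cm show opL: "solution_op f \<in> Lp_space p T" by (simp add: Lp_space_iff)
  have "Lp_mass p T (solution f) \<le> ennreal ((1 / \<mu> 0) powr p) * Lp_mass p T (solution_op f)"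
  proof (rule Lp_mass_cmult_le)
    show "AE t in lborel. norm (cut T (solution f) t) \<le> 1 / \<mu> 0 * norm (cut T (solution_op f) t)"
      using dom
    proof eventually_elim
      case (elim t)
      show ?case using elim norm_le_op[of "solution f t"] by (auto simp: cut_def indicator_def)
    qed
  qed (use \<mu>0 p cm in auto)
  also have "\<dots> < \<infinity>" using opL by (simp add: Lp_space_iff ennreal_mult_less_top)
  finally show solL: "solution f \<in> Lp_space p T" using cm by (simp add: Lp_space_iff)
  have "cut T (solution_deriv f) = (\<lambda>t. cut T f t + \<i> *\<^sub>C cut T (solution_op f) t)"
    by (auto simp: fun_eq_iff cut_def indicator_def solution_deriv_def linear_0[OF bounded_linear.linear[OF bounded_linear_scaleC]])
  then have dm: "cut T (solution_deriv f) \<in> borel_measurable borel" using cm by simp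
  have "Lp_mass p T (solution_deriv f) \<le> ennreal (2 powr p) * (Lp_mass p T f + Lp_mass p T (solution_op f))"
    by (rule Lp_mass_add_le)
      (use p cm in \<open>auto simp: solution_deriv_def norm_scaleC intro: order_trans[OF norm_triangle_ineq]\<close>)
  also have "\<dots> \<le> ennreal (2 powr p) * (Lp_mass p T f + ennreal C * Lp_mass p T f)"
    by (intro mult_left_mono add_left_mono mass) auto
  also have "\<dots> = ennreal (2 powr p) * ((1 + ennreal C) * Lp_mass p T f)" by (simp add: distrib_right)
  also have "1 + ennreal C = ennreal (1 + C)" using C0 by simp
  also have "ennreal (2 powr p) * (ennreal (1 + C) * Lp_mass p T f) = ennreal (2 powr p * (1 + C)) * Lp_mass p T f"
    using C0 by (simp add: ennreal_mult mult.assoc del: ennreal_plus)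
  finally show dmass: "Lp_mass p T (solution_deriv f) \<le> ennreal (2 powr p * (1 + C)) * Lp_mass p T f" .
  also have "\<dots> < \<infinity>" using fm2 by (simp add: ennreal_mult_less_top)
  finally show derL: "solution_deriv f \<in> Lp_space p T" using dm by (simp add: Lp_space_iff)
  have di: "integrable lborel (cut T (solution_deriv f))" by (rule Lp_L1[OF derL p1 T])
  have "AE t in lborel. 0 < t \<and> t < T \<longrightarrow> coord n (solution f t) = coord n (frac_integral \<alpha> (solution_deriv f) t)" for n
  proof -
    let ?fn = "\<lambda>t. coord n (f t)"
    have "AE t in lborel. 0 < t \<and> t < T \<longrightarrow> conv (frac_ker \<alpha>) (\<lambda>s. coord n (solution_deriv f s)) t
      = conv (frac_ker \<alpha>) (\<lambda>s. ?fn s + (- \<i> * of_real (\<mu> n)) * conv (kernel (\<mu> n)) ?fn s) t"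
    proof (rule always_eventually, intro allI impI, rule conv_cong_AE[where T=T])
      show "AE s in lborel. 0 < s \<and> s < T \<longrightarrow> coord n (solution_deriv f s) = ?fn s + (- \<i> * of_real (\<mu> n)) * conv (kernel (\<mu> n)) ?fn s"
        using co by eventually_elim (auto simp: solution_deriv_def coord_simps mode_def)
      have "L1_on T (\<lambda>s. ?fn s + (- \<i> * of_real (\<mu> n)) * conv (kernel (\<mu> n)) ?fn s)"
        using L1_on_coord[OF fi, of n] L1_on_conv[OF L1_kernel[of n] L1_on_coord[OF fi, of n]] by (auto simp: L1_on_set)
      then show "cut T (\<lambda>s. ?fn s + (- \<i> * of_real (\<mu> n)) * conv (kernel (\<mu> n)) ?fn s) \<in> borel_measurable borel"
        by (rule cut_borel)
    qed (use \<alpha> in \<open>auto intro!: cut_borel L1_on_frac_ker L1_on_coord di\<close>)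
    then show ?thesis
      using coord_frac_integral[OF di \<alpha>(1)] mode_solution[OF L1_on_coord[OF fi, of n], of n] co
      by eventually_elim (auto simp: mode_def)
  qed
  then have "AE t in lborel. \<forall>n. 0 < t \<and> t < T \<longrightarrow> coord n (solution f t) = coord n (frac_integral \<alpha> (solution_deriv f) t)"
    by (subst AE_all_countable) blast
  then show "AE t in lborel. 0 < t \<and> t < T \<longrightarrow> solution f t = frac_integral \<alpha> (solution_deriv f) t"
    by eventually_elim (auto intro: coord_eqI)
qed

text \<open>Fractional integration by parts: transposition moves J^a from \<open>b\<close> to the
  other factor, where it meets J^(1 - a) and the two compose to the primitive.\<close>

lemma frac_duality:
  assumes a: "0 < a" "a < 1" and b: "L1_on T b"
    and x [measurable]: "cut T x \<in> borel_measurable borel" and xM: "\<And>t. cmod (x t) \<le> M" and M: "0 \<le> M"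
  shows "(LINT t:{0<..<T}|lborel. conv (frac_ker a) b t * conv (frac_ker (1 - a)) x (T - t))
    = (LINT t:{0<..<T}|lborel. b t * conv (frac_ker 1) x (T - t))"
proof -
  have xL: "L1_on T x"
  proof -
    have "integrable lborel (cut T x)"
    proof (rule Bochner_Integration.integrable_bound)
      show "integrable lborel (\<lambda>t. indicator {0<..<T} t * M)" by (intro integrable_mult_left integrable_real_indicator) (use T in auto)
      show "AE t in lborel. norm (cut T x t) \<le> norm (indicator {0<..<T} t * M)"
        using xM M by (intro always_eventually allI) (auto simp: cut_def indicator_def)
    qed measurable
    then show ?thesis by (simp add: L1_on_def)
  qed
  let ?w = "conv (frac_ker (1 - a)) x"
  have wL: "L1_on T ?w" using a by (intro L1_on_conv L1_on_frac_ker xL) auto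
  have "(LINT t:{0<..<T}|lborel. conv (frac_ker a) b t * ?w (T - t)) = (LINT s:{0<..<T}|lborel. b s * conv (frac_ker a) ?w (T - s))"
    using a by (intro conv_bilinear[OF L1_on_frac_ker b cut_borel[OF wL] frac_ker_conv_bound[OF _ xM]]) auto
  also have "\<dots> = (LINT s:{0<..<T}|lborel. b s * conv (frac_ker 1) x (T - s))"
    unfolding set_lebesgue_integral_def
  proof (rule integral_cong_AE)
    have "AE t in lborel. 0 < t \<and> t < T \<longrightarrow> conv (frac_ker a) ?w t = conv (frac_ker 1) x t"
      by (rule conv_frac_ker_compose[OF a xL])
    from AE_reflect[OF this, of T]
    show "AE s in lborel. indicator {0<..<T} s *\<^sub>R (b s * conv (frac_ker a) ?w (T - s)) = indicator {0<..<T} s *\<^sub>R (b s * conv (frac_ker 1) x (T - s))"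
      by eventually_elim (auto simp: indicator_def)
    have m: "(\<lambda>s. indicator {0<..<T} s *\<^sub>R (b s * h (T - s))) \<in> borel_measurable lborel" if h: "L1_on T h" for h
    proof -
      have [measurable]: "cut T b \<in> borel_measurable borel" "cut T h \<in> borel_measurable borel" using b h by (auto intro: cut_borel)
      have "(\<lambda>s. indicator {0<..<T} s *\<^sub>R (b s * h (T - s))) = (\<lambda>s. cut T b s * cut T h (T - s))"
        by (auto simp: fun_eq_iff cut_def indicator_def)
      then show ?thesis by simp
    qed
    have "L1_on T (conv (frac_ker a) ?w)" "L1_on T (conv (frac_ker 1) x)"
      using a by (auto intro!: L1_on_conv L1_on_frac_ker wL xL)
    then show "(\<lambda>s. indicator {0<..<T} s *\<^sub>R (b s * conv (frac_ker a) ?w (T - s))) \<in> borel_measurable lborel"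
      "(\<lambda>s. indicator {0<..<T} s *\<^sub>R (b s * conv (frac_ker 1) x (T - s))) \<in> borel_measurable lborel"
      by (simp_all only: m)
  qed
  finally show ?thesis .
qed

text \<open>With v = f + \<i> A u and u = J^\<alpha> v, the pairing of u with the adjoint fractional
  derivative J^(1 - \<alpha>) \<xi> equals, by \<open>frac_duality\<close>, the pairing of v with
  \<psi>. Symmetry of \<open>A\<close> on \<open>D\<close> makes the term \<i> A \<psi> cancel the
  part \<i> A u of v, and only f remains.\<close>

lemma solution_weak:
  assumes C: "regular_bound C" and f: "f \<in> Lp_space p T"
  shows "weak_solution \<alpha> p T D A f (solution f)"
  unfolding weak_solution_def
proof (intro conjI ballI)
  note sf = solution_facts[OF C f]
  show "solution f \<in> Lp_space p T" by (rule sf(4))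
  fix \<psi> assume "\<psi> \<in> test_functions T D A"
  then obtain \<psi>' where d: "has_cont_derivative \<psi> \<psi>'" and \<psi>D: "\<And>t. t \<in> {0..T} \<Longrightarrow> \<psi> t \<in> D"
    and cA: "continuous_on {0..T} (\<lambda>t. A (\<psi> t))" and \<psi>T: "\<psi> T = 0"
    by (rule test_function_derivative) (rule that)
  have p1: "1 \<le> p" using p by simp
  define q where "q = conjugate_exponent p"
  have q: "1 \<le> q" using p by (simp add: q_def conjugate_exponent_def)
  define \<xi> where "\<xi> = rev_deriv \<psi>'"
  note rd = rev_deriv_facts[OF d \<psi>T, folded \<xi>_def] and fd = frac_deriv_adj_test[OF d \<psi>T q, folded \<xi>_def]
  define F where "F = frac_deriv_adj \<alpha> q T \<psi>"
  let ?u = "solution f" and ?v = "solution_deriv f"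
  have ui: "integrable lborel (cut T ?u)" and vi: "integrable lborel (cut T ?v)" and fi: "integrable lborel (cut T f)"
    by (rule Lp_L1[OF _ p1 T], rule sf(4) sf(5) f)+
  have [measurable]: "cut T ?u \<in> borel_measurable borel" "cut T ?v \<in> borel_measurable borel" "cut T f \<in> borel_measurable borel"
    using ui vi fi by (auto dest: borel_measurable_integrable)
  have [measurable]: "cut T F \<in> borel_measurable borel" using fd(1) by (simp add: F_def)
  obtain MF where MF: "AE t in lborel. norm (cut T F t) \<le> MF" using fd(2) by (auto simp: F_def)
  have c\<psi>: "continuous_on {0..T} \<psi>"
    using d has_vector_derivative_continuous continuous_on_eq_continuous_within unfolding has_cont_derivative_def by blast
  have \<psi>m [measurable]: "cut T \<psi> \<in> borel_measurable borel"
    unfolding cut_def[abs_def] using c\<psi> by (intro borel_measurable_continuous_on_indicator) (auto intro: continuous_on_subset)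
  have Am [measurable]: "cut T (\<lambda>t. A (\<psi> t)) \<in> borel_measurable borel"
    unfolding cut_def[abs_def] using cA by (intro borel_measurable_continuous_on_indicator) (auto intro: continuous_on_subset)
  obtain M\<psi> where M\<psi>: "\<And>t. norm (cut T \<psi> t) \<le> M\<psi>"
  proof -
    have "compact (\<psi> ` {0..T})" by (rule compact_continuous_image[OF c\<psi>]) simp
    then obtain B where B: "\<forall>x\<in>\<psi> ` {0..T}. norm x \<le> B" using compact_imp_bounded bounded_iff by metis
    have "norm (cut T \<psi> t) \<le> max 0 B" for t using B by (auto simp: cut_def indicator_def le_max_iff_disj)
    then show ?thesis by (rule that)
  qed
  have ib: "integrable lborel (\<lambda>t. norm (cut T x t) * norm (y t))"
    if "integrable lborel (cut T x)" "AE t in lborel. norm (y t) \<le> M" "y \<in> borel_measurable borel" for x y :: "real \<Rightarrow> 'a" and M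
  proof (rule Bochner_Integration.integrable_bound)
    show "integrable lborel (\<lambda>t. norm (cut T x t) * M)" using that(1) by simp
    show "AE t in lborel. norm (norm (cut T x t) * norm (y t)) \<le> norm (norm (cut T x t) * M)"
      using that(2) by eventually_elim (auto simp: abs_mult intro!: mult_left_mono)
    have [measurable]: "cut T x \<in> borel_measurable borel" "y \<in> borel_measurable borel"
      using that by (auto dest: borel_measurable_integrable)
    show "(\<lambda>t. norm (cut T x t) * norm (y t)) \<in> borel_measurable lborel" by measurable
  qed
  have b\<psi>: "AE t in lborel. norm (cut T \<psi> t) \<le> M\<psi>" using M\<psi> by simp
  note iu = ib[OF ui MF \<open>cut T F \<in> borel_measurable borel\<close>]
    and iv = ib[OF vi b\<psi> \<psi>m] and iif = ib[OF fi b\<psi> \<psi>m]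
  note Lu = LINT_cinner[OF _ _ iu] and Lv = LINT_cinner[OF _ _ iv] and Lf = LINT_cinner[OF _ _ iif]
  \<comment> \<open>The identity is proved for each coordinate and summed with
    \<open>LINT_cinner\<close>, so the scalar duality suffices.\<close>
  have main: "(LINT t|lborel. cinner (cut T ?u t) (cut T F t)) = (LINT t|lborel. cinner (cut T ?v t) (cut T \<psi> t))"
  proof -
    have "(LINT t|lborel. coord n (cut T ?u t) * cnj (coord n (cut T F t))) = (LINT t|lborel. coord n (cut T ?v t) * cnj (coord n (cut T \<psi> t)))" for n
    proof -
      let ?b = "\<lambda>s. coord n (?v s)" and ?x = "\<lambda>s. cnj (coord n (\<xi> s))"
      obtain M where M: "0 \<le> M" "\<And>t. norm (\<xi> t) \<le> M" using rd(2) by blast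
      have [measurable]: "\<xi> \<in> borel_measurable borel" by (rule rd(1))
      have bL: "L1_on T ?b" by (rule L1_on_coord[OF vi])
      have cv: "conv (frac_ker a) ?x t = cnj (conv (frac_ker a) (\<lambda>s. coord n (\<xi> s)) t)" for a t
        using conv_cnj[of "frac_ker a" "\<lambda>s. coord n (\<xi> s)" t] by (simp add: cnj_frac_ker)
      have "(LINT t|lborel. coord n (cut T ?u t) * cnj (coord n (cut T F t)))
        = (LINT t:{0<..<T}|lborel. conv (frac_ker \<alpha>) ?b t * conv (frac_ker (1 - \<alpha>)) ?x (T - t))"
        unfolding set_lebesgue_integral_def
      proof (rule integral_cong_AE)
        show "AE t in lborel. coord n (cut T ?u t) * cnj (coord n (cut T F t))
          = indicator {0<..<T} t *\<^sub>R (conv (frac_ker \<alpha>) ?b t * conv (frac_ker (1 - \<alpha>)) ?x (T - t))"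
          using sf(7) coord_frac_integral[OF vi \<alpha>(1)] fd(3)
          by eventually_elim (auto simp: cut_def indicator_def coord_simps F_def cv)
        have [measurable]: "cut T (conv (frac_ker \<alpha>) ?b) \<in> borel_measurable borel"
          by (intro cut_borel L1_on_conv L1_on_frac_ker bL \<alpha>)
        have [measurable]: "cut T (conv (frac_ker (1 - \<alpha>)) (\<lambda>s. coord n (\<xi> s))) \<in> borel_measurable borel"
          using \<alpha> by (intro cut_borel L1_on_conv L1_on_frac_ker L1_on_coord rd(3)) auto
        have "(\<lambda>t. indicator {0<..<T} t *\<^sub>R (conv (frac_ker \<alpha>) ?b t * conv (frac_ker (1 - \<alpha>)) ?x (T - t)))
          = (\<lambda>t. cut T (conv (frac_ker \<alpha>) ?b) t * cnj (cut T (conv (frac_ker (1 - \<alpha>)) (\<lambda>s. coord n (\<xi> s))) (T - t)))"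
          by (auto simp: fun_eq_iff cut_def indicator_def cv)
        then show "(\<lambda>t. indicator {0<..<T} t *\<^sub>R (conv (frac_ker \<alpha>) ?b t * conv (frac_ker (1 - \<alpha>)) ?x (T - t))) \<in> borel_measurable lborel"
          by simp
      qed measurable
      also have "\<dots> = (LINT t:{0<..<T}|lborel. ?b t * conv (frac_ker 1) ?x (T - t))"
      proof (rule frac_duality[OF \<alpha> bL _ _ M(1)])
        show "cut T ?x \<in> borel_measurable borel" unfolding cut_def[abs_def] by measurable
        show "cmod (?x t) \<le> M" for t using norm_coord[of n "\<xi> t"] M(2)[of t] by simp
      qed
      also have "\<dots> = (LINT t|lborel. coord n (cut T ?v t) * cnj (coord n (cut T \<psi> t)))"
        unfolding set_lebesgue_integral_def
      proof (rule Bochner_Integration.integral_cong[OF refl])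
        fix t
        show "indicator {0<..<T} t *\<^sub>R (?b t * conv (frac_ker 1) ?x (T - t)) = coord n (cut T ?v t) * cnj (coord n (cut T \<psi> t))"
          using rd(4)[of "T - t" n] by (auto simp: cut_def indicator_def coord_simps cv)
      qed
      finally show ?thesis .
    qed
    then show ?thesis using sums_unique2[OF Lu(1) Lv(1)[THEN sums_cong[THEN iffD1, rotated]]] by simp
  qed
  have "(LINT t|interval_lborel T. cinner (?u t) (F t + \<i> *\<^sub>C A (\<psi> t)))
    = (LINT t|lborel. cinner (cut T ?u t) (cut T F t) + (cinner (cut T f t) (cut T \<psi> t) - cinner (cut T ?v t) (cut T \<psi> t)))"
    unfolding integral_interval
  proof (rule integral_cong_AE)
    show "AE t in lborel. cut T (\<lambda>t. cinner (?u t) (F t + \<i> *\<^sub>C A (\<psi> t))) t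
      = cinner (cut T ?u t) (cut T F t) + (cinner (cut T f t) (cut T \<psi> t) - cinner (cut T ?v t) (cut T \<psi> t))"
      using sf(2)
    proof eventually_elim
      case (elim t)
      show ?case
      proof (cases "0 < t \<and> t < T")
        case True
        then have "cinner (?u t) (A (\<psi> t)) = cinner (solution_op f t) (\<psi> t)"
          using elim symmetric_op[of "?u t" "\<psi> t"] \<psi>D[of t] by simp
        then show ?thesis using True
          by (simp add: cut_def cinner_add_right cinner_scaleC_right solution_deriv_def cinner_add_left cinner_scaleC_left)
      qed (auto simp: cut_def)
    qed
    have "cut T (\<lambda>t. cinner (?u t) (F t + \<i> *\<^sub>C A (\<psi> t))) = (\<lambda>t. cinner (cut T ?u t) (cut T F t + \<i> *\<^sub>C cut T (\<lambda>t. A (\<psi> t)) t))"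
      by (auto simp: fun_eq_iff cut_def indicator_def)
    then show "cut T (\<lambda>t. cinner (?u t) (F t + \<i> *\<^sub>C A (\<psi> t))) \<in> borel_measurable lborel" by simp
  qed measurable
  also have "\<dots> = (LINT t|lborel. cinner (cut T ?u t) (cut T F t)) + ((LINT t|lborel. cinner (cut T f t) (cut T \<psi> t)) - (LINT t|lborel. cinner (cut T ?v t) (cut T \<psi> t)))"
    using Lu(2) Lv(2) Lf(2) by simp
  also have "\<dots> = (LINT t|lborel. cinner (cut T f t) (cut T \<psi> t))" by (simp add: main)
  also have "\<dots> = (LINT t|interval_lborel T. cinner (f t) (\<psi> t))"
    unfolding integral_interval by (rule Bochner_Integration.integral_cong) (auto simp: cut_def indicator_def)
  finally show "(LINT t|interval_lborel T. cinner (?u t) (frac_deriv_adj \<alpha> (conjugate_exponent p) T \<psi> t + \<i> *\<^sub>C A (\<psi> t)))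
    = (LINT t|interval_lborel T. cinner (f t) (\<psi> t))" unfolding F_def q_def .
qed

lemma weak_solution_unique:
  assumes C: "regular_bound C" and f: "f \<in> Lp_space p T" and u: "weak_solution \<alpha> p T D A f u"
  shows "AE t in lborel. 0 < t \<and> t < T \<longrightarrow> u t = solution f t"
proof -
  have "AE t in lborel. \<forall>n. 0 < t \<and> t < T \<longrightarrow> coord n (u t) = mode f n t"
    by (subst AE_all_countable) (blast intro: weak_solution_mode[OF f u])
  then show ?thesis using solution_facts(1)[OF C f] by eventually_elim (auto intro: coord_eqI)
qed

text \<open>By uniqueness \<open>u\<close> agrees almost everywhere with the series solution, so its
  fractional derivative is \<open>solution_deriv\<close> and its image under \<open>A\<close> is
  \<open>solution_op\<close>, both already bounded. Membership and norms depend only on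
  almost-everywhere classes once measurability of \<open>apply_op D A u\<close> is known.\<close>

lemma weak_solution_regular:
  assumes C: "regular_bound C" and f: "f \<in> Lp_space p T" and u: "weak_solution \<alpha> p T D A f u"
  shows "u \<in> W_space \<alpha> p T" "u \<in> Lp_domain_space p T D A"
    and "W_norm \<alpha> p T u \<le> (2 powr p * (1 + C)) powr (1 / p) * Lp_norm p T f"
    and "Lp_domain_norm p T D A u \<le> C powr (1 / p) * Lp_norm p T f"
proof -
  note sf = solution_facts[OF C f] and uq = weak_solution_unique[OF C f u]
  have C0: "0 < C" using C by (simp add: regular_bound_def)
  have p1: "1 \<le> p" and p0: "0 < p" using p by auto
  have uL: "u \<in> Lp_space p T" using u by (simp add: weak_solution_def)
  then have um: "u \<in> borel_measurable (interval_lborel T)" by (simp add: Lp_space_def)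
  have rep: "AE t in lborel. 0 < t \<and> t < T \<longrightarrow> u t = frac_integral \<alpha> (solution_deriv f) t"
    using uq sf(7) by eventually_elim auto
  then show "u \<in> W_space \<alpha> p T" using um sf(5) unfolding W_space_def AE_interval by blast
  note fd = frac_deriv_eq[OF sf(5) rep \<alpha> T p1]
  have m: "cut T (solution_deriv f) \<in> borel_measurable borel" "cut T (frac_deriv \<alpha> p T u) \<in> borel_measurable borel"
    using sf(5) fd(1) by (auto simp: Lp_space_iff)
  have "W_norm \<alpha> p T u = Lp_norm p T (solution_deriv f)"
    unfolding W_norm_def by (rule Lp_norm_cong_AE[OF m(2,1)]) (use fd(2) in eventually_elim, simp)
  also have "\<dots> \<le> (2 powr p * (1 + C)) powr (1 / p) * Lp_norm p T f"
    by (rule Lp_norm_mono[OF m(1) f sf(6)]) (use C0 p0 in auto)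
  finally show "W_norm \<alpha> p T u \<le> (2 powr p * (1 + C)) powr (1 / p) * Lp_norm p T f" .
  have dom: "AE t in lborel. 0 < t \<and> t < T \<longrightarrow> u t \<in> D \<and> apply_op D A u t = solution_op f t"
    using uq sf(2) by eventually_elim (auto simp: apply_op_def)
  have am: "cut T (apply_op D A u) \<in> borel_measurable borel"
    using apply_op_measurable[OF um] by (simp add: cut_measurable)
  have n: "AE t in lborel. 0 < t \<and> t < T \<longrightarrow> norm (solution_op f t) = norm (apply_op D A u t)"
    using dom by eventually_elim simp
  have "apply_op D A u \<in> Lp_space p T" by (rule Lp_cong_AE[OF sf(3) am n])
  moreover have "AE t in interval_lborel T. u t \<in> D" unfolding AE_interval using dom by eventually_elim simp
  ultimately show "u \<in> Lp_domain_space p T D A" using um by (simp add: Lp_domain_space_def)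
  have "Lp_mass p T (apply_op D A u) \<le> ennreal C * Lp_mass p T f"
    using C f unfolding regular_bound_def Lp_mass_cong_AE[OF n, symmetric] by blast
  then show "Lp_domain_norm p T D A u \<le> C powr (1 / p) * Lp_norm p T f"
    unfolding Lp_domain_norm_def by (intro Lp_norm_mono am f) (use C0 p0 in auto)
qed

end

theorem theorem4p5:
  fixes A :: "'a::{complex_hilbert, second_countable_topology} \<Rightarrow> 'a"
    and D :: "'a set"
    and \<phi> :: "nat \<Rightarrow> 'a"
    and \<mu> :: "nat \<Rightarrow> real"
    and \<alpha> p T :: real
  assumes "self_adjoint D A"
    and "negative_definite D A"
    and "compact_resolvent D A"
    and "orthonormal_basis \<phi>"
    and "\<And>n. \<phi> n \<in> D"
    and "\<And>n. A (\<phi> n) = - (\<mu> n *\<^sub>R \<phi> n)"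
    and "0 < \<mu> 0"
    and "incseq \<mu>"
    and "filterlim \<mu> at_top sequentially"
    and "0 < \<alpha>" "\<alpha> < 1"
    and "1 < p"
    and "0 < T"
  shows "\<exists>C>0. \<forall>f\<in>Lp_space p T.
    (\<exists>u. weak_solution \<alpha> p T D A f u) \<and>
    (\<forall>u v. weak_solution \<alpha> p T D A f u \<and> weak_solution \<alpha> p T D A f v \<longrightarrow>
      (AE t in interval_lborel T. u t = v t)) \<and>
    (\<forall>u. weak_solution \<alpha> p T D A f u \<longrightarrow>
      u \<in> W_space \<alpha> p T \<inter> Lp_domain_space p T D A \<and>
      W_norm \<alpha> p T u + Lp_domain_norm p T D A u \<le> C * Lp_norm p T f)"
proof -
  interpret diffusion \<phi> D A \<mu> \<alpha> p T
    by unfold_locales (use assms in auto)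
  obtain C where C: "regular_bound C" using regular_bound_exists by blast
  have C0: "0 < C" using C by (simp add: regular_bound_def)
  show ?thesis
  \<comment> \<open>The first summand bounds the fractional derivative f + \<i> A u, where 2 powr p
    (1 + C) comes from the p-th power of a sum; the second bounds A u.\<close>
  proof (intro exI[of _ "(2 powr p * (1 + C)) powr (1 / p) + C powr (1 / p)"] conjI ballI allI impI)
    fix f :: "real \<Rightarrow> 'a" assume f: "f \<in> Lp_space p T"
    show "\<exists>u. weak_solution \<alpha> p T D A f u" using solution_weak[OF C f] by blast
    show "AE t in interval_lborel T. u t = v t"
      if "weak_solution \<alpha> p T D A f u \<and> weak_solution \<alpha> p T D A f v" for u v
      unfolding AE_interval
      using weak_solution_unique[OF C f conjunct1[OF that]] weak_solution_unique[OF C f conjunct2[OF that]]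
      by eventually_elim simp
    fix u assume u: "weak_solution \<alpha> p T D A f u"
    note reg = weak_solution_regular[OF C f u]
    show "u \<in> W_space \<alpha> p T \<inter> Lp_domain_space p T D A" using reg(1,2) by blast
    show "W_norm \<alpha> p T u + Lp_domain_norm p T D A u \<le> ((2 powr p * (1 + C)) powr (1 / p) + C powr (1 / p)) * Lp_norm p T f"
      using reg(3,4) by (simp add: distrib_right)
  qed (use C0 in \<open>auto intro: add_pos_pos\<close>)
qed

end
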